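(* The Poincaré series associated with a generalized Weierstrass semigroup at several rational points of a curve determines completely the whole semigroup. That is, if $(\mathbb{F},\mathcal{X},\mathbf{Q})$ and $(\mathbb{F}',\mathcal{X}',\mathbf{Q}')$ are two data as in the context, with the same number $m$ of points, and their Poincaré series are equal, then $\widehat{H}(\mathbf{Q})=\widehat{H}(\mathbf{Q}')$ as subsets of $\mathbb{Z}^m$. Furthermore, the Poincaré series is determined by its semigroup polynomial $P^*(\mathbf{t})$, through the functional equation $$P(\mathbf{t})=\Big(\sum_{\eta\in\Theta(\mathbf{Q})}\mathbf{t}^{\eta}\Big)\cdot P^*(\mathbf{t}).$$
   Context: A datum $(\mathbb{F},\mathcal{X},\mathbf{Q})$ consists of a finite field $\mathbb{F}$, a projective, non-singular, geometrically irreducible algebraic curve $\mathcal{X}$ over $\mathbb{F}$, and an $m$-tuple $\mathbf{Q}=(Q_1,\ldots,Q_m)$ of pairwise distinct $\mathbb{F}$-rational points of $\mathcal{X}$, where $\#\mathbb{F}\geq m\geq 2$. Put $I=\{1,\ldots,m\}$. Let $R_{\mathbf{Q}}$ be the ring of functions of $\mathcal{X}$ that are regular outside $\{Q_1,\ldots,Q_m\}$. For $f\in R_{\mathbf{Q}}\setminus\{0\}$ put $\rho_{\mathbf{Q}}(f)=(-v_{Q_1}(f),\ldots,-v_{Q_m}(f))\in\mathbb{Z}^m$. The generalized Weierstrass semigroup is $\widehat{H}(\mathbf{Q})=\{\rho_{\mathbf{Q}}(f): f\in R_{\mathbf{Q}}\setminus\{0\}\}\subseteq\mathbb{Z}^m$.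 For $\alpha\in\mathbb{Z}^m$, put $\nabla_i(\alpha)=\{\beta\in\widehat{H}(\mathbf{Q}):\beta_i=\alpha_i,\ \beta_j<\alpha_j\ \forall j\neq i\}$. An element $\alpha\in\widehat{H}(\mathbf{Q})$ is maximal if $\bigcup_{i=1}^m\nabla_i(\alpha)=\emptyset$; $\mathcal{M}(\mathbf{Q})$ is the set of maximal elements. For $\alpha\in\mathbb{Z}^m$, $\ell(\alpha)$ is the $\mathbb{F}$-dimension of the Riemann-Roch space of $\sum_i\alpha_iQ_i$. For $J\subseteq I$, $\mathbf{1}_J\in\mathbb{Z}^m$ has $j$-th coordinate $1$ if $j\in J$ and $0$ otherwise; $\mathbf{1}=\mathbf{1}_I$, $\mathbf{e}_i=\mathbf{1}_{\{i\}}$. Put $d_i(\beta)=\ell(\beta)-\ell(\beta-\mathbf{e}_i)$. Write $\mathbf{t}^\alpha=t_1^{\alpha_1}\cdots t_m^{\alpha_m}$. The Poincaré series associated with $\widehat{H}(\mathbf{Q})$ is the formal series $P(\mathbf{t})=\sum_{\alpha\in\mathbb{Z}^m}p(\alpha)\mathbf{t}^\alpha$ with $$p(\alpha)=(-1)^{m-1}\sum_{J\subseteq I\setminus\{i\}}(-1)^{\#J}d_i(\alpha-\mathbf{1}+\mathbf{1}_J+\mathbf{e}_i),$$ which does not depend on the choice of $i\in I$. A formal series means a $\mathbb{Z}$-valued function on $\mathbb{Z}^m$; formal series form a module over the ring of Laurent polynomials over $\mathbb{Z}$ via the usual multiplication rule. For $i=1,\ldots,m-1$, let $a_i$ be the smallest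 positive integer $t$ such that $t(Q_i-Q_{i+1})$ is a principal divisor on $\mathcal{X}$, and let $\eta^i\in\mathbb{Z}^m$ be the tuple with $i$-th coordinate $a_i$, $(i+1)$-th coordinate $-a_i$, and all other coordinates $0$. $\Theta(\mathbf{Q})$ is the subgroup of $\mathbb{Z}^m$ generated by $\eta^1,\ldots,\eta^{m-1}$, and $\mathcal{C}=\{\alpha\in\mathbb{Z}^m: 0\leq\alpha_i<a_i\text{ for }i=1,\ldots,m-1\}$. The semigroup polynomial associated with $\widehat{H}(\mathbf{Q})$ is the Laurent polynomial $P^*(\mathbf{t})=\sum_{\alpha\in\mathcal{M}(\mathbf{Q})\cap\mathcal{C}}p(\alpha)\mathbf{t}^\alpha$. *)

theory Defs
  imports
    "HOL-Library.Poly_Mapping"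
    "HOL-Algebra.Algebraic_Closure_Type"
    "HOL-Algebra.Finite_Extensions"
    "HOL-Algebra.Generated_Fields"
    "HOL-Computational_Algebra.Group_Closure"
begin

section \<open>Projective algebraic sets\<close>

text \<open>
  Polynomials are finitely supported functions from exponent vectors to coefficients; the
  coordinates of projective \<open>n\<close>-space are indexed by \<open>0, \<dots>, n\<close>. A projective point is the set of
  all its homogeneous coordinate vectors.
\<close>

type_synonym 'k mpoly = "(nat \<Rightarrow>\<^sub>0 nat) \<Rightarrow>\<^sub>0 'k"

type_synonym 'k ppoint = "(nat \<Rightarrow> 'k) set"

definition homogeneous :: "nat \<Rightarrow> nat \<Rightarrow> 'k::zero mpoly set" where
  "homogeneous n d =
     {p. \<forall>\<mu>\<in>Poly_Mapping.keys p.
           Poly_Mapping.keys \<mu> \<subseteq> {..n} \<and> (\<Sum>i\<in>Poly_Mapping.keys \<mu>. Poly_Mapping.lookup \<mu> i) = d}"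

definition eval_mpoly :: "'k::comm_semiring_1 mpoly \<Rightarrow> (nat \<Rightarrow> 'k) \<Rightarrow> 'k" where
  "eval_mpoly p x =
     (\<Sum>\<mu>\<in>Poly_Mapping.keys p. 
        Poly_Mapping.lookup p \<mu> * (\<Prod>i\<in>Poly_Mapping.keys \<mu>. x i ^ Poly_Mapping.lookup \<mu> i))"

definition proj_space :: "nat \<Rightarrow> 'k::field ppoint set" where
  "proj_space n =
     {x. x \<noteq> (\<lambda>_. 0) \<and> (\<forall>i>n. x i = 0)} // {(x, y). \<exists>c. c \<noteq> 0 \<and> y = (\<lambda>i. c * x i)}"

definition vanishes_at :: "'k::field mpoly \<Rightarrow> 'k ppoint \<Rightarrow> bool" where
  "vanishes_at p P \<longleftrightarrow> (\<forall>x\<in>P. eval_mpoly p x = 0)"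

definition zero_locus :: "nat \<Rightarrow> 'k::field mpoly set \<Rightarrow> 'k ppoint set" where
  "zero_locus n S = {P \<in> proj_space n. \<forall>p\<in>S. vanishes_at p P}"

definition zariski_closed :: "nat \<Rightarrow> 'k::field ppoint set \<Rightarrow> bool" where
  "zariski_closed n A \<longleftrightarrow> (\<exists>S \<subseteq> (\<Union>d. homogeneous n d). A = zero_locus n S)"

definition zariski_irreducible :: "nat \<Rightarrow> 'k::field ppoint set \<Rightarrow> bool" where
  "zariski_irreducible n A \<longleftrightarrow>
     A \<noteq> {} \<and>
     (\<forall>B D. zariski_closed n B \<longrightarrow> zariski_closed n D \<longrightarrow> A \<subseteq> B \<union> D \<longrightarrow> A \<subseteq> B \<or> A \<subseteq> D)"

text \<open>
  From here on \<open>'a\<close> is the ground field \<open>F\<close>. A projective algebraic set over \<open>F\<close> is given by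
  its set \<open>C\<close> of points over the algebraic closure of \<open>F\<close>, inside projective \<open>n\<close>-space.
  For the finite (hence perfect) fields considered here, a reduced closed subscheme of
  projective space over \<open>F\<close> is determined by this set, and it is geometrically irreducible
  iff this set is irreducible in the Zariski topology over the algebraic closure.
\<close>

abbreviation base_change :: "'a::field mpoly \<Rightarrow> 'a alg_closure mpoly" where
  "base_change \<equiv> Poly_Mapping.map to_ac"

definition algebraic_set_over_base :: "nat \<Rightarrow> 'a::field alg_closure ppoint set \<Rightarrow> bool" where
  "algebraic_set_over_base n C \<longleftrightarrow>
     (\<exists>S \<subseteq> (\<Union>d. homogeneous n d :: 'a mpoly set). C = zero_locus n (base_change ` S))"

definition rational_point :: "'a::field alg_closure ppoint \<Rightarrow> bool" where
  "rational_point P \<longleftrightarrow> (\<exists>y. (\<lambda>i. to_ac (y i)) \<in> P)"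


section \<open>The function field over the ground field, and local rings\<close>

text \<open>
  \<open>F(C)\<close> consists of the fractions \<open>g / h\<close> of forms over \<open>F\<close> of equal degree, \<open>h\<close> not vanishing
  identically on \<open>C\<close>, where \<open>g / h = g' / h'\<close> iff \<open>g h' - g' h\<close> vanishes on \<open>C\<close>.
\<close>

type_synonym 'a ratfun = "('a mpoly \<times> 'a mpoly) set"

definition fractions ::
    "nat \<Rightarrow> 'a::field alg_closure ppoint set \<Rightarrow> ('a mpoly \<times> 'a mpoly) set" where
  "fractions n C =
     {(g, h). (\<exists>d. g \<in> homogeneous n d \<and> h \<in> homogeneous n d) \<and>
              (\<exists>P\<in>C. \<not> vanishes_at (base_change h) P)}"

definition frac_rel ::
    "nat \<Rightarrow> 'a::field alg_closure ppoint set \<Rightarrow> (('a mpoly \<times> 'a mpoly) \<times> ('a mpoly \<times> 'a mpoly)) set" where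
  "frac_rel n C =
     {((g, h), (g', h')). (g, h) \<in> fractions n C \<and> (g', h') \<in> fractions n C \<and>
        (\<forall>P\<in>C. vanishes_at (base_change (g * h' - g' * h)) P)}"

definition fraction ::
    "nat \<Rightarrow> 'a::field alg_closure ppoint set \<Rightarrow> 'a mpoly \<Rightarrow> 'a mpoly \<Rightarrow> 'a ratfun" where
  "fraction n C g h = frac_rel n C `` {(g, h)}"

definition function_field :: "nat \<Rightarrow> 'a::field alg_closure ppoint set \<Rightarrow> 'a ratfun ring" where
  "function_field n C =
     \<lparr>carrier = fractions n C // frac_rel n C,
      monoid.mult = (\<lambda>A B. \<Union>(g, h)\<in>A. \<Union>(g', h')\<in>B. fraction n C (g * g') (h * h')),
      monoid.one = fraction n C 1 1,
      ring.zero = fraction n C 0 1,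
      ring.add = (\<lambda>A B. \<Union>(g, h)\<in>A. \<Union>(g', h')\<in>B. fraction n C (g * h' + g' * h) (h * h'))\<rparr>"

definition constants :: "nat \<Rightarrow> 'a::field alg_closure ppoint set \<Rightarrow> 'a ratfun set" where
  "constants n C = {fraction n C (Poly_Mapping.single 0 c) 1 | c. True}"

definition regular_at ::
    "nat \<Rightarrow> 'a::field alg_closure ppoint set \<Rightarrow> 'a alg_closure ppoint \<Rightarrow> 'a ratfun set" where
  "regular_at n C P =
     {f \<in> carrier (function_field n C). \<exists>(g, h)\<in>f. \<not> vanishes_at (base_change h) P}"

text \<open>
  Only functions over \<open>F\<close> occur, so this is the local ring of the curve over \<open>F\<close> at the closed
  point (Galois orbit) of \<open>P\<close>.
\<close>

definition local_ring ::
    "nat \<Rightarrow> 'a::field alg_closure ppoint set \<Rightarrow> 'a alg_closure ppoint \<Rightarrow> 'a ratfun ring" where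
  "local_ring n C P = (function_field n C)\<lparr>carrier := regular_at n C P\<rparr>"

definition max_ideal_at ::
    "nat \<Rightarrow> 'a::field alg_closure ppoint set \<Rightarrow> 'a alg_closure ppoint \<Rightarrow> 'a ratfun set" where
  "max_ideal_at n C P =
     {f \<in> carrier (function_field n C).
        \<exists>(g, h)\<in>f. \<not> vanishes_at (base_change h) P \<and> vanishes_at (base_change g) P}"

text \<open>The transcendence degree of \<open>F(C)\<close> over \<open>F\<close> is one.\<close>

definition one_dimensional :: "nat \<Rightarrow> 'a::field alg_closure ppoint set \<Rightarrow> bool" where
  "one_dimensional n C \<longleftrightarrow>
     (let K = function_field n C in
      \<exists>x\<in>carrier K. ring.transcendental K (constants n C) x \<and>
        (\<forall>y\<in>carrier K. ring.algebraic K (generate_field K (insert x (constants n C))) y))"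

text \<open>
  A local ring of a curve is regular iff its maximal ideal is generated by as many elements as
  its dimension, that is, by one element.
\<close>

definition nonsingular_at ::
    "nat \<Rightarrow> 'a::field alg_closure ppoint set \<Rightarrow> 'a alg_closure ppoint \<Rightarrow> bool" where
  "nonsingular_at n C P \<longleftrightarrow> principalideal (max_ideal_at n C P) (local_ring n C P)"

definition nonsingular_projective_curve ::
    "nat \<Rightarrow> 'a::field alg_closure ppoint set \<Rightarrow> bool" where
  "nonsingular_projective_curve n C \<longleftrightarrow>
     algebraic_set_over_base n C \<and> zariski_irreducible n C \<and> one_dimensional n C \<and>
     (\<forall>P\<in>C. nonsingular_at n C P)"

text \<open>\<open>v\<^sub>P(f) = k\<close> iff \<open>f = u t\<^sup>k\<close> with \<open>t\<close> a uniformizer and \<open>u\<close> a unit of the local ring.\<close>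

definition order_at ::
    "nat \<Rightarrow> 'a::field alg_closure ppoint set \<Rightarrow> 'a alg_closure ppoint \<Rightarrow> 'a ratfun \<Rightarrow> int" where
  "order_at n C P f =
     (THE k. \<exists>t\<in>regular_at n C P. \<exists>u\<in>Units (local_ring n C P).
        max_ideal_at n C P = Idl\<^bsub>local_ring n C P\<^esub> {t} \<and>
        f = u \<otimes>\<^bsub>function_field n C\<^esub> (t [^]\<^bsub>function_field n C\<^esub> (k::int)))"

text \<open>
  A divisor is recorded by its coefficient at every point of \<open>C\<close> over the algebraic closure,
  the coefficients being constant on Galois orbits.
\<close>

definition riemann_roch_space ::
    "nat \<Rightarrow> 'a::field alg_closure ppoint set \<Rightarrow> ('a alg_closure ppoint \<Rightarrow> int) \<Rightarrow> 'a ratfun set" where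
  "riemann_roch_space n C D =
     {f \<in> carrier (function_field n C).
        f = \<zero>\<^bsub>function_field n C\<^esub> \<or> (\<forall>P\<in>C. order_at n C P f + D P \<ge> 0)}"

definition principal_divisor ::
    "nat \<Rightarrow> 'a::field alg_closure ppoint set \<Rightarrow> ('a alg_closure ppoint \<Rightarrow> int) \<Rightarrow> bool" where
  "principal_divisor n C D \<longleftrightarrow>
     (\<exists>f\<in>carrier (function_field n C) - {\<zero>\<^bsub>function_field n C\<^esub>}. \<forall>P\<in>C. order_at n C P f = D P)"


section \<open>Generalized Weierstrass semigroups\<close>

text \<open>
  Elements of \<open>\<int>\<^sup>m\<close> are finitely supported functions on \<open>nat\<close> with support in \<open>{1..m}\<close>, so that
  Laurent polynomials over \<open>\<int>\<close> are elements of \<open>(nat \<Rightarrow>\<^sub>0 int) \<Rightarrow>\<^sub>0 int\<close>.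
\<close>

type_synonym ivec = "nat \<Rightarrow>\<^sub>0 int"

definition int_vecs :: "nat \<Rightarrow> ivec set" where
  "int_vecs m = {\<alpha>. Poly_Mapping.keys \<alpha> \<subseteq> {1..m}}"

definition ones :: "nat set \<Rightarrow> ivec" where
  "ones J = (\<Sum>j\<in>J. Poly_Mapping.single j 1)"

definition weierstrass_datum ::
    "nat \<Rightarrow> nat \<Rightarrow> 'a::{field, finite} alg_closure ppoint set \<Rightarrow> (nat \<Rightarrow> 'a alg_closure ppoint) \<Rightarrow> bool" where
  "weierstrass_datum m n C Q \<longleftrightarrow>
     nonsingular_projective_curve n C \<and>
     (\<forall>i\<in>{1..m}. Q i \<in> C \<and> rational_point (Q i)) \<and> inj_on Q {1..m} \<and>
     2 \<le> m \<and> m \<le> card (UNIV :: 'a set)"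

definition point_divisor :: "nat \<Rightarrow> (nat \<Rightarrow> 'p) \<Rightarrow> ivec \<Rightarrow> 'p \<Rightarrow> int" where
  "point_divisor m Q \<alpha> P = (\<Sum>i\<in>{1..m}. if Q i = P then Poly_Mapping.lookup \<alpha> i else 0)"

definition regular_outside ::
    "nat \<Rightarrow> nat \<Rightarrow> 'a::field alg_closure ppoint set \<Rightarrow> (nat \<Rightarrow> 'a alg_closure ppoint) \<Rightarrow> 'a ratfun set" where
  "regular_outside m n C Q =
     {f \<in> carrier (function_field n C). \<forall>P\<in>C - Q ` {1..m}. f \<in> regular_at n C P}"

definition pole_vector ::
    "nat \<Rightarrow> nat \<Rightarrow> 'a::field alg_closure ppoint set \<Rightarrow> (nat \<Rightarrow> 'a alg_closure ppoint) \<Rightarrow> 'a ratfun \<Rightarrow> ivec" where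
  "pole_vector m n C Q f = (\<Sum>i\<in>{1..m}. Poly_Mapping.single i (- order_at n C (Q i) f))"

definition weierstrass_semigroup ::
    "nat \<Rightarrow> nat \<Rightarrow> 'a::field alg_closure ppoint set \<Rightarrow> (nat \<Rightarrow> 'a alg_closure ppoint) \<Rightarrow> ivec set" where
  "weierstrass_semigroup m n C Q =
     pole_vector m n C Q ` (regular_outside m n C Q - {\<zero>\<^bsub>function_field n C\<^esub>})"

definition nabla ::
    "nat \<Rightarrow> nat \<Rightarrow> 'a::field alg_closure ppoint set \<Rightarrow> (nat \<Rightarrow> 'a alg_closure ppoint) \<Rightarrow> nat \<Rightarrow> ivec \<Rightarrow> ivec set" where
  "nabla m n C Q i \<alpha> =
     {\<beta> \<in> weierstrass_semigroup m n C Q.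
        Poly_Mapping.lookup \<beta> i = Poly_Mapping.lookup \<alpha> i \<and>
        (\<forall>j\<in>{1..m} - {i}. Poly_Mapping.lookup \<beta> j < Poly_Mapping.lookup \<alpha> j)}"

definition maximal_elements ::
    "nat \<Rightarrow> nat \<Rightarrow> 'a::field alg_closure ppoint set \<Rightarrow> (nat \<Rightarrow> 'a alg_closure ppoint) \<Rightarrow> ivec set" where
  "maximal_elements m n C Q =
     {\<alpha> \<in> weierstrass_semigroup m n C Q. (\<Union>i\<in>{1..m}. nabla m n C Q i \<alpha>) = {}}"

definition ell ::
    "nat \<Rightarrow> nat \<Rightarrow> 'a::field alg_closure ppoint set \<Rightarrow> (nat \<Rightarrow> 'a alg_closure ppoint) \<Rightarrow> ivec \<Rightarrow> nat" where
  "ell m n C Q \<alpha> =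
     ring.dim (function_field n C) (constants n C) (riemann_roch_space n C (point_divisor m Q \<alpha>))"

definition ell_diff ::
    "nat \<Rightarrow> nat \<Rightarrow> 'a::field alg_closure ppoint set \<Rightarrow> (nat \<Rightarrow> 'a alg_closure ppoint) \<Rightarrow> nat \<Rightarrow> ivec \<Rightarrow> int" where
  "ell_diff m n C Q i \<beta> = int (ell m n C Q \<beta>) - int (ell m n C Q (\<beta> - ones {i}))"


section \<open>Poincare series and semigroup polynomial\<close>

type_synonym laurent_poly = "ivec \<Rightarrow>\<^sub>0 int"

type_synonym formal_series = "ivec \<Rightarrow> int"

text \<open>
  The coefficients do not depend on the index \<open>i\<close> in \<open>{1..m}\<close>. It is kept as an argument, so that
  statements can be made for every choice of it. Coefficients outside \<open>\<int>\<^sup>m\<close> are zero.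
\<close>

definition poincare_coeff ::
    "nat \<Rightarrow> nat \<Rightarrow> 'a::field alg_closure ppoint set \<Rightarrow> (nat \<Rightarrow> 'a alg_closure ppoint) \<Rightarrow> nat \<Rightarrow> ivec \<Rightarrow> int" where
  "poincare_coeff m n C Q i \<alpha> =
     (-1) ^ (m - 1) *
     (\<Sum>J\<in>Pow ({1..m} - {i}).
        (-1) ^ card J * ell_diff m n C Q i (\<alpha> - ones {1..m} + ones J + ones {i}))"

definition poincare_series ::
    "nat \<Rightarrow> nat \<Rightarrow> 'a::field alg_closure ppoint set \<Rightarrow> (nat \<Rightarrow> 'a alg_closure ppoint) \<Rightarrow> nat \<Rightarrow> formal_series" where
  "poincare_series m n C Q i =
     (\<lambda>\<alpha>. if \<alpha> \<in> int_vecs m then poincare_coeff m n C Q i \<alpha> else 0)"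

definition period ::
    "nat \<Rightarrow> nat \<Rightarrow> 'a::field alg_closure ppoint set \<Rightarrow> (nat \<Rightarrow> 'a alg_closure ppoint) \<Rightarrow> nat \<Rightarrow> nat" where
  "period m n C Q i =
     (LEAST t. 0 < t \<and>
        principal_divisor n C
          (point_divisor m Q (Poly_Mapping.single i (int t) - Poly_Mapping.single (Suc i) (int t))))"

definition eta ::
    "nat \<Rightarrow> nat \<Rightarrow> 'a::field alg_closure ppoint set \<Rightarrow> (nat \<Rightarrow> 'a alg_closure ppoint) \<Rightarrow> nat \<Rightarrow> ivec" where
  "eta m n C Q i =
     Poly_Mapping.single i (int (period m n C Q i)) -
     Poly_Mapping.single (Suc i) (int (period m n C Q i))"

definition theta_group ::
    "nat \<Rightarrow> nat \<Rightarrow> 'a::field alg_closure ppoint set \<Rightarrow> (nat \<Rightarrow> 'a alg_closure ppoint) \<Rightarrow> ivec set" where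
  "theta_group m n C Q = group_closure (eta m n C Q ` {1..<m})"

definition fundamental_region ::
    "nat \<Rightarrow> nat \<Rightarrow> 'a::field alg_closure ppoint set \<Rightarrow> (nat \<Rightarrow> 'a alg_closure ppoint) \<Rightarrow> ivec set" where
  "fundamental_region m n C Q =
     {\<alpha> \<in> int_vecs m. \<forall>i\<in>{1..<m}.
        0 \<le> Poly_Mapping.lookup \<alpha> i \<and> Poly_Mapping.lookup \<alpha> i < int (period m n C Q i)}"

text \<open>
  For a datum, the least \<open>t\<close> defining \<^const>\<open>period\<close> exists and the index set of the following
  sum is finite.
\<close>

definition semigroup_poly ::
    "nat \<Rightarrow> nat \<Rightarrow> 'a::field alg_closure ppoint set \<Rightarrow> (nat \<Rightarrow> 'a alg_closure ppoint) \<Rightarrow> nat \<Rightarrow> laurent_poly" where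
  "semigroup_poly m n C Q i =
     (\<Sum>\<alpha>\<in>maximal_elements m n C Q \<inter> fundamental_region m n C Q.
        Poly_Mapping.single \<alpha> (poincare_coeff m n C Q i \<alpha>))"

text \<open>The formal series with coefficient one exactly on \<open>A\<close>.\<close>

definition support_series :: "ivec set \<Rightarrow> formal_series" where
  "support_series A = (\<lambda>\<alpha>. of_bool (\<alpha> \<in> A))"

definition series_mult :: "formal_series \<Rightarrow> laurent_poly \<Rightarrow> formal_series" where
  "series_mult S L = (\<lambda>\<alpha>. \<Sum>\<beta>\<in>Poly_Mapping.keys L. S (\<alpha> - \<beta>) * Poly_Mapping.lookup L \<beta>)"

end

theory Submission
  imports Defs "HOL-Library.Countable_Set"
begin

text \<open>
  \<^bold>\<open>The series determines the semigroup.\<close> The coefficient \<open>p(\<alpha>)\<close> is the iterated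
  difference of \<open>\<ell>\<close> at \<open>\<alpha>\<close> in all \<open>m\<close> coordinate directions. Since \<open>\<ell>\<close> vanishes far out in
  every negative direction, such differences can be inverted, so \<open>p\<close> determines \<open>\<ell>\<close>
  (\<open>alt_diff_inject\<close>). In turn \<open>\<ell>\<close> determines the semigroup: \<open>\<alpha>\<close> belongs to it iff
  \<open>d\<^sub>i(\<alpha>) = 1\<close> for all \<open>i\<close>, because a vector space over a field with at least \<open>m\<close> elements is
  not the union of \<open>m\<close> proper subspaces (\<open>H_iff\<close>).

  \<^bold>\<open>The functional equation.\<close> The coefficient \<open>p(\<alpha>)\<close> vanishes unless \<open>\<alpha>\<close> is maximal
  (\<open>alt_coeff_nonzero_imp_maximal\<close>), and \<open>p\<close> is invariant under \<open>\<Theta>(Q)\<close>, because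
  multiplication by a function whose divisor is \<open>\<eta> \<in> \<Theta>(Q)\<close> identifies the Riemann-Roch spaces
  of \<open>\<alpha> + \<eta>\<close> and \<open>\<alpha>\<close>. Every vector is congruent modulo \<open>\<Theta>(Q)\<close> to exactly one vector of
  the fundamental region, so \<open>p(\<alpha>)\<close> occurs exactly once on the right-hand side. That the
  periods \<open>a\<^sub>i\<close> exist and that the polynomial is a finite sum follows from Riemann's inequality:
  \<open>deg \<alpha> - \<ell>(\<alpha>)\<close> is bounded above. The existence of the periods is the finiteness of the group of
  divisor classes of degree \<open>0\<close> supported on two points (\<open>unit_period\<close>).

  \<^bold>\<open>The geometry.\<close> All of this depends only on a ring of functions with orders at \<open>m\<close> places
  (locales \<open>pole_filtered_ring\<close> and \<open>riemann_ring\<close>). For a curve it has to be shown that the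
  spaces \<open>L(\<alpha>)\<close> are finite and that Riemann's inequality holds. Both follow from counting, as
  the ground field is finite. Transcendence degree one bounds the number of forms of degree \<open>d\<close>,
  as functions on the curve, by \<open>B ^ (d + 1)\<close> (\<open>growth_bound\<close>). Hence the coordinate ring of an
  affine chart is finite modulo each nonzero element (\<open>chart_quotient_finite\<close>). This finiteness
  yields a Nullstellensatz, the constancy of everywhere regular functions, the discreteness of the
  orders, and finally Riemann's inequality (\<open>riemann_bound\<close>), by comparing the number of functions
  with poles at the zeros of a form with the number of conditions at these zeros.

  The function field is realized inside an ultrapower of the algebraic closure, as the field
  generated by the coordinate quotients of a generic point, so that its elements can be computed
  with in an ordinary field.
\<close>

section \<open>Integer vectors\<close>

abbreviation coord :: "ivec \<Rightarrow> nat \<Rightarrow> int" where "coord \<equiv> Poly_Mapping.lookup"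
abbreviation axis :: "nat \<Rightarrow> int \<Rightarrow> ivec" where "axis \<equiv> Poly_Mapping.single"

lemma coord_axis: "coord (axis i k) j = (if j = i then k else 0)"
  by (simp add: lookup_single when_def)

lemma coord_ones: "finite J \<Longrightarrow> coord (ones J) j = of_bool (j \<in> J)"
  by (induction J rule: finite_induct) (auto simp: ones_def lookup_add coord_axis)

lemmas coord_simps = lookup_add lookup_minus coord_axis coord_ones

lemma ones_singleton [simp]: "ones {i} = axis i 1"
  by (simp add: ones_def)

lemma ones_insert: "finite J \<Longrightarrow> i \<notin> J \<Longrightarrow> ones (insert i J) = axis i 1 + ones J"
  by (simp add: ones_def)

lemma int_vecs_iff: "\<alpha> \<in> int_vecs m \<longleftrightarrow> (\<forall>j. j \<notin> {1..m} \<longrightarrow> coord \<alpha> j = 0)"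
  unfolding int_vecs_def by (auto simp: in_keys_iff)

lemma int_vecs_add: "\<alpha> \<in> int_vecs m \<Longrightarrow> \<beta> \<in> int_vecs m \<Longrightarrow> \<alpha> + \<beta> \<in> int_vecs m"
  and int_vecs_diff: "\<alpha> \<in> int_vecs m \<Longrightarrow> \<beta> \<in> int_vecs m \<Longrightarrow> \<alpha> - \<beta> \<in> int_vecs m"
  and int_vecs_axis: "i \<in> {1..m} \<Longrightarrow> axis i k \<in> int_vecs m"
  and int_vecs_ones: "J \<subseteq> {1..m} \<Longrightarrow> ones J \<in> int_vecs m"
  and int_vecs_0: "0 \<in> int_vecs m"
  by (auto simp: int_vecs_iff coord_simps finite_subset[of J "{1..m}"])

lemmas int_vecs_intros = int_vecs_add int_vecs_diff int_vecs_axis int_vecs_ones int_vecs_0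

lemma int_vecs_eqI:
  "\<alpha> \<in> int_vecs m \<Longrightarrow> \<beta> \<in> int_vecs m \<Longrightarrow> (\<And>i. i \<in> {1..m} \<Longrightarrow> coord \<alpha> i = coord \<beta> i) \<Longrightarrow> \<alpha> = \<beta>"
  by (rule poly_mapping_eqI) (metis int_vecs_iff)

definition vec_of :: "nat \<Rightarrow> (nat \<Rightarrow> int) \<Rightarrow> ivec" where
  "vec_of m f = (\<Sum>i\<in>{1..m}. axis i (f i))"

lemma coord_vec_of: "coord (vec_of m f) j = (if j \<in> {1..m} then f j else 0)"
  by (auto simp: vec_of_def lookup_sum coord_axis)

lemma vec_of_int_vecs: "vec_of m f \<in> int_vecs m"
  by (auto simp: int_vecs_iff coord_vec_of)

definition vdeg :: "nat \<Rightarrow> ivec \<Rightarrow> int" where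
  "vdeg m \<alpha> = (\<Sum>i\<in>{1..m}. coord \<alpha> i)"

lemma vdeg_add: "vdeg m (\<alpha> + \<beta>) = vdeg m \<alpha> + vdeg m \<beta>"
  and vdeg_diff: "vdeg m (\<alpha> - \<beta>) = vdeg m \<alpha> - vdeg m \<beta>"
  and vdeg_axis: "i \<in> {1..m} \<Longrightarrow> vdeg m (axis i k) = k"
  by (auto simp: vdeg_def lookup_add lookup_minus sum.distrib sum_subtractf coord_axis)

definition vec_le :: "nat \<Rightarrow> ivec \<Rightarrow> ivec \<Rightarrow> bool" where
  "vec_le m \<alpha> \<beta> \<longleftrightarrow> (\<forall>i\<in>{1..m}. coord \<alpha> i \<le> coord \<beta> i)"

lemma vec_le_induct [consumes 3, case_names base step]:
  assumes "\<alpha> \<in> int_vecs m" "\<beta> \<in> int_vecs m" "vec_le m \<alpha> \<beta>"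
    and "P \<alpha>"
    and step: "\<And>\<gamma> i. \<gamma> \<in> int_vecs m \<Longrightarrow> vec_le m \<alpha> \<gamma> \<Longrightarrow> i \<in> {1..m} \<Longrightarrow> P \<gamma> \<Longrightarrow> P (\<gamma> + axis i 1)"
  shows "P \<beta>"
  using assms(2,3)
proof (induction "nat (vdeg m \<beta> - vdeg m \<alpha>)" arbitrary: \<beta>)
  case (0 \<beta>)
  have "vdeg m \<beta> - vdeg m \<alpha> = (\<Sum>i\<in>{1..m}. coord \<beta> i - coord \<alpha> i)"
    by (simp add: vdeg_def sum_subtractf)
  with 0 have "(\<Sum>i\<in>{1..m}. coord \<beta> i - coord \<alpha> i) = 0"
    by (intro antisym sum_nonneg) (auto simp: vec_le_def)
  with 0 have "\<forall>i\<in>{1..m}. coord \<beta> i - coord \<alpha> i = 0"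
    by (subst (asm) sum_nonneg_eq_0_iff) (auto simp: vec_le_def)
  hence "\<beta> = \<alpha>"
    using 0 assms(1) by (intro int_vecs_eqI) auto
  with assms show ?case by simp
next
  case (Suc k \<beta>)
  have "\<exists>i\<in>{1..m}. coord \<alpha> i < coord \<beta> i"
  proof (rule ccontr)
    assume "\<not> ?thesis"
    hence "vdeg m \<beta> \<le> vdeg m \<alpha>"
      unfolding vdeg_def by (intro sum_mono) (meson not_less)
    with Suc(2) show False by simp
  qed
  then obtain i where i: "i \<in> {1..m}" "coord \<alpha> i < coord \<beta> i" by blast
  let ?\<gamma> = "\<beta> - axis i 1"
  have "P ?\<gamma>"
  proof (rule Suc(1))
    show "k = nat (vdeg m ?\<gamma> - vdeg m \<alpha>)"
      using Suc(2) i(1) by (simp add: vdeg_diff vdeg_axis)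
    show "?\<gamma> \<in> int_vecs m" using Suc i by (intro int_vecs_intros)
    show "vec_le m \<alpha> ?\<gamma>" using Suc(4) i by (auto simp: vec_le_def coord_simps)
  qed
  moreover have "vec_le m \<alpha> ?\<gamma>" using Suc(4) i by (auto simp: vec_le_def coord_simps)
  ultimately have "P (?\<gamma> + axis i 1)"
    using Suc i by (intro step int_vecs_intros) auto
  thus ?case by simp
qed

section \<open>The Poincare series determines the dimensions\<close>

text \<open>
  The formula for the coefficients of the Poincare series, for an arbitrary dimension function \<open>l\<close>.
\<close>

definition alt_coeff :: "nat \<Rightarrow> (ivec \<Rightarrow> nat) \<Rightarrow> nat \<Rightarrow> ivec \<Rightarrow> int" where
  "alt_coeff m l i \<alpha> =
     (-1) ^ (m - 1) *
     (\<Sum>J\<in>Pow ({1..m} - {i}).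
        (-1) ^ card J * (int (l (\<alpha> - ones {1..m} + ones J + ones {i})) -
                         int (l (\<alpha> - ones {1..m} + ones J + ones {i} - ones {i}))))"

text \<open>
  The product of the difference operators \<open>h \<mapsto> (\<lambda>\<alpha>. h \<alpha> - h (\<alpha> - e\<^sub>j))\<close> over \<open>j \<in> J\<close>, expanded.
\<close>

definition alt_diff :: "(ivec \<Rightarrow> int) \<Rightarrow> nat set \<Rightarrow> ivec \<Rightarrow> int" where
  "alt_diff h J \<alpha> = (\<Sum>T\<in>Pow J. (-1) ^ card T * h (\<alpha> - ones T))"

lemma sum_Pow_insert:
  fixes f :: "'b set \<Rightarrow> 'c::comm_monoid_add"
  assumes "finite J" "i \<notin> J"
  shows "(\<Sum>T\<in>Pow (insert i J). f T) = (\<Sum>T\<in>Pow J. f T) + (\<Sum>T\<in>Pow J. f (insert i T))"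
proof -
  have "(\<Sum>T\<in>Pow (insert i J). f T) = (\<Sum>T\<in>Pow J \<union> insert i ` Pow J. f T)"
    by (simp add: Pow_insert)
  also have "\<dots> = (\<Sum>T\<in>Pow J. f T) + (\<Sum>T\<in>insert i ` Pow J. f T)"
    using assms by (intro sum.union_disjoint) auto
  also have "(\<Sum>T\<in>insert i ` Pow J. f T) = (\<Sum>T\<in>Pow J. f (insert i T))"
    using assms by (subst sum.reindex) (auto simp: inj_on_def)
  finally show ?thesis .
qed

lemma alt_diff_insert:
  assumes "finite J" "i \<notin> J"
  shows "alt_diff h (insert i J) \<alpha> = alt_diff h J \<alpha> - alt_diff h J (\<alpha> - axis i 1)"
proof -
  have "(\<Sum>T\<in>Pow J. (-1) ^ card (insert i T) * h (\<alpha> - ones (insert i T))) =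
        (\<Sum>T\<in>Pow J. - ((-1) ^ card T * h (\<alpha> - axis i 1 - ones T)))"
  proof (rule sum.cong)
    fix T assume "T \<in> Pow J"
    hence T: "finite T" "i \<notin> T" using assms finite_subset by auto
    show "(-1) ^ card (insert i T) * h (\<alpha> - ones (insert i T)) =
            - ((-1) ^ card T * h (\<alpha> - axis i 1 - ones T))"
      using T by (simp add: ones_insert diff_diff_eq)
  qed auto
  thus ?thesis
    unfolding alt_diff_def by (subst sum_Pow_insert[OF assms]) (simp add: sum_negf)
qed

text \<open>
  With \<open>T\<close> the complement of \<open>J\<close> in \<open>{1..m} - {i}\<close>, the two terms for \<open>J\<close> are those of the
  full alternating difference for \<open>T\<close> and \<open>insert i T\<close>. In particular the coefficient is independent of \<open>i\<close>.
\<close>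

lemma alt_coeff_eq_alt_diff:
  assumes "i \<in> {1..m}"
  shows "alt_coeff m l i \<alpha> = alt_diff (\<lambda>\<beta>. int (l \<beta>)) {1..m} \<alpha>"
proof -
  let ?I = "{1..m} - {i}"
  have I: "{1..m} = insert i ?I" using assms by auto
  have "card ?I = m - 1" using assms by simp
  have "alt_diff (\<lambda>\<beta>. int (l \<beta>)) {1..m} \<alpha> = 
     (\<Sum>T\<in>Pow ?I. (-1) ^ card T * (int (l (\<alpha> - ones T)) - int (l (\<alpha> - axis i 1 - ones T))))"
    by (subst I, subst alt_diff_insert) (auto simp: alt_diff_def sum_subtractf algebra_simps)
  also have "\<dots> = (\<Sum>J\<in>Pow ?I. (-1) ^ (m - 1) * ((-1) ^ card J * (int (l (\<alpha> - ones {1..m} + ones J + ones {i})) -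
                         int (l (\<alpha> - ones {1..m} + ones J + ones {i} - ones {i})))))"
  proof (rule sum.reindex_bij_witness[of _ "\<lambda>J. ?I - J" "\<lambda>J. ?I - J"])
    fix T assume "T \<in> Pow ?I"
    hence T: "T \<subseteq> ?I" by simp
    hence fT: "finite T" by (rule finite_subset) simp
    have c: "card (?I - T) + card T = m - 1"
      using T fT card_Diff_subset[OF fT T] card_mono[OF _ T] \<open>card ?I = m - 1\<close> by simp
    have e: "\<alpha> - ones {1..m} + ones (?I - T) + ones {i} = \<alpha> - ones T"
      using T fT assms by (intro poly_mapping_eqI) (auto simp: coord_simps)
    have e2: "\<alpha> - ones T - ones {i} = \<alpha> - axis i 1 - ones T"
      by (simp add: diff_diff_eq add.commute)
    have "(-1::int) ^ (m - 1) * (-1) ^ card (?I - T) = (-1) ^ card T"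
      unfolding c[symmetric] by (simp add: minus_one_power_iff)
    thus "(- 1) ^ (m - 1) *
        ((- 1) ^ card (?I - T) * (int (l (\<alpha> - ones {1..m} + ones (?I - T) + ones {i})) -
          int (l (\<alpha> - ones {1..m} + ones (?I - T) + ones {i} - ones {i})))) =
      (-1) ^ card T * (int (l (\<alpha> - ones T)) - int (l (\<alpha> - axis i 1 - ones T)))"
      unfolding e e2 by (simp only: mult.assoc[symmetric])
  qed auto
  finally show ?thesis
    by (simp add: alt_coeff_def sum_distrib_left)
qed

text \<open>
  The directions can be removed one at a time: if the difference in direction \<open>i\<close> of some function
  vanishes, the function is invariant under \<open>e\<^sub>i\<close>, and it is zero because it is zero far out in the
  direction \<open>- e\<^sub>i\<close>.
\<close>

lemma alt_diff_inject:
  assumes "finite J" "J \<subseteq> {1..m}"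
    and decay: "\<And>\<alpha> i. \<alpha> \<in> int_vecs m \<Longrightarrow> i \<in> {1..m} \<Longrightarrow>
           eventually (\<lambda>n. h (\<alpha> - axis i (int n)) = 0) sequentially"
    and zero: "\<And>\<alpha>. \<alpha> \<in> int_vecs m \<Longrightarrow> alt_diff h J \<alpha> = 0"
    and "\<alpha> \<in> int_vecs m"
  shows "h \<alpha> = 0"
  using assms(1,2,4,5)
proof (induction J arbitrary: \<alpha> rule: finite_induct)
  case empty
  thus ?case by (simp add: alt_diff_def ones_def)
next
  case (insert i J)
  have i: "i \<in> {1..m}" and J: "J \<subseteq> {1..m}" using insert by auto
  have "alt_diff h J \<beta> = 0" if \<beta>: "\<beta> \<in> int_vecs m" for \<beta>
  proof -
    have const: "alt_diff h J (\<beta> - axis i (int n)) = alt_diff h J \<beta>" for n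
    proof (induction n)
      case (Suc n)
      have "\<beta> - axis i (int n) \<in> int_vecs m" using \<beta> i by (intro int_vecs_intros)
      from insert.prems(2)[OF this] have
        "alt_diff h J (\<beta> - axis i (int n) - axis i 1) = alt_diff h J (\<beta> - axis i (int n))"
        using insert.hyps by (simp add: alt_diff_insert)
      moreover have "\<beta> - axis i (int n) - axis i 1 = \<beta> - axis i (int (Suc n))"
        by (intro poly_mapping_eqI) (auto simp: coord_simps)
      ultimately show ?case using Suc by simp
    qed simp
    have "eventually (\<lambda>n. \<forall>T\<in>Pow J. h (\<beta> - ones T - axis i (int n)) = 0) sequentially"
    proof (intro eventually_ball_finite ballI)
      show "finite (Pow J)" using insert.hyps(1) by simp
      fix T assume "T \<in> Pow J"
      hence "\<beta> - ones T \<in> int_vecs m"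
        using \<beta> J by (intro int_vecs_diff int_vecs_ones) auto
      thus "eventually (\<lambda>n. h (\<beta> - ones T - axis i (int n)) = 0) sequentially"
        using i by (rule decay)
    qed
    then obtain n where n: "\<forall>T\<in>Pow J. h (\<beta> - ones T - axis i (int n)) = 0"
      using eventually_happens'[OF sequentially_bot] by blast
    have "alt_diff h J (\<beta> - axis i (int n)) = 0"
      unfolding alt_diff_def
    proof (intro sum.neutral ballI)
      fix T assume T: "T \<in> Pow J"
      have eq: "\<beta> - axis i (int n) - ones T = \<beta> - ones T - axis i (int n)"
        by (rule poly_mapping_eqI) (simp add: lookup_minus)
      show "(-1) ^ card T * h (\<beta> - axis i (int n) - ones T) = 0"
        unfolding eq using n T by simp
    qed
    thus ?thesis using const by simp
  qed
  with insert J show ?case by blast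
qed

section \<open>Fundamental region\<close>

definition eta_vec :: "(nat \<Rightarrow> nat) \<Rightarrow> nat \<Rightarrow> ivec" where
  "eta_vec a i = axis i (int (a i)) - axis (Suc i) (int (a i))"

definition theta_lattice :: "nat \<Rightarrow> (nat \<Rightarrow> nat) \<Rightarrow> ivec set" where
  "theta_lattice m a = group_closure (eta_vec a ` {1..<m})"

definition fund_region :: "nat \<Rightarrow> (nat \<Rightarrow> nat) \<Rightarrow> ivec set" where
  "fund_region m a = {\<alpha> \<in> int_vecs m. \<forall>i\<in>{1..<m}. 0 \<le> coord \<alpha> i \<and> coord \<alpha> i < int (a i)}"

lemma theta_lattice_int_vecs: "\<eta> \<in> theta_lattice m a \<Longrightarrow> \<eta> \<in> int_vecs m"
  unfolding theta_lattice_def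
  by (induction rule: group_closure.induct)
     (auto simp: eta_vec_def intro!: int_vecs_intros)

text \<open>
  The first \<open>k\<close> coordinates of \<open>eta_vec a i\<close> sum to \<open>a k\<close> if \<open>i = k\<close>, and to \<open>0\<close> otherwise.
\<close>

lemma theta_lattice_partial_sums:
  assumes "\<eta> \<in> theta_lattice m a" "k \<in> {1..<m}"
  shows "int (a k) dvd (\<Sum>j\<in>{1..k}. coord \<eta> j)"
  using assms unfolding theta_lattice_def
proof (induction rule: group_closure.induct)
  case (base s)
  show ?case
  proof (cases "s = 0")
    case False
    then obtain i where i: "i \<in> {1..<m}" "s = eta_vec a i" using base by auto
    have "(\<Sum>j\<in>{1..k}. coord s j) = 
          (\<Sum>j\<in>{1..k}. (if j = i then int (a i) else 0)) - (\<Sum>j\<in>{1..k}. (if j = Suc i then int (a i) else 0))"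
      unfolding i(2) eta_vec_def lookup_minus coord_axis by (rule sum_subtractf)
    also have "\<dots> = (if i \<le> k then int (a i) else 0) - (if Suc i \<le> k then int (a i) else 0)"
      using i(1) by (simp add: sum.delta)
    also have "int (a k) dvd \<dots>" by (cases "i = k") auto
    finally show ?thesis .
  qed auto
next
  case (diff s t)
  thus ?case by (simp add: lookup_minus sum_subtractf)
qed

lemma theta_lattice_vdeg: "\<eta> \<in> theta_lattice m a \<Longrightarrow> vdeg m \<eta> = 0"
  unfolding theta_lattice_def
  by (induction rule: group_closure.induct)
     (auto simp: vdeg_diff eta_vec_def vdeg_axis, simp add: vdeg_def)

text \<open>
  If the coordinates before the \<open>j\<close>-th agree, the partial sums show that the \<open>j\<close>-th coordinates are
  congruent modulo \<open>a j\<close>, hence equal. The last coordinates agree because the degrees do.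
\<close>

lemma fund_region_unique:
  assumes "\<gamma> \<in> fund_region m a" "\<gamma>' \<in> fund_region m a" "\<gamma> - \<gamma>' \<in> theta_lattice m a"
  shows "\<gamma> = \<gamma>'"
proof -
  let ?d = "\<lambda>j. coord (\<gamma> - \<gamma>') j"
  have eq: "?d j = 0" if "j \<in> {1..<m}" for j
    using that
  proof (induction j rule: less_induct)
    case (less j)
    have "{1..j} = insert j {1..<j}" using less.prems by auto
    hence "(\<Sum>k\<in>{1..j}. ?d k) = ?d j + (\<Sum>k\<in>{1..<j}. ?d k)" by simp
    also have "(\<Sum>k\<in>{1..<j}. ?d k) = 0"
      using less by (intro sum.neutral ballI less.IH) auto
    finally have dvd: "int (a j) dvd ?d j"
      using theta_lattice_partial_sums[OF assms(3) less.prems] by simp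
    have "\<bar>?d j\<bar> < int (a j)"
      using assms(1,2) less.prems unfolding fund_region_def lookup_minus
      by (smt (verit) mem_Collect_eq)
    with dvd show ?case
      using zdvd_imp_le[of "int (a j)" "\<bar>?d j\<bar>"] by (cases "?d j = 0") auto
  qed
  have "vdeg m (\<gamma> - \<gamma>') = 0" by (rule theta_lattice_vdeg) fact
  moreover have "vdeg m (\<gamma> - \<gamma>') = ?d m" if "m \<ge> 1"
  proof -
    have "{1..m} = insert m {1..<m}" using that by auto
    thus ?thesis using eq by (simp add: vdeg_def)
  qed
  ultimately have "?d j = 0" if "j \<in> {1..m}" for j
    using eq that by (cases "j = m") auto
  thus ?thesis
    using assms by (intro int_vecs_eqI[of _ m]) (auto simp: fund_region_def lookup_minus)
qed

lemma group_closure_axis_multiple: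
  fixes \<eta> :: "ivec"
  assumes "\<eta> \<in> group_closure S"
  shows "Poly_Mapping.map ((*) k) \<eta> \<in> group_closure S"
proof -
  have nat: "Poly_Mapping.map ((*) (int n)) \<eta> \<in> group_closure S" for n
  proof (induction n)
    case 0
    have "Poly_Mapping.map ((*) (int 0)) \<eta> = 0"
      by (rule poly_mapping_eqI) (simp add: map.rep_eq when_def)
    thus ?case by (metis zero_in_group_closure)
  next
    case (Suc n)
    have "Poly_Mapping.map ((*) (int (Suc n))) \<eta> = Poly_Mapping.map ((*) (int n)) \<eta> + \<eta>"
      by (rule poly_mapping_eqI) (auto simp: map.rep_eq when_def lookup_add algebra_simps)
    thus ?case using Suc assms by (simp add: group_closure_add)
  qed
  show ?thesis
  proof (cases "k \<ge> 0")
    case True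
    thus ?thesis using nat[of "nat k"] by simp
  next
    case False
    have "Poly_Mapping.map ((*) k) \<eta> = - Poly_Mapping.map ((*) (int (nat (-k)))) \<eta>"
      using False by (intro poly_mapping_eqI) (auto simp: map.rep_eq when_def)
    thus ?thesis using nat[of "nat (-k)"] by simp
  qed
qed

text \<open>
  Division with remainder by \<open>a 1, \<dots>, a (m - 1)\<close>, in this order: subtracting a multiple of
  \<open>eta_vec a k\<close> leaves the coordinates before the \<open>k\<close>-th unchanged.
\<close>

lemma fund_region_exists:
  assumes "\<alpha> \<in> int_vecs m" and pos: "\<And>i. i \<in> {1..<m} \<Longrightarrow> 0 < a i"
  shows "\<exists>\<gamma>\<in>fund_region m a. \<alpha> - \<gamma> \<in> theta_lattice m a"
proof -
  have "\<exists>\<gamma>\<in>int_vecs m. \<alpha> - \<gamma> \<in> theta_lattice m a \<and>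
          (\<forall>i\<in>{1..<k}. 0 \<le> coord \<gamma> i \<and> coord \<gamma> i < int (a i))" if "k \<le> m" for k
    using that
  proof (induction k)
    case 0
    show ?case using assms by (intro bexI[of _ \<alpha>]) (auto simp: theta_lattice_def)
  next
    case (Suc k)
    then obtain \<gamma> where \<gamma>: "\<gamma> \<in> int_vecs m" "\<alpha> - \<gamma> \<in> theta_lattice m a"
      "\<forall>i\<in>{1..<k}. 0 \<le> coord \<gamma> i \<and> coord \<gamma> i < int (a i)" by auto
    show ?case
    proof (cases "k = 0")
      case True
      thus ?thesis using \<gamma> by auto
    next
      case False
      hence k: "k \<in> {1..<m}" using Suc.prems by auto
      define \<eta> where "\<eta> = Poly_Mapping.map ((*) (coord \<gamma> k div int (a k))) (eta_vec a k)"
      have \<eta>: "\<eta> \<in> theta_lattice m a"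
        unfolding \<eta>_def theta_lattice_def using k
        by (intro group_closure_axis_multiple group_closure.base) auto
      have c: "coord \<eta> j = (coord \<gamma> k div int (a k)) * coord (eta_vec a k) j" for j
        by (simp add: \<eta>_def map.rep_eq when_def)
      show ?thesis
      proof (rule bexI[of _ "\<gamma> - \<eta>"], intro conjI ballI)
        have "\<alpha> - (\<gamma> - \<eta>) = (\<alpha> - \<gamma>) + \<eta>" by simp
        thus "\<alpha> - (\<gamma> - \<eta>) \<in> theta_lattice m a"
          using \<gamma>(2) \<eta> unfolding theta_lattice_def by (metis group_closure_add)
        show "\<gamma> - \<eta> \<in> int_vecs m"
          using \<gamma>(1) theta_lattice_int_vecs[OF \<eta>] by (rule int_vecs_diff)
        fix i assume i: "i \<in> {1..<Suc k}"
        have "coord (\<gamma> - \<eta>) i = (if i = k then coord \<gamma> k mod int (a k) else coord \<gamma> i)"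
          using i by (auto simp: lookup_minus c eta_vec_def coord_axis minus_div_mult_eq_mod)
        thus "0 \<le> coord (\<gamma> - \<eta>) i" "coord (\<gamma> - \<eta>) i < int (a i)"
          using \<gamma>(3) i pos[OF k] by auto
      qed
    qed
  qed
  from this[of m] show ?thesis by (auto simp: fund_region_def)
qed

section \<open>Finite quotients\<close>

definition transversal :: "'k::ab_group_add set \<Rightarrow> 'k set \<Rightarrow> 'k set \<Rightarrow> bool" where
  "transversal A I T \<longleftrightarrow> finite T \<and> T \<subseteq> A \<and> (\<forall>a\<in>A. \<exists>!x. x \<in> T \<and> a - x \<in> I)"

definition separated :: "'k::ab_group_add set \<Rightarrow> 'k set \<Rightarrow> bool" where
  "separated I Y \<longleftrightarrow> (\<forall>a\<in>Y. \<forall>b\<in>Y. a - b \<in> I \<longrightarrow> a = b)"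

text \<open>
  A separated subset of maximal size meets every class.
\<close>

lemma transversal_exists:
  fixes A I :: "'k::ab_group_add set"
  assumes zero: "0 \<in> I" and diff: "\<And>a b. a \<in> I \<Longrightarrow> b \<in> I \<Longrightarrow> a - b \<in> I"
    and bound: "\<And>Y. finite Y \<Longrightarrow> Y \<subseteq> A \<Longrightarrow> separated I Y \<Longrightarrow> card Y \<le> M"
  obtains T where "transversal A I T" "card T \<le> M"
proof -
  let ?P = "\<lambda>n. \<exists>Y. finite Y \<and> Y \<subseteq> A \<and> separated I Y \<and> card Y = n"
  have "?P 0" by (intro exI[of _ "{}"]) (auto simp: separated_def)
  moreover have "\<And>n. ?P n \<Longrightarrow> n \<le> M" using bound by blast
  ultimately have "?P (GREATEST n. ?P n)" and max: "\<And>n. ?P n \<Longrightarrow> n \<le> (GREATEST n. ?P n)"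
    using GreatestI_nat[of ?P 0 M] Greatest_le_nat[of ?P _ M] by blast+
  then obtain T where T: "finite T" "T \<subseteq> A" "separated I T" "card T = (GREATEST n. ?P n)"
    by blast
  have sym: "a - b \<in> I" if "b - a \<in> I" for a b
    using diff[OF zero that] by simp
  have ex: "\<exists>x\<in>T. a - x \<in> I" if "a \<in> A" for a
  proof (rule ccontr)
    assume *: "\<not> ?thesis"
    hence "a \<notin> T" using zero by (metis diff_self)
    have "separated I (insert a T)"
      using T(3) * sym unfolding separated_def by blast
    hence "?P (card (insert a T))" using T that by (intro exI[of _ "insert a T"]) auto
    from max[OF this] show False using T(1,4) \<open>a \<notin> T\<close> by simp
  qed
  have uniq: "x = x'" if "x \<in> T" "x' \<in> T" "a - x \<in> I" "a - x' \<in> I" for a x x'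
  proof -
    have "x - x' = (a - x') - (a - x)" by simp
    hence "x - x' \<in> I" using diff[OF that(4,3)] by metis
    thus ?thesis using T(3) that unfolding separated_def by blast
  qed
  have "transversal A I T"
    unfolding transversal_def using T(1,2) ex uniq by blast
  moreover have "card T \<le> M" using bound[OF T(1-3)] .
  ultimately show ?thesis using that by blast
qed

section \<open>Functions with poles at finitely many places\<close>

text \<open>
  What the combinatorics needs to know about a curve: \<open>F\<close> stands for the constants, \<open>R\<close> for the
  functions that are regular outside the points, and \<open>v i\<close> for the order at the \<open>i\<close>-th point. The
  assumption \<open>v_residue\<close> expresses that this point is rational, and \<open>finite_regular\<close> that there are
  only finitely many functions without poles. The value of \<open>v i\<close> at \<open>0\<close> is arbitrary, so \<open>0\<close> is
  treated separately throughout.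
\<close>

locale pole_filtered_ring =
  fixes F R :: "'k::field set" and v :: "nat \<Rightarrow> 'k \<Rightarrow> int" and m :: nat
  assumes m2: "2 \<le> m"
    and finF: "finite F" and cardF: "m \<le> card F"
    and F01: "0 \<in> F" "1 \<in> F"
    and F_diff: "\<And>a b. a \<in> F \<Longrightarrow> b \<in> F \<Longrightarrow> a - b \<in> F"
    and F_inverse: "\<And>a. a \<in> F \<Longrightarrow> inverse a \<in> F"
    and F_R: "F \<subseteq> R"
    and R_diff: "\<And>a b. a \<in> R \<Longrightarrow> b \<in> R \<Longrightarrow> a - b \<in> R"
    and R_mult: "\<And>a b. a \<in> R \<Longrightarrow> b \<in> R \<Longrightarrow> a * b \<in> R"
    and v_const: "\<And>i c. i \<in> {1..m} \<Longrightarrow> c \<in> F \<Longrightarrow> c \<noteq> 0 \<Longrightarrow> v i c = 0"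
    and v_mult: "\<And>i f g. i \<in> {1..m} \<Longrightarrow> f \<in> R \<Longrightarrow> g \<in> R \<Longrightarrow> f \<noteq> 0 \<Longrightarrow> g \<noteq> 0 \<Longrightarrow>
                   v i (f * g) = v i f + v i g"
    and v_diff: "\<And>i f g. i \<in> {1..m} \<Longrightarrow> f \<in> R \<Longrightarrow> g \<in> R \<Longrightarrow> f \<noteq> 0 \<Longrightarrow> g \<noteq> 0 \<Longrightarrow> f \<noteq> g \<Longrightarrow>
                   min (v i f) (v i g) \<le> v i (f - g)"
    and v_residue: "\<And>i f g. i \<in> {1..m} \<Longrightarrow> f \<in> R \<Longrightarrow> g \<in> R \<Longrightarrow> f \<noteq> 0 \<Longrightarrow> g \<noteq> 0 \<Longrightarrow> v i f = v i g \<Longrightarrow>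
                   \<exists>c\<in>F. f = c * g \<or> v i f < v i (f - c * g)"
    and finite_regular: "finite {f \<in> R. f = 0 \<or> (\<forall>i\<in>{1..m}. 0 \<le> v i f)}"
begin

abbreviation q :: nat where "q \<equiv> card F"

definition L :: "ivec \<Rightarrow> 'k set" where
  "L \<alpha> = {f \<in> R. f = 0 \<or> (\<forall>i\<in>{1..m}. - coord \<alpha> i \<le> v i f)}"

lemma q2: "2 \<le> q"
  using m2 cardF by simp

lemma R01: "0 \<in> R" "1 \<in> R"
  using F01 F_R by auto

lemma R_uminus: "a \<in> R \<Longrightarrow> - a \<in> R"
  using R_diff[of 0 a] R01 by simp

lemma R_add: "a \<in> R \<Longrightarrow> b \<in> R \<Longrightarrow> a + b \<in> R"
  using R_diff[of a "- b"] R_uminus by simp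

lemma F_uminus: "a \<in> F \<Longrightarrow> - a \<in> F"
  using F_diff[of 0 a] F01 by simp

lemma L_R: "f \<in> L \<alpha> \<Longrightarrow> f \<in> R"
  by (simp add: L_def)

lemma L_bound: "f \<in> L \<alpha> \<Longrightarrow> f \<noteq> 0 \<Longrightarrow> i \<in> {1..m} \<Longrightarrow> - coord \<alpha> i \<le> v i f"
  by (simp add: L_def)

lemma zero_L [simp]: "0 \<in> L \<alpha>"
  by (simp add: L_def R01)

lemma L_diff:
  assumes "f \<in> L \<alpha>" "g \<in> L \<alpha>"
  shows "f - g \<in> L \<alpha>"
proof (cases "f = 0 \<or> g = 0 \<or> f = g")
  case True
  moreover have "- g \<in> L \<alpha>"
  proof (cases "g = 0")
    case False
    have "v i (- g) = v i g" if "i \<in> {1..m}" for i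
      using v_mult[of i "-1" g] v_const[of i "-1"] that assms(2) F01 F_R F_uminus[of 1] False
      by (auto simp: L_def)
    thus ?thesis using assms False by (auto simp: L_def R_uminus)
  qed simp
  ultimately show ?thesis using assms by auto
next
  case False
  have "- coord \<alpha> i \<le> v i (f - g)" if i: "i \<in> {1..m}" for i
  proof -
    have "- coord \<alpha> i \<le> v i f" "- coord \<alpha> i \<le> v i g" using assms False i by (auto simp: L_def)
    moreover have "min (v i f) (v i g) \<le> v i (f - g)"
      using assms False i by (intro v_diff) (auto simp: L_def)
    ultimately show ?thesis by linarith
  qed
  thus ?thesis using assms by (auto simp: L_def R_diff)
qed

lemma L_uminus: "f \<in> L \<alpha> \<Longrightarrow> - f \<in> L \<alpha>"
  using L_diff[of 0 \<alpha> f] by simp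

lemma L_add: "f \<in> L \<alpha> \<Longrightarrow> g \<in> L \<alpha> \<Longrightarrow> f + g \<in> L \<alpha>"
  using L_diff[of f \<alpha> "- g"] L_uminus by simp

lemma L_mult:
  assumes "f \<in> L \<alpha>" "g \<in> L \<beta>"
  shows "f * g \<in> L (\<alpha> + \<beta>)"
proof (cases "f = 0 \<or> g = 0")
  case False
  have "- coord (\<alpha> + \<beta>) i \<le> v i (f * g)" if "i \<in> {1..m}" for i
  proof -
    have "- coord \<alpha> i \<le> v i f" "- coord \<beta> i \<le> v i g" using assms False that by (auto simp: L_def)
    thus ?thesis using v_mult[OF that, of f g] assms False by (auto simp: L_def lookup_add)
  qed
  thus ?thesis using assms by (auto simp: L_def R_mult)
qed auto

lemma L_scale:
  assumes "c \<in> F" "f \<in> L \<alpha>"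
  shows "c * f \<in> L \<alpha>"
proof -
  have "c \<in> L 0" using assms F_R v_const[of _ c] by (auto simp: L_def)
  from L_mult[OF this assms(2)] show ?thesis by simp
qed

lemma L_mono: "vec_le m \<alpha> \<beta> \<Longrightarrow> L \<alpha> \<subseteq> L \<beta>"
  unfolding L_def vec_le_def by (auto; force)

text \<open>
  By \<open>ldim_step\<close> below, this says that the dimension drops from \<open>\<beta>\<close> to \<open>\<beta> - e\<^sub>i\<close>.
\<close>

definition attained :: "nat \<Rightarrow> ivec \<Rightarrow> bool" where
  "attained i \<beta> \<longleftrightarrow> (\<exists>f\<in>L \<beta>. f \<noteq> 0 \<and> v i f = - coord \<beta> i)"

lemma L_lower:
  assumes "i \<in> {1..m}" "f \<in> L \<beta>" "f \<noteq> 0"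
  shows "f \<in> L (\<beta> - axis i 1) \<longleftrightarrow> v i f \<noteq> - coord \<beta> i"
proof
  assume "f \<in> L (\<beta> - axis i 1)"
  hence "- coord (\<beta> - axis i 1) i \<le> v i f" using assms by (auto simp: L_def)
  thus "v i f \<noteq> - coord \<beta> i" by (simp add: coord_simps)
next
  assume *: "v i f \<noteq> - coord \<beta> i"
  have "- coord (\<beta> - axis i 1) j \<le> v j f" if "j \<in> {1..m}" for j
  proof -
    have "- coord \<beta> j \<le> v j f" using assms that by (auto simp: L_def)
    thus ?thesis using * by (auto simp: coord_simps)
  qed
  thus "f \<in> L (\<beta> - axis i 1)" using assms by (auto simp: L_def)
qed

lemma L_lower_subset: "i \<in> {1..m} \<Longrightarrow> L (\<beta> - axis i 1) \<subseteq> L \<beta>"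
  by (rule L_mono) (auto simp: vec_le_def coord_simps)

lemma not_attained_L:
  assumes "i \<in> {1..m}" "\<not> attained i \<beta>"
  shows "L \<beta> = L (\<beta> - axis i 1)"
proof
  show "L \<beta> \<subseteq> L (\<beta> - axis i 1)"
  proof
    fix f assume "f \<in> L \<beta>"
    thus "f \<in> L (\<beta> - axis i 1)"
      using L_lower[OF assms(1), of f \<beta>] assms(2) by (cases "f = 0") (auto simp: attained_def)
  qed
qed (rule L_lower_subset[OF assms(1)])

text \<open>
  At a rational point, the leading coefficient of an element of \<open>L \<beta>\<close> is a constant multiple of that
  of \<open>g\<close>.
\<close>

lemma attained_L_bij:
  assumes i: "i \<in> {1..m}" and g: "g \<in> L \<beta>" "g \<noteq> 0" "v i g = - coord \<beta> i"
  shows "bij_betw (\<lambda>(c, h). c * g + h) (F \<times> L (\<beta> - axis i 1)) (L \<beta>)"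
proof -
  have gn: "g \<notin> L (\<beta> - axis i 1)" using L_lower[OF i g(1,2)] g(3) by simp
  have "inj_on (\<lambda>(c, h). c * g + h) (F \<times> L (\<beta> - axis i 1))"
  proof (rule inj_onI; clarify)
    fix c h d k assume *: "c \<in> F" "d \<in> F" "h \<in> L (\<beta> - axis i 1)" "k \<in> L (\<beta> - axis i 1)"
      and eq: "c * g + h = d * g + k"
    have eq': "(c - d) * g = k - h" using eq by (simp add: algebra_simps)
    have "c = d"
    proof (rule ccontr)
      assume "c \<noteq> d"
      hence "g = inverse (c - d) * (k - h)" using eq' by (simp add: field_simps)
      also have "\<dots> \<in> L (\<beta> - axis i 1)"
        using * by (intro L_scale F_inverse F_diff L_diff)
      finally show False using gn by simp
    qed
    thus "c = d \<and> h = k" using eq by simp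
  qed
  moreover have "(\<lambda>(c, h). c * g + h) ` (F \<times> L (\<beta> - axis i 1)) = L \<beta>"
  proof safe
    fix c h assume "c \<in> F" "h \<in> L (\<beta> - axis i 1)"
    thus "c * g + h \<in> L \<beta>"
      using L_lower_subset[OF i] by (intro L_add L_scale g(1)) auto
  next
    fix f assume f: "f \<in> L \<beta>"
    show "f \<in> (\<lambda>(c, h). c * g + h) ` (F \<times> L (\<beta> - axis i 1))"
    proof (cases "f \<in> L (\<beta> - axis i 1)")
      case True
      thus ?thesis using F01 by (intro image_eqI[of _ _ "(0, f)"]) auto
    next
      case False
      hence "f \<noteq> 0" using zero_L by blast
      with False have "v i f = v i g" using L_lower[OF i f] g(3) by auto
      then obtain c where c: "c \<in> F" "f = c * g \<or> v i f < v i (f - c * g)"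
        using v_residue[OF i L_R[OF f] L_R[OF g(1)] \<open>f \<noteq> 0\<close> g(2)] by blast
      have "f - c * g \<in> L \<beta>" using f g c by (intro L_diff L_scale)
      hence "f - c * g \<in> L (\<beta> - axis i 1)"
        using L_lower[OF i, of "f - c * g" \<beta>] c(2) \<open>v i f = v i g\<close> g(3)
        by (cases "f = c * g") auto
      thus ?thesis using c(1) by (intro image_eqI[of _ _ "(c, f - c * g)"]) auto
    qed
  qed
  ultimately show ?thesis by (simp add: bij_betw_def)
qed

lemma card_L_step:
  assumes "i \<in> {1..m}" "finite (L (\<beta> - axis i 1))"
  shows "finite (L \<beta>)" "card (L \<beta>) = (if attained i \<beta> then q else 1) * card (L (\<beta> - axis i 1))"
proof -
  have "finite (L \<beta>) \<and> card (L \<beta>) = (if attained i \<beta> then q else 1) * card (L (\<beta> - axis i 1))"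
  proof (cases "attained i \<beta>")
    case True
    then obtain g where g: "g \<in> L \<beta>" "g \<noteq> 0" "v i g = - coord \<beta> i"
      by (auto simp: attained_def)
    note bij = attained_L_bij[OF assms(1) g]
    have "finite (F \<times> L (\<beta> - axis i 1))" using finF assms(2) by simp
    thus ?thesis
      using bij_betw_finite[OF bij] bij_betw_same_card[OF bij] True
      by (simp add: card_cartesian_product)
  qed (use not_attained_L[OF assms(1)] assms(2) in auto)
  thus "finite (L \<beta>)" "card (L \<beta>) = (if attained i \<beta> then q else 1) * card (L (\<beta> - axis i 1))"
    by auto
qed

lemma finite_L: "finite (L \<alpha>)"
proof -
  let ?\<alpha> = "vec_of m (\<lambda>i. max 0 (coord \<alpha> i))"
  have "finite (L ?\<alpha>)"
  proof (rule vec_le_induct[of 0 m ?\<alpha>])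
    show "0 \<in> int_vecs m" "?\<alpha> \<in> int_vecs m" by (simp_all add: int_vecs_0 vec_of_int_vecs)
    show "vec_le m 0 ?\<alpha>" by (auto simp: vec_le_def coord_vec_of)
    show "finite (L 0)" using finite_regular by (simp add: L_def)
    fix \<gamma> i assume "i \<in> {1..m}" "finite (L \<gamma>)"
    thus "finite (L (\<gamma> + axis i 1))" using card_L_step(1)[of i "\<gamma> + axis i 1"] by simp
  qed
  moreover have "L \<alpha> \<subseteq> L ?\<alpha>" by (rule L_mono) (auto simp: vec_le_def coord_vec_of)
  ultimately show ?thesis by (rule finite_subset[rotated])
qed

text \<open>
  The set \<open>L \<alpha>\<close> is finite, so the orders at the \<open>i\<close>-th point of its nonzero elements are bounded.
\<close>

lemma L_eventually_0:
  assumes "i \<in> {1..m}"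
  shows "eventually (\<lambda>n. L (\<alpha> - axis i (int n)) = {0}) sequentially"
proof -
  define N where "N = nat (Max (insert 0 ((\<lambda>f. v i f + coord \<alpha> i) ` L \<alpha>))) + 1"
  have "L (\<alpha> - axis i (int n)) = {0}" if "n \<ge> N" for n
  proof -
    have "f = 0" if f: "f \<in> L (\<alpha> - axis i (int n))" for f
    proof (rule ccontr)
      assume "f \<noteq> 0"
      have "vec_le m (\<alpha> - axis i (int n)) \<alpha>" by (auto simp: vec_le_def coord_simps)
      hence "f \<in> L \<alpha>" using f L_mono by blast
      hence "v i f + coord \<alpha> i \<le> Max (insert 0 ((\<lambda>f. v i f + coord \<alpha> i) ` L \<alpha>))"
        using finite_L by (intro Max_ge) auto
      moreover have "- (coord \<alpha> i - int n) \<le> v i f"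
        using L_bound[OF f \<open>f \<noteq> 0\<close> assms] by (simp add: coord_simps)
      ultimately show False using \<open>n \<ge> N\<close> unfolding N_def by linarith
    qed
    thus ?thesis by auto
  qed
  thus ?thesis unfolding eventually_sequentially by blast
qed

lemma card_L_power:
  assumes "\<alpha> \<in> int_vecs m"
  shows "\<exists>k. card (L \<alpha>) = q ^ k"
proof -
  have 1: "1 \<in> {1..m}" using m2 by simp
  obtain n where n: "L (\<alpha> - axis 1 (int n)) = {0}"
    using eventually_happens'[OF sequentially_bot L_eventually_0[OF 1]] by blast
  show ?thesis
  proof (rule vec_le_induct[of "\<alpha> - axis 1 (int n)" m \<alpha>])
    show "\<alpha> - axis 1 (int n) \<in> int_vecs m" using assms 1 by (intro int_vecs_diff int_vecs_axis)
    show "\<exists>k. card (L (\<alpha> - axis 1 (int n))) = q ^ k" using n by (intro exI[of _ 0]) simp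
    show "vec_le m (\<alpha> - axis 1 (int n)) \<alpha>" by (auto simp: vec_le_def coord_simps)
    fix \<gamma> i assume i: "i \<in> {1..m}" and "\<exists>k. card (L \<gamma>) = q ^ k"
    then obtain k where k: "card (L \<gamma>) = q ^ k" by blast
    have "card (L (\<gamma> + axis i 1)) = (if attained i (\<gamma> + axis i 1) then q else 1) * q ^ k"
      using card_L_step(2)[OF i, of "\<gamma> + axis i 1"] finite_L k by simp
    thus "\<exists>k. card (L (\<gamma> + axis i 1)) = q ^ k"
      by (cases "attained i (\<gamma> + axis i 1)") (auto intro: exI[of _ "Suc k"])
  qed fact
qed

text \<open>
  Dimensions are read off from cardinalities, so that counting arguments apply to them directly.
\<close>

definition ldim :: "ivec \<Rightarrow> nat" where
  "ldim \<alpha> = (THE k. card (L \<alpha>) = q ^ k)"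

lemma card_L_eq:
  assumes "card (L \<alpha>) = q ^ k"
  shows "ldim \<alpha> = k"
  unfolding ldim_def using assms q2 by (intro the_equality) (auto simp: power_inject_exp)

lemma card_L: "\<alpha> \<in> int_vecs m \<Longrightarrow> card (L \<alpha>) = q ^ ldim \<alpha>"
  using card_L_power card_L_eq by blast

lemma ldim_step:
  assumes "\<beta> \<in> int_vecs m" "i \<in> {1..m}"
  shows "int (ldim \<beta>) - int (ldim (\<beta> - axis i 1)) = of_bool (attained i \<beta>)"
proof -
  have \<beta>': "\<beta> - axis i 1 \<in> int_vecs m" using assms by (intro int_vecs_diff int_vecs_axis)
  have "card (L \<beta>) = (if attained i \<beta> then q else 1) * q ^ ldim (\<beta> - axis i 1)"
    using card_L_step(2)[of i \<beta>, OF assms(2) finite_L] card_L[OF \<beta>'] by simp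
  also have "\<dots> = q ^ (ldim (\<beta> - axis i 1) + of_bool (attained i \<beta>))"
    by simp
  finally have "ldim \<beta> = ldim (\<beta> - axis i 1) + of_bool (attained i \<beta>)" by (rule card_L_eq)
  thus ?thesis by simp
qed

lemma attained_mono:
  assumes "attained i \<beta>" "vec_le m \<beta> \<gamma>" "coord \<beta> i = coord \<gamma> i"
  shows "attained i \<gamma>"
  using assms L_mono[OF assms(2)] unfolding attained_def by auto

section \<open>The semigroup\<close>

definition rho :: "'k \<Rightarrow> ivec" where
  "rho f = (\<Sum>i\<in>{1..m}. axis i (- v i f))"

definition H :: "ivec set" where
  "H = rho ` (R - {0})"

lemma rho_vec_of: "rho f = vec_of m (\<lambda>i. - v i f)"
  by (simp add: rho_def vec_of_def)

lemma coord_rho: "i \<in> {1..m} \<Longrightarrow> coord (rho f) i = - v i f"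
  by (simp add: rho_vec_of coord_vec_of)

lemma rho_int_vecs: "rho f \<in> int_vecs m"
  by (simp add: rho_vec_of vec_of_int_vecs)

lemma L_rho: "f \<noteq> 0 \<Longrightarrow> f \<in> L \<alpha> \<longleftrightarrow> f \<in> R \<and> vec_le m (rho f) \<alpha>"
  unfolding L_def vec_le_def by (auto simp: coord_rho)

text \<open>
  If the \<open>i\<close>-th condition holds, \<open>L (\<alpha> - e\<^sub>i)\<close> has index \<open>q\<close> in \<open>L \<alpha>\<close>. As these \<open>m \<le> q\<close> subspaces
  share the element \<open>0\<close>, they do not cover \<open>L \<alpha>\<close>, and a function outside all of them has pole
  order \<open>\<alpha>\<^sub>i\<close> at every point.
\<close>

lemma H_iff:
  assumes "\<alpha> \<in> int_vecs m"
  shows "\<alpha> \<in> H \<longleftrightarrow> (\<forall>i\<in>{1..m}. attained i \<alpha>)"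
proof
  assume "\<alpha> \<in> H"
  then obtain f where f: "f \<in> R" "f \<noteq> 0" "\<alpha> = rho f" by (auto simp: H_def)
  have "f \<in> L \<alpha>" using f by (simp add: L_rho vec_le_def)
  show "\<forall>i\<in>{1..m}. attained i \<alpha>"
  proof
    fix i assume "i \<in> {1..m}"
    hence "v i f = - coord \<alpha> i" using coord_rho[of i f] f(3) by simp
    with \<open>f \<in> L \<alpha>\<close> f(2) show "attained i \<alpha>" unfolding attained_def by blast
  qed
next
  assume att: "\<forall>i\<in>{1..m}. attained i \<alpha>"
  have "L \<alpha> \<noteq> (\<Union>i\<in>{1..m}. L (\<alpha> - axis i 1))"
  proof
    assume eq: "L \<alpha> = (\<Union>i\<in>{1..m}. L (\<alpha> - axis i 1))"
    define N where "N = (\<lambda>i. L (\<alpha> - axis i 1) - {0})"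
    define N0 where "N0 = L \<alpha> - {0}"
    have card_N: "q * card (N i) + q = card (L \<alpha>)" if "i \<in> {1..m}" for i
    proof -
      have "card (L \<alpha>) = q * card (L (\<alpha> - axis i 1))"
        using card_L_step(2)[of i \<alpha>, OF that finite_L] att that by simp
      also have "card (L (\<alpha> - axis i 1)) = Suc (card (N i))"
        unfolding N_def using finite_L by (intro card.remove) auto
      finally show ?thesis by simp
    qed
    have "card (L \<alpha>) = Suc (card N0)"
      unfolding N0_def using finite_L by (intro card.remove) auto
    moreover have "card N0 \<le> (\<Sum>i\<in>{1..m}. card (N i))"
    proof -
      have "N0 = (\<Union>i\<in>{1..m}. N i)" using eq by (auto simp: N_def N0_def)
      thus ?thesis using card_UN_le[of "{1..m}" N] by simp
    qed
    moreover have "(\<Sum>i\<in>{1..m}. card (N i)) = m * card (N 1)"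
    proof -
      have "card (N i) = card (N 1)" if "i \<in> {1..m}" for i
      proof -
        have "1 \<in> {1..m}" using m2 by simp
        hence "q * card (N i) + q = q * card (N 1) + q"
          unfolding card_N[OF that] by (subst card_N) auto
        thus ?thesis using q2 by auto
      qed
      hence "(\<Sum>i\<in>{1..m}. card (N i)) = (\<Sum>i\<in>{1..m}. card (N 1))" by (rule sum.cong[OF refl])
      thus ?thesis by simp
    qed
    moreover have "m * card (N 1) \<le> q * card (N 1)" using cardF by simp
    moreover have "q * card (N 1) + q = card (L \<alpha>)" using card_N[of 1] m2 by simp
    ultimately show False using q2 by linarith
  qed
  moreover have "(\<Union>i\<in>{1..m}. L (\<alpha> - axis i 1)) \<subseteq> L \<alpha>" using L_lower_subset by blast
  ultimately obtain f where f: "f \<in> L \<alpha>" "\<And>i. i \<in> {1..m} \<Longrightarrow> f \<notin> L (\<alpha> - axis i 1)" by blast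
  have "f \<noteq> 0" using f(2)[of 1] m2 by auto
  have "rho f = \<alpha>"
    using assms L_lower[OF _ f(1) \<open>f \<noteq> 0\<close>] f(2)
    by (intro int_vecs_eqI[of _ m]) (auto simp: rho_int_vecs coord_rho)
  thus "\<alpha> \<in> H" using \<open>f \<noteq> 0\<close> f(1) by (auto simp: H_def L_R)
qed

lemma H_int_vecs: "H \<subseteq> int_vecs m"
  by (auto simp: H_def rho_int_vecs)

definition nab :: "nat \<Rightarrow> ivec \<Rightarrow> ivec set" where
  "nab i \<alpha> = {\<beta> \<in> H. coord \<beta> i = coord \<alpha> i \<and> (\<forall>j\<in>{1..m} - {i}. coord \<beta> j < coord \<alpha> j)}"

definition Max_H :: "ivec set" where
  "Max_H = {\<alpha> \<in> H. (\<Union>i\<in>{1..m}. nab i \<alpha>) = {}}"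

lemma nab_nonempty_iff:
  assumes "i \<in> {1..m}"
  shows "nab i \<alpha> \<noteq> {} \<longleftrightarrow> attained i (\<alpha> - ones {1..m} + axis i 1)"
proof
  assume "nab i \<alpha> \<noteq> {}"
  then obtain f where f: "f \<in> R" "f \<noteq> 0" "coord (rho f) i = coord \<alpha> i"
    "\<forall>j\<in>{1..m} - {i}. coord (rho f) j < coord \<alpha> j" by (auto simp: nab_def H_def)
  have "vec_le m (rho f) (\<alpha> - ones {1..m} + axis i 1)"
    unfolding vec_le_def
  proof
    fix j assume "j \<in> {1..m}"
    thus "coord (rho f) j \<le> coord (\<alpha> - ones {1..m} + axis i 1) j"
      using f(3,4) assms by (cases "j = i") (auto simp: coord_simps dest: bspec[of _ _ j])
  qed
  thus "attained i (\<alpha> - ones {1..m} + axis i 1)"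
    unfolding attained_def using f assms
    by (intro bexI[of _ f]) (auto simp: L_rho coord_rho coord_simps)
next
  assume "attained i (\<alpha> - ones {1..m} + axis i 1)"
  then obtain f where f: "f \<in> L (\<alpha> - ones {1..m} + axis i 1)" "f \<noteq> 0"
      "v i f = - coord (\<alpha> - ones {1..m} + axis i 1) i"
    unfolding attained_def by blast
  have le: "coord (rho f) j \<le> coord (\<alpha> - ones {1..m} + axis i 1) j" if "j \<in> {1..m}" for j
    using f(1,2) that unfolding L_rho[OF f(2)] vec_le_def by blast
  have "rho f \<in> nab i \<alpha>"
    unfolding nab_def H_def mem_Collect_eq
  proof (intro conjI ballI)
    show "rho f \<in> rho ` (R - {0})" using f L_R by blast
    show "coord (rho f) i = coord \<alpha> i" using f(3) assms by (simp add: coord_rho coord_simps)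
    fix j assume "j \<in> {1..m} - {i}"
    thus "coord (rho f) j < coord \<alpha> j" using le[of j] by (auto simp: coord_simps)
  qed
  thus "nab i \<alpha> \<noteq> {}" by blast
qed

lemma alt_coeff_eq_sum:
  assumes "\<alpha> \<in> int_vecs m" "i \<in> {1..m}"
  shows "alt_coeff m ldim i \<alpha> = (-1) ^ (m - 1) *
     (\<Sum>J\<in>Pow ({1..m} - {i}). (-1) ^ card J * of_bool (attained i (\<alpha> - ones {1..m} + ones J + axis i 1)))"
proof -
  have "int (ldim (\<alpha> - ones {1..m} + ones J + ones {i})) -
      int (ldim (\<alpha> - ones {1..m} + ones J + ones {i} - ones {i})) = 
      of_bool (attained i (\<alpha> - ones {1..m} + ones J + axis i 1))" if "J \<in> Pow ({1..m} - {i})" for J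
    using that assms unfolding ones_singleton
    by (intro ldim_step int_vecs_add int_vecs_diff int_vecs_ones int_vecs_axis) auto
  hence "(\<Sum>J\<in>Pow ({1..m} - {i}). (-1) ^ card J *
      (int (ldim (\<alpha> - ones {1..m} + ones J + ones {i})) -
       int (ldim (\<alpha> - ones {1..m} + ones J + ones {i} - ones {i})))) =
    (\<Sum>J\<in>Pow ({1..m} - {i}). (-1) ^ card J * of_bool (attained i (\<alpha> - ones {1..m} + ones J + axis i 1)))"
    by (intro sum.cong refl arg_cong2[where f = "(*)"])
  thus ?thesis unfolding alt_coeff_def by (rule arg_cong)
qed

text \<open>
  The coefficient can be computed with any index \<open>k\<close>. The condition that \<open>k\<close> is attained at
  \<open>\<alpha> - 1 + 1\<^sub>J + e\<^sub>k\<close> is monotone in \<open>J\<close>. If \<open>\<alpha>\<close> is not in the semigroup, it fails for some \<open>k\<close> and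
  all \<open>J\<close>; if some \<open>nab k \<alpha>\<close> is nonempty, it holds for this \<open>k\<close> and all \<open>J\<close>, and the signs cancel,
  as \<open>m \<ge> 2\<close>. In both cases the sum for \<open>k\<close> is zero.
\<close>

lemma alt_coeff_nonzero_imp_maximal:
  assumes "\<alpha> \<in> int_vecs m" "i \<in> {1..m}" "alt_coeff m ldim i \<alpha> \<noteq> 0"
  shows "\<alpha> \<in> Max_H"
proof -
  have nz: "alt_coeff m ldim k \<alpha> \<noteq> 0" if "k \<in> {1..m}" for k
    using assms(3) alt_coeff_eq_alt_diff that assms(2) by simp
  let ?b = "\<lambda>k J. \<alpha> - ones {1..m} + ones J + axis k 1"
  have le1: "vec_le m (?b k J) \<alpha>" if "k \<in> {1..m}" "J \<in> Pow ({1..m} - {k})" for k J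
  proof -
    have "finite J" using that finite_subset[of J "{1..m}"] by auto
    thus ?thesis using that by (auto simp: vec_le_def coord_simps)
  qed
  have ci: "coord (?b k J) k = coord \<alpha> k" if "k \<in> {1..m}" "J \<in> Pow ({1..m} - {k})" for k J
  proof -
    have "finite J" using that finite_subset[of J "{1..m}"] by auto
    thus ?thesis using that by (auto simp: coord_simps)
  qed
  have "attained k \<alpha>" if k: "k \<in> {1..m}" for k
  proof (rule ccontr)
    assume "\<not> attained k \<alpha>"
    hence "\<not> attained k (?b k J)" if "J \<in> Pow ({1..m} - {k})" for J
      using attained_mono[OF _ le1[OF k that] ci[OF k that]] by blast
    hence "alt_coeff m ldim k \<alpha> = 0"
      unfolding alt_coeff_eq_sum[OF assms(1) k] by simp
    with nz[OF k] show False by simp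
  qed
  hence "\<alpha> \<in> H" using H_iff[OF assms(1)] by blast
  moreover have "nab k \<alpha> = {}" if k: "k \<in> {1..m}" for k
  proof (rule ccontr)
    assume "nab k \<alpha> \<noteq> {}"
    hence att0: "attained k (\<alpha> - ones {1..m} + axis k 1)" using nab_nonempty_iff[OF k] by simp
    have "attained k (?b k J)" if J: "J \<in> Pow ({1..m} - {k})" for J
    proof (rule attained_mono[OF att0])
      have "finite J" using J finite_subset[of J "{1..m}"] by auto
      thus "vec_le m (\<alpha> - ones {1..m} + axis k 1) (?b k J)"
        "coord (\<alpha> - ones {1..m} + axis k 1) k = coord (?b k J) k"
        using J by (auto simp: vec_le_def coord_simps)
    qed
    hence "(\<Sum>J\<in>Pow ({1..m} - {k}). (-1) ^ card J * of_bool (attained k (?b k J))) =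
           (\<Sum>J\<in>Pow ({1..m} - {k}). (-1::int) ^ card J)" by simp
    also have "\<dots> = 0"
    proof -
      obtain j where j: "j \<in> {1..m}" "j \<noteq> k"
        using m2 by (cases "k = 1") (auto intro: that[of 1] that[of 2])
      have "{1..m} - {k} = insert j ({1..m} - {k} - {j})" using j by auto
      hence "(\<Sum>J\<in>Pow ({1..m} - {k}). (-1::int) ^ card J) =
        (\<Sum>J\<in>Pow (insert j ({1..m} - {k} - {j})). (-1::int) ^ card J)" by simp
      also have "\<dots> = (\<Sum>J\<in>Pow ({1..m} - {k} - {j}). (-1::int) ^ card J) +
         (\<Sum>J\<in>Pow ({1..m} - {k} - {j}). (-1::int) ^ card (insert j J))"
        by (rule sum_Pow_insert) auto
      also have "(\<Sum>J\<in>Pow ({1..m} - {k} - {j}). (-1::int) ^ card (insert j J)) =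
          (\<Sum>J\<in>Pow ({1..m} - {k} - {j}). - ((-1::int) ^ card J))"
      proof (rule sum.cong)
        fix J assume "J \<in> Pow ({1..m} - {k} - {j})"
        hence "finite J" "j \<notin> J" using finite_subset[of J "{1..m}"] by auto
        thus "(-1::int) ^ card (insert j J) = - ((-1) ^ card J)" by simp
      qed auto
      finally show ?thesis by (simp add: sum_negf)
    qed
    finally have "alt_coeff m ldim k \<alpha> = 0" unfolding alt_coeff_eq_sum[OF assms(1) k] by simp
    with nz[OF k] show False by simp
  qed
  ultimately show ?thesis by (auto simp: Max_H_def)
qed

lemma ldim_eventually_0:
  assumes "i \<in> {1..m}"
  shows "eventually (\<lambda>n. ldim (\<alpha> - axis i (int n)) = 0) sequentially"
  using L_eventually_0[OF assms, of \<alpha>]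
  by eventually_elim (rule card_L_eq, simp)

end

text \<open>
  The difference of the two dimension functions vanishes by \<open>alt_diff_inject\<close>, and \<open>H_iff\<close> describes
  the semigroup in terms of dimensions.
\<close>

theorem alt_coeff_determines_semigroup:
  fixes F R :: "'k::field set" and F' R' :: "'l::field set"
  assumes "pole_filtered_ring F R v m" "pole_filtered_ring F' R' v' m"
    and ij: "i \<in> {1..m}" "j \<in> {1..m}"
    and eq: "\<And>\<alpha>. \<alpha> \<in> int_vecs m \<Longrightarrow>
        alt_coeff m (pole_filtered_ring.ldim F R v m) i \<alpha> =
        alt_coeff m (pole_filtered_ring.ldim F' R' v' m) j \<alpha>"
  shows "pole_filtered_ring.H R v m = pole_filtered_ring.H R' v' m"
proof -
  interpret A: pole_filtered_ring F R v m by fact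
  interpret B: pole_filtered_ring F' R' v' m by fact
  let ?h = "\<lambda>\<alpha>. int (A.ldim \<alpha>) - int (B.ldim \<alpha>)"
  have 0: "?h \<alpha> = 0" if "\<alpha> \<in> int_vecs m" for \<alpha>
  proof (rule alt_diff_inject[of "{1..m}" m])
    fix \<beta> assume "\<beta> \<in> int_vecs m"
    have "alt_diff ?h {1..m} \<beta> =
       alt_diff (\<lambda>\<alpha>. int (A.ldim \<alpha>)) {1..m} \<beta> - alt_diff (\<lambda>\<alpha>. int (B.ldim \<alpha>)) {1..m} \<beta>"
      by (simp add: alt_diff_def right_diff_distrib sum_subtractf)
    also have "\<dots> = 0"
      using eq[OF \<open>\<beta> \<in> int_vecs m\<close>] alt_coeff_eq_alt_diff ij by simp
    finally show "alt_diff ?h {1..m} \<beta> = 0" .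
  next
    fix \<beta> k assume "k \<in> {1..m}"
    show "eventually (\<lambda>n. ?h (\<beta> - axis k (int n)) = 0) sequentially"
      using A.ldim_eventually_0[OF \<open>k \<in> {1..m}\<close>, of \<beta>] B.ldim_eventually_0[OF \<open>k \<in> {1..m}\<close>, of \<beta>]
      by eventually_elim simp
  qed (use that in auto)
  have "A.attained k \<alpha> \<longleftrightarrow> B.attained k \<alpha>" if "\<alpha> \<in> int_vecs m" "k \<in> {1..m}" for \<alpha> k
  proof -
    have "\<alpha> - axis k 1 \<in> int_vecs m" using that by (intro int_vecs_diff int_vecs_axis)
    from 0[OF this] 0[OF that(1)] A.ldim_step[OF that] B.ldim_step[OF that]
    have "(of_bool (A.attained k \<alpha>) :: int) = of_bool (B.attained k \<alpha>)" by linarith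
    thus ?thesis by (simp only: of_bool_eq_iff)
  qed
  hence "\<alpha> \<in> A.H \<longleftrightarrow> \<alpha> \<in> B.H" if "\<alpha> \<in> int_vecs m" for \<alpha>
    using A.H_iff[OF that] B.H_iff[OF that] that by blast
  thus ?thesis using A.H_int_vecs B.H_int_vecs by blast
qed

section \<open>Consequences of the Riemann inequality\<close>

text \<open>
  In terms of dimensions, the additional assumption says that \<open>deg \<alpha> - \<ell>(\<alpha>)\<close> is bounded above for
  \<open>\<alpha> \<ge> 0\<close>.
\<close>

locale riemann_ring = pole_filtered_ring F R v m for F R :: "'k::field set" and v m +
  assumes riemann: "\<exists>c. \<forall>\<alpha>\<in>int_vecs m. vec_le m 0 \<alpha> \<longrightarrow> q ^ nat (vdeg m \<alpha>) \<le> c * card (L \<alpha>)"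
begin

text \<open>
  By the Riemann-Roch theorem this is the genus minus one, minus the index of speciality.
\<close>

definition defect :: "ivec \<Rightarrow> int" where
  "defect \<alpha> = vdeg m \<alpha> - int (ldim \<alpha>)"

lemma defect_step:
  assumes "\<beta> \<in> int_vecs m" "i \<in> {1..m}"
  shows "defect \<beta> = defect (\<beta> - axis i 1) + of_bool (\<not> attained i \<beta>)"
  using ldim_step[OF assms] assms(2) by (auto simp: defect_def vdeg_diff vdeg_axis split: if_splits)

lemma defect_mono:
  assumes "\<alpha> \<in> int_vecs m" "\<beta> \<in> int_vecs m" "vec_le m \<alpha> \<beta>"
  shows "defect \<alpha> \<le> defect \<beta>"
  using assms
proof (induction rule: vec_le_induct)
  case (step \<gamma> i)
  have "\<gamma> + axis i 1 \<in> int_vecs m" using step by (intro int_vecs_add int_vecs_axis)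
  from defect_step[OF this step(3)] have "defect \<gamma> \<le> defect (\<gamma> + axis i 1)" by simp
  with step show ?case by linarith
qed simp

lemma defect_bounded: "\<exists>c. \<forall>\<alpha>\<in>int_vecs m. defect \<alpha> \<le> c"
proof -
  obtain c where c: "\<And>\<alpha>. \<alpha> \<in> int_vecs m \<Longrightarrow> vec_le m 0 \<alpha> \<Longrightarrow> q ^ nat (vdeg m \<alpha>) \<le> c * card (L \<alpha>)"
    using riemann by blast
  have "c < 2 ^ c" by (rule less_exp)
  also have "(2::nat) ^ c \<le> q ^ c" using q2 by (intro power_mono) auto
  finally have cq: "c \<le> q ^ c" by simp
  have pos: "defect \<alpha> \<le> int c" if "\<alpha> \<in> int_vecs m" "vec_le m 0 \<alpha>" for \<alpha>
  proof -
    have "q ^ nat (vdeg m \<alpha>) \<le> c * q ^ ldim \<alpha>" using c[OF that] card_L[OF that(1)] by simp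
    also have "\<dots> \<le> q ^ c * q ^ ldim \<alpha>" using cq by (intro mult_right_mono) auto
    also have "\<dots> = q ^ (c + ldim \<alpha>)" by (simp add: power_add)
    finally have "nat (vdeg m \<alpha>) \<le> c + ldim \<alpha>" using q2 by (simp add: power_le_imp_le_exp)
    thus ?thesis unfolding defect_def by linarith
  qed
  have "defect \<alpha> \<le> int c" if "\<alpha> \<in> int_vecs m" for \<alpha>
  proof -
    let ?\<alpha> = "vec_of m (\<lambda>i. max 0 (coord \<alpha> i))"
    have "defect \<alpha> \<le> defect ?\<alpha>"
      using that by (intro defect_mono) (auto simp: vec_of_int_vecs vec_le_def coord_vec_of)
    also have "\<dots> \<le> int c"
      by (intro pos) (auto simp: vec_of_int_vecs vec_le_def coord_vec_of)
    finally show ?thesis .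
  qed
  thus ?thesis by blast
qed

lemma defect_max_exists:
  obtains \<alpha>0 where "\<alpha>0 \<in> int_vecs m" "\<And>\<beta>. \<beta> \<in> int_vecs m \<Longrightarrow> defect \<beta> \<le> defect \<alpha>0"
proof -
  obtain c where c: "\<And>\<alpha>. \<alpha> \<in> int_vecs m \<Longrightarrow> defect \<alpha> \<le> c" using defect_bounded by blast
  obtain \<alpha>0 where \<alpha>0: "\<alpha>0 \<in> int_vecs m"
      "\<And>\<beta>. \<beta> \<in> int_vecs m \<Longrightarrow> nat (c - defect \<alpha>0) \<le> nat (c - defect \<beta>)"
    using ex_has_least_nat[of "\<lambda>\<alpha>. \<alpha> \<in> int_vecs m" 0 "\<lambda>\<alpha>. nat (c - defect \<alpha>)"] int_vecs_0 by blast
  have "defect \<beta> \<le> defect \<alpha>0" if "\<beta> \<in> int_vecs m" for \<beta>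
    using \<alpha>0(2)[OF that] c[OF that] c[OF \<alpha>0(1)] by linarith
  with \<alpha>0(1) show ?thesis by (rule that)
qed

text \<open>
  A vector of maximal defect. Since the defect is monotone, it is constant above \<open>max_vec\<close>; this takes
  the place of the vanishing of the index of speciality for divisors of large degree.
\<close>

definition max_vec :: ivec where
  "max_vec = (SOME \<alpha>0. \<alpha>0 \<in> int_vecs m \<and> (\<forall>\<beta>\<in>int_vecs m. defect \<beta> \<le> defect \<alpha>0))"

lemma max_vec: "max_vec \<in> int_vecs m" "\<And>\<beta>. \<beta> \<in> int_vecs m \<Longrightarrow> defect \<beta> \<le> defect max_vec"
proof -
  obtain \<alpha>0 where "\<alpha>0 \<in> int_vecs m \<and> (\<forall>\<beta>\<in>int_vecs m. defect \<beta> \<le> defect \<alpha>0)"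
    by (rule defect_max_exists) blast
  hence "max_vec \<in> int_vecs m \<and> (\<forall>\<beta>\<in>int_vecs m. defect \<beta> \<le> defect max_vec)"
    unfolding max_vec_def by (rule someI)
  thus "max_vec \<in> int_vecs m" "\<And>\<beta>. \<beta> \<in> int_vecs m \<Longrightarrow> defect \<beta> \<le> defect max_vec" by auto
qed

lemma defect_above_max_vec:
  assumes "\<beta> \<in> int_vecs m" "vec_le m max_vec \<beta>"
  shows "defect \<beta> = defect max_vec"
  using max_vec(2)[OF assms(1)] defect_mono[OF max_vec(1) assms] by simp

lemma attained_above_max_vec:
  assumes "\<beta> \<in> int_vecs m" "i \<in> {1..m}" "vec_le m max_vec (\<beta> - axis i 1)"
  shows "attained i \<beta>"
proof -
  have "\<beta> - axis i 1 \<in> int_vecs m" using assms by (intro int_vecs_diff int_vecs_axis)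
  hence 1: "defect (\<beta> - axis i 1) = defect max_vec" using assms(3) by (rule defect_above_max_vec)
  have "coord (\<beta> - axis i 1) j \<le> coord \<beta> j" for j by (simp add: coord_simps)
  hence "vec_le m max_vec \<beta>"
    using assms(3) unfolding vec_le_def by (meson order_trans)
  hence 2: "defect \<beta> = defect max_vec" using assms(1) by (intro defect_above_max_vec)
  show ?thesis using 1 2 defect_step[OF assms(1,2)] by (auto split: if_splits)
qed

lemma upper_vec:
  assumes "finite S"
  obtains \<beta> where "\<beta> \<in> int_vecs m" "\<And>\<alpha>. \<alpha> \<in> S \<Longrightarrow> vec_le m \<alpha> \<beta>"
proof -
  let ?T = "insert 0 ((\<lambda>(\<alpha>, i). coord \<alpha> i) ` (S \<times> {1..m}))"
  have "coord \<alpha> i \<le> Max ?T" if "\<alpha> \<in> S" "i \<in> {1..m}" for \<alpha> i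
    using that assms by (intro Max_ge) auto
  thus ?thesis
    by (intro that[of "vec_of m (\<lambda>_. Max ?T)"])
       (auto simp: vec_of_int_vecs vec_le_def coord_vec_of)
qed

text \<open>
  For large \<open>\<beta>\<close> the vectors \<open>\<beta>\<close> and \<open>\<beta> - rho f\<close> have the same defect, so the subspace
  \<open>f L (\<beta> - rho f)\<close> of \<open>L \<beta>\<close> has index \<open>q ^ deg (rho f)\<close>. Elements of \<open>R\<close> that are incongruent
  modulo \<open>f R\<close> are incongruent modulo this subspace.
\<close>

lemma principal_ideal_index:
  assumes f: "f \<in> R" "f \<noteq> 0"
  shows "0 \<le> vdeg m (rho f)"
    and "\<And>Y. finite Y \<Longrightarrow> Y \<subseteq> R \<Longrightarrow> separated ((*) f ` R) Y \<Longrightarrow> card Y \<le> q ^ nat (vdeg m (rho f))"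
proof -
  have main: "0 \<le> vdeg m (rho f) \<and> card Y \<le> q ^ nat (vdeg m (rho f))"
    if Y: "finite Y" "Y \<subseteq> R" "separated ((*) f ` R) Y" for Y
  proof -
    obtain \<beta> where \<beta>: "\<beta> \<in> int_vecs m"
      and up: "\<And>\<alpha>. \<alpha> \<in> insert max_vec (insert (max_vec + rho f) (rho ` Y)) \<Longrightarrow> vec_le m \<alpha> \<beta>"
      using upper_vec[of "insert max_vec (insert (max_vec + rho f) (rho ` Y))"] Y(1) by auto
    let ?\<beta> = "\<beta> - rho f"
    have \<beta>': "?\<beta> \<in> int_vecs m" using \<beta> rho_int_vecs by (rule int_vecs_diff)
    have "vec_le m max_vec ?\<beta>" using up[of "max_vec + rho f"]
      by (auto simp: vec_le_def lookup_add lookup_minus algebra_simps)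
    hence "defect ?\<beta> = defect \<beta>"
      using defect_above_max_vec[OF \<beta>'] defect_above_max_vec[OF \<beta>] up[of max_vec] by simp
    hence deg: "int (ldim \<beta>) = int (ldim ?\<beta>) + vdeg m (rho f)"
      by (simp add: defect_def vdeg_diff)
    have fL: "f * h \<in> L \<beta>" if "h \<in> L ?\<beta>" for h
    proof -
      have "f \<in> L (rho f)" using f by (simp add: L_rho vec_le_def)
      from L_mult[OF this that] show ?thesis by simp
    qed
    have "card (L ?\<beta>) \<le> card (L \<beta>)"
      using f fL finite_L by (intro card_inj_on_le[of "(*) f"]) (auto simp: inj_on_def)
    hence "ldim ?\<beta> \<le> ldim \<beta>"
      using card_L[OF \<beta>] card_L[OF \<beta>'] q2 by (simp add: power_le_imp_le_exp)
    with deg have nonneg: "0 \<le> vdeg m (rho f)" by simp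
    have YL: "y \<in> L \<beta>" if "y \<in> Y" for y
      using up[of "rho y"] that Y(2) by (cases "y = 0") (auto simp: L_rho)
    have "card (Y \<times> L ?\<beta>) \<le> card (L \<beta>)"
    proof (rule card_inj_on_le[of "\<lambda>(y, h). y + f * h"])
      show "(\<lambda>(y, h). y + f * h) ` (Y \<times> L ?\<beta>) \<subseteq> L \<beta>" using fL YL L_add by auto
      show "inj_on (\<lambda>(y, h). y + f * h) (Y \<times> L ?\<beta>)"
      proof (rule inj_onI; clarify)
        fix y h y' h' assume *: "y \<in> Y" "y' \<in> Y" "h \<in> L ?\<beta>" "h' \<in> L ?\<beta>" "y + f * h = y' + f * h'"
        hence "y - y' = f * (h' - h)" by (simp add: algebra_simps)
        moreover have "h' - h \<in> R" using * L_R R_diff by blast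
        ultimately have "y = y'" using Y(3) * unfolding separated_def by blast
        thus "y = y' \<and> h = h'" using * f by simp
      qed
    qed (rule finite_L)
    hence "card Y * q ^ ldim ?\<beta> \<le> q ^ ldim \<beta>"
      using card_L[OF \<beta>] card_L[OF \<beta>'] by (simp add: card_cartesian_product)
    also have "ldim \<beta> = nat (vdeg m (rho f)) + ldim ?\<beta>" using deg nonneg by linarith
    finally have "card Y * q ^ ldim ?\<beta> \<le> q ^ nat (vdeg m (rho f)) * q ^ ldim ?\<beta>"
      by (simp add: power_add)
    hence "card Y \<le> q ^ nat (vdeg m (rho f))" using q2 by simp
    with nonneg show ?thesis by simp
  qed
  show "0 \<le> vdeg m (rho f)" using main[of "{}"] by (simp add: separated_def)
  show "card Y \<le> q ^ nat (vdeg m (rho f))"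
    if "finite Y" "Y \<subseteq> R" "separated ((*) f ` R) Y" for Y
    using main[OF that] by simp
qed

lemma H_vdeg_nonneg: "\<alpha> \<in> H \<Longrightarrow> 0 \<le> vdeg m \<alpha>"
  using principal_ideal_index(1) by (auto simp: H_def)

section \<open>Units supported on two places\<close>

definition R_unit :: "'k \<Rightarrow> bool" where
  "R_unit u \<longleftrightarrow> u \<in> R \<and> (\<exists>w\<in>R. u * w = 1)"

lemma large_finite_subset: "\<exists>Y \<subseteq> R. finite Y \<and> M < card Y"
proof -
  let ?\<beta> = "axis 1 (int M + 1 + \<bar>defect max_vec\<bar>)"
  have \<beta>: "?\<beta> \<in> int_vecs m" using m2 by (intro int_vecs_axis) simp
  have "vdeg m ?\<beta> = int M + 1 + \<bar>defect max_vec\<bar>" using m2 by (intro vdeg_axis) simp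
  hence "M < ldim ?\<beta>" using max_vec(2)[OF \<beta>] unfolding defect_def by linarith
  also have "ldim ?\<beta> < 2 ^ ldim ?\<beta>" by (rule less_exp)
  also have "(2::nat) ^ ldim ?\<beta> \<le> q ^ ldim ?\<beta>" using q2 by (intro power_mono) auto
  also have "\<dots> = card (L ?\<beta>)" using card_L[OF \<beta>] by simp
  finally show ?thesis using finite_L L_R by blast
qed

text \<open>
  Among more than \<open>q ^ K\<close> elements of \<open>R\<close>, two are congruent modulo \<open>f t\<close>. So the product of all
  differences of distinct elements of a set of this size is divisible by every \<open>f t\<close>.
\<close>

lemma common_element:
  assumes "\<And>t. f t \<in> R" "\<And>t. f t \<noteq> 0" "\<And>t. vdeg m (rho (f t)) \<le> int K"
  obtains z where "z \<in> R" "z \<noteq> 0" "\<And>t. z \<in> (*) (f t) ` R"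
proof -
  obtain Y where Y: "Y \<subseteq> R" "finite Y" "q ^ K < card Y" using large_finite_subset by blast
  define D where "D = {(a, b). a \<in> Y \<and> b \<in> Y \<and> a \<noteq> b}"
  define z where "z = (\<Prod>(a, b)\<in>D. a - b)"
  have finD: "finite D" by (rule finite_subset[of _ "Y \<times> Y"]) (use Y in \<open>auto simp: D_def\<close>)
  have prod_R: "(\<Prod>(a, b)\<in>E. a - b) \<in> R" if "E \<subseteq> D" for E
  proof -
    have "finite E" using that finD finite_subset by blast
    thus ?thesis using that
      by (induction E rule: finite_induct) (use Y R01 in \<open>auto simp: D_def intro!: R_mult R_diff\<close>)
  qed
  have "z \<in> (*) (f t) ` R" for t
  proof -
    have "\<not> separated ((*) (f t) ` R) Y"
    proof
      assume sep: "separated ((*) (f t) ` R) Y"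
      have "card Y \<le> q ^ nat (vdeg m (rho (f t)))"
        by (rule principal_ideal_index(2)[OF assms(1,2) Y(2,1) sep])
      also have "\<dots> \<le> q ^ K"
        using assms(3)[of t] q2 by (intro power_increasing) auto
      finally show False using Y by simp
    qed
    then obtain a b where ab: "a \<in> Y" "b \<in> Y" "a \<noteq> b" "a - b \<in> (*) (f t) ` R"
      unfolding separated_def by blast
    then obtain r where r: "r \<in> R" "a - b = f t * r" by blast
    have "z = (a - b) * (\<Prod>(a, b)\<in>D - {(a, b)}. a - b)"
      unfolding z_def using finD ab by (subst prod.remove[of _ "(a, b)"]) (auto simp: D_def)
    also have "\<dots> = f t * (r * (\<Prod>(a, b)\<in>D - {(a, b)}. a - b))"
      by (simp add: r(2) mult.assoc)
    finally show ?thesis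
      using R_mult[OF r(1) prod_R[of "D - {(a, b)}"]] by blast
  qed
  moreover have "z \<noteq> 0" unfolding z_def using finD by (auto simp: D_def)
  moreover have "z \<in> R" unfolding z_def by (rule prod_R) simp
  ultimately show ?thesis using that by blast
qed

text \<open>
  The finiteness argument for divisor classes. By Riemann's inequality there is for each \<open>t\<close> a nonzero
  function \<open>f t\<close> whose pole orders are at most \<open>t + K\<close> at the \<open>i\<close>-th point, \<open>- t\<close> at the \<open>j\<close>-th point
  and \<open>0\<close> at the others. Its degree is bounded, so its ideal is one of finitely many and its orders
  differ from the prescribed ones by bounded amounts. For two values of \<open>t\<close> with the same ideal
  and the same deviations, the quotient of the two functions is the unit sought.
\<close>

lemma unit_period:
  assumes ij: "i \<in> {1..m}" "j \<in> {1..m}" "i \<noteq> j"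
  shows "\<exists>t>0. \<exists>u. R_unit u \<and> (\<forall>k\<in>{1..m}. v k u = coord (axis i (int t) - axis j (int t)) k)"
proof -
  define K where "K = nat \<bar>defect max_vec\<bar> + 1"
  define \<alpha> where "\<alpha> = (\<lambda>t. axis i (int t + int K) - axis j (int t))"
  have \<alpha>: "\<alpha> t \<in> int_vecs m" for t unfolding \<alpha>_def using ij by (intro int_vecs_diff int_vecs_axis)
  have deg\<alpha>: "vdeg m (\<alpha> t) = int K" for t
    unfolding \<alpha>_def using ij by (simp add: vdeg_diff vdeg_axis)
  have "\<exists>f. f \<in> L (\<alpha> t) \<and> f \<noteq> 0" for t
  proof (rule ccontr)
    assume "\<not> ?thesis"
    hence "L (\<alpha> t) = {0}" using zero_L by blast
    hence "ldim (\<alpha> t) = 0" by (intro card_L_eq) simp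
    thus False using max_vec(2)[OF \<alpha>[of t]] deg\<alpha>[of t] unfolding defect_def K_def by linarith
  qed
  then obtain f where f: "\<And>t. f t \<in> L (\<alpha> t)" "\<And>t. f t \<noteq> 0" by metis
  have fR: "f t \<in> R" for t using f(1) L_R by blast
  have le: "vec_le m (rho (f t)) (\<alpha> t)" for t using f L_rho by blast
  have slack: "coord (\<alpha> t) k + v k (f t) \<in> {0..int K}" if k: "k \<in> {1..m}" for t k
  proof -
    let ?s = "\<lambda>k. coord (\<alpha> t) k + v k (f t)"
    have nn: "0 \<le> ?s k" if "k \<in> {1..m}" for k
      using le[of t] that by (auto simp: vec_le_def coord_rho dest!: bspec[of _ _ k])
    have "?s k \<le> (\<Sum>k\<in>{1..m}. ?s k)"
      using nn k by (intro member_le_sum) auto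
    also have "\<dots> = vdeg m (\<alpha> t) - vdeg m (rho (f t))"
      unfolding vdeg_def sum_subtractf[symmetric] by (intro sum.cong) (auto simp: coord_rho)
    also have "\<dots> \<le> int K" using deg\<alpha> principal_ideal_index(1)[OF fR f(2), of t] by simp
    finally show ?thesis using nn[OF k] by simp
  qed
  have degf: "vdeg m (rho (f t)) \<le> int K" for t
    using sum_mono[of "{1..m}" "coord (rho (f t))" "coord (\<alpha> t)"] le[of t] deg\<alpha>[of t]
    by (simp add: vdeg_def vec_le_def)
  obtain z where z: "z \<in> R" "z \<noteq> 0" "\<And>t. z \<in> (*) (f t) ` R"
    using common_element[of f K] fR f(2) degf by blast
  have zI: "0 \<in> (*) z ` R" "\<And>a b. a \<in> (*) z ` R \<Longrightarrow> b \<in> (*) z ` R \<Longrightarrow> a - b \<in> (*) z ` R"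
    using R01 R_diff by (auto simp: right_diff_distrib[symmetric])
  obtain T where T: "transversal R ((*) z ` R) T"
    using transversal_exists[OF zI principal_ideal_index(2)[OF z(1,2)]] by blast
  \<comment> \<open>As \<open>f t\<close> divides \<open>z\<close>, its ideal is determined by the representatives modulo \<open>z\<close> that it contains.\<close>
  define \<Phi> where "\<Phi> = (\<lambda>t. (T \<inter> (*) (f t) ` R, restrict (\<lambda>k. coord (\<alpha> t) k + v k (f t)) {1..m}))"
  have "range \<Phi> \<subseteq> Pow T \<times> PiE {1..m} (\<lambda>_. {0..int K})"
    unfolding \<Phi>_def using slack by (auto simp: PiE_def)
  moreover have "finite (Pow T \<times> PiE {1..m} (\<lambda>_. {0..int K}))"
    using T by (intro finite_cartesian_product finite_PiE) (auto simp: transversal_def)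
  ultimately have "finite (range \<Phi>)" by (rule finite_subset)
  hence "\<not> inj \<Phi>" using finite_imageD[of \<Phi> UNIV] by auto
  then obtain s t where st: "s < t" "\<Phi> s = \<Phi> t"
    unfolding inj_def by (metis linorder_neqE_nat)
  have sub: "f s \<in> (*) (f t) ` R" if "T \<inter> (*) (f s) ` R = T \<inter> (*) (f t) ` R" for s t
  proof -
    obtain x where x: "x \<in> T" "f s - x \<in> (*) z ` R" using T fR[of s] unfolding transversal_def by blast
    then obtain r where r: "r \<in> R" "f s - x = z * r" by blast
    obtain a where a: "a \<in> R" "z = f s * a" using z(3)[of s] by blast
    obtain b where b: "b \<in> R" "z = f t * b" using z(3)[of t] by blast
    have "x = f s * (1 - a * r)" using r(2) a(2) by (simp add: algebra_simps)
    moreover have "1 - a * r \<in> R" using a r R01 by (intro R_diff R_mult) auto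
    ultimately have "x \<in> (*) (f t) ` R" using that x(1) by blast
    then obtain c where c: "c \<in> R" "x = f t * c" by blast
    have "f s = f t * (c + b * r)" using r(2) b(2) c(2) by (simp add: algebra_simps)
    moreover have "c + b * r \<in> R" using b c r by (intro R_add R_mult)
    ultimately show ?thesis by blast
  qed
  have eqT: "T \<inter> (*) (f s) ` R = T \<inter> (*) (f t) ` R" using st(2) by (simp add: \<Phi>_def)
  have eqv: "coord (\<alpha> s) k + v k (f s) = coord (\<alpha> t) k + v k (f t)" if "k \<in> {1..m}" for k
    using st(2) that unfolding \<Phi>_def by (metis (no_types, lifting) prod.inject restrict_apply')
  obtain u where u: "u \<in> R" "f s = f t * u" using sub[OF eqT] by blast
  obtain w where w: "w \<in> R" "f t = f s * w" using sub[OF eqT[symmetric]] by blast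
  have "f t * (u * w) = f t * 1" using u w by (simp add: algebra_simps)
  hence uw: "u * w = 1" using f(2)[of t] by (metis mult_left_cancel)
  have "v k u = coord (axis i (int (t - s)) - axis j (int (t - s))) k" if k: "k \<in> {1..m}" for k
  proof -
    have "v k (f s) = v k (f t) + v k u"
      unfolding u(2) using uw by (intro v_mult k fR u f) auto
    hence "v k u = coord (\<alpha> t) k - coord (\<alpha> s) k" using eqv[OF k] by simp
    thus ?thesis using st(1) ij by (simp add: \<alpha>_def coord_simps of_nat_diff)
  qed
  thus ?thesis
    using st(1) u(1) w(1) uw unfolding R_unit_def by (intro exI[of _ "t - s"]) auto
qed

section \<open>The functional equation\<close>

lemma R_unit_nonzero: "R_unit u \<Longrightarrow> u \<noteq> 0"
  by (auto simp: R_unit_def)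

text \<open>
  Multiplication by \<open>u\<close> maps \<open>L (\<alpha> + \<eta>)\<close> into \<open>L \<alpha>\<close>.
\<close>

lemma ldim_translate_le:
  assumes u: "R_unit u" "\<And>k. k \<in> {1..m} \<Longrightarrow> v k u = coord \<eta> k"
  shows "card (L (\<alpha> + \<eta>)) \<le> card (L \<alpha>)"
proof (rule card_inj_on_le[of "(*) u"])
  show "inj_on ((*) u) (L (\<alpha> + \<eta>))" using R_unit_nonzero[OF u(1)] by (auto simp: inj_on_def)
  show "(*) u ` L (\<alpha> + \<eta>) \<subseteq> L \<alpha>"
  proof safe
    fix f assume "f \<in> L (\<alpha> + \<eta>)"
    moreover have "u \<in> L (- \<eta>)" using u by (auto simp: L_def R_unit_def)
    ultimately have "u * f \<in> L (- \<eta> + (\<alpha> + \<eta>))" by (intro L_mult)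
    thus "u * f \<in> L \<alpha>" by (simp add: algebra_simps)
  qed
qed (rule finite_L)

lemma R_unit_inverse:
  assumes "R_unit u"
  obtains w where "R_unit w" "u * w = 1" "\<And>k. k \<in> {1..m} \<Longrightarrow> v k w = - v k u"
proof -
  obtain w where w: "w \<in> R" "u * w = 1" "u \<in> R" using assms by (auto simp: R_unit_def)
  have "u \<noteq> 0" "w \<noteq> 0" using w(2) by auto
  hence "v k u + v k w = v k 1" if "k \<in> {1..m}" for k
    using v_mult[OF that w(3,1)] w(2) by simp
  hence "v k w = - v k u" if "k \<in> {1..m}" for k
    using v_const[OF that F01(2)] that by fastforce
  moreover have "R_unit w" using w by (auto simp: R_unit_def mult.commute)
  ultimately show ?thesis using that w by blast
qed

lemma ldim_translate:
  assumes u: "R_unit u" "\<And>k. k \<in> {1..m} \<Longrightarrow> v k u = coord \<eta> k"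
    and "\<alpha> \<in> int_vecs m" "\<eta> \<in> int_vecs m"
  shows "ldim (\<alpha> + \<eta>) = ldim \<alpha>"
proof -
  obtain w where w: "R_unit w" "\<And>k. k \<in> {1..m} \<Longrightarrow> v k w = - v k u" using R_unit_inverse[OF u(1)] by metis
  have "card (L (\<alpha> + \<eta> + - \<eta>)) \<le> card (L (\<alpha> + \<eta>))"
    by (rule ldim_translate_le[OF w(1)]) (simp add: w(2) u(2))
  moreover have "card (L (\<alpha> + \<eta>)) \<le> card (L \<alpha>)" by (rule ldim_translate_le[OF u])
  ultimately have "card (L (\<alpha> + \<eta>)) = q ^ ldim \<alpha>" using card_L[OF assms(3)] by simp
  thus ?thesis by (rule card_L_eq)
qed

definition unit_periods :: "(nat \<Rightarrow> nat) \<Rightarrow> bool" where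
  "unit_periods a \<longleftrightarrow> (\<forall>i\<in>{1..<m}. 0 < a i \<and>
     (\<exists>u. R_unit u \<and> (\<forall>k\<in>{1..m}. v k u = coord (eta_vec a i) k)))"

lemma theta_unit:
  assumes "unit_periods a" "\<eta> \<in> theta_lattice m a"
  shows "\<exists>u. R_unit u \<and> (\<forall>k\<in>{1..m}. v k u = coord \<eta> k)"
  using assms(2) unfolding theta_lattice_def
proof (induction rule: group_closure.induct)
  case (base s)
  show ?case
  proof (cases "s = 0")
    case True
    thus ?thesis using R01 F01 v_const by (intro exI[of _ 1]) (auto simp: R_unit_def)
  next
    case False
    thus ?thesis using base assms(1) by (auto simp: unit_periods_def)
  qed
next
  case (diff s t)
  then obtain a b where a: "R_unit a" "\<forall>k\<in>{1..m}. v k a = coord s k"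
    and b: "R_unit b" "\<forall>k\<in>{1..m}. v k b = coord t k" by blast
  obtain w where w: "R_unit w" "\<And>k. k \<in> {1..m} \<Longrightarrow> v k w = - v k b" using R_unit_inverse[OF b(1)] by metis
  have "R_unit (a * w)"
  proof -
    obtain a' w' where "a' \<in> R" "w' \<in> R" "a * a' = 1" "w * w' = 1" using a w by (auto simp: R_unit_def)
    moreover from this have "(a * w) * (a' * w') = 1" by (simp add: algebra_simps)
    ultimately show ?thesis using a w unfolding R_unit_def by (blast intro: R_mult)
  qed
  moreover have "v k (a * w) = coord (s - t) k" if "k \<in> {1..m}" for k
    using v_mult[OF that, of a w] a w b that R_unit_nonzero by (auto simp: R_unit_def lookup_minus)
  ultimately show ?case by blast
qed

lemma ldim_theta:
  assumes "unit_periods a" "\<eta> \<in> theta_lattice m a" "\<alpha> \<in> int_vecs m"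
  shows "ldim (\<alpha> + \<eta>) = ldim \<alpha>"
  using theta_unit[OF assms(1,2)] ldim_translate[of _ \<eta> \<alpha>] assms theta_lattice_int_vecs by blast

lemma attained_theta:
  assumes "unit_periods a" "\<eta> \<in> theta_lattice m a" "\<alpha> \<in> int_vecs m" "i \<in> {1..m}"
  shows "attained i (\<alpha> + \<eta>) \<longleftrightarrow> attained i \<alpha>"
proof -
  have 1: "\<alpha> + \<eta> \<in> int_vecs m" using assms theta_lattice_int_vecs by (blast intro: int_vecs_add)
  have 2: "\<alpha> - axis i 1 \<in> int_vecs m" using assms by (intro int_vecs_diff int_vecs_axis)
  have 3: "\<alpha> + \<eta> - axis i 1 = \<alpha> - axis i 1 + \<eta>" by (simp add: algebra_simps)
  have "(of_bool (attained i (\<alpha> + \<eta>)) :: int) = of_bool (attained i \<alpha>)"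
    using ldim_step[OF 1 assms(4)] ldim_step[OF assms(3,4)] ldim_theta[OF assms(1,2) 2]
      ldim_theta[OF assms(1-3)] unfolding 3 by linarith
  thus ?thesis by (simp only: of_bool_eq_iff)
qed

lemma alt_coeff_theta:
  assumes "unit_periods a" "\<eta> \<in> theta_lattice m a" "\<alpha> \<in> int_vecs m" "i \<in> {1..m}"
  shows "alt_coeff m ldim i (\<alpha> + \<eta>) = alt_coeff m ldim i \<alpha>"
  unfolding alt_coeff_eq_alt_diff[OF assms(4)] alt_diff_def
proof (rule sum.cong)
  fix T assume "T \<in> Pow {1..m}"
  hence "\<alpha> - ones T \<in> int_vecs m" using assms by (intro int_vecs_diff int_vecs_ones) auto
  hence eq: "ldim (\<alpha> - ones T + \<eta>) = ldim (\<alpha> - ones T)" by (rule ldim_theta[OF assms(1,2)])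
  have "\<alpha> + \<eta> - ones T = \<alpha> - ones T + \<eta>" by (simp add: algebra_simps)
  thus "(-1) ^ card T * int (ldim (\<alpha> + \<eta> - ones T)) = (-1) ^ card T * int (ldim (\<alpha> - ones T))"
    by (simp only: eq)
qed simp

lemma finite_vec_box: "finite {\<alpha> \<in> int_vecs m. \<forall>i\<in>{1..m}. coord \<alpha> i \<in> {lo..hi}}"
proof (rule finite_subset)
  show "{\<alpha> \<in> int_vecs m. \<forall>i\<in>{1..m}. coord \<alpha> i \<in> {lo..hi}} \<subseteq> vec_of m ` PiE {1..m} (\<lambda>_. {lo..hi})"
  proof safe
    fix \<alpha> assume \<alpha>: "\<alpha> \<in> int_vecs m" "\<forall>i\<in>{1..m}. coord \<alpha> i \<in> {lo..hi}"
    have "\<alpha> = vec_of m (restrict (coord \<alpha>) {1..m})"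
      using \<alpha>(1) by (intro int_vecs_eqI) (auto simp: vec_of_int_vecs coord_vec_of)
    moreover have "restrict (coord \<alpha>) {1..m} \<in> PiE {1..m} (\<lambda>_. {lo..hi})" using \<alpha>(2) by auto
    ultimately show "\<alpha> \<in> vec_of m ` PiE {1..m} (\<lambda>_. {lo..hi})" by blast
  qed
  show "finite (vec_of m ` PiE {1..m} (\<lambda>_. {lo..hi}))" by (intro finite_imageI finite_PiE) auto
qed

text \<open>
  All coordinates but the last are bounded in the fundamental region, and the last one is bounded below
  because degrees of elements of the semigroup are nonnegative. If it is large, then \<open>\<alpha> - 1\<close> can
  be moved above \<open>max_vec\<close> by an element of the lattice. Everything is attained there, so
  \<open>nab 1 \<alpha>\<close> is nonempty.
\<close>

lemma finite_Max_fund: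
  assumes a: "unit_periods a"
  shows "finite (Max_H \<inter> fund_region m a)"
proof -
  have pos: "0 < a i" if "i \<in> {1..<m}" for i using a that by (auto simp: unit_periods_def)
  define N where "N = Max (insert 0 (coord max_vec ` {1..m})) + 1"
  have N: "coord max_vec i + 1 \<le> N" if "i \<in> {1..m}" for i
  proof -
    have "coord max_vec i \<le> Max (insert 0 (coord max_vec ` {1..m}))" using that by (intro Max_ge) auto
    thus ?thesis by (simp add: N_def)
  qed
  \<comment> \<open>The difference of \<open>?\<tau>\<close> and its representative is a lattice vector with coordinates at least \<open>N\<close> before the last.\<close>
  let ?\<tau> = "vec_of m (\<lambda>i. N + int (a i))"
  obtain \<gamma> where \<gamma>: "\<gamma> \<in> fund_region m a" "?\<tau> - \<gamma> \<in> theta_lattice m a"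
    using fund_region_exists[OF vec_of_int_vecs, of m a] pos by blast
  define \<eta> where "\<eta> = ?\<tau> - \<gamma>"
  have \<eta>: "\<eta> \<in> theta_lattice m a" "\<eta> \<in> int_vecs m"
    using \<gamma>(2) theta_lattice_int_vecs unfolding \<eta>_def by blast+
  have \<eta>N: "N \<le> coord \<eta> i" if "i \<in> {1..<m}" for i
  proof -
    have "coord \<gamma> i < int (a i)" using \<gamma>(1) that by (auto simp: fund_region_def)
    thus ?thesis using that by (simp add: \<eta>_def lookup_minus coord_vec_of)
  qed
  define A where "A = (\<Sum>i\<in>{1..<m}. int (a i))"
  define hi where "hi = max A (coord max_vec m - coord \<eta> m + 1)"
  have "coord \<alpha> i \<in> {- A..hi}" if \<alpha>: "\<alpha> \<in> Max_H" "\<alpha> \<in> fund_region m a" and i: "i \<in> {1..m}" for \<alpha> i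
  proof -
    have \<alpha>i: "\<alpha> \<in> int_vecs m" using \<alpha>(2) by (auto simp: fund_region_def)
    have lo: "0 \<le> coord \<alpha> k" "coord \<alpha> k < int (a k)" if "k \<in> {1..<m}" for k
      using \<alpha>(2) that by (auto simp: fund_region_def)
    have A0: "0 \<le> A" unfolding A_def by (intro sum_nonneg) auto
    have split: "{1..m} = insert m {1..<m}" using m2 by auto
    have "0 \<le> vdeg m \<alpha>" using H_vdeg_nonneg \<alpha>(1) by (auto simp: Max_H_def)
    also have "vdeg m \<alpha> = coord \<alpha> m + (\<Sum>k\<in>{1..<m}. coord \<alpha> k)" unfolding vdeg_def split by simp
    also have "(\<Sum>k\<in>{1..<m}. coord \<alpha> k) \<le> A"
      unfolding A_def using lo(2) by (intro sum_mono) (simp add: less_imp_le)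
    finally have mlo: "- A \<le> coord \<alpha> m" by simp
    have mhi: "coord \<alpha> m \<le> coord max_vec m - coord \<eta> m + 1"
    proof (rule ccontr)
      assume *: "\<not> ?thesis"
      have 1: "1 \<in> {1..m}" using m2 by simp
      let ?b = "\<alpha> - ones {1..m} + axis 1 1"
      have b: "?b \<in> int_vecs m" using \<alpha>i 1 by (intro int_vecs_add int_vecs_diff int_vecs_ones int_vecs_axis) auto
      have "vec_le m max_vec (?b + \<eta> - axis 1 1)"
        unfolding vec_le_def
      proof
        fix k assume k: "k \<in> {1..m}"
        have "coord (?b + \<eta> - axis 1 1) k = coord \<alpha> k - 1 + coord \<eta> k" using k by (simp add: coord_simps)
        moreover have "coord max_vec k \<le> coord \<alpha> k - 1 + coord \<eta> k"
        proof (cases "k = m")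
          case False
          hence "k \<in> {1..<m}" using k by simp
          from lo(1)[OF this] \<eta>N[OF this] N[OF k] show ?thesis by linarith
        qed (use * in simp)
        ultimately show "coord max_vec k \<le> coord (?b + \<eta> - axis 1 1) k" by simp
      qed
      hence "attained 1 (?b + \<eta>)"
        by (rule attained_above_max_vec[OF int_vecs_add[OF b \<eta>(2)] 1])
      hence "attained 1 ?b" using attained_theta[OF a \<eta>(1) b 1] by simp
      hence "nab 1 \<alpha> \<noteq> {}" using nab_nonempty_iff[OF 1] by simp
      thus False using \<alpha>(1) 1 by (auto simp: Max_H_def)
    qed
    show ?thesis
    proof (cases "i = m")
      case False
      hence i': "i \<in> {1..<m}" using i by simp
      have "int (a i) \<le> A" unfolding A_def using i' by (intro member_le_sum) auto
      thus ?thesis using lo[OF i'] A0 by (auto simp: hi_def)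
    qed (use mlo mhi in \<open>auto simp: hi_def\<close>)
  qed
  hence "Max_H \<inter> fund_region m a \<subseteq> {\<alpha> \<in> int_vecs m. \<forall>i\<in>{1..m}. coord \<alpha> i \<in> {- A..hi}}"
    by (auto simp: fund_region_def)
  thus ?thesis using finite_vec_box by (rule finite_subset)
qed

text \<open>
  If \<open>\<gamma>\<close> is the vector of the fundamental region congruent to \<open>\<alpha>\<close>, the series product at \<open>\<alpha>\<close>
  has only the term for \<open>\<gamma>\<close>, and the coefficients at \<open>\<alpha>\<close> and \<open>\<gamma>\<close> agree. If \<open>\<gamma>\<close> is not maximal,
  both sides vanish.
\<close>

theorem functional_equation:
  assumes a: "unit_periods a" and i: "i \<in> {1..m}"
  shows "(if \<alpha> \<in> int_vecs m then alt_coeff m ldim i \<alpha> else 0) =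
         series_mult (support_series (theta_lattice m a))
           (\<Sum>\<gamma>\<in>Max_H \<inter> fund_region m a. Poly_Mapping.single \<gamma> (alt_coeff m ldim i \<gamma>)) \<alpha>"
proof -
  let ?S = "Max_H \<inter> fund_region m a"
  let ?c = "alt_coeff m ldim i"
  let ?P = "\<Sum>\<gamma>\<in>?S. Poly_Mapping.single \<gamma> (?c \<gamma>)"
  have pos: "0 < a i" if "i \<in> {1..<m}" for i using a that by (auto simp: unit_periods_def)
  have fin: "finite ?S" by (rule finite_Max_fund[OF a])
  have lk: "Poly_Mapping.lookup ?P \<beta> = (if \<beta> \<in> ?S then ?c \<beta> else 0)" for \<beta>
    using fin by (simp add: lookup_sum lookup_single when_def)
  have "series_mult (support_series (theta_lattice m a)) ?P \<alpha> =
        (\<Sum>\<beta>\<in>?S. of_bool (\<alpha> - \<beta> \<in> theta_lattice m a) * ?c \<beta>)"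
    unfolding series_mult_def support_series_def
    by (rule sum.mono_neutral_cong_left) (use fin lk in \<open>auto simp: in_keys_iff split: if_splits\<close>)
  also have "\<dots> = (if \<alpha> \<in> int_vecs m then ?c \<alpha> else 0)"
  proof (cases "\<alpha> \<in> int_vecs m")
    case False
    have "\<alpha> - \<beta> \<notin> theta_lattice m a" if "\<beta> \<in> ?S" for \<beta>
    proof
      assume "\<alpha> - \<beta> \<in> theta_lattice m a"
      hence "\<alpha> - \<beta> + \<beta> \<in> int_vecs m"
        using that theta_lattice_int_vecs by (intro int_vecs_add) (auto simp: fund_region_def)
      with False show False by simp
    qed
    thus ?thesis using False by simp
  next
    case True
    then obtain \<gamma> where \<gamma>: "\<gamma> \<in> fund_region m a" "\<alpha> - \<gamma> \<in> theta_lattice m a"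
      using fund_region_exists[OF True, of a] pos by blast
    have \<gamma>i: "\<gamma> \<in> int_vecs m" using \<gamma>(1) by (simp add: fund_region_def)
    have "\<gamma> + (\<alpha> - \<gamma>) = \<alpha>" by simp
    hence c: "?c \<alpha> = ?c \<gamma>" using alt_coeff_theta[OF a \<gamma>(2) \<gamma>i i] by (simp only:)
    have uniq: "\<beta> = \<gamma>" if "\<beta> \<in> ?S" "\<alpha> - \<beta> \<in> theta_lattice m a" for \<beta>
    proof (rule fund_region_unique)
      have "\<beta> - \<gamma> = (\<alpha> - \<gamma>) - (\<alpha> - \<beta>)" by simp
      thus "\<beta> - \<gamma> \<in> theta_lattice m a"
        using group_closure.diff[OF \<gamma>(2)[unfolded theta_lattice_def] that(2)[unfolded theta_lattice_def]]
        unfolding theta_lattice_def by (simp only:)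
    qed (use that(1) \<gamma>(1) in blast)+
    have "(\<Sum>\<beta>\<in>?S. of_bool (\<alpha> - \<beta> \<in> theta_lattice m a) * ?c \<beta>) = (\<Sum>\<beta>\<in>?S. if \<beta> = \<gamma> then ?c \<gamma> else 0)"
    proof (rule sum.cong)
      fix \<beta> assume "\<beta> \<in> ?S"
      with uniq[OF this] \<gamma>(2)
      show "of_bool (\<alpha> - \<beta> \<in> theta_lattice m a) * ?c \<beta> = (if \<beta> = \<gamma> then ?c \<gamma> else 0)"
        by (cases "\<alpha> - \<beta> \<in> theta_lattice m a") auto
    qed simp
    also have "\<dots> = (if \<gamma> \<in> ?S then ?c \<gamma> else 0)" using fin by simp
    also have "\<dots> = ?c \<gamma>"
      using alt_coeff_nonzero_imp_maximal[OF \<gamma>i i] \<gamma>(1) by auto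
    finally show ?thesis using True c by simp
  qed
  finally show ?thesis by simp
qed

end

section \<open>An ultrapower of a field\<close>

text \<open>
  A curve over a finite field has a generic point with coordinates in an ultrapower of the algebraic
  closure: there are countably many forms that do not vanish identically on the curve, and the
  generic point is the class of a sequence of points that avoids more and more of their zeros.
\<close>

definition proper_filter_sets :: "nat set set \<Rightarrow> bool" where
  "proper_filter_sets U \<longleftrightarrow>
     {} \<notin> U \<and> (\<forall>k. {k..} \<in> U) \<and>
     (\<forall>A\<in>U. \<forall>B\<in>U. A \<inter> B \<in> U) \<and> (\<forall>A B. A \<in> U \<longrightarrow> A \<subseteq> B \<longrightarrow> B \<in> U)"

text \<open>
  Zorn's lemma, applied to the proper filters that contain all tails.
\<close>

lemma free_ultrafilter_exists: "\<exists>U. proper_filter_sets U \<and> (\<forall>A. A \<in> U \<or> - A \<in> U)"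
proof -
  let ?\<A> = "Collect proper_filter_sets"
  have "\<exists>M\<in>?\<A>. \<forall>V\<in>?\<A>. M \<subseteq> V \<longrightarrow> V = M"
  proof (rule subset_Zorn_nonempty)
    have "proper_filter_sets {A. \<exists>k. {k..} \<subseteq> A}"
      unfolding proper_filter_sets_def
    proof (intro conjI allI ballI impI)
      fix A B :: "nat set" assume "A \<in> {A. \<exists>k. {k..} \<subseteq> A}" "B \<in> {A. \<exists>k. {k..} \<subseteq> A}"
      then obtain k l where "{k..} \<subseteq> A" "{l..} \<subseteq> B" by blast
      hence "{max k l..} \<subseteq> A \<inter> B" by auto
      thus "A \<inter> B \<in> {A. \<exists>k. {k..} \<subseteq> A}" by blast
    qed auto
    thus "?\<A> \<noteq> {}" by blast
  next
    fix \<C> assume \<C>: "\<C> \<noteq> {}" "subset.chain ?\<A> \<C>"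
    hence pf: "\<And>U. U \<in> \<C> \<Longrightarrow> proper_filter_sets U" by (auto simp: subset.chain_def)
    have "proper_filter_sets (\<Union>\<C>)"
      unfolding proper_filter_sets_def
    proof (intro conjI allI ballI impI)
      show "{} \<notin> \<Union>\<C>" using pf by (auto simp: proper_filter_sets_def)
      show "{k..} \<in> \<Union>\<C>" for k using pf \<C>(1) by (fastforce simp: proper_filter_sets_def)
      show "A \<inter> B \<in> \<Union>\<C>" if AB: "A \<in> \<Union>\<C>" "B \<in> \<Union>\<C>" for A B
      proof -
        obtain U where U: "U \<in> \<C>" "A \<in> U" using AB(1) by blast
        obtain V where V: "V \<in> \<C>" "B \<in> V" using AB(2) by blast
        note UV = U(1) V(1) U(2) V(2)
        have "U \<subseteq> V \<or> V \<subseteq> U" using \<C>(2) UV(1,2) by (auto simp: subset.chain_def)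
        then obtain W where "W \<in> \<C>" "A \<in> W" "B \<in> W" using UV by blast
        thus ?thesis using pf[of W] by (auto simp: proper_filter_sets_def)
      qed
      show "B \<in> \<Union>\<C>" if AB: "A \<in> \<Union>\<C>" "A \<subseteq> B" for A B
      proof -
        obtain U where "U \<in> \<C>" "A \<in> U" using AB(1) by blast
        moreover from this have "B \<in> U" using pf[of U] AB(2) by (auto simp: proper_filter_sets_def)
        ultimately show ?thesis by blast
      qed
    qed
    thus "\<Union>\<C> \<in> ?\<A>" by simp
  qed
  then obtain M where M: "proper_filter_sets M"
    "\<And>V. proper_filter_sets V \<Longrightarrow> M \<subseteq> V \<Longrightarrow> V = M" by blast
  note m = M(1)[unfolded proper_filter_sets_def]
  have "A \<in> M \<or> - A \<in> M" for A
  proof (rule ccontr)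
    assume *: "\<not> ?thesis"
    define V where "V = {B. \<exists>D\<in>M. D \<inter> A \<subseteq> B}"
    have "M \<subseteq> V" unfolding V_def by blast
    moreover have "proper_filter_sets V"
      unfolding proper_filter_sets_def
    proof (intro conjI allI ballI impI)
      show "{} \<notin> V"
      proof
        assume "{} \<in> V"
        then obtain D where "D \<in> M" "D \<subseteq> - A" unfolding V_def by blast
        hence "- A \<in> M" using m by blast
        with * show False by blast
      qed
      show "{k..} \<in> V" for k using \<open>M \<subseteq> V\<close> m by blast
      show "B \<inter> B' \<in> V" if BB': "B \<in> V" "B' \<in> V" for B B'
      proof -
        obtain D D' where "D \<in> M" "D' \<in> M" "D \<inter> A \<subseteq> B" "D' \<inter> A \<subseteq> B'"
          using BB' unfolding V_def by blast
        moreover from this have "D \<inter> D' \<in> M" using m by blast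
        ultimately show ?thesis unfolding V_def by blast
      qed
      show "B' \<in> V" if "B \<in> V" "B \<subseteq> B'" for B B' using that unfolding V_def by blast
    qed
    ultimately have "V = M" using M(2) by blast
    moreover have "{0..} \<in> M" using m by blast
    hence "A \<in> V" unfolding V_def by blast
    ultimately show False using * by blast
  qed
  with M(1) show ?thesis by blast
qed

definition ultra :: "nat set set" where
  "ultra = (SOME U. proper_filter_sets U \<and> (\<forall>A. A \<in> U \<or> - A \<in> U))"

lemma ultra_props: "proper_filter_sets ultra \<and> (\<forall>A. A \<in> ultra \<or> - A \<in> ultra)"
  unfolding ultra_def by (rule someI_ex[OF free_ultrafilter_exists])

lemma ultra_Int: "A \<in> ultra \<Longrightarrow> B \<in> ultra \<Longrightarrow> A \<inter> B \<in> ultra"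
  and ultra_mono: "A \<in> ultra \<Longrightarrow> A \<subseteq> B \<Longrightarrow> B \<in> ultra"
  and ultra_tail: "{k..} \<in> ultra"
  and ultra_compl: "A \<notin> ultra \<Longrightarrow> - A \<in> ultra"
  and ultra_empty: "{} \<notin> ultra"
  using ultra_props unfolding proper_filter_sets_def by blast+

lemma ultra_UNIV: "UNIV \<in> ultra"
  using ultra_mono[OF ultra_tail] by blast

definition ultra_eq :: "(nat \<Rightarrow> 'b) \<Rightarrow> (nat \<Rightarrow> 'b) \<Rightarrow> bool" where
  "ultra_eq f g \<longleftrightarrow> {k. f k = g k} \<in> ultra"

lemma ultra_eq_cong:
  assumes "ultra_eq f f'" "ultra_eq g g'" "\<And>k. f k = f' k \<Longrightarrow> g k = g' k \<Longrightarrow> h k = h' k"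
  shows "ultra_eq h h'"
proof -
  have "{k. f k = f' k} \<inter> {k. g k = g' k} \<subseteq> {k. h k = h' k}" using assms(3) by blast
  thus ?thesis using ultra_mono[OF ultra_Int] assms(1,2) unfolding ultra_eq_def by blast
qed

lemma ultra_eq_refl: "ultra_eq f f"
  by (simp add: ultra_eq_def ultra_UNIV)

quotient_type 'b ultrapower = "nat \<Rightarrow> 'b" / ultra_eq
  morphisms rep_ultra to_ultra
proof (rule equivpI)
  show "reflp (ultra_eq :: (nat \<Rightarrow> 'b) \<Rightarrow> _)" by (rule reflpI) (rule ultra_eq_refl)
  show "symp (ultra_eq :: (nat \<Rightarrow> 'b) \<Rightarrow> _)"
    by (rule sympI) (auto simp: ultra_eq_def eq_commute)
  show "transp (ultra_eq :: (nat \<Rightarrow> 'b) \<Rightarrow> _)"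
    by (rule transpI) (erule (1) ultra_eq_cong, simp)
qed

lemma to_ultra_eq_iff: "to_ultra f = to_ultra g \<longleftrightarrow> ultra_eq f g"
  by (simp add: ultrapower.abs_eq_iff)

instantiation ultrapower :: (field) field
begin

lift_definition zero_ultrapower :: "'a ultrapower" is "\<lambda>_. 0" .
lift_definition one_ultrapower :: "'a ultrapower" is "\<lambda>_. 1" .
lift_definition plus_ultrapower :: "'a ultrapower \<Rightarrow> 'a ultrapower \<Rightarrow> 'a ultrapower"
  is "\<lambda>f g k. f k + g k" by (erule (1) ultra_eq_cong) simp
lift_definition minus_ultrapower :: "'a ultrapower \<Rightarrow> 'a ultrapower \<Rightarrow> 'a ultrapower"
  is "\<lambda>f g k. f k - g k" by (erule (1) ultra_eq_cong) simp
lift_definition times_ultrapower :: "'a ultrapower \<Rightarrow> 'a ultrapower \<Rightarrow> 'a ultrapower"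
  is "\<lambda>f g k. f k * g k" by (erule (1) ultra_eq_cong) simp
lift_definition uminus_ultrapower :: "'a ultrapower \<Rightarrow> 'a ultrapower"
  is "\<lambda>f k. - f k" by (erule ultra_eq_cong[OF ultra_eq_refl]) simp
lift_definition inverse_ultrapower :: "'a ultrapower \<Rightarrow> 'a ultrapower"
  is "\<lambda>f k. inverse (f k)" by (erule ultra_eq_cong[OF ultra_eq_refl]) simp
lift_definition divide_ultrapower :: "'a ultrapower \<Rightarrow> 'a ultrapower \<Rightarrow> 'a ultrapower"
  is "\<lambda>f g k. f k div g k" by (erule (1) ultra_eq_cong) simp

instance
proof
  fix a b c :: "'a ultrapower"
  show "a * b * c = a * (b * c)" by transfer (simp add: mult.assoc ultra_eq_refl)
  show "a * b = b * a" by transfer (simp add: mult.commute ultra_eq_refl)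
  show "1 * a = a" by transfer (simp add: ultra_eq_refl)
  show "a + b + c = a + (b + c)" by transfer (simp add: add.assoc ultra_eq_refl)
  show "a + b = b + a" by transfer (simp add: add.commute ultra_eq_refl)
  show "0 + a = a" by transfer (simp add: ultra_eq_refl)
  show "- a + a = 0" by transfer (simp add: ultra_eq_refl)
  show "a - b = a + - b" by transfer (simp add: ultra_eq_refl)
  show "(a + b) * c = a * c + b * c" by transfer (simp add: distrib_right ultra_eq_refl)
  show "(0::'a ultrapower) \<noteq> 1" by transfer (simp add: ultra_eq_def ultra_empty)
  show "inverse (0::'a ultrapower) = 0" by transfer (simp add: ultra_eq_refl)
  show "a div b = a * inverse b" by transfer (simp add: divide_inverse ultra_eq_refl)
  show "inverse a * a = 1" if "a \<noteq> 0" using that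
  proof transfer
    fix f :: "nat \<Rightarrow> 'a" assume "\<not> ultra_eq f (\<lambda>_. 0)"
    hence "- {k. f k = 0} \<in> ultra" unfolding ultra_eq_def by (rule ultra_compl)
    thus "ultra_eq (\<lambda>k. inverse (f k) * f k) (\<lambda>_. 1)"
      unfolding ultra_eq_def by (rule ultra_mono) auto
  qed
qed

end

lemma to_ultra_add: "to_ultra f + to_ultra g = to_ultra (\<lambda>k. f k + g k :: 'b::field)"
  and to_ultra_mult: "to_ultra f * to_ultra g = to_ultra (\<lambda>k. f k * g k :: 'b::field)"
  and to_ultra_0: "to_ultra (\<lambda>k. 0 :: 'b::field) = 0"
  and to_ultra_1: "to_ultra (\<lambda>k. 1 :: 'b::field) = 1"
  by (simp_all add: plus_ultrapower.abs_eq times_ultrapower.abs_eq zero_ultrapower_def one_ultrapower_def)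

lemma to_ultra_sum: "(\<Sum>i\<in>A. to_ultra (f i)) = to_ultra (\<lambda>k. \<Sum>i\<in>A. f i k :: 'b::field)"
  by (induction A rule: infinite_finite_induct) (simp_all add: to_ultra_0 to_ultra_add)

lemma to_ultra_prod: "(\<Prod>i\<in>A. to_ultra (f i)) = to_ultra (\<lambda>k. \<Prod>i\<in>A. f i k :: 'b::field)"
  by (induction A rule: infinite_finite_induct) (simp_all add: to_ultra_1 to_ultra_mult)

lemma to_ultra_power: "to_ultra f ^ e = to_ultra (\<lambda>k. f k ^ e :: 'b::field)"
  by (induction e) (simp_all add: to_ultra_1 to_ultra_mult)

section \<open>Evaluating polynomials\<close>

definition ring_emb :: "('a::field \<Rightarrow> 'k::field) \<Rightarrow> bool" where
  "ring_emb \<iota> \<longleftrightarrow> \<iota> 1 = 1 \<and> (\<forall>a b. \<iota> (a + b) = \<iota> a + \<iota> b) \<and> (\<forall>a b. \<iota> (a * b) = \<iota> a * \<iota> b)"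

lemma ring_emb_0: "ring_emb \<iota> \<Longrightarrow> \<iota> 0 = 0"
  unfolding ring_emb_def by (metis add_cancel_right_right)

lemma ring_emb_1: "ring_emb \<iota> \<Longrightarrow> \<iota> 1 = 1"
  and ring_emb_add: "ring_emb \<iota> \<Longrightarrow> \<iota> (a + b) = \<iota> a + \<iota> b"
  and ring_emb_mult: "ring_emb \<iota> \<Longrightarrow> \<iota> (a * b) = \<iota> a * \<iota> b"
  by (auto simp: ring_emb_def)

lemma ring_emb_uminus: "ring_emb \<iota> \<Longrightarrow> \<iota> (- a) = - \<iota> a"
  using ring_emb_add[of \<iota> a "- a"] ring_emb_0[of \<iota>] by (simp add: eq_neg_iff_add_eq_0 add.commute)

lemma ring_emb_diff: "ring_emb \<iota> \<Longrightarrow> \<iota> (a - b) = \<iota> a - \<iota> b"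
  using ring_emb_add[of \<iota> a "- b"] ring_emb_uminus[of \<iota> b] by simp

lemma ring_emb_eq_0: assumes "ring_emb \<iota>" shows "\<iota> a = 0 \<longleftrightarrow> a = 0"
proof
  assume 0: "\<iota> a = 0"
  show "a = 0"
  proof (rule ccontr)
    assume "a \<noteq> 0"
    hence "\<iota> a * \<iota> (inverse a) = 1"
      using ring_emb_mult[OF assms, of a "inverse a"] ring_emb_1[OF assms] by simp
    with 0 show False by simp
  qed
qed (simp add: ring_emb_0[OF assms])

lemma ring_emb_inj: "ring_emb \<iota> \<Longrightarrow> inj \<iota>"
  unfolding inj_def using ring_emb_diff ring_emb_eq_0 by (metis eq_iff_diff_eq_0)

lemma ring_emb_inverse: "ring_emb \<iota> \<Longrightarrow> \<iota> (inverse a) = inverse (\<iota> a)"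
proof (cases "a = 0")
  case False
  assume \<iota>: "ring_emb \<iota>"
  have "\<iota> a * \<iota> (inverse a) = 1"
    using ring_emb_mult[OF \<iota>, of a "inverse a"] ring_emb_1[OF \<iota>] False by simp
  thus ?thesis by (metis inverse_unique)
qed (simp add: ring_emb_0)

lemma ring_emb_to_ac: "ring_emb to_ac"
  by (simp add: ring_emb_def)

definition monomial_at :: "(nat \<Rightarrow> 'k::field) \<Rightarrow> (nat \<Rightarrow>\<^sub>0 nat) \<Rightarrow> 'k" where
  "monomial_at x \<mu> = (\<Prod>i\<in>Poly_Mapping.keys \<mu>. x i ^ Poly_Mapping.lookup \<mu> i)"

definition ev :: "('a::field \<Rightarrow> 'k::field) \<Rightarrow> 'a mpoly \<Rightarrow> (nat \<Rightarrow> 'k) \<Rightarrow> 'k" where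
  "ev \<iota> p x = (\<Sum>\<mu>\<in>Poly_Mapping.keys p. \<iota> (Poly_Mapping.lookup p \<mu>) * monomial_at x \<mu>)"

definition mdeg :: "(nat \<Rightarrow>\<^sub>0 nat) \<Rightarrow> nat" where
  "mdeg \<mu> = (\<Sum>i\<in>Poly_Mapping.keys \<mu>. Poly_Mapping.lookup \<mu> i)"

lemma monomial_at_superset:
  assumes "finite T" "Poly_Mapping.keys \<mu> \<subseteq> T"
  shows "monomial_at x \<mu> = (\<Prod>i\<in>T. x i ^ Poly_Mapping.lookup \<mu> i)"
  unfolding monomial_at_def using assms
  by (intro prod.mono_neutral_left) (auto simp: in_keys_iff)

lemma mdeg_superset:
  assumes "finite T" "Poly_Mapping.keys \<mu> \<subseteq> T"
  shows "mdeg \<mu> = (\<Sum>i\<in>T. Poly_Mapping.lookup \<mu> i)"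
  unfolding mdeg_def using assms by (intro sum.mono_neutral_left) (auto simp: in_keys_iff)

lemma keys_add_nat: "Poly_Mapping.keys (\<mu> + \<nu> :: nat \<Rightarrow>\<^sub>0 nat) = Poly_Mapping.keys \<mu> \<union> Poly_Mapping.keys \<nu>"
  by (auto simp: in_keys_iff lookup_add)

lemma monomial_at_add: "monomial_at x (\<mu> + \<nu>) = monomial_at x \<mu> * monomial_at x \<nu>"
proof -
  let ?T = "Poly_Mapping.keys \<mu> \<union> Poly_Mapping.keys \<nu>"
  have "finite ?T" by simp
  thus ?thesis
    by (simp add: monomial_at_superset[of ?T] keys_add_nat lookup_add power_add prod.distrib)
qed

lemma mdeg_add: "mdeg (\<mu> + \<nu>) = mdeg \<mu> + mdeg \<nu>"
proof -
  let ?T = "Poly_Mapping.keys \<mu> \<union> Poly_Mapping.keys \<nu>"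
  have "finite ?T" by simp
  thus ?thesis by (simp add: mdeg_superset[of ?T] keys_add_nat lookup_add sum.distrib)
qed

lemma monomial_at_0: "monomial_at x 0 = 1"
  by (simp add: monomial_at_def)

lemma monomial_at_single: "monomial_at x (Poly_Mapping.single i e) = x i ^ e"
  by (cases "e = 0") (simp_all add: monomial_at_def)

lemma ev_superset:
  assumes "ring_emb \<iota>" "finite T" "Poly_Mapping.keys p \<subseteq> T"
  shows "ev \<iota> p x = (\<Sum>\<mu>\<in>T. \<iota> (Poly_Mapping.lookup p \<mu>) * monomial_at x \<mu>)"
  unfolding ev_def using assms
  by (intro sum.mono_neutral_left) (auto simp: in_keys_iff ring_emb_0)

lemma ev_0: "ev \<iota> 0 x = 0"
  by (simp add: ev_def)

lemma ev_single: "ring_emb \<iota> \<Longrightarrow> ev \<iota> (Poly_Mapping.single \<mu> c) x = \<iota> c * monomial_at x \<mu>"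
  by (cases "c = 0") (simp_all add: ev_def ring_emb_0)

lemma ev_1: "ring_emb \<iota> \<Longrightarrow> ev \<iota> 1 x = 1"
  using ev_single[of \<iota> 0 1 x] by (simp add: monomial_at_0 ring_emb_1)

lemma ev_add: "ring_emb \<iota> \<Longrightarrow> ev \<iota> (p + q) x = ev \<iota> p x + ev \<iota> q x"
proof -
  assume \<iota>: "ring_emb \<iota>"
  let ?T = "Poly_Mapping.keys p \<union> Poly_Mapping.keys q"
  have "finite ?T" "Poly_Mapping.keys (p + q) \<subseteq> ?T" by (simp_all add: keys_add)
  thus ?thesis
    by (simp add: ev_superset[OF \<iota>, of ?T] lookup_add ring_emb_add[OF \<iota>] distrib_right sum.distrib)
qed

lemma ev_uminus: "ring_emb \<iota> \<Longrightarrow> ev \<iota> (- p) x = - ev \<iota> p x"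
  using ev_add[of \<iota> p "- p" x] by (simp add: ev_0 eq_neg_iff_add_eq_0 add.commute)

lemma ev_diff: "ring_emb \<iota> \<Longrightarrow> ev \<iota> (p - q) x = ev \<iota> p x - ev \<iota> q x"
  using ev_add[of \<iota> p "- q" x] ev_uminus[of \<iota> q x] by simp

lemma ev_sum: "ring_emb \<iota> \<Longrightarrow> ev \<iota> (\<Sum>i\<in>A. f i) x = (\<Sum>i\<in>A. ev \<iota> (f i) x)"
  by (induction A rule: infinite_finite_induct) (simp_all add: ev_0 ev_add)

lemma mpoly_sum_single: "p = (\<Sum>\<mu>\<in>Poly_Mapping.keys p. Poly_Mapping.single \<mu> (Poly_Mapping.lookup p \<mu>))"
  by (rule poly_mapping_eqI) (auto simp: lookup_sum lookup_single when_def in_keys_iff)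

lemma ev_mult:
  assumes \<iota>: "ring_emb \<iota>"
  shows "ev \<iota> (p * q) x = ev \<iota> p x * ev \<iota> q x"
proof -
  let ?s = "\<lambda>p \<mu>. Poly_Mapping.single \<mu> (Poly_Mapping.lookup p \<mu>)"
  have "p * q = (\<Sum>\<mu>\<in>Poly_Mapping.keys p. ?s p \<mu>) * (\<Sum>\<nu>\<in>Poly_Mapping.keys q. ?s q \<nu>)"
    using mpoly_sum_single[of p] mpoly_sum_single[of q] by simp
  also have "\<dots> = (\<Sum>\<mu>\<in>Poly_Mapping.keys p. \<Sum>\<nu>\<in>Poly_Mapping.keys q. ?s p \<mu> * ?s q \<nu>)"
    by (rule sum_product)
  also have "ev \<iota> \<dots> x = (\<Sum>\<mu>\<in>Poly_Mapping.keys p. \<Sum>\<nu>\<in>Poly_Mapping.keys q. 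
     (\<iota> (Poly_Mapping.lookup p \<mu>) * monomial_at x \<mu>) * (\<iota> (Poly_Mapping.lookup q \<nu>) * monomial_at x \<nu>))"
    by (simp add: ev_sum[OF \<iota>] mult_single ev_single[OF \<iota>] monomial_at_add ring_emb_mult[OF \<iota>] ac_simps)
  also have "\<dots> = ev \<iota> p x * ev \<iota> q x" unfolding ev_def by (rule sum_product[symmetric])
  finally show ?thesis .
qed

lemma ev_power: "ring_emb \<iota> \<Longrightarrow> ev \<iota> (p ^ e) x = ev \<iota> p x ^ e"
  by (induction e) (simp_all add: ev_1 ev_mult)

lemma ev_prod: "ring_emb \<iota> \<Longrightarrow> ev \<iota> (\<Prod>i\<in>A. f i) x = (\<Prod>i\<in>A. ev \<iota> (f i) x)"
  by (induction A rule: infinite_finite_induct) (simp_all add: ev_1 ev_mult)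

lemma eval_base_change: "eval_mpoly (base_change p) x = ev to_ac p x"
proof -
  have "Poly_Mapping.keys (base_change p) = Poly_Mapping.keys p"
    by (auto simp: in_keys_iff map.rep_eq when_def)
  thus ?thesis
    unfolding eval_mpoly_def ev_def monomial_at_def
    by (intro sum.cong) (auto simp: map.rep_eq when_def in_keys_iff)
qed

lemma ev_to_ultra:
  fixes f :: "nat \<Rightarrow> nat \<Rightarrow> 'k::field"
  shows "ev (\<lambda>c. to_ultra (\<lambda>_. \<iota> c)) p (\<lambda>i. to_ultra (\<lambda>k. f k i)) = to_ultra (\<lambda>k. ev \<iota> p (f k))"
  unfolding ev_def monomial_at_def
  by (simp add: to_ultra_power to_ultra_prod to_ultra_mult to_ultra_sum)

section \<open>Forms\<close>

lemma homogeneous_iff: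
  "p \<in> homogeneous n d \<longleftrightarrow> (\<forall>\<mu>\<in>Poly_Mapping.keys p. Poly_Mapping.keys \<mu> \<subseteq> {..n} \<and> mdeg \<mu> = d)"
  by (simp add: homogeneous_def mdeg_def)

lemma homogeneous_0: "0 \<in> homogeneous n d"
  by (simp add: homogeneous_iff)

lemma homogeneous_single:
  "Poly_Mapping.keys \<mu> \<subseteq> {..n} \<Longrightarrow> mdeg \<mu> = d \<Longrightarrow> Poly_Mapping.single \<mu> c \<in> homogeneous n d"
  by (auto simp: homogeneous_iff)

lemma homogeneous_const: "Poly_Mapping.single 0 c \<in> homogeneous n 0"
  by (rule homogeneous_single) (auto simp: mdeg_def)

lemma homogeneous_1: "1 \<in> homogeneous n 0"
  unfolding single_one[symmetric] by (rule homogeneous_const)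

lemma homogeneous_add:
  fixes p q :: "'a::field mpoly"
  shows "p \<in> homogeneous n d \<Longrightarrow> q \<in> homogeneous n d \<Longrightarrow> p + q \<in> homogeneous n d"
  unfolding homogeneous_iff using keys_add[of p q] by blast

lemma homogeneous_uminus:
  fixes p :: "'a::field mpoly"
  shows "p \<in> homogeneous n d \<Longrightarrow> - p \<in> homogeneous n d"
  unfolding homogeneous_iff by (auto simp: in_keys_iff)

lemma homogeneous_diff:
  fixes p q :: "'a::field mpoly"
  shows "p \<in> homogeneous n d \<Longrightarrow> q \<in> homogeneous n d \<Longrightarrow> p - q \<in> homogeneous n d"
  using homogeneous_add[of p n d "- q"] homogeneous_uminus[of q n d] by simp

lemma homogeneous_mult:
  fixes p q :: "'a::field mpoly"
  assumes "p \<in> homogeneous n d" "q \<in> homogeneous n e"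
  shows "p * q \<in> homogeneous n (d + e)"
  unfolding homogeneous_iff
proof
  fix \<mu> assume "\<mu> \<in> Poly_Mapping.keys (p * q)"
  then obtain a b where ab: "\<mu> = a + b" "a \<in> Poly_Mapping.keys p" "b \<in> Poly_Mapping.keys q"
    using keys_mult[of p q] by blast
  thus "Poly_Mapping.keys \<mu> \<subseteq> {..n} \<and> mdeg \<mu> = d + e"
    using assms unfolding homogeneous_iff by (simp add: keys_add_nat mdeg_add)
qed

lemma homogeneous_scale:
  fixes p :: "'a::field mpoly"
  shows "p \<in> homogeneous n d \<Longrightarrow> Poly_Mapping.single 0 c * p \<in> homogeneous n d"
  using homogeneous_mult[OF homogeneous_const] by fastforce

lemma homogeneous_power:
  fixes p :: "'a::field mpoly"
  shows "p \<in> homogeneous n d \<Longrightarrow> p ^ e \<in> homogeneous n (e * d)"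
  by (induction e) (auto simp: homogeneous_1 dest: homogeneous_mult)

lemma homogeneous_prod:
  fixes f :: "'i \<Rightarrow> 'a::field mpoly"
  assumes "\<And>i. i \<in> A \<Longrightarrow> f i \<in> homogeneous n (d i)"
  shows "(\<Prod>i\<in>A. f i) \<in> homogeneous n (\<Sum>i\<in>A. d i)"
  using assms by (induction A rule: infinite_finite_induct) (auto simp: homogeneous_1 intro: homogeneous_mult)

definition hvar :: "nat \<Rightarrow> 'a::field mpoly" where
  "hvar i = Poly_Mapping.single (Poly_Mapping.single i 1) 1"

lemma homogeneous_var: "i \<le> n \<Longrightarrow> hvar i \<in> homogeneous n 1"
  unfolding hvar_def by (rule homogeneous_single) (auto simp: mdeg_def)

lemma ev_var: "ring_emb \<iota> \<Longrightarrow> ev \<iota> (hvar i) x = x i"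
  by (simp add: hvar_def ev_single monomial_at_single ring_emb_1)

lemma monomial_at_scale: "monomial_at (\<lambda>i. c * x i) \<mu> = c ^ mdeg \<mu> * monomial_at x \<mu>"
  by (simp add: monomial_at_def mdeg_def power_mult_distrib prod.distrib power_sum)

lemma ev_scale:
  assumes "g \<in> homogeneous n d"
  shows "ev \<iota> g (\<lambda>i. c * x i) = c ^ d * ev \<iota> g x"
proof -
  have "ev \<iota> g (\<lambda>i. c * x i) = (\<Sum>\<mu>\<in>Poly_Mapping.keys g. c ^ d * (\<iota> (Poly_Mapping.lookup g \<mu>) * monomial_at x \<mu>))"
    unfolding ev_def using assms
    by (intro sum.cong) (auto simp: homogeneous_iff monomial_at_scale algebra_simps)
  thus ?thesis by (simp add: ev_def sum_distrib_left)
qed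

lemma finite_exponents: "finite {\<mu>. Poly_Mapping.keys \<mu> \<subseteq> {..n} \<and> mdeg \<mu> = d}"
proof (rule finite_imageD[of Poly_Mapping.lookup])
  have "Poly_Mapping.lookup ` {\<mu>. Poly_Mapping.keys \<mu> \<subseteq> {..n} \<and> mdeg \<mu> = d} \<subseteq>
        {f. \<forall>i. (i \<in> {..n} \<longrightarrow> f i \<in> {..d}) \<and> (i \<notin> {..n} \<longrightarrow> f i = 0)}"
  proof (intro image_subsetI CollectI allI conjI impI)
    fix \<mu> :: "nat \<Rightarrow>\<^sub>0 nat" and i
    assume \<mu>: "\<mu> \<in> {\<mu>. Poly_Mapping.keys \<mu> \<subseteq> {..n} \<and> mdeg \<mu> = d}"
    show "Poly_Mapping.lookup \<mu> i \<in> {..d}" if "i \<in> {..n}"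
      using member_le_sum[of i "{..n}" "Poly_Mapping.lookup \<mu>"] that \<mu>
      by (auto simp: mdeg_superset[of "{..n}"])
    show "Poly_Mapping.lookup \<mu> i = 0" if "i \<notin> {..n}" using \<mu> that by (auto simp: in_keys_iff)
  qed
  moreover have "finite {f. \<forall>i. (i \<in> {..n} \<longrightarrow> f i \<in> {..d}) \<and> (i \<notin> {..n} \<longrightarrow> f i = (0::nat))}"
    by (rule finite_set_of_finite_funs) auto
  ultimately show "finite (Poly_Mapping.lookup ` {\<mu>. Poly_Mapping.keys \<mu> \<subseteq> {..n} \<and> mdeg \<mu> = d})"
    by (rule finite_subset)
qed (rule inj_onI, rule poly_mapping_eqI, simp)

lemma finite_homogeneous: "finite (homogeneous n d :: 'a::{field, finite} mpoly set)"
proof (rule finite_imageD[of Poly_Mapping.lookup])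
  let ?T = "{\<mu>. Poly_Mapping.keys \<mu> \<subseteq> {..n} \<and> mdeg \<mu> = d}"
  have "Poly_Mapping.lookup ` (homogeneous n d :: 'a mpoly set) \<subseteq>
        {f. \<forall>i. (i \<in> ?T \<longrightarrow> f i \<in> UNIV) \<and> (i \<notin> ?T \<longrightarrow> f i = 0)}"
  proof (intro image_subsetI CollectI allI conjI impI)
    fix p :: "'a mpoly" and \<mu> assume "p \<in> homogeneous n d" "\<mu> \<notin> ?T"
    hence "\<mu> \<notin> Poly_Mapping.keys p" unfolding homogeneous_iff by blast
    thus "Poly_Mapping.lookup p \<mu> = 0" by (simp add: in_keys_iff)
  qed simp
  moreover have "finite {f. \<forall>i. (i \<in> ?T \<longrightarrow> f i \<in> (UNIV :: 'a set)) \<and> (i \<notin> ?T \<longrightarrow> f i = 0)}"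
    by (rule finite_set_of_finite_funs) (auto simp: finite_exponents)
  ultimately show "finite (Poly_Mapping.lookup ` (homogeneous n d :: 'a mpoly set))"
    by (rule finite_subset)
qed (rule inj_onI, rule poly_mapping_eqI, simp)

section \<open>The generic point of an irreducible algebraic set\<close>

locale curve_set =
  fixes n :: nat and C :: "'a::{field, finite} alg_closure ppoint set"
  assumes algebraic_set: "algebraic_set_over_base n C"
    and irreducible: "zariski_irreducible n C"
begin

definition cone :: "(nat \<Rightarrow> 'a alg_closure) set" where
  "cone = \<Union>C"

abbreviation val_at :: "'a mpoly \<Rightarrow> (nat \<Rightarrow> 'a alg_closure) \<Rightarrow> 'a alg_closure" where
  "val_at \<equiv> ev to_ac"

abbreviation forms :: "nat \<Rightarrow> 'a mpoly set" where
  "forms \<equiv> homogeneous n"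

definition nonvanishing :: "'a mpoly \<Rightarrow> bool" where
  "nonvanishing g \<longleftrightarrow> (\<exists>x\<in>cone. val_at g x \<noteq> 0)"

lemma C_proj: "C \<subseteq> proj_space n"
  using algebraic_set by (auto simp: algebraic_set_over_base_def zero_locus_def)

lemma point_rep:
  fixes P :: "'a alg_closure ppoint"
  assumes "P \<in> proj_space n" "x \<in> P"
  shows "x \<noteq> (\<lambda>_. 0)" "\<And>i. n < i \<Longrightarrow> x i = 0" "P = {y. \<exists>c. c \<noteq> 0 \<and> y = (\<lambda>i. c * x i)}"
proof -
  obtain x0 where x0: "x0 \<noteq> (\<lambda>_. 0)" "\<forall>i>n. x0 i = 0"
    "P = {y. \<exists>c. c \<noteq> 0 \<and> y = (\<lambda>i. c * x0 i)}"
    using assms(1) unfolding proj_space_def quotient_def by auto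
  obtain c where c: "c \<noteq> 0" "x = (\<lambda>i. c * x0 i)" using assms(2) x0(3) by blast
  obtain j where "x0 j \<noteq> 0" using x0(1) by auto
  hence "x j \<noteq> 0" using c by simp
  thus "x \<noteq> (\<lambda>_. 0)" by auto
  show "n < i \<Longrightarrow> x i = 0" for i using c x0(2) by simp
  show "P = {y. \<exists>c. c \<noteq> 0 \<and> y = (\<lambda>i. c * x i)}"
  proof safe
    fix y assume "y \<in> P"
    then obtain b where b: "b \<noteq> 0" "y = (\<lambda>i. b * x0 i)" using x0(3) by blast
    have "y = (\<lambda>i. (b / c) * x i)" using b c by auto
    thus "\<exists>c. c \<noteq> 0 \<and> y = (\<lambda>i. c * x i)" using b(1) c(1) by (intro exI[of _ "b / c"]) auto
  next
    fix b :: "'a alg_closure" assume "b \<noteq> 0"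
    hence "b * c \<noteq> 0" "(\<lambda>i. b * x i) = (\<lambda>i. (b * c) * x0 i)" using c by (auto simp: mult.assoc)
    thus "(\<lambda>i. b * x i) \<in> P" using x0(3) by blast
  qed
qed

lemma vanishes_at_iff:
  assumes "P \<in> proj_space n" "x \<in> P" "g \<in> forms d"
  shows "vanishes_at (base_change g) P \<longleftrightarrow> val_at g x = 0"
proof
  assume "vanishes_at (base_change g) P"
  thus "val_at g x = 0" using assms(2) by (simp add: vanishes_at_def eval_base_change)
next
  assume 0: "val_at g x = 0"
  show "vanishes_at (base_change g) P"
    unfolding vanishes_at_def eval_base_change
  proof
    fix y assume "y \<in> P"
    then obtain c where "y = (\<lambda>i. c * x i)" using point_rep(3)[OF assms(1,2)] by blast
    thus "val_at g y = 0" using ev_scale[OF assms(3), of to_ac c x] 0 by simp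
  qed
qed

lemma proj_nonempty: "P \<in> proj_space n \<Longrightarrow> \<exists>x. x \<in> P"
proof -
  assume "P \<in> proj_space n"
  then obtain x0 where "P = {y. \<exists>c. c \<noteq> 0 \<and> y = (\<lambda>i. c * x0 i)}"
    unfolding proj_space_def quotient_def by auto
  hence "(\<lambda>i. 1 * x0 i) \<in> P" by (simp only: mem_Collect_eq) (intro exI[of _ 1], simp)
  thus ?thesis by blast
qed

lemma nonvanishing_iff:
  assumes "g \<in> forms d"
  shows "nonvanishing g \<longleftrightarrow> (\<exists>P\<in>C. \<not> vanishes_at (base_change g) P)"
proof
  assume "nonvanishing g"
  then obtain x P where "x \<in> P" "P \<in> C" "val_at g x \<noteq> 0"
    unfolding nonvanishing_def cone_def by blast
  thus "\<exists>P\<in>C. \<not> vanishes_at (base_change g) P"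
    using vanishes_at_iff[of P x g d] C_proj assms by blast
next
  assume "\<exists>P\<in>C. \<not> vanishes_at (base_change g) P"
  then obtain P where P: "P \<in> C" "\<not> vanishes_at (base_change g) P" by blast
  obtain x where "x \<in> P" using proj_nonempty P C_proj by blast
  hence "val_at g x \<noteq> 0" using vanishes_at_iff[of P x g d] P C_proj assms by blast
  thus "nonvanishing g" unfolding nonvanishing_def cone_def using \<open>x \<in> P\<close> P by blast
qed

lemma cone_nonzero: "x \<in> cone \<Longrightarrow> \<exists>j\<le>n. x j \<noteq> 0"
proof -
  assume "x \<in> cone"
  then obtain P where P: "P \<in> proj_space n" "x \<in> P" using C_proj unfolding cone_def by blast
  obtain j where "x j \<noteq> 0" using point_rep(1)[OF P] by auto
  moreover from this have "j \<le> n" using point_rep(2)[OF P, of j] by (meson not_le)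
  ultimately show ?thesis by blast
qed

text \<open>
  The set \<open>C\<close> is cut out by forms over the ground field, so membership can be tested on these.
\<close>

lemma cone_memI:
  assumes x: "x j \<noteq> 0" "\<And>i. n < i \<Longrightarrow> x i = 0"
    and van: "\<And>d g. g \<in> forms d \<Longrightarrow> \<forall>y\<in>cone. val_at g y = 0 \<Longrightarrow> val_at g x = 0"
  shows "x \<in> cone"
proof -
  let ?P = "{y. \<exists>c. c \<noteq> 0 \<and> y = (\<lambda>i. c * x i)}"
  have xP: "x \<in> ?P" by (simp only: mem_Collect_eq) (intro exI[of _ 1], simp)
  have P: "?P \<in> proj_space n"
  proof -
    have "x \<noteq> (\<lambda>_. 0)" using x(1) by auto
    thus ?thesis unfolding proj_space_def quotient_def using x(2) by (auto simp: Image_def)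
  qed
  obtain S where S: "S \<subseteq> (\<Union>d. homogeneous n d :: 'a mpoly set)" "C = zero_locus n (base_change ` S)"
    using algebraic_set by (auto simp: algebraic_set_over_base_def)
  have "vanishes_at (base_change g) ?P" if g: "g \<in> S" for g
  proof -
    obtain d where d: "g \<in> forms d" using g S by blast
    have "\<forall>y\<in>cone. val_at g y = 0"
      using g S(2) unfolding cone_def by (auto simp: zero_locus_def vanishes_at_def eval_base_change)
    hence "val_at g x = 0" using van[OF d] by blast
    thus ?thesis using vanishes_at_iff[OF P xP d] by simp
  qed
  hence "?P \<in> C" unfolding S(2) zero_locus_def using P by auto
  thus ?thesis using xP unfolding cone_def by blast
qed

text \<open>
  An irreducible set is not the union of the zero sets of \<open>g\<close> and \<open>h\<close> unless it is contained in one
  of them.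
\<close>

lemma nonvanishing_mult:
  assumes "g \<in> forms d" "h \<in> forms e" "nonvanishing g" "nonvanishing h"
  shows "nonvanishing (g * h)"
proof (rule ccontr)
  assume not: "\<not> ?thesis"
  have closed: "zariski_closed n (zero_locus n {base_change f})" if "f \<in> forms k" for f k
  proof -
    have "base_change f \<in> homogeneous n k"
      using that unfolding homogeneous_iff by (auto simp: in_keys_iff map.rep_eq when_def)
    thus ?thesis unfolding zariski_closed_def by (intro exI[of _ "{base_change f}"]) auto
  qed
  have "C \<subseteq> zero_locus n {base_change g} \<union> zero_locus n {base_change h}"
  proof
    fix P assume P: "P \<in> C"
    obtain x where x: "x \<in> P" using proj_nonempty P C_proj by blast
    have "val_at (g * h) x = 0" using not x P unfolding nonvanishing_def cone_def by blast
    hence "val_at g x = 0 \<or> val_at h x = 0" by (simp add: ev_mult[OF ring_emb_to_ac])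
    thus "P \<in> zero_locus n {base_change g} \<union> zero_locus n {base_change h}"
      unfolding zero_locus_def using vanishes_at_iff[of P x] P x C_proj assms(1,2) by blast
  qed
  hence "C \<subseteq> zero_locus n {base_change g} \<or> C \<subseteq> zero_locus n {base_change h}"
    using irreducible closed[OF assms(1)] closed[OF assms(2)] unfolding zariski_irreducible_def by blast
  thus False
    using assms nonvanishing_iff unfolding zero_locus_def by blast
qed

lemma cone_nonempty: "cone \<noteq> {}"
proof -
  obtain P where "P \<in> C" using irreducible by (auto simp: zariski_irreducible_def)
  thus ?thesis using proj_nonempty C_proj unfolding cone_def by blast
qed

lemma nonvanishing_1: "nonvanishing 1"
  using cone_nonempty by (auto simp: nonvanishing_def ev_1[OF ring_emb_to_ac])

lemma nonvanishing_prod: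
  assumes "finite A" "\<And>i. i \<in> A \<Longrightarrow> f i \<in> forms (d i)" "\<And>i. i \<in> A \<Longrightarrow> nonvanishing (f i)"
  shows "nonvanishing (\<Prod>i\<in>A. f i)"
  using assms
proof (induction A rule: finite_induct)
  case (insert i A)
  have "f i \<in> forms (d i)" "(\<Prod>i\<in>A. f i) \<in> forms (\<Sum>i\<in>A. d i)"
    using insert by (auto intro: homogeneous_prod)
  thus ?case using insert by (auto intro: nonvanishing_mult)
qed (simp add: nonvanishing_1)

definition nzforms :: "'a mpoly set" where
  "nzforms = {g. (\<exists>d. g \<in> forms d) \<and> nonvanishing g}"

lemma nzformsD: "g \<in> nzforms \<Longrightarrow> (\<exists>d. g \<in> forms d) \<and> nonvanishing g"
  by (simp add: nzforms_def)

lemma nzforms_countable: "countable nzforms"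
proof (rule countable_subset)
  show "nzforms \<subseteq> (\<Union>d. forms d)" by (auto simp: nzforms_def)
  show "countable (\<Union>d. forms d)"
    by (rule countable_UN[OF countableI_type]) (rule countable_finite[OF finite_homogeneous])
qed

text \<open>
  The first \<open>k + 1\<close> forms have a product that does not vanish identically.
\<close>

lemma generic_sequence:
  "\<exists>p. \<forall>k. p k \<in> cone \<and> (\<forall>j\<le>k. val_at (from_nat_into nzforms j) (p k) \<noteq> 0)"
proof -
  have "1 \<in> nzforms" unfolding nzforms_def using nonvanishing_1 homogeneous_1 by blast
  hence ne: "nzforms \<noteq> {}" by blast
  have "\<exists>x. x \<in> cone \<and> (\<forall>j\<le>k. val_at (from_nat_into nzforms j) x \<noteq> 0)" for k
  proof -
    let ?g = "from_nat_into nzforms"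
    have g: "?g j \<in> nzforms" for j by (rule from_nat_into[OF ne])
    obtain d where d: "\<And>j. ?g j \<in> forms (d j)" using nzformsD[OF g] by metis
    have "nonvanishing (\<Prod>j\<in>{..k}. ?g j)"
      using d nzformsD[OF g] by (intro nonvanishing_prod[of _ _ d]) auto
    then obtain x where "x \<in> cone" "val_at (\<Prod>j\<in>{..k}. ?g j) x \<noteq> 0" unfolding nonvanishing_def by blast
    thus ?thesis by (intro exI[of _ x]) (auto simp: ev_prod[OF ring_emb_to_ac])
  qed
  thus ?thesis by metis
qed

definition pts :: "nat \<Rightarrow> nat \<Rightarrow> 'a alg_closure" where
  "pts = (SOME p. \<forall>k. p k \<in> cone \<and> (\<forall>j\<le>k. val_at (from_nat_into nzforms j) (p k) \<noteq> 0))"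

lemma pts: "pts k \<in> cone" "j \<le> k \<Longrightarrow> val_at (from_nat_into nzforms j) (pts k) \<noteq> 0"
proof -
  have "\<forall>k. pts k \<in> cone \<and> (\<forall>j\<le>k. val_at (from_nat_into nzforms j) (pts k) \<noteq> 0)"
    unfolding pts_def by (rule someI_ex[OF generic_sequence])
  thus "pts k \<in> cone" "j \<le> k \<Longrightarrow> val_at (from_nat_into nzforms j) (pts k) \<noteq> 0" by auto
qed

text \<open>
  The class of the sequence \<open>pts\<close>, a generic point of \<open>C\<close> by \<open>E_eq_0_iff\<close> below.
\<close>

definition gen :: "nat \<Rightarrow> 'a alg_closure ultrapower" where
  "gen i = to_ultra (\<lambda>k. pts k i)"

definition const :: "'a \<Rightarrow> 'a alg_closure ultrapower" where
  "const c = to_ultra (\<lambda>_. to_ac c)"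

definition E :: "'a mpoly \<Rightarrow> 'a alg_closure ultrapower" where
  "E g = ev const g gen"

lemma ring_emb_const: "ring_emb const"
  unfolding ring_emb_def const_def by (simp add: to_ultra_add to_ultra_mult to_ultra_1)

lemma E_eq_to_ultra: "E g = to_ultra (\<lambda>k. val_at g (pts k))"
  unfolding E_def using ev_to_ultra[of to_ac g pts]
  by (simp add: const_def[abs_def] gen_def[abs_def])

text \<open>
  A form that does not vanish identically on \<open>C\<close> is one of the countably many that are enumerated, so
  it is nonzero at all but finitely many terms of \<open>pts\<close>.
\<close>

lemma E_eq_0_iff:
  assumes "g \<in> forms d"
  shows "E g = 0 \<longleftrightarrow> (\<forall>x\<in>cone. val_at g x = 0)"
proof
  assume "\<forall>x\<in>cone. val_at g x = 0"
  thus "E g = 0" using pts(1) by (simp add: E_eq_to_ultra to_ultra_0)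
next
  assume 0: "E g = 0"
  show "\<forall>x\<in>cone. val_at g x = 0"
  proof (rule ccontr)
    assume "\<not> ?thesis"
    hence "g \<in> nzforms" using assms by (auto simp: nzforms_def nonvanishing_def)
    then obtain j where j: "g = from_nat_into nzforms j"
      using from_nat_into_surj[OF nzforms_countable] by metis
    have "E g = to_ultra (\<lambda>_. 0)" unfolding to_ultra_0 by (rule 0)
    hence "{k. val_at g (pts k) = 0} \<in> ultra"
      by (simp add: E_eq_to_ultra to_ultra_eq_iff ultra_eq_def)
    from ultra_Int[OF this ultra_tail[of j]] have "{} \<in> ultra"
      by (rule ultra_mono) (use pts(2) j in auto)
    thus False using ultra_empty by blast
  qed
qed

lemma E_nonzero_iff: "g \<in> forms d \<Longrightarrow> E g \<noteq> 0 \<longleftrightarrow> nonvanishing g"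
  using E_eq_0_iff by (auto simp: nonvanishing_def)

lemma E_nonzeroI: "g \<in> forms d \<Longrightarrow> x \<in> cone \<Longrightarrow> val_at g x \<noteq> 0 \<Longrightarrow> E g \<noteq> 0"
  using E_eq_0_iff by blast

lemma E_0: "E 0 = 0" and E_1: "E 1 = 1" and E_single0: "E (Poly_Mapping.single 0 c) = const c"
  and E_add: "E (g + h) = E g + E h" and E_diff: "E (g - h) = E g - E h"
  and E_mult: "E (g * h) = E g * E h" and E_uminus: "E (- g) = - E g" and E_power: "E (g ^ k) = E g ^ k"
  and E_var: "E (hvar i) = gen i"
  and E_prod: "E (\<Prod>i\<in>I. f i) = (\<Prod>i\<in>I. E (f i))"
  using ring_emb_const
  by (simp_all add: E_def ev_0 ev_1 ev_add ev_diff ev_mult ev_uminus ev_power ev_var ev_prod ev_single monomial_at_0)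

lemmas val_simps = ev_0 ev_1[OF ring_emb_to_ac] ev_add[OF ring_emb_to_ac] ev_diff[OF ring_emb_to_ac]
  ev_mult[OF ring_emb_to_ac] ev_power[OF ring_emb_to_ac] ev_var[OF ring_emb_to_ac]
  ev_prod[OF ring_emb_to_ac] ev_single[OF ring_emb_to_ac] monomial_at_0

lemmas E_simps = E_0 E_1 E_single0 E_add E_diff E_mult E_uminus E_power E_var E_prod

lemma E_identity:
  assumes "g \<in> forms d" "h \<in> forms d" "E g = E h" "x \<in> cone"
  shows "val_at g x = val_at h x"
proof -
  have "E (g - h) = 0" using assms by (simp add: E_diff)
  hence "val_at (g - h) x = 0" using E_eq_0_iff[OF homogeneous_diff[OF assms(1,2)]] assms(4) by blast
  thus ?thesis by (simp add: val_simps)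
qed

section \<open>The function field\<close>

text \<open>
  The function field, as a subfield of the ultrapower.
\<close>

definition K :: "'a alg_closure ultrapower set" where
  "K = {E g / E h | g h d. g \<in> forms d \<and> h \<in> forms d \<and> E h \<noteq> 0}"

lemma K_I: "g \<in> forms d \<Longrightarrow> h \<in> forms d \<Longrightarrow> E h \<noteq> 0 \<Longrightarrow> E g / E h \<in> K"
  unfolding K_def by blast

lemma K_E:
  assumes "z \<in> K"
  obtains g h d where "g \<in> forms d" "h \<in> forms d" "E h \<noteq> 0" "z = E g / E h"
  using assms unfolding K_def by blast

lemma K_const: "const c \<in> K"
  using K_I[OF homogeneous_const homogeneous_1, of c] by (simp add: E_simps)

lemma K_01: "0 \<in> K" "1 \<in> K"
  using K_const[of 0] K_const[of 1] ring_emb_0[OF ring_emb_const] ring_emb_1[OF ring_emb_const] by auto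

lemma K_diff:
  assumes "z \<in> K" "w \<in> K"
  shows "z - w \<in> K"
proof -
  obtain g h d where 1: "g \<in> forms d" "h \<in> forms d" "E h \<noteq> 0" "z = E g / E h" using assms(1) by (rule K_E)
  obtain g' h' d' where 2: "g' \<in> forms d'" "h' \<in> forms d'" "E h' \<noteq> 0" "w = E g' / E h'" using assms(2) by (rule K_E)
  have "g * h' - h * g' \<in> forms (d + d')" "h * h' \<in> forms (d + d')"
    using 1 2 by (intro homogeneous_diff homogeneous_mult; simp)+
  from K_I[OF this] have "E (g * h' - h * g') / E (h * h') \<in> K" using 1 2 by (simp add: E_simps)
  also have "E (g * h' - h * g') / E (h * h') = z - w"
    unfolding 1(4) 2(4) using 1(3) 2(3) by (simp add: E_simps diff_frac_eq mult.commute)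
  finally show ?thesis .
qed

lemma K_mult:
  assumes "z \<in> K" "w \<in> K"
  shows "z * w \<in> K"
proof -
  obtain g h d where 1: "g \<in> forms d" "h \<in> forms d" "E h \<noteq> 0" "z = E g / E h" using assms(1) by (rule K_E)
  obtain g' h' d' where 2: "g' \<in> forms d'" "h' \<in> forms d'" "E h' \<noteq> 0" "w = E g' / E h'" using assms(2) by (rule K_E)
  have "g * g' \<in> forms (d + d')" "h * h' \<in> forms (d + d')"
    using 1 2 by (intro homogeneous_mult; simp)+
  from K_I[OF this] show ?thesis using 1 2 by (simp add: E_simps)
qed

lemma K_inverse:
  assumes "z \<in> K"
  shows "inverse z \<in> K"
proof (cases "z = 0")
  case False
  obtain g h d where 1: "g \<in> forms d" "h \<in> forms d" "E h \<noteq> 0" "z = E g / E h" using assms by (rule K_E)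
  hence "E g \<noteq> 0" using False by auto
  thus ?thesis using K_I[OF 1(2,1)] 1 by simp
qed (use K_01 in simp)

lemma K_uminus: "z \<in> K \<Longrightarrow> - z \<in> K"
  using K_diff[of 0 z] K_01 by simp

lemma K_add: "z \<in> K \<Longrightarrow> w \<in> K \<Longrightarrow> z + w \<in> K"
  using K_diff[of z "- w"] K_uminus by simp

lemma K_divide: "z \<in> K \<Longrightarrow> w \<in> K \<Longrightarrow> z / w \<in> K"
  using K_mult[of z "inverse w"] K_inverse by (simp add: divide_inverse)

lemma K_power: "z \<in> K \<Longrightarrow> z ^ k \<in> K"
  by (induction k) (auto simp: K_01 K_mult)

text \<open>
  The isomorphism from \<open>K\<close> to the field of equivalence classes of fractions: a function is sent to
  the set of all its representations as a quotient of forms.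
\<close>

definition phi :: "'a alg_closure ultrapower \<Rightarrow> 'a ratfun" where
  "phi z = {(g, h). (g, h) \<in> fractions n C \<and> E g / E h = z}"

abbreviation FF :: "'a ratfun ring" where "FF \<equiv> function_field n C"

lemma fractions_iff: "(g, h) \<in> fractions n C \<longleftrightarrow> (\<exists>d. g \<in> forms d \<and> h \<in> forms d \<and> E h \<noteq> 0)"
proof
  assume "(g, h) \<in> fractions n C"
  then obtain d where d: "g \<in> forms d" "h \<in> forms d" "\<exists>P\<in>C. \<not> vanishes_at (base_change h) P"
    by (auto simp: fractions_def)
  thus "\<exists>d. g \<in> forms d \<and> h \<in> forms d \<and> E h \<noteq> 0"
    using nonvanishing_iff[OF d(2)] E_nonzero_iff[OF d(2)] by blast
next
  assume "\<exists>d. g \<in> forms d \<and> h \<in> forms d \<and> E h \<noteq> 0"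
  then obtain d where d: "g \<in> forms d" "h \<in> forms d" "E h \<noteq> 0" by blast
  thus "(g, h) \<in> fractions n C"
    using nonvanishing_iff[OF d(2)] E_nonzero_iff[OF d(2)] by (auto simp: fractions_def)
qed

lemma fraction_phi:
  assumes "(g, h) \<in> fractions n C"
  shows "fraction n C g h = phi (E g / E h)"
proof -
  obtain d where d: "g \<in> forms d" "h \<in> forms d" "E h \<noteq> 0" using assms by (auto simp: fractions_iff)
  have "((g, h), (g', h')) \<in> frac_rel n C \<longleftrightarrow> (g', h') \<in> phi (E g / E h)" for g' h'
  proof (cases "(g', h') \<in> fractions n C")
    case True
    then obtain d' where d': "g' \<in> forms d'" "h' \<in> forms d'" "E h' \<noteq> 0" by (auto simp: fractions_iff)
    have f1: "g * h' \<in> forms (d + d')" using d d' by (intro homogeneous_mult)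
    have f2: "g' * h \<in> forms (d + d')" using homogeneous_mult[OF d'(1) d(2)] by (simp add: add.commute)
    have f: "g * h' - g' * h \<in> forms (d + d')" by (rule homogeneous_diff[OF f1 f2])
    have "((g, h), (g', h')) \<in> frac_rel n C \<longleftrightarrow> (\<forall>P\<in>C. vanishes_at (base_change (g * h' - g' * h)) P)"
      using True assms by (simp add: frac_rel_def)
    also have "\<dots> \<longleftrightarrow> E (g * h' - g' * h) = 0"
      using nonvanishing_iff[OF f] E_nonzero_iff[OF f] by blast
    also have "\<dots> \<longleftrightarrow> E g' / E h' = E g / E h"
      using d d' by (auto simp: E_simps field_simps)
    finally show ?thesis using True by (simp add: phi_def)
  qed (auto simp: frac_rel_def phi_def)
  thus ?thesis unfolding fraction_def by auto
qed

lemma phi_nonempty: "z \<in> K \<Longrightarrow> \<exists>g h. (g, h) \<in> phi z"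
  by (erule K_E) (auto simp: phi_def fractions_iff)

lemma phi_mem: "(g, h) \<in> phi z \<Longrightarrow> (g, h) \<in> fractions n C \<and> z = E g / E h"
  by (auto simp: phi_def)

lemma phi_inj: "inj_on phi K"
proof (rule inj_onI)
  fix z w assume "z \<in> K" "w \<in> K" "phi z = phi w"
  then obtain g h where "(g, h) \<in> phi z" "(g, h) \<in> phi w" using phi_nonempty by blast
  thus "z = w" using phi_mem by blast
qed

lemma carrier_FF: "carrier FF = phi ` K"
proof -
  have "carrier FF = {fraction n C g h | g h. (g, h) \<in> fractions n C}"
    unfolding function_field_def fraction_def quotient_def by auto
  also have "\<dots> = phi ` K"
  proof safe
    fix g h assume gh: "(g, h) \<in> fractions n C"
    thus "fraction n C g h \<in> phi ` K" unfolding fraction_phi[OF gh] by (auto simp: fractions_iff intro: K_I)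
  next
    fix z assume "z \<in> K"
    then obtain g h where "(g, h) \<in> phi z" using phi_nonempty by blast
    thus "\<exists>g h. phi z = fraction n C g h \<and> (g, h) \<in> fractions n C" using phi_mem fraction_phi by blast
  qed
  finally show ?thesis .
qed

lemma phi_union:
  assumes "z \<in> K" "w \<in> K"
    and "\<And>g h g' h'. (g, h) \<in> phi z \<Longrightarrow> (g', h') \<in> phi w \<Longrightarrow> G g h g' h' = c"
  shows "(\<Union>(g, h)\<in>phi z. \<Union>(g', h')\<in>phi w. G g h g' h') = c"
  using phi_nonempty[OF assms(1)] phi_nonempty[OF assms(2)] assms(3) by fast

lemma phi_mult:
  assumes "z \<in> K" "w \<in> K"
  shows "phi z \<otimes>\<^bsub>FF\<^esub> phi w = phi (z * w)"
proof -
  have "(\<Union>(g, h)\<in>phi z. \<Union>(g', h')\<in>phi w. fraction n C (g * g') (h * h')) = phi (z * w)"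
  proof (rule phi_union[OF assms])
    fix g h g' h' assume gh: "(g, h) \<in> phi z" "(g', h') \<in> phi w"
    then obtain d d' where d: "g \<in> forms d" "h \<in> forms d" "E h \<noteq> 0" "g' \<in> forms d'" "h' \<in> forms d'" "E h' \<noteq> 0"
      using phi_mem by (metis fractions_iff)
    hence "(g * g', h * h') \<in> fractions n C"
      unfolding fractions_iff by (intro exI[of _ "d + d'"]) (auto intro: homogeneous_mult simp: E_simps)
    from fraction_phi[OF this] show "fraction n C (g * g') (h * h') = phi (z * w)"
      using phi_mem[OF gh(1)] phi_mem[OF gh(2)] by (simp add: E_simps)
  qed
  thus ?thesis by (simp add: function_field_def)
qed

lemma phi_add:
  assumes "z \<in> K" "w \<in> K"
  shows "phi z \<oplus>\<^bsub>FF\<^esub> phi w = phi (z + w)"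
proof -
  have "(\<Union>(g, h)\<in>phi z. \<Union>(g', h')\<in>phi w. fraction n C (g * h' + g' * h) (h * h')) = phi (z + w)"
  proof (rule phi_union[OF assms])
    fix g h g' h' assume gh: "(g, h) \<in> phi z" "(g', h') \<in> phi w"
    then obtain d d' where d: "g \<in> forms d" "h \<in> forms d" "E h \<noteq> 0" "g' \<in> forms d'" "h' \<in> forms d'" "E h' \<noteq> 0"
      using phi_mem by (metis fractions_iff)
    have "g * h' \<in> forms (d + d')" "g' * h \<in> forms (d + d')"
      using homogeneous_mult[OF d(1,5)] homogeneous_mult[OF d(4,2)] by (simp_all add: add.commute)
    hence "(g * h' + g' * h, h * h') \<in> fractions n C"
      unfolding fractions_iff using d
      by (intro exI[of _ "d + d'"]) (auto intro: homogeneous_mult homogeneous_add simp: E_simps)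
    from fraction_phi[OF this] show "fraction n C (g * h' + g' * h) (h * h') = phi (z + w)"
      using phi_mem[OF gh(1)] phi_mem[OF gh(2)] d by (simp add: E_simps add_frac_eq mult.commute)
  qed
  thus ?thesis by (simp add: function_field_def)
qed

lemma phi_const: "fraction n C (Poly_Mapping.single 0 c) 1 = phi (const c)"
proof -
  have "(Poly_Mapping.single 0 c, 1) \<in> fractions n C"
    unfolding fractions_iff by (intro exI[of _ 0]) (auto simp: homogeneous_const homogeneous_1 E_simps)
  from fraction_phi[OF this] show ?thesis by (simp add: E_simps)
qed

lemma phi_0: "\<zero>\<^bsub>FF\<^esub> = phi 0"
  using phi_const[of 0] by (simp add: function_field_def ring_emb_0[OF ring_emb_const])

lemma phi_1: "\<one>\<^bsub>FF\<^esub> = phi 1"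
  using phi_const[of 1] by (simp add: function_field_def ring_emb_1[OF ring_emb_const])

lemma constants_eq: "constants n C = phi ` range const"
  unfolding constants_def by (auto simp: phi_const)

definition Kr :: "'a alg_closure ultrapower ring" where
  "Kr = \<lparr>carrier = K, monoid.mult = (*), one = 1, ring.zero = 0, add = (+)\<rparr>"

lemma field_Kr: "field Kr"
proof (rule cring.cring_fieldI2)
  have "\<exists>y\<in>K. y + x = 0 \<and> x + y = 0" if "x \<in> K" for x
    using that by (intro bexI[of _ "- x"]) (auto intro: K_uminus)
  thus "cring Kr"
    unfolding Kr_def
    by (intro cringI abelian_groupI comm_monoidI) (auto simp: K_add K_mult K_01 algebra_simps)
  show "\<zero>\<^bsub>Kr\<^esub> \<noteq> \<one>\<^bsub>Kr\<^esub>" by (simp add: Kr_def)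
  fix a assume "a \<in> carrier Kr" "a \<noteq> \<zero>\<^bsub>Kr\<^esub>"
  thus "\<exists>b\<in>carrier Kr. a \<otimes>\<^bsub>Kr\<^esub> b = \<one>\<^bsub>Kr\<^esub>"
    by (intro bexI[of _ "inverse a"]) (auto simp: Kr_def K_inverse)
qed

lemma phi_iso: "phi \<in> ring_iso Kr FF"
  unfolding ring_iso_def ring_hom_def bij_betw_def
  by (auto simp: Kr_def carrier_FF phi_mult phi_add phi_1 phi_inj)

lemma field_FF: "field FF"
proof -
  have "field (FF\<lparr>zero := phi 0\<rparr>)"
    using field.ring_iso_imp_img_field[OF field_Kr phi_iso] by (simp add: Kr_def)
  also have "FF\<lparr>zero := phi 0\<rparr> = FF"
    unfolding phi_0[symmetric] by (simp add: function_field_def)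
  finally show ?thesis .
qed

lemma phi_eq_iff: "z \<in> K \<Longrightarrow> w \<in> K \<Longrightarrow> phi z = phi w \<longleftrightarrow> z = w"
  using phi_inj by (auto dest: inj_onD)

lemma phi_carrier: "z \<in> K \<Longrightarrow> phi z \<in> carrier FF"
  by (simp add: carrier_FF)

lemma phi_uminus: "z \<in> K \<Longrightarrow> \<ominus>\<^bsub>FF\<^esub> phi z = phi (- z)"
proof -
  interpret field FF by (rule field_FF)
  assume z: "z \<in> K"
  have "phi (- z) \<oplus>\<^bsub>FF\<^esub> phi z = \<zero>\<^bsub>FF\<^esub>" using z by (simp add: phi_add K_uminus phi_0)
  thus ?thesis using z by (intro minus_equality) (auto simp: phi_carrier K_uminus)
qed

lemma phi_inverse: "z \<in> K \<Longrightarrow> z \<noteq> 0 \<Longrightarrow> inv\<^bsub>FF\<^esub> phi z = phi (inverse z)"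
proof -
  interpret field FF by (rule field_FF)
  assume z: "z \<in> K" "z \<noteq> 0"
  have "phi z \<otimes>\<^bsub>FF\<^esub> phi (inverse z) = \<one>\<^bsub>FF\<^esub>" using z by (simp add: phi_mult K_inverse phi_1)
  thus ?thesis using z by (intro comm_inv_char) (auto simp: phi_carrier K_inverse)
qed

lemma phi_pow: "z \<in> K \<Longrightarrow> phi z [^]\<^bsub>FF\<^esub> (k::nat) = phi (z ^ k)"
  by (induction k) (simp_all add: phi_1 phi_mult K_power mult.commute)

lemma phi_int_pow: "z \<in> K \<Longrightarrow> z \<noteq> 0 \<Longrightarrow> phi z [^]\<^bsub>FF\<^esub> (k::int) = phi (z powi k)"
proof (cases "k < 0")
  case True
  assume z: "z \<in> K" "z \<noteq> 0"
  have "phi z [^]\<^bsub>FF\<^esub> k = inv\<^bsub>FF\<^esub> phi (z ^ nat (- k))"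
    using True unfolding int_pow_def2 phi_pow[OF z(1)] by simp
  also have "\<dots> = phi (inverse (z ^ nat (- k)))" using z by (intro phi_inverse K_power) auto
  also have "inverse (z ^ nat (- k)) = z powi k" using True by (simp add: power_int_def power_inverse)
  finally show ?thesis .
next
  case False
  assume z: "z \<in> K" "z \<noteq> 0"
  show ?thesis using False unfolding int_pow_def2 phi_pow[OF z(1)] by (simp add: power_int_def)
qed

section \<open>Local rings\<close>

definition Loc :: "(nat \<Rightarrow> 'a alg_closure) \<Rightarrow> 'a alg_closure ultrapower set" where
  "Loc p = {E g / E h | g h d. g \<in> forms d \<and> h \<in> forms d \<and> val_at h p \<noteq> 0}"

definition Mloc :: "(nat \<Rightarrow> 'a alg_closure) \<Rightarrow> 'a alg_closure ultrapower set" where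
  "Mloc p = {E g / E h | g h d. g \<in> forms d \<and> h \<in> forms d \<and> val_at h p \<noteq> 0 \<and> val_at g p = 0}"

text \<open>
  The value at \<open>p\<close> of a function regular there, well-defined by \<open>resv_eq\<close> below.
\<close>

definition resv :: "(nat \<Rightarrow> 'a alg_closure) \<Rightarrow> 'a alg_closure ultrapower \<Rightarrow> 'a alg_closure" where
  "resv p z = (THE c. \<exists>g h d. g \<in> forms d \<and> h \<in> forms d \<and> val_at h p \<noteq> 0 \<and> z = E g / E h \<and> c = val_at g p / val_at h p)"

lemma Loc_I: "g \<in> forms d \<Longrightarrow> h \<in> forms d \<Longrightarrow> val_at h p \<noteq> 0 \<Longrightarrow> E g / E h \<in> Loc p"
  unfolding Loc_def by blast

lemma Loc_E:
  assumes "z \<in> Loc p"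
  obtains g h d where "g \<in> forms d" "h \<in> forms d" "val_at h p \<noteq> 0" "z = E g / E h"
  using assms unfolding Loc_def by blast

lemma resv_eq:
  assumes p: "p \<in> cone" and "g \<in> forms d" "h \<in> forms d" "val_at h p \<noteq> 0"
  shows "resv p (E g / E h) = val_at g p / val_at h p"
  unfolding resv_def
proof (rule the_equality)
  fix c assume "\<exists>g' h' d'. g' \<in> forms d' \<and> h' \<in> forms d' \<and> val_at h' p \<noteq> 0 \<and> E g / E h = E g' / E h' \<and> c = val_at g' p / val_at h' p"
  then obtain g' h' d' where *: "g' \<in> forms d'" "h' \<in> forms d'" "val_at h' p \<noteq> 0" "E g / E h = E g' / E h'" "c = val_at g' p / val_at h' p" by blast
  have nz: "E h \<noteq> 0" "E h' \<noteq> 0" using E_nonzeroI p assms * by blast+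
  have "val_at (g * h') p = val_at (g' * h) p"
  proof (rule E_identity[OF _ _ _ p])
    show "g * h' \<in> forms (d + d')" using assms * by (intro homogeneous_mult)
    show "g' * h \<in> forms (d + d')" using homogeneous_mult[OF *(1) assms(3)] by (simp add: add.commute)
    show "E (g * h') = E (g' * h)" using *(4) nz by (simp add: E_simps field_simps)
  qed
  thus "c = val_at g p / val_at h p"
    unfolding *(5) using *(3) assms(4) by (simp add: val_simps frac_eq_eq)
qed (use assms in blast)

lemma Loc_K: "p \<in> cone \<Longrightarrow> Loc p \<subseteq> K"
  unfolding Loc_def K_def using E_nonzeroI by blast

lemma Mloc_iff: "p \<in> cone \<Longrightarrow> z \<in> Mloc p \<longleftrightarrow> z \<in> Loc p \<and> resv p z = 0"
proof
  assume p: "p \<in> cone" and "z \<in> Mloc p"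
  then obtain g h d where *: "g \<in> forms d" "h \<in> forms d" "val_at h p \<noteq> 0" "val_at g p = 0" "z = E g / E h"
    unfolding Mloc_def by blast
  thus "z \<in> Loc p \<and> resv p z = 0" using resv_eq[OF p *(1-3)] Loc_I by simp
next
  assume p: "p \<in> cone" and z: "z \<in> Loc p \<and> resv p z = 0"
  then obtain g h d where *: "g \<in> forms d" "h \<in> forms d" "val_at h p \<noteq> 0" "z = E g / E h" by (blast elim: Loc_E)
  have "val_at g p = 0" using resv_eq[OF p *(1-3)] z * by simp
  thus "z \<in> Mloc p" unfolding Mloc_def using * by blast
qed

lemma Loc_const: "const c \<in> Loc p" and resv_const: "p \<in> cone \<Longrightarrow> resv p (const c) = to_ac c"
proof -
  have *: "val_at 1 p \<noteq> 0" by (simp add: val_simps)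
  show "const c \<in> Loc p" using Loc_I[OF homogeneous_const homogeneous_1 *, of c] by (simp add: E_simps)
  show "resv p (const c) = to_ac c" if "p \<in> cone"
    using resv_eq[OF that homogeneous_const homogeneous_1 *, of c] by (simp add: E_simps val_simps)
qed

lemma Loc_01: "0 \<in> Loc p" "1 \<in> Loc p"
  using Loc_const[of 0 p] Loc_const[of 1 p] ring_emb_0[OF ring_emb_const] ring_emb_1[OF ring_emb_const] by auto

lemma resv_01: "p \<in> cone \<Longrightarrow> resv p 0 = 0" "p \<in> cone \<Longrightarrow> resv p 1 = 1"
  using resv_const[of p 0] resv_const[of p 1] ring_emb_0[OF ring_emb_const] ring_emb_1[OF ring_emb_const] by auto

lemma Loc_diff_resv:
  assumes p: "p \<in> cone" and "z \<in> Loc p" "w \<in> Loc p"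
  shows "z - w \<in> Loc p \<and> resv p (z - w) = resv p z - resv p w"
proof -
  obtain g h d where 1: "g \<in> forms d" "h \<in> forms d" "val_at h p \<noteq> 0" "z = E g / E h" using assms(2) by (rule Loc_E)
  obtain g' h' d' where 2: "g' \<in> forms d'" "h' \<in> forms d'" "val_at h' p \<noteq> 0" "w = E g' / E h'" using assms(3) by (rule Loc_E)
  have nz: "E h \<noteq> 0" "E h' \<noteq> 0" using E_nonzeroI p 1 2 by blast+
  have f: "g * h' - h * g' \<in> forms (d + d')" "h * h' \<in> forms (d + d')"
    using 1 2 by (intro homogeneous_diff homogeneous_mult; simp)+
  have v: "val_at (h * h') p \<noteq> 0" using 1 2 by (simp add: val_simps)
  have eq: "z - w = E (g * h' - h * g') / E (h * h')"
    unfolding 1(4) 2(4) using nz by (simp add: E_simps diff_frac_eq mult.commute)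
  have "resv p (z - w) = resv p z - resv p w"
    unfolding eq resv_eq[OF p f v] unfolding 1(4) 2(4) resv_eq[OF p 1(1-3)] resv_eq[OF p 2(1-3)]
    using 1(3) 2(3) by (simp add: val_simps diff_frac_eq mult.commute)
  thus ?thesis using Loc_I[OF f v] eq by simp
qed

lemma Loc_mult_resv:
  assumes p: "p \<in> cone" and "z \<in> Loc p" "w \<in> Loc p"
  shows "z * w \<in> Loc p \<and> resv p (z * w) = resv p z * resv p w"
proof -
  obtain g h d where 1: "g \<in> forms d" "h \<in> forms d" "val_at h p \<noteq> 0" "z = E g / E h" using assms(2) by (rule Loc_E)
  obtain g' h' d' where 2: "g' \<in> forms d'" "h' \<in> forms d'" "val_at h' p \<noteq> 0" "w = E g' / E h'" using assms(3) by (rule Loc_E)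
  have f: "g * g' \<in> forms (d + d')" "h * h' \<in> forms (d + d')"
    using 1 2 by (intro homogeneous_mult; simp)+
  have v: "val_at (h * h') p \<noteq> 0" using 1 2 by (simp add: val_simps)
  have eq: "z * w = E (g * g') / E (h * h')" using 1 2 by (simp add: E_simps)
  show ?thesis unfolding eq using Loc_I[OF f v] resv_eq[OF p f v] resv_eq[OF p 1(1-3)] resv_eq[OF p 2(1-3)] 1 2
    by (simp add: val_simps)
qed

lemmas Loc_diff = Loc_diff_resv[THEN conjunct1] and resv_diff = Loc_diff_resv[THEN conjunct2]
lemmas Loc_mult = Loc_mult_resv[THEN conjunct1] and resv_mult = Loc_mult_resv[THEN conjunct2]

lemma Loc_add: "p \<in> cone \<Longrightarrow> z \<in> Loc p \<Longrightarrow> w \<in> Loc p \<Longrightarrow> z + w \<in> Loc p"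
  using Loc_diff[of p z "0 - w"] Loc_diff[of p 0 w] Loc_01 by simp

lemma Loc_power: "p \<in> cone \<Longrightarrow> z \<in> Loc p \<Longrightarrow> z ^ k \<in> Loc p"
  by (induction k) (auto simp: Loc_01 Loc_mult)

lemma resv_power: "p \<in> cone \<Longrightarrow> z \<in> Loc p \<Longrightarrow> resv p (z ^ k) = resv p z ^ k"
  by (induction k) (auto simp: resv_01 resv_mult Loc_power)

lemma Loc_inverse:
  assumes p: "p \<in> cone" and "z \<in> Loc p" "resv p z \<noteq> 0"
  shows "inverse z \<in> Loc p"
proof -
  obtain g h d where 1: "g \<in> forms d" "h \<in> forms d" "val_at h p \<noteq> 0" "z = E g / E h" using assms(2) by (rule Loc_E)
  have "val_at g p \<noteq> 0" using resv_eq[OF p 1(1-3)] 1(4) assms(3) by auto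
  from Loc_I[OF 1(2,1) this] show ?thesis using 1(4) by simp
qed

lemma regular_at_eq:
  assumes P: "P \<in> C" "p \<in> P"
  shows "regular_at n C P = phi ` Loc p"
proof -
  have p: "p \<in> cone" using P unfolding cone_def by blast
  have Pp: "P \<in> proj_space n" using P C_proj by blast
  show ?thesis
  proof safe
    fix f assume "f \<in> regular_at n C P"
    then obtain z g h where z: "z \<in> K" "f = phi z" and gh: "(g, h) \<in> f" "\<not> vanishes_at (base_change h) P"
      unfolding regular_at_def carrier_FF by blast
    obtain d where d: "g \<in> forms d" "h \<in> forms d" "z = E g / E h"
      using phi_mem gh z fractions_iff by metis
    have "val_at h p \<noteq> 0" using vanishes_at_iff[OF Pp P(2) d(2)] gh(2) by blast
    thus "f \<in> phi ` Loc p" using Loc_I[OF d(1,2)] z d(3) by blast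
  next
    fix z assume z: "z \<in> Loc p"
    then obtain g h d where 1: "g \<in> forms d" "h \<in> forms d" "val_at h p \<noteq> 0" "z = E g / E h" by (rule Loc_E)
    have "E h \<noteq> 0" using E_nonzeroI p 1 by blast
    hence "(g, h) \<in> phi z" using 1 unfolding phi_def fractions_iff by blast
    moreover have "\<not> vanishes_at (base_change h) P" using vanishes_at_iff[OF Pp P(2) 1(2)] 1(3) by blast
    ultimately show "phi z \<in> regular_at n C P"
      unfolding regular_at_def carrier_FF using Loc_K[OF p] z by blast
  qed
qed

lemma max_ideal_at_eq:
  assumes P: "P \<in> C" "p \<in> P"
  shows "max_ideal_at n C P = phi ` Mloc p"
proof -
  have p: "p \<in> cone" using P unfolding cone_def by blast
  have Pp: "P \<in> proj_space n" using P C_proj by blast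
  show ?thesis
  proof safe
    fix f assume "f \<in> max_ideal_at n C P"
    then obtain z g h where z: "z \<in> K" "f = phi z"
      and gh: "(g, h) \<in> f" "\<not> vanishes_at (base_change h) P" "vanishes_at (base_change g) P"
      unfolding max_ideal_at_def carrier_FF by blast
    obtain d where d: "g \<in> forms d" "h \<in> forms d" "z = E g / E h"
      using phi_mem gh z fractions_iff by metis
    have "val_at h p \<noteq> 0" "val_at g p = 0"
      using vanishes_at_iff[OF Pp P(2) d(2)] vanishes_at_iff[OF Pp P(2) d(1)] gh(2,3) by blast+
    thus "f \<in> phi ` Mloc p" using d z unfolding Mloc_def by blast
  next
    fix z assume z: "z \<in> Mloc p"
    then obtain g h d where 1: "g \<in> forms d" "h \<in> forms d" "val_at h p \<noteq> 0" "val_at g p = 0" "z = E g / E h"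
      unfolding Mloc_def by blast
    have "E h \<noteq> 0" using E_nonzeroI p 1 by blast
    hence "(g, h) \<in> phi z" using 1 unfolding phi_def fractions_iff by blast
    moreover have "\<not> vanishes_at (base_change h) P" "vanishes_at (base_change g) P"
      using vanishes_at_iff[OF Pp P(2) 1(2)] vanishes_at_iff[OF Pp P(2) 1(1)] 1(3,4) by blast+
    ultimately show "phi z \<in> max_ideal_at n C P"
      unfolding max_ideal_at_def carrier_FF using Loc_K[OF p] z Mloc_iff[OF p] by blast
  qed
qed

end

section \<open>Linear growth in transcendence degree one\<close>

locale finite_coeffs =
  fixes F :: "'k::field set"
  assumes finite_F: "finite F"
    and one_F: "1 \<in> F"
    and diff_F: "\<And>a b. a \<in> F \<Longrightarrow> b \<in> F \<Longrightarrow> a - b \<in> F"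
    and mult_F: "\<And>a b. a \<in> F \<Longrightarrow> b \<in> F \<Longrightarrow> a * b \<in> F"
begin

lemma zero_F: "0 \<in> F"
  using diff_F[OF one_F one_F] by simp

lemma uminus_F: "a \<in> F \<Longrightarrow> - a \<in> F"
  using diff_F[OF zero_F, of a] by simp

lemma add_F: "a \<in> F \<Longrightarrow> b \<in> F \<Longrightarrow> a + b \<in> F"
  using diff_F[of a "- b"] uminus_F by simp

lemma sum_F: "(\<And>i. i \<in> A \<Longrightarrow> f i \<in> F) \<Longrightarrow> (\<Sum>i\<in>A. f i) \<in> F"
  by (induction A rule: infinite_finite_induct) (auto intro: zero_F add_F)

definition PX :: "nat \<Rightarrow> 'k \<Rightarrow> 'k set" where
  "PX N x = {poly p x | p. Polynomial.degree p \<le> N \<and> (\<forall>i. Polynomial.coeff p i \<in> F)}"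

lemma PX_I: "Polynomial.degree p \<le> N \<Longrightarrow> (\<And>i. Polynomial.coeff p i \<in> F) \<Longrightarrow> poly p x \<in> PX N x"
  unfolding PX_def by blast

lemma PX_E:
  assumes "a \<in> PX N x"
  obtains p where "a = poly p x" "Polynomial.degree p \<le> N" "\<And>i. Polynomial.coeff p i \<in> F"
  using assms unfolding PX_def by blast

lemma PX_mono: "N \<le> N' \<Longrightarrow> a \<in> PX N x \<Longrightarrow> a \<in> PX N' x"
  unfolding PX_def by fastforce

lemma PX_const: "c \<in> F \<Longrightarrow> c \<in> PX N x"
  using PX_I[of "[:c:]" N x] zero_F by (simp add: coeff_pCons split: nat.splits)

lemma PX_add: "a \<in> PX N x \<Longrightarrow> b \<in> PX N x \<Longrightarrow> a + b \<in> PX N x"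
  by (elim PX_E, simp only: poly_add[symmetric])
     (rule PX_I, auto intro: degree_add_le add_F)

lemma PX_mult:
  assumes "a \<in> PX N x" "b \<in> PX N' x"
  shows "a * b \<in> PX (N + N') x"
proof -
  obtain p where p: "a = poly p x" "Polynomial.degree p \<le> N" "\<And>i. Polynomial.coeff p i \<in> F"
    using assms(1) by (rule PX_E) blast
  obtain r where r: "b = poly r x" "Polynomial.degree r \<le> N'" "\<And>i. Polynomial.coeff r i \<in> F"
    using assms(2) by (rule PX_E) blast
  have "poly (p * r) x \<in> PX (N + N') x"
  proof (rule PX_I)
    show "Polynomial.degree (p * r) \<le> N + N'"
      using degree_mult_le[of p r] p(2) r(2) by linarith
    show "Polynomial.coeff (p * r) i \<in> F" for i
      unfolding coeff_mult using p(3) r(3) by (intro sum_F mult_F)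
  qed
  thus ?thesis using p(1) r(1) by simp
qed

lemma PX_uminus: "a \<in> PX N x \<Longrightarrow> - a \<in> PX N x"
  using PX_mult[OF PX_const[OF uminus_F[OF one_F], of 0], of a N x] by simp

lemma PX_var: "x \<in> PX 1 x"
  using PX_I[of "[:0, 1:]" 1 x] zero_F one_F by (auto simp: coeff_pCons split: nat.splits)

lemma card_PX: "finite (PX N x)" "card (PX N x) \<le> card F ^ (N + 1)"
proof -
  let ?f = "\<lambda>c. \<Sum>i\<le>N. c i * x ^ i"
  have sub: "PX N x \<subseteq> ?f ` PiE {..N} (\<lambda>_. F)"
  proof
    fix a assume "a \<in> PX N x"
    then obtain p where p: "a = poly p x" "Polynomial.degree p \<le> N" "\<And>i. Polynomial.coeff p i \<in> F" by (rule PX_E) blast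
    have "poly p x = (\<Sum>i\<le>N. Polynomial.coeff p i * x ^ i)"
      unfolding poly_altdef using p(2) by (intro sum.mono_neutral_left) (auto simp: coeff_eq_0)
    also have "\<dots> = ?f (restrict (Polynomial.coeff p) {..N})" by simp
    finally have "a = ?f (restrict (Polynomial.coeff p) {..N})" using p(1) by simp
    moreover have "restrict (Polynomial.coeff p) {..N} \<in> PiE {..N} (\<lambda>_. F)" using p(3) by auto
    ultimately show "a \<in> ?f ` PiE {..N} (\<lambda>_. F)" by (rule image_eqI)
  qed
  have fin: "finite (PiE {..N} (\<lambda>_. F))" by (intro finite_PiE) (auto simp: finite_F)
  show "finite (PX N x)" using sub fin by (rule finite_surj[rotated])
  have "card (PX N x) \<le> card (PiE {..N} (\<lambda>_. F))" using sub fin by (rule surj_card_le[rotated])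
  also have "\<dots> = card F ^ (N + 1)" by (simp add: card_PiE)
  finally show "card (PX N x) \<le> card F ^ (N + 1)" .
qed

text \<open>
  Algebraicity of \<open>y\<close> over \<open>F(x)\<close>, with denominators cleared.
\<close>

definition alg_dep :: "'k \<Rightarrow> 'k \<Rightarrow> bool" where
  "alg_dep x y \<longleftrightarrow> (\<exists>D N b. (\<forall>i\<le>D. b i \<in> PX N x) \<and> b D \<noteq> 0 \<and> (\<Sum>i\<le>D. b i * y ^ i) = 0)"

text \<open>
  A filtration of a finitely generated \<open>F[x]\<close>-module, on which the elements of \<open>W\<close> act up to the
  common denominator \<open>\<delta>\<close>, raising the filtration degree by at most \<open>a\<close>. The point is the
  exponential bound on cardinalities.
\<close>

definition growth_lattice :: "'k \<Rightarrow> 'k set \<Rightarrow> (nat \<Rightarrow> 'k set) \<Rightarrow> 'k \<Rightarrow> nat \<Rightarrow> nat \<Rightarrow> bool" where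
  "growth_lattice x W V \<delta> a B \<longleftrightarrow>
     \<delta> \<noteq> 0 \<and> \<delta> \<in> PX a x \<and> 1 \<in> V 0 \<and>
     (\<forall>N. finite (V N) \<and> card (V N) \<le> B ^ (N + 1)) \<and>
     (\<forall>N. \<forall>u\<in>V N. \<forall>w\<in>V N. u + w \<in> V N) \<and>
     (\<forall>N N' p u. p \<in> PX N x \<longrightarrow> u \<in> V N' \<longrightarrow> p * u \<in> V (N + N')) \<and>
     (\<forall>N. \<forall>w\<in>W. \<forall>u\<in>V N. \<delta> * w * u \<in> V (N + a))"

lemma growth_lattice_empty: "growth_lattice x {} (\<lambda>N. PX N x) 1 0 (card F)"
  unfolding growth_lattice_def
  using card_PX PX_add PX_mult PX_const[OF one_F] by auto

text \<open>
  If \<open>y\<close> satisfies an equation of degree \<open>D\<close> over \<open>F[x]\<close>, the new module is spanned over the old one by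
  \<open>1, y, \<dots>, y ^ (D - 1)\<close>. Multiplication by \<open>y\<close> stays inside after multiplication by the leading
  coefficient of the equation, which is therefore included in the denominator.
\<close>

lemma growth_lattice_insert:
  assumes L: "growth_lattice x W V \<delta> a B" and y: "alg_dep x y"
  shows "\<exists>V' \<delta>' a' B'. growth_lattice x (insert y W) V' \<delta>' a' B'"
proof -
  from L have \<delta>: "\<delta> \<noteq> 0" "\<delta> \<in> PX a x" and one: "1 \<in> V 0"
    and fin: "\<And>N. finite (V N)" and card: "\<And>N. card (V N) \<le> B ^ (N + 1)"
    and add: "\<And>N u w. u \<in> V N \<Longrightarrow> w \<in> V N \<Longrightarrow> u + w \<in> V N"
    and scale: "\<And>N N' p u. p \<in> PX N x \<Longrightarrow> u \<in> V N' \<Longrightarrow> p * u \<in> V (N + N')"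
    and mult: "\<And>N w u. w \<in> W \<Longrightarrow> u \<in> V N \<Longrightarrow> \<delta> * w * u \<in> V (N + a)"
    unfolding growth_lattice_def by blast+
  from y obtain D N0 b where b: "\<And>i. i \<le> D \<Longrightarrow> b i \<in> PX N0 x" "b D \<noteq> 0" "(\<Sum>i\<le>D. b i * y ^ i) = 0"
    unfolding alg_dep_def by blast
  have D: "D > 0" using b(2,3) by (cases D) auto
  have V0: "0 \<in> V N" for N
  proof -
    have "0 \<in> PX N x" by (rule PX_const[OF zero_F])
    from scale[OF this one] show ?thesis by simp
  qed
  define S where "S = (\<lambda>u. \<Sum>k<D. u k * y ^ k)"
  define V' where "V' = (\<lambda>N. S ` PiE {..<D} (\<lambda>_. V N))"
  have V'_I: "S u \<in> V' N" if "\<And>k. k < D \<Longrightarrow> u k \<in> V N" for u N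
  proof -
    have "S u = S (restrict u {..<D})" by (simp add: S_def)
    moreover have "restrict u {..<D} \<in> PiE {..<D} (\<lambda>_. V N)" using that by auto
    ultimately show ?thesis unfolding V'_def by blast
  qed
  have V'_E: "\<exists>u. z = S u \<and> (\<forall>k<D. u k \<in> V N)" if "z \<in> V' N" for z N
    using that unfolding V'_def by auto
  have top: "b D * y ^ D = (\<Sum>k<D. - b k * y ^ k)"
  proof -
    have "(\<Sum>i<D. b i * y ^ i) + b D * y ^ D = 0"
      using b(3) by (simp add: lessThan_Suc_atMost[symmetric])
    thus ?thesis by (simp add: sum_negf eq_neg_iff_add_eq_0 add.commute)
  qed
  have "growth_lattice x (insert y W) V' (\<delta> * b D) (a + N0) (B ^ D)"
    unfolding growth_lattice_def
  proof (intro conjI allI impI ballI)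
    show "\<delta> * b D \<noteq> 0" using \<delta> b by simp
    show "\<delta> * b D \<in> PX (a + N0) x" using \<delta> b by (intro PX_mult) auto
    have "S (\<lambda>k. if k = 0 then 1 else 0) = (\<Sum>k<D. if k = 0 then 1 else 0)"
      unfolding S_def by (intro sum.cong) auto
    also have "\<dots> = 1" using D by simp
    finally show "1 \<in> V' 0" using V'_I[of "\<lambda>k. if k = 0 then 1 else 0" 0] one V0 by auto
    fix N
    have finP: "finite (PiE {..<D} (\<lambda>_. V N))" using fin by (intro finite_PiE) auto
    show "finite (V' N)" unfolding V'_def using finP by simp
    have "card (V' N) \<le> card (PiE {..<D} (\<lambda>_. V N))" unfolding V'_def using finP by (rule card_image_le)
    also have "\<dots> = card (V N) ^ D" by (simp add: card_PiE)
    also have "\<dots> \<le> (B ^ (N + 1)) ^ D" using card by (intro power_mono) auto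
    also have "\<dots> = (B ^ D) ^ (N + 1)" by (simp only: power_mult[symmetric] mult.commute)
    finally show "card (V' N) \<le> (B ^ D) ^ (N + 1)" .
  next
    fix N z w assume "z \<in> V' N" "w \<in> V' N"
    then obtain u t where "z = S u" "\<forall>k<D. u k \<in> V N" "w = S t" "\<forall>k<D. t k \<in> V N" using V'_E by metis
    moreover have "S u + S t = S (\<lambda>k. u k + t k)" by (simp add: S_def sum.distrib distrib_right)
    ultimately show "z + w \<in> V' N" using V'_I[of "\<lambda>k. u k + t k" N] add by simp
  next
    fix N N' p z assume p: "p \<in> PX N x" and "z \<in> V' N'"
    then obtain u where u: "z = S u" "\<forall>k<D. u k \<in> V N'" using V'_E by blast
    have "p * S u = S (\<lambda>k. p * u k)" by (simp add: S_def sum_distrib_left mult.assoc)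
    thus "p * z \<in> V' (N + N')" using V'_I[of "\<lambda>k. p * u k" "N + N'"] u scale[OF p] by simp
  next
    fix N w z assume w: "w \<in> insert y W" and "z \<in> V' N"
    then obtain u where u: "z = S u" "\<forall>k<D. u k \<in> V N" using V'_E by blast
    have bu: "b j * u k \<in> V (N + N0)" if "k < D" "j \<le> D" for j k
      using scale[OF b(1)[OF that(2)], of "u k" N] u(2) that(1) by (simp add: add.commute)
    show "\<delta> * b D * w * z \<in> V' (N + (a + N0))"
    proof (cases "w \<in> W")
      case True
      have "\<delta> * b D * w * z = S (\<lambda>k. \<delta> * w * (b D * u k))"
        by (simp add: u(1) S_def sum_distrib_left mult_ac)
      moreover have "\<delta> * w * (b D * u k) \<in> V (N + (a + N0))" if "k < D" for k
        using mult[OF True bu[OF that order_refl]] by (simp add: ac_simps)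
      ultimately show ?thesis using V'_I[of "\<lambda>k. \<delta> * w * (b D * u k)"] by simp
    next
      case False
      hence w: "w = y" using w by simp
      obtain D' where D': "D = Suc D'" using D by (cases D) auto
      \<comment> \<open>The coefficients of \<open>b D * y * S u\<close> after replacing \<open>b D * y ^ D\<close> by lower powers of \<open>y\<close>.\<close>
      define r where "r = (\<lambda>k. (if k = 0 then 0 else b D * u (k - 1)) + - b k * u D')"
      define t where "t = (\<lambda>k. \<delta> * r k)"
      have "b D * y * S u = b D * y * (\<Sum>k<D'. u k * y ^ k) + u D' * (b D * y ^ D)"
        by (simp add: S_def D' algebra_simps)
      also have "b D * y * (\<Sum>k<D'. u k * y ^ k) = (\<Sum>k<D. (if k = 0 then 0 else b D * u (k - 1)) * y ^ k)"
        unfolding D' sum.lessThan_Suc_shift by (simp add: sum_distrib_left mult_ac)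
      also have "u D' * (b D * y ^ D) = (\<Sum>k<D. (- b k * u D') * y ^ k)"
        unfolding top by (simp add: sum_distrib_left mult_ac)
      finally have "b D * y * S u = (\<Sum>k<D. (if k = 0 then 0 else b D * u (k - 1)) * y ^ k) + (\<Sum>k<D. (- b k * u D') * y ^ k)" .
      also have "\<dots> = S r" unfolding S_def r_def by (simp only: distrib_right sum.distrib)
      finally have "\<delta> * (b D * y * S u) = S t"
        by (simp add: S_def t_def sum_distrib_left mult.assoc)
      moreover have "t k \<in> V (N + (a + N0))" if k: "k < D" for k
      proof -
        have "- b k * u D' \<in> V (N + N0)"
          using scale[OF PX_uminus[OF b(1)], of k "u D'" N] u(2) k D' by (simp add: add.commute)
        moreover have "(if k = 0 then 0 else b D * u (k - 1)) \<in> V (N + N0)"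
          using bu[of "k - 1" D] k V0 by auto
        ultimately have "r k \<in> V (N + N0)" unfolding r_def by (intro add)
        from scale[OF \<delta>(2) this] show ?thesis by (simp add: t_def ac_simps)
      qed
      ultimately show ?thesis using V'_I[of t] by (simp add: w u(1) mult_ac)
    qed
  qed
  thus ?thesis by blast
qed

lemma growth_lattice_exists:
  assumes "finite W" "\<And>w. w \<in> W \<Longrightarrow> alg_dep x w"
  shows "\<exists>V \<delta> a B. growth_lattice x W V \<delta> a B"
  using assms
proof (induction W rule: finite_induct)
  case empty
  show ?case using growth_lattice_empty by blast
next
  case (insert y W)
  then obtain V \<delta> a B where "growth_lattice x W V \<delta> a B" by blast
  thus ?case using growth_lattice_insert insert.prems by blast
qed

definition PQ :: "'k \<Rightarrow> 'k set" where
  "PQ x = {u / w | u w N. u \<in> PX N x \<and> w \<in> PX N x \<and> w \<noteq> 0}"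

lemma PQ_I: "u \<in> PX N x \<Longrightarrow> w \<in> PX N' x \<Longrightarrow> w \<noteq> 0 \<Longrightarrow> u / w \<in> PQ x"
  unfolding PQ_def using PX_mono[of N "max N N'" u x] PX_mono[of N' "max N N'" w x] by auto

lemma PQ_E:
  assumes "z \<in> PQ x"
  obtains u w N where "z = u / w" "u \<in> PX N x" "w \<in> PX N x" "w \<noteq> 0"
  using assms unfolding PQ_def by blast

lemma PQ_add:
  assumes "z \<in> PQ x" "z' \<in> PQ x"
  shows "z + z' \<in> PQ x"
proof -
  obtain u w N where 1: "z = u / w" "u \<in> PX N x" "w \<in> PX N x" "w \<noteq> 0" using assms(1) by (rule PQ_E)
  obtain u' w' N' where 2: "z' = u' / w'" "u' \<in> PX N' x" "w' \<in> PX N' x" "w' \<noteq> 0" using assms(2) by (rule PQ_E)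
  have "z + z' = (u * w' + w * u') / (w * w')" using 1 2 by (simp add: add_frac_eq mult.commute)
  moreover have "u * w' + w * u' \<in> PX (N + N') x" "w * w' \<in> PX (N + N') x"
    using 1 2 by (auto intro: PX_add PX_mult)
  ultimately show ?thesis using 1 2 by (auto intro: PQ_I)
qed

lemma PQ_mult:
  assumes "z \<in> PQ x" "z' \<in> PQ x"
  shows "z * z' \<in> PQ x"
proof -
  obtain u w N where 1: "z = u / w" "u \<in> PX N x" "w \<in> PX N x" "w \<noteq> 0" using assms(1) by (rule PQ_E)
  obtain u' w' N' where 2: "z' = u' / w'" "u' \<in> PX N' x" "w' \<in> PX N' x" "w' \<noteq> 0" using assms(2) by (rule PQ_E)
  have "z * z' = (u * u') / (w * w')" using 1 2 by simp
  moreover have "u * u' \<in> PX (N + N') x" "w * w' \<in> PX (N + N') x"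
    using 1 2 by (auto intro: PX_mult)
  ultimately show ?thesis using 1 2 by (auto intro: PQ_I)
qed

lemma PQ_uminus: "z \<in> PQ x \<Longrightarrow> - z \<in> PQ x"
  by (elim PQ_E) (metis PQ_I PX_uminus minus_divide_left)

lemma PQ_inverse: "z \<in> PQ x \<Longrightarrow> z \<noteq> 0 \<Longrightarrow> inverse z \<in> PQ x"
  by (elim PQ_E) (auto intro: PQ_I)

lemma PQ_PX: "u \<in> PX N x \<Longrightarrow> u \<in> PQ x"
  using PQ_I[of u N x 1 N] PX_const[OF one_F] by simp

lemma PQ_common_denominator:
  assumes "finite S" "S \<subseteq> PQ x"
  shows "\<exists>N w. w \<in> PX N x \<and> w \<noteq> 0 \<and> (\<forall>s\<in>S. w * s \<in> PX N x)"
  using assms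
proof (induction S rule: finite_induct)
  case empty
  show ?case using PX_const[OF one_F] by (intro exI[of _ 0] exI[of _ 1]) auto
next
  case (insert s S)
  then obtain N w where w: "w \<in> PX N x" "w \<noteq> 0" "\<forall>s\<in>S. w * s \<in> PX N x" by blast
  obtain u v N' where s: "s = u / v" "u \<in> PX N' x" "v \<in> PX N' x" "v \<noteq> 0" using insert.prems by (blast elim: PQ_E)
  have "w * v * s \<in> PX (N + N') x" using PX_mult[OF w(1) s(2)] s by simp
  moreover have "w * v * t \<in> PX (N + N') x" if "t \<in> S" for t
    using PX_mult[of "w * t" N x v N'] w(3) s(3) that by (simp add: mult_ac)
  moreover have "w * v \<in> PX (N + N') x" using w s by (intro PX_mult)
  ultimately show ?case using w(2) s(4) by (intro exI[of _ "N + N'"] exI[of _ "w * v"]) auto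
qed

end

section \<open>The function field has transcendence degree one\<close>

locale one_dim_curve = curve_set n C for n :: nat and C :: "'a::{field, finite} alg_closure ppoint set" +
  assumes one_dim: "one_dimensional n C"
begin

abbreviation cF :: "'a alg_closure ultrapower set" where "cF \<equiv> range const"

sublocale coeffs: finite_coeffs cF
proof
  show "finite cF" by simp
  show "1 \<in> cF" using ring_emb_1[OF ring_emb_const] by (metis rangeI)
  show "a - b \<in> cF" "a * b \<in> cF" if "a \<in> cF" "b \<in> cF" for a b
    using that ring_emb_diff[OF ring_emb_const] ring_emb_mult[OF ring_emb_const] by (auto simp: image_iff) metis+
qed

lemma cF_K: "cF \<subseteq> K" using K_const by blast

lemma PX_K:
  assumes "x \<in> K" "a \<in> coeffs.PX N x"
  shows "a \<in> K"
proof -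
  obtain p where p: "a = poly p x" "\<And>i. Polynomial.coeff p i \<in> cF" using assms(2) by (rule coeffs.PX_E) blast
  have "(\<Sum>i\<in>I. Polynomial.coeff p i * x ^ i) \<in> K" for I
  proof (induction I rule: infinite_finite_induct)
    case (insert i I)
    have "Polynomial.coeff p i \<in> K" using p(2) cF_K by blast
    thus ?case using insert assms(1) by (auto intro!: K_add K_mult K_power)
  qed (auto simp: K_01)
  thus ?thesis unfolding p(1) poly_altdef .
qed

lemma PQ_K: "x \<in> K \<Longrightarrow> coeffs.PQ x \<subseteq> K"
  using PX_K by (auto elim!: coeffs.PQ_E intro!: K_divide)

lemma phi_eval:
  assumes "set cs \<subseteq> K" "z \<in> K"
  shows "ring.eval FF (map phi cs) (phi z) = phi (\<Sum>i<length cs. rev cs ! i * z ^ i) \<and>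
         (\<Sum>i<length cs. rev cs ! i * z ^ i) \<in> K"
  using assms(1)
proof (induction cs)
  case Nil
  interpret field FF by (rule field_FF)
  show ?case by (simp add: phi_0 K_01)
next
  case (Cons c cs)
  interpret field FF by (rule field_FF)
  let ?s = "\<Sum>i<length cs. rev cs ! i * z ^ i"
  have c: "c \<in> K" and IH: "eval (map phi cs) (phi z) = phi ?s" "?s \<in> K" using Cons by auto
  have "(\<Sum>i<length (c # cs). rev (c # cs) ! i * z ^ i) = c * z ^ length cs + ?s"
    by (simp add: nth_append)
  moreover have "c * z ^ length cs \<in> K" using c assms(2) by (intro K_mult K_power)
  ultimately show ?case
    using IH c assms(2) by (simp add: phi_pow phi_mult phi_add K_power K_add)
qed

text \<open>
  The field generated by a transcendence basis \<open>x\<close> over the constants consists of the fractions of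
  polynomials in \<open>x\<close>, so the coefficients of an algebraic equation over it have a common denominator.
\<close>

lemma transcendental_element:
  obtains x where "x \<in> K" "\<And>p. p \<noteq> 0 \<Longrightarrow> (\<And>i. Polynomial.coeff p i \<in> cF) \<Longrightarrow> poly p x \<noteq> 0"
    "\<And>y. y \<in> K \<Longrightarrow> coeffs.alg_dep x y"
proof -
  interpret field FF by (rule field_FF)
  obtain x where x: "x \<in> K" and tr: "transcendental (constants n C) (phi x)"
    and alg: "\<forall>y\<in>phi ` K. algebraic (generate_field FF (insert (phi x) (constants n C))) y"
    using one_dim unfolding one_dimensional_def Let_def carrier_FF by blast
  have 1: "poly p x \<noteq> 0" if p: "p \<noteq> 0" "\<And>i. Polynomial.coeff p i \<in> cF" for p
  proof
    assume 0: "poly p x = 0"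
    let ?cs = "rev (coeffs p)"
    have sub: "set ?cs \<subseteq> cF" using p(2) by (auto simp: coeffs_def)
    have "poly p x = (\<Sum>i<length ?cs. rev ?cs ! i * x ^ i)"
      unfolding poly_altdef using p(1)
      by (simp add: length_coeffs lessThan_Suc_atMost coeffs_nth)
    hence "eval (map phi ?cs) (phi x) = phi 0" using phi_eval[of ?cs x] sub cF_K x 0 by auto
    hence e: "eval (map phi ?cs) (phi x) = eval [] (phi x)" by (simp add: phi_0)
    have "hd ?cs = Polynomial.lead_coeff p" using p(1) by (simp add: hd_rev last_coeffs_eq_coeff_degree)
    moreover have "Polynomial.lead_coeff p \<in> K" "Polynomial.lead_coeff p \<noteq> 0" using p cF_K by auto
    ultimately have "phi (hd ?cs) \<noteq> \<zero>\<^bsub>FF\<^esub>" using phi_eq_iff K_01 by (simp add: phi_0)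
    hence "map phi ?cs \<in> carrier ((constants n C)[X]\<^bsub>FF\<^esub>)"
      using sub p(1) by (auto simp: univ_poly_def polynomial_def constants_eq hd_map)
    moreover have "[] \<in> carrier ((constants n C)[X]\<^bsub>FF\<^esub>)" by (simp add: univ_poly_def polynomial_def)
    ultimately have "map phi ?cs = []" using tr e unfolding transcendental_def by (meson inj_onD)
    thus False using p(1) by simp
  qed
  have Hc: "insert (phi x) (constants n C) \<subseteq> carrier FF"
    using x cF_K by (auto simp: constants_eq carrier_FF)
  let ?G = "generate_field FF (insert (phi x) (constants n C))"
  have G: "a \<in> phi ` coeffs.PQ x" if "a \<in> ?G" for a
    using that
  proof (induction rule: generate_field.induct)
    case one
    show ?case using coeffs.PQ_PX[OF coeffs.PX_const[OF coeffs.one_F]] by (auto simp: phi_1)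
  next
    case (incl h)
    thus ?case using coeffs.PQ_PX[OF coeffs.PX_const] coeffs.PQ_PX[OF coeffs.PX_var] by (auto simp: constants_eq)
  next
    case (a_inv h)
    then obtain z where "z \<in> coeffs.PQ x" "h = phi z" by blast
    thus ?case using phi_uminus[of z] PQ_K[OF x] coeffs.PQ_uminus by auto
  next
    case (m_inv h)
    then obtain z where z: "z \<in> coeffs.PQ x" "h = phi z" by blast
    moreover from this have "z \<noteq> 0" using m_inv by (auto simp: phi_0)
    ultimately show ?case using phi_inverse[of z] PQ_K[OF x] coeffs.PQ_inverse by auto
  next
    case (eng_add h h')
    then obtain z z' where z: "z \<in> coeffs.PQ x" "h = phi z" "z' \<in> coeffs.PQ x" "h' = phi z'" by blast
    hence "h \<oplus>\<^bsub>FF\<^esub> h' = phi (z + z')" using PQ_K[OF x] by (auto simp: phi_add subset_iff)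
    thus ?case using coeffs.PQ_add z by blast
  next
    case (eng_mult h h')
    then obtain z z' where z: "z \<in> coeffs.PQ x" "h = phi z" "z' \<in> coeffs.PQ x" "h' = phi z'" by blast
    hence "h \<otimes>\<^bsub>FF\<^esub> h' = phi (z * z')" using PQ_K[OF x] by (auto simp: phi_mult subset_iff)
    thus ?case using coeffs.PQ_mult z by blast
  qed
  have 2: "coeffs.alg_dep x y" if y: "y \<in> K" for y
  proof -
    have "subring ?G FF" using generate_field_is_subfield[OF Hc] by (rule subfieldE(1))
    moreover have "(algebraic over ?G) (phi y)" using alg y by (simp add: over_def)
    ultimately obtain ps where ps: "ps \<in> carrier (?G[X]\<^bsub>FF\<^esub>)" "ps \<noteq> []" "eval ps (phi y) = \<zero>\<^bsub>FF\<^esub>"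
      using algebraicE[OF _ phi_carrier[OF y]] by blast
    have set: "set ps \<subseteq> phi ` coeffs.PQ x" and hd: "hd ps \<noteq> \<zero>\<^bsub>FF\<^esub>"
      using ps(1,2) G by (auto simp: univ_poly_def polynomial_def)
    define cs where "cs = map (inv_into (coeffs.PQ x) phi) ps"
    have cs: "ps = map phi cs" "set cs \<subseteq> coeffs.PQ x"
    proof -
      have "map (phi \<circ> inv_into (coeffs.PQ x) phi) ps = ps"
        by (rule map_idI) (use set in \<open>auto simp: f_inv_into_f\<close>)
      thus "ps = map phi cs" by (simp add: cs_def)
      show "set cs \<subseteq> coeffs.PQ x" using set by (auto simp: cs_def inv_into_into)
    qed
    let ?D = "length cs - 1"
    have ne: "cs \<noteq> []" using cs ps(2) by auto
    have csK: "set cs \<subseteq> K" using cs(2) PQ_K[OF x] by blast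
    have "phi (\<Sum>i<length cs. rev cs ! i * y ^ i) = phi 0"
      using phi_eval[OF csK y] ps(3) cs(1) by (simp add: phi_0)
    hence "(\<Sum>i<length cs. rev cs ! i * y ^ i) = 0"
      using phi_eval[OF csK y] phi_eq_iff[OF _ K_01(1)] by blast
    moreover have "{..<length cs} = {..?D}" using ne by (cases cs) auto
    ultimately have sum0: "(\<Sum>i\<le>?D. rev cs ! i * y ^ i) = 0" by simp
    obtain N w where w: "w \<in> coeffs.PX N x" "w \<noteq> 0" "\<forall>s\<in>set cs. w * s \<in> coeffs.PX N x"
      using coeffs.PQ_common_denominator[OF finite_set cs(2)] by blast
    have mem: "rev cs ! i \<in> set cs" if "i \<le> ?D" for i
      using that ne nth_mem[of i "rev cs"] by (cases cs) auto
    have "rev cs ! ?D = hd cs" using ne by (simp add: rev_nth hd_conv_nth)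
    hence nz: "w * rev cs ! ?D \<noteq> 0" using hd cs(1) ne w(2) by (auto simp: hd_map phi_0)
    have "(\<Sum>i\<le>?D. (w * rev cs ! i) * y ^ i) = 0"
      using sum0 by (simp add: mult.assoc sum_distrib_left[symmetric])
    thus ?thesis
      unfolding coeffs.alg_dep_def using nz w(3) mem
      by (intro exI[of _ ?D] exI[of _ N] exI[of _ "\<lambda>i. w * rev cs ! i"]) auto
  qed
  show ?thesis using that[OF x] 1 2 by blast
qed

lemma gen_nonzero: "\<exists>j\<le>n. gen j \<noteq> 0"
proof -
  obtain p where p: "p \<in> cone" using cone_nonempty by blast
  obtain j where "j \<le> n" "p j \<noteq> 0" using cone_nonzero[OF p] by blast
  thus ?thesis using E_nonzeroI[OF homogeneous_var p, of j] by (auto simp: E_simps val_simps)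
qed

lemma E_over_gen:
  assumes "g \<in> forms d"
  shows "E g / gen j ^ d = ev const g (\<lambda>i. gen i / gen j)"
  using ev_scale[OF assms, of const "inverse (gen j)" gen]
  by (simp add: E_def divide_inverse mult.commute power_inverse)

lemma gen_quotient_K: "i \<le> n \<Longrightarrow> gen j \<noteq> 0 \<Longrightarrow> j \<le> n \<Longrightarrow> gen i / gen j \<in> K"
  using K_I[OF homogeneous_var homogeneous_var, of i j] by (simp add: E_simps)

text \<open>
  Divided by the \<open>d\<close>-th power of a coordinate, a form of degree \<open>d\<close> becomes a combination of products of
  \<open>d\<close> coordinate quotients. Multiplied by \<open>\<delta> ^ d\<close>, these lie in degree \<open>a * d\<close> of a growth lattice
  for the coordinate quotients.
\<close>

theorem growth_bound: "\<exists>B. \<forall>d. card (E ` forms d) \<le> B ^ (d + 1)"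
proof -
  obtain j where j: "j \<le> n" "gen j \<noteq> 0" using gen_nonzero by blast
  obtain x where x: "x \<in> K" "\<And>y. y \<in> K \<Longrightarrow> coeffs.alg_dep x y" by (rule transcendental_element) blast
  let ?u = "\<lambda>i. gen i / gen j"
  obtain V \<delta> a B where L: "coeffs.growth_lattice x (?u ` {..n}) V \<delta> a B"
    using coeffs.growth_lattice_exists[of "?u ` {..n}" x] x(2) gen_quotient_K j by blast
  from L have \<delta>: "\<delta> \<noteq> 0" and one: "1 \<in> V 0"
    and fin: "\<And>N. finite (V N)" and card: "\<And>N. card (V N) \<le> B ^ (N + 1)"
    and add: "\<And>N u w. u \<in> V N \<Longrightarrow> w \<in> V N \<Longrightarrow> u + w \<in> V N"
    and scale: "\<And>N N' p u. p \<in> coeffs.PX N x \<Longrightarrow> u \<in> V N' \<Longrightarrow> p * u \<in> V (N + N')"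
    and mult: "\<And>N i u. i \<le> n \<Longrightarrow> u \<in> V N \<Longrightarrow> \<delta> * ?u i * u \<in> V (N + a)"
    unfolding coeffs.growth_lattice_def by blast+
  have V0: "0 \<in> V N" for N
  proof -
    have "0 \<in> coeffs.PX N x" by (rule coeffs.PX_const[OF coeffs.zero_F])
    from scale[OF this one] show ?thesis by simp
  qed
  have mono: "\<delta> ^ d * monomial_at ?u \<mu> \<in> V (a * d)"
    if "Poly_Mapping.keys \<mu> \<subseteq> {..n}" "mdeg \<mu> = d" for \<mu> d
    using that
  proof (induction d arbitrary: \<mu>)
    case 0
    hence "\<mu> = 0" by (auto simp: mdeg_def in_keys_iff intro!: poly_mapping_eqI)
    thus ?case using one by (simp add: monomial_at_0)
  next
    case (Suc d)
    hence "\<mu> \<noteq> 0" by (auto simp: mdeg_def)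
    then obtain i where i: "i \<in> Poly_Mapping.keys \<mu>" by (metis keys_eq_empty all_not_in_conv)
    let ?\<nu> = "\<mu> - Poly_Mapping.single i 1"
    have \<mu>: "\<mu> = ?\<nu> + Poly_Mapping.single i 1"
      using i by (intro poly_mapping_eqI) (auto simp: lookup_add lookup_minus lookup_single when_def in_keys_iff)
    have "mdeg \<mu> = mdeg ?\<nu> + 1" by (subst \<mu>, subst mdeg_add) (simp add: mdeg_def)
    hence d: "mdeg ?\<nu> = d" using Suc.prems by simp
    have "Poly_Mapping.keys ?\<nu> \<subseteq> Poly_Mapping.keys \<mu>" by (auto simp: in_keys_iff lookup_minus)
    hence "\<delta> ^ d * monomial_at ?u ?\<nu> \<in> V (a * d)" using Suc.prems by (intro Suc.IH d) auto
    hence "\<delta> * ?u i * (\<delta> ^ d * monomial_at ?u ?\<nu>) \<in> V (a * d + a)"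
      using i Suc.prems by (intro mult) auto
    also have "\<delta> * ?u i * (\<delta> ^ d * monomial_at ?u ?\<nu>) = \<delta> ^ Suc d * monomial_at ?u \<mu>"
      by (subst \<mu>, subst monomial_at_add) (simp add: monomial_at_single mult_ac)
    finally show ?case by (simp add: algebra_simps)
  qed
  have form: "\<delta> ^ d * (E g / gen j ^ d) \<in> V (a * d)" if g: "g \<in> forms d" for g d
  proof -
    have "(\<Sum>\<mu>\<in>T. const (Poly_Mapping.lookup g \<mu>) * (\<delta> ^ d * monomial_at ?u \<mu>)) \<in> V (a * d)"
      if "T \<subseteq> Poly_Mapping.keys g" for T
    proof -
      have "finite T" using that finite_subset finite_keys by blast
      thus ?thesis using that
      proof (induction T rule: finite_induct)
        case (insert \<mu> T)
        have "\<delta> ^ d * monomial_at ?u \<mu> \<in> V (a * d)"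
          using insert.prems g by (intro mono) (auto simp: homogeneous_iff)
        from scale[OF coeffs.PX_const this, of "const (Poly_Mapping.lookup g \<mu>)" 0]
        show ?case using insert by (auto intro: add)
      qed (simp add: V0)
    qed
    from this[OF order_refl] show ?thesis
      by (simp add: E_over_gen[OF g] ev_def sum_distrib_left mult_ac)
  qed
  have "card (E ` forms d) \<le> (B ^ (a + 1)) ^ (d + 1)" for d
  proof -
    have "card (E ` forms d) \<le> card (V (a * d))"
    proof (rule card_inj_on_le[of "\<lambda>z. \<delta> ^ d * (z / gen j ^ d)"])
      show "inj_on (\<lambda>z. \<delta> ^ d * (z / gen j ^ d)) (E ` forms d)" using \<delta> j by (auto simp: inj_on_def)
      show "(\<lambda>z. \<delta> ^ d * (z / gen j ^ d)) ` (E ` forms d) \<subseteq> V (a * d)" using form by blast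
    qed (rule fin)
    also have "\<dots> \<le> B ^ (a * d + 1)" by (rule card)
    also have "\<dots> \<le> B ^ ((a + 1) * (d + 1))"
    proof (cases "B = 0")
      case True
      hence "card (V 0) = 0" using card[of 0] by simp
      hence False using one fin by auto
      thus ?thesis ..
    next
      case False
      thus ?thesis by (intro power_increasing) auto
    qed
    finally show ?thesis by (simp only: power_mult)
  qed
  thus ?thesis by blast
qed

section \<open>Finite quotients of affine coordinate rings\<close>

text \<open>
  The coordinate ring of the affine open subset of \<open>C\<close> where \<open>G\<close> does not vanish.
\<close>

definition chart :: "nat \<Rightarrow> 'a mpoly \<Rightarrow> 'a alg_closure ultrapower set" where
  "chart e G = {E g / E G ^ l | g l. g \<in> forms (l * e)}"

definition level :: "nat \<Rightarrow> 'a mpoly \<Rightarrow> nat \<Rightarrow> 'a alg_closure ultrapower set" where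
  "level e G l = (\<lambda>g. E g / E G ^ l) ` forms (l * e)"

lemma chart_UN: "chart e G = (\<Union>l. level e G l)"
  by (auto simp: chart_def level_def)

lemma finite_level: "finite (level e G l)"
  unfolding level_def by (intro finite_imageI finite_homogeneous)

lemma level_raise:
  assumes G: "G \<in> forms e" "E G \<noteq> 0" and z: "z \<in> level e G l" and "l \<le> l'"
  shows "z \<in> level e G l'"
proof -
  obtain g where g: "g \<in> forms (l * e)" "z = E g / E G ^ l" using z unfolding level_def by blast
  have "G ^ (l' - l) * g \<in> forms ((l' - l) * e + l * e)" using G g by (intro homogeneous_mult homogeneous_power)
  also have "(l' - l) * e + l * e = l' * e" using assms(4) by (simp add: algebra_simps flip: distrib_right)
  finally have "G ^ (l' - l) * g \<in> forms (l' * e)" .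
  moreover have "z = E (G ^ (l' - l) * g) / E G ^ l'"
    using G(2) g(2) assms(4) by (simp add: E_simps power_diff)
  ultimately show ?thesis unfolding level_def by blast
qed

lemma level_diff: "z \<in> level e G l \<Longrightarrow> w \<in> level e G l \<Longrightarrow> z - w \<in> level e G l"
proof -
  assume "z \<in> level e G l" "w \<in> level e G l"
  then obtain g h where "g \<in> forms (l * e)" "z = E g / E G ^ l" "h \<in> forms (l * e)" "w = E h / E G ^ l"
    unfolding level_def by blast
  hence "g - h \<in> forms (l * e)" "z - w = E (g - h) / E G ^ l"
    by (auto simp: E_diff diff_divide_distrib intro: homogeneous_diff)
  thus ?thesis unfolding level_def by blast
qed

lemma level_mult:
  assumes "z \<in> level e G l" "w \<in> level e G l'"
  shows "z * w \<in> level e G (l + l')"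
proof -
  obtain g h where "g \<in> forms (l * e)" "z = E g / E G ^ l" "h \<in> forms (l' * e)" "w = E h / E G ^ l'"
    using assms unfolding level_def by blast
  hence "g * h \<in> forms ((l + l') * e)" "z * w = E (g * h) / E G ^ (l + l')"
    by (auto simp: distrib_right E_mult power_add intro: homogeneous_mult)
  thus ?thesis unfolding level_def by blast
qed

lemma level_0: "0 \<in> level e G l"
  unfolding level_def by (rule image_eqI[of _ _ 0]) (simp_all add: E_0 homogeneous_0)

lemma level_add: "z \<in> level e G l \<Longrightarrow> w \<in> level e G l \<Longrightarrow> z + w \<in> level e G l"
  using level_diff[of z e G l "0 - w"] level_diff[OF level_0, of w e G l] by simp

lemma level_const: "const c \<in> level e G 0"
  unfolding level_def
  by (rule image_eqI[of _ _ "Poly_Mapping.single 0 c"]) (simp_all add: E_single0 homogeneous_const)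

lemma chart_common_level:
  assumes G: "G \<in> forms e" "E G \<noteq> 0" and "finite Y" "Y \<subseteq> chart e G"
  shows "\<exists>l. Y \<subseteq> level e G l"
  using assms(3,4)
proof (induction Y rule: finite_induct)
  case (insert y Y)
  then obtain l l' where "Y \<subseteq> level e G l" "y \<in> level e G l'" unfolding chart_UN by blast
  thus ?case using level_raise[OF G, of _ l "max l l'"] level_raise[OF G, of _ l' "max l l'"]
    by (intro exI[of _ "max l l'"]) auto
qed simp

lemma chart_diff:
  assumes G: "G \<in> forms e" "E G \<noteq> 0" and "z \<in> chart e G" "w \<in> chart e G"
  shows "z - w \<in> chart e G"
proof -
  obtain l where "{z, w} \<subseteq> level e G l"
    using chart_common_level[OF G, of "{z, w}"] assms(3,4) by blast
  hence "z - w \<in> level e G l" using level_diff by blast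
  thus ?thesis unfolding chart_UN by blast
qed

lemma chart_mult: "z \<in> chart e G \<Longrightarrow> w \<in> chart e G \<Longrightarrow> z * w \<in> chart e G"
proof -
  assume "z \<in> chart e G" "w \<in> chart e G"
  then obtain l l' where "z \<in> level e G l" "w \<in> level e G l'" unfolding chart_UN by blast
  hence "z * w \<in> level e G (l + l')" by (rule level_mult)
  thus ?thesis unfolding chart_UN by blast
qed

lemma chart_const: "const c \<in> chart e G"
  unfolding chart_UN using level_const by blast

lemma chart_01: "0 \<in> chart e G" "1 \<in> chart e G"
  using chart_const[of 0 e G] chart_const[of 1 e G] ring_emb_0[OF ring_emb_const] ring_emb_1[OF ring_emb_const]
  by simp_all

lemma chart_add:
  assumes G: "G \<in> forms e" "E G \<noteq> 0" and "z \<in> chart e G" "w \<in> chart e G"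
  shows "z + w \<in> chart e G"
  using chart_diff[OF G assms(3), of "0 - w"] chart_diff[OF G chart_01(1) assms(4)] by simp

lemma chart_power: "z \<in> chart e G \<Longrightarrow> z ^ k \<in> chart e G"
  by (induction k) (auto simp: chart_01 chart_mult)

text \<open>
  The factor \<open>B ^ (k * e)\<close> is the growth permitted by \<open>growth_bound\<close> between the levels \<open>l\<close> and \<open>l + k\<close>.
  If the ratio were eventually at least twice this factor, the bound would be exceeded.
\<close>

lemma level_growth_ratio:
  assumes G: "G \<in> forms e" "E G \<noteq> 0"
  shows "\<exists>M. \<forall>l1. \<exists>l\<ge>l1. card (level e G (l + k)) \<le> M * card (level e G l)"
proof -
  obtain B where B: "\<And>d. card (E ` forms d) \<le> B ^ (d + 1)" using growth_bound by blast
  have lB: "card (level e G l) \<le> B ^ (l * e + 1)" for l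
  proof -
    have "level e G l = (\<lambda>z. z / E G ^ l) ` (E ` forms (l * e))" by (auto simp: level_def)
    hence "card (level e G l) \<le> card (E ` forms (l * e))"
      by (simp add: card_image_le finite_homogeneous)
    thus ?thesis using B order_trans by blast
  qed
  have pos: "0 < card (level e G l)" for l using level_0 finite_level by (metis card_gt_0_iff empty_iff)
  have B0: "0 < B" using lB[of 0] pos[of 0] by (cases B) auto
  let ?M = "2 * B ^ (k * e)"
  have "\<exists>l\<ge>l1. card (level e G (l + k)) \<le> ?M * card (level e G l)" for l1
  proof (rule ccontr)
    assume "\<not> ?thesis"
    hence gr: "?M * card (level e G l) \<le> card (level e G (l + k))" if "l \<ge> l1" for l
      using that by (meson nat_le_linear)
    have grow: "?M ^ s \<le> card (level e G (l1 + s * k))" for s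
    proof (induction s)
      case (Suc s)
      have "?M ^ Suc s \<le> ?M * card (level e G (l1 + s * k))" using Suc by simp
      also have "\<dots> \<le> card (level e G (l1 + s * k + k))" by (rule gr) simp
      finally show ?case by (simp add: algebra_simps)
    qed (use pos[of l1] in simp)
    define c where "c = B ^ (l1 * e + 1)"
    have "2 ^ c * B ^ (k * e * c) = ?M ^ c" by (simp add: power_mult_distrib power_mult)
    also have "\<dots> \<le> B ^ ((l1 + c * k) * e + 1)" using grow[of c] lB[of "l1 + c * k"] by linarith
    also have "(l1 + c * k) * e + 1 = (l1 * e + 1) + k * e * c" by (simp add: algebra_simps)
    also have "B ^ \<dots> = c * B ^ (k * e * c)" by (simp only: power_add c_def)
    finally have "2 ^ c \<le> c" using B0 by simp
    thus False using less_exp[of c] by simp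
  qed
  thus ?thesis by blast
qed

text \<open>
  If \<open>Y\<close> is a set of elements of level at most \<open>l\<close> that are incongruent modulo \<open>a\<close>, and \<open>a\<close> has level
  \<open>k\<close>, the elements \<open>y + a c\<close> with \<open>y \<in> Y\<close> and \<open>c\<close> of level \<open>l\<close> are distinct and of level \<open>l + k\<close>.
  So the size of \<open>Y\<close> is at most the growth ratio from level \<open>l\<close> to \<open>l + k\<close>, which is bounded for
  suitable large \<open>l\<close>.
\<close>

theorem chart_quotient_finite:
  assumes G: "G \<in> forms e" "E G \<noteq> 0" and a: "a \<in> chart e G" "a \<noteq> 0"
  obtains T where "transversal (chart e G) ((*) a ` chart e G) T"
proof -
  obtain k where k: "a \<in> level e G k" using a(1) unfolding chart_UN by blast
  obtain M where M: "\<And>l1. \<exists>l\<ge>l1. card (level e G (l + k)) \<le> M * card (level e G l)"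
    using level_growth_ratio[OF G] by blast
  have "card Y \<le> M" if Y: "finite Y" "Y \<subseteq> chart e G" "separated ((*) a ` chart e G) Y" for Y
  proof -
    obtain l1 where l1: "Y \<subseteq> level e G l1" using chart_common_level[OF G Y(1,2)] by blast
    obtain l where l: "l \<ge> l1" "card (level e G (l + k)) \<le> M * card (level e G l)" using M by blast
    have "card (Y \<times> level e G l) \<le> card (level e G (l + k))"
    proof (rule card_inj_on_le[of "\<lambda>(y, c). y + a * c"])
      show "inj_on (\<lambda>(y, c). y + a * c) (Y \<times> level e G l)"
      proof (rule inj_onI; clarify)
        fix y c y' c' assume *: "y \<in> Y" "y' \<in> Y" "c \<in> level e G l" "c' \<in> level e G l" "y + a * c = y' + a * c'"
        hence "y - y' = a * (c' - c)" by (simp add: algebra_simps)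
        moreover have "c' - c \<in> chart e G" using level_diff[OF *(4,3)] unfolding chart_UN by blast
        ultimately have "y = y'" using Y(3) * unfolding separated_def by blast
        thus "y = y' \<and> c = c'" using * a by simp
      qed
      show "(\<lambda>(y, c). y + a * c) ` (Y \<times> level e G l) \<subseteq> level e G (l + k)"
      proof clarify
        fix y c assume "y \<in> Y" "c \<in> level e G l"
        thus "y + a * c \<in> level e G (l + k)"
          using level_raise[OF G, of y l1 "l + k"] l1 l(1) level_mult[OF k, of c l]
          by (intro level_add) (auto simp: add.commute)
      qed
    qed (rule finite_level)
    hence "card Y * card (level e G l) \<le> card (level e G (l + k))"
      by (simp only: card_cartesian_product)
    also have "\<dots> \<le> M * card (level e G l)" by (rule l(2))
    finally have "card Y * card (level e G l) \<le> M * card (level e G l)" .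
    moreover have "0 < card (level e G l)" using level_0 finite_level by (metis card_gt_0_iff empty_iff)
    ultimately show "card Y \<le> M" by simp
  qed
  moreover have "0 \<in> (*) a ` chart e G" using chart_01 by force
  moreover have "b - c \<in> (*) a ` chart e G" if "b \<in> (*) a ` chart e G" "c \<in> (*) a ` chart e G" for b c
    using that chart_diff[OF G] by (auto simp: right_diff_distrib[symmetric])
  ultimately obtain T where "transversal (chart e G) ((*) a ` chart e G) T"
    using transversal_exists[of "(*) a ` chart e G" "chart e G" M] by blast
  thus ?thesis by (rule that)
qed

end

section \<open>Points on a chart\<close>

definition pv :: "('a::field \<Rightarrow> 'k::field) \<Rightarrow> 'a poly \<Rightarrow> 'k \<Rightarrow> 'k" where
  "pv \<iota> P w = poly (map_poly \<iota> P) w"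

lemma ring_emb_sum: "ring_emb \<iota> \<Longrightarrow> \<iota> (\<Sum>i\<in>A. f i) = (\<Sum>i\<in>A. \<iota> (f i))"
  by (induction A rule: infinite_finite_induct) (simp_all add: ring_emb_0 ring_emb_add)

lemma pv_add: "ring_emb \<iota> \<Longrightarrow> pv \<iota> (P + Q) w = pv \<iota> P w + pv \<iota> Q w"
proof -
  assume \<iota>: "ring_emb \<iota>"
  have "map_poly \<iota> (P + Q) = map_poly \<iota> P + map_poly \<iota> Q"
    by (rule poly_eqI) (simp add: coeff_map_poly ring_emb_0[OF \<iota>] ring_emb_add[OF \<iota>])
  thus ?thesis by (simp add: pv_def)
qed

lemma pv_mult: "ring_emb \<iota> \<Longrightarrow> pv \<iota> (P * Q) w = pv \<iota> P w * pv \<iota> Q w"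
proof -
  assume \<iota>: "ring_emb \<iota>"
  have "map_poly \<iota> (P * Q) = map_poly \<iota> P * map_poly \<iota> Q"
    by (rule poly_eqI)
       (simp add: coeff_map_poly ring_emb_0[OF \<iota>] coeff_mult ring_emb_sum[OF \<iota>] ring_emb_mult[OF \<iota>])
  thus ?thesis by (simp add: pv_def)
qed

lemma pv_0: "pv \<iota> 0 w = 0"
  by (simp add: pv_def)

lemma pv_const: "ring_emb \<iota> \<Longrightarrow> pv \<iota> [:c:] w = \<iota> c"
  by (simp add: pv_def map_poly_pCons ring_emb_0)

lemma pv_monom: "ring_emb \<iota> \<Longrightarrow> pv \<iota> (Polynomial.monom 1 i) w = w ^ i"
  by (simp add: pv_def map_poly_monom ring_emb_0 ring_emb_1 poly_monom)

lemma pv_uminus: "ring_emb \<iota> \<Longrightarrow> pv \<iota> (- P) w = - pv \<iota> P w"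
  using pv_add[of \<iota> P "- P" w] by (simp add: pv_0 eq_neg_iff_add_eq_0 add.commute)

lemma pv_diff: "ring_emb \<iota> \<Longrightarrow> pv \<iota> (P - Q) w = pv \<iota> P w - pv \<iota> Q w"
  using pv_add[of \<iota> P "- Q" w] pv_uminus[of \<iota> Q w] by simp

text \<open>
  Evaluation is compatible with every relation that respects the ring operations. It is applied to a
  relation that reduces functions modulo a maximal ideal.
\<close>

lemma ev_related:
  assumes g: "g \<in> homogeneous n d"
    and const: "\<And>c. rel (\<iota> c) (\<iota>' c)" and zero: "rel 0 0" and one: "rel 1 1"
    and add: "\<And>a b a' b'. rel a a' \<Longrightarrow> rel b b' \<Longrightarrow> rel (a + b) (a' + b')"
    and mult: "\<And>a b a' b'. rel a a' \<Longrightarrow> rel b b' \<Longrightarrow> rel (a * b) (a' * b')"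
    and x: "\<And>i. i \<le> n \<Longrightarrow> rel (x i) (x' i)"
  shows "rel (ev \<iota> g x) (ev \<iota>' g x')"
proof -
  have pow: "rel (a ^ k) (a' ^ k)" if "rel a a'" for a a' k
    using that by (induction k) (auto intro: one mult)
  have prod: "rel (\<Prod>i\<in>T. x i ^ e i) (\<Prod>i\<in>T. x' i ^ e i)" if "T \<subseteq> {..n}" for T and e :: "nat \<Rightarrow> nat"
  proof -
    have "finite T" using that finite_subset by blast
    thus ?thesis using that by (induction T rule: finite_induct) (auto intro!: one mult pow x)
  qed
  have "rel (\<Sum>\<mu>\<in>T. \<iota> (Poly_Mapping.lookup g \<mu>) * monomial_at x \<mu>)
            (\<Sum>\<mu>\<in>T. \<iota>' (Poly_Mapping.lookup g \<mu>) * monomial_at x' \<mu>)" if "T \<subseteq> Poly_Mapping.keys g" for T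
  proof -
    have "finite T" using that finite_subset finite_keys by blast
    thus ?thesis using that
    proof (induction T rule: finite_induct)
      case (insert \<mu> T)
      have "Poly_Mapping.keys \<mu> \<subseteq> {..n}" using insert.prems g by (auto simp: homogeneous_iff)
      hence "rel (monomial_at x \<mu>) (monomial_at x' \<mu>)" unfolding monomial_at_def by (rule prod)
      thus ?case using insert by (auto intro!: add mult const)
    qed (simp add: zero)
  qed
  thus ?thesis unfolding ev_def by blast
qed

definition mult_ideal :: "'k::field set \<Rightarrow> 'k set \<Rightarrow> bool" where
  "mult_ideal A J \<longleftrightarrow> J \<subseteq> A \<and> 0 \<in> J \<and> (\<forall>a\<in>J. \<forall>b\<in>J. a - b \<in> J) \<and> (\<forall>a\<in>J. \<forall>b\<in>A. b * a \<in> J)"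

definition sub_ring :: "'k::field set \<Rightarrow> 'k ring" where
  "sub_ring A = \<lparr>carrier = A, monoid.mult = (*), one = 1, ring.zero = 0, add = (+)\<rparr>"

text \<open>
  The residue field is finite, so its multiplicative group is cyclic.
\<close>

lemma primitive_element_mod_maximal:
  fixes A :: "'k::field set"
  assumes A: "1 \<in> A" "\<And>a b. a \<in> A \<Longrightarrow> b \<in> A \<Longrightarrow> a - b \<in> A" "\<And>a b. a \<in> A \<Longrightarrow> b \<in> A \<Longrightarrow> a * b \<in> A"
    and J: "mult_ideal A J" "1 \<notin> J"
    and max: "\<And>J'. mult_ideal A J' \<Longrightarrow> J \<subseteq> J' \<Longrightarrow> 1 \<notin> J' \<Longrightarrow> J' = J"
    and T: "finite T" "T \<subseteq> A" "\<And>a. a \<in> A \<Longrightarrow> \<exists>t\<in>T. a - t \<in> J"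
  shows "\<exists>w\<in>A. \<forall>a\<in>A. a \<in> J \<or> (\<exists>i::nat. a - w ^ i \<in> J)"
proof -
  let ?R = "sub_ring A"
  have A0: "0 \<in> A" using A(2)[OF A(1,1)] by simp
  have Am: "- a \<in> A" if "a \<in> A" for a using A(2)[OF A0 that] by simp
  have Aa: "a + b \<in> A" if "a \<in> A" "b \<in> A" for a b using A(2)[OF that(1) Am[OF that(2)]] by simp
  have "\<exists>y\<in>A. y + x = 0 \<and> x + y = 0" if "x \<in> A" for x
    using that by (intro bexI[of _ "- x"]) (auto intro: Am)
  hence cr: "cring ?R"
    unfolding sub_ring_def
    by (intro cringI abelian_groupI comm_monoidI) (auto simp: Aa A0 A algebra_simps)
  interpret R: cring ?R by (rule cr)
  have um: "\<ominus>\<^bsub>?R\<^esub> a = - a" if "a \<in> A" for a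
    by (rule R.minus_equality) (use that Am in \<open>auto simp: sub_ring_def\<close>)
  have idI: "ideal J' ?R" if J': "mult_ideal A J'" for J'
  proof (rule idealI)
    show "ring ?R" by (rule R.ring_axioms)
    have sub: "J' \<subseteq> A" "0 \<in> J'" "\<And>a b. a \<in> J' \<Longrightarrow> b \<in> J' \<Longrightarrow> a - b \<in> J'"
      using J' by (auto simp: mult_ideal_def)
    show "subgroup J' (add_monoid ?R)"
    proof (rule group.subgroupI)
      show "group (add_monoid ?R)" by (rule R.a_group)
      show "J' \<subseteq> carrier (add_monoid ?R)" "J' \<noteq> {}" using sub by (auto simp: sub_ring_def)
      fix a b assume ab: "a \<in> J'" "b \<in> J'"
      have "inv\<^bsub>add_monoid ?R\<^esub> a = - a" using um[of a] sub ab by (auto simp: a_inv_def)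
      thus "inv\<^bsub>add_monoid ?R\<^esub> a \<in> J'" using sub(3)[OF sub(2) ab(1)] by simp
      have "a - (0 - b) \<in> J'" using ab sub by blast
      thus "a \<otimes>\<^bsub>add_monoid ?R\<^esub> b \<in> J'" by (simp add: sub_ring_def)
    qed
    fix a x assume "a \<in> J'" "x \<in> carrier ?R"
    hence "x * a \<in> J'" using J' by (auto simp: mult_ideal_def sub_ring_def)
    thus "x \<otimes>\<^bsub>?R\<^esub> a \<in> J'" "a \<otimes>\<^bsub>?R\<^esub> x \<in> J'" by (auto simp: sub_ring_def mult.commute)
  qed
  have mid: "mult_ideal A J'" if J': "ideal J' ?R" for J'
  proof -
    interpret J': ideal J' ?R by (rule J')
    have sub: "J' \<subseteq> A" using J'.a_subset by (simp add: sub_ring_def)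
    have mul: "b * a \<in> J'" if "a \<in> J'" "b \<in> A" for a b
      using J'.I_l_closed[of a b] that by (simp add: sub_ring_def)
    have add: "a + b \<in> J'" if "a \<in> J'" "b \<in> J'" for a b
      using J'.a_closed[of a b] that by (simp add: sub_ring_def)
    have "a - b \<in> J'" if "a \<in> J'" "b \<in> J'" for a b
      using add[OF that(1) mul[OF that(2) Am[OF A(1)]]] by simp
    moreover have "0 \<in> J'" using J'.zero_closed by (simp add: sub_ring_def)
    ultimately show ?thesis using sub mul by (auto simp: mult_ideal_def)
  qed
  have maxid: "maximalideal J ?R"
  proof (rule maximalidealI)
    show "ideal J ?R" by (rule idI[OF J(1)])
    show "carrier ?R \<noteq> J" using A(1) J(2) by (auto simp: sub_ring_def)
    fix J' assume J': "ideal J' ?R" "J \<subseteq> J'" "J' \<subseteq> carrier ?R"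
    show "J' = J \<or> J' = carrier ?R"
    proof (cases "1 \<in> J'")
      case True
      have "b * 1 \<in> J'" if "b \<in> A" for b using mid[OF J'(1)] True that unfolding mult_ideal_def by blast
      thus ?thesis using J'(3) by (auto simp: sub_ring_def)
    qed (use max[OF mid[OF J'(1)] J'(2)] in blast)
  qed
  interpret J: maximalideal J ?R by (rule maxid)
  let ?Q = "?R Quot J"
  let ?h = "\<lambda>a. J +>\<^bsub>?R\<^esub> a"
  interpret Q: field ?Q by (rule J.quotient_is_field[OF cr])
  have h_eq: "?h a = ?h b \<longleftrightarrow> a - b \<in> J" if "a \<in> A" "b \<in> A" for a b
  proof -
    have "a \<ominus>\<^bsub>?R\<^esub> b = a - b" using um[OF that(2)] by (simp add: a_minus_def) (simp add: sub_ring_def)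
    thus ?thesis using R.quotient_eq_iff_same_a_r_cos[OF J.is_ideal, of a b] that by (simp add: sub_ring_def)
  qed
  have carrier_Q: "carrier ?Q = ?h ` A"
    by (auto simp: FactRing_def A_RCOSETS_def' sub_ring_def)
  have h_mult: "?h a \<otimes>\<^bsub>?Q\<^esub> ?h b = ?h (a * b)" if "a \<in> A" "b \<in> A" for a b
    using ring_hom_mult[OF J.rcos_ring_hom, of a b] that by (simp add: sub_ring_def)
  have h_one: "\<one>\<^bsub>?Q\<^esub> = ?h 1" using ring_hom_one[OF J.rcos_ring_hom] by (simp add: sub_ring_def)
  have h_zero: "\<zero>\<^bsub>?Q\<^esub> = ?h 0"
    using ring_hom_zero[OF J.rcos_ring_hom R.ring_axioms Q.ring_axioms] by (simp add: sub_ring_def)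
  have "carrier ?Q \<subseteq> ?h ` T"
  proof
    fix c assume "c \<in> carrier ?Q"
    then obtain a where a: "a \<in> A" "c = ?h a" using carrier_Q by blast
    then obtain t where "t \<in> T" "a - t \<in> J" using T(3) by blast
    thus "c \<in> ?h ` T" using h_eq[of a t] a T(2) by blast
  qed
  hence finQ: "finite (carrier ?Q)" using T(1) by (rule finite_surj[rotated])
  obtain c where c: "c \<in> carrier (Multiplicative_Group.mult_of ?Q)" "carrier (Multiplicative_Group.mult_of ?Q) = {c [^]\<^bsub>?Q\<^esub> i | i::nat. i \<in> UNIV}"
    using Q.finite_field_mult_group_has_gen[OF finQ] by (rule bexE)
  obtain w where w: "w \<in> A" "c = ?h w" using c(1) carrier_Q by (auto simp: Multiplicative_Group.mult_of_def)
  have Apow: "w ^ i \<in> A" for i by (induction i) (auto intro: A w)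
  have hpow: "c [^]\<^bsub>?Q\<^esub> (i::nat) = ?h (w ^ i)" for i
  proof (induction i)
    case (Suc i)
    have "c [^]\<^bsub>?Q\<^esub> Suc i = c [^]\<^bsub>?Q\<^esub> i \<otimes>\<^bsub>?Q\<^esub> c" by (simp add: nat_pow_def Multiplicative_Group.mult_of_def)
    also have "\<dots> = ?h (w ^ i) \<otimes>\<^bsub>?Q\<^esub> ?h w" by (simp only: Suc w(2)[symmetric])
    also have "\<dots> = ?h (w ^ i * w)" by (rule h_mult[OF Apow w(1)])
    finally show ?case by (simp add: mult.commute)
  qed (simp add: nat_pow_def Multiplicative_Group.mult_of_def h_one)
  have "a \<in> J \<or> (\<exists>i::nat. a - w ^ i \<in> J)" if a: "a \<in> A" for a
  proof (cases "a \<in> J")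
    case False
    hence "?h a \<noteq> ?h 0" using h_eq[OF a A0] by simp
    hence "?h a \<in> carrier (Multiplicative_Group.mult_of ?Q)" using a carrier_Q h_zero by (auto simp: Multiplicative_Group.mult_of_def)
    then obtain i where "?h a = c [^]\<^bsub>?Q\<^esub> (i::nat)" using c(2) by blast
    hence "a - w ^ i \<in> J" using h_eq[OF a Apow] hpow by simp
    thus ?thesis by blast
  qed simp
  thus ?thesis using w(1) by blast
qed

context one_dim_curve
begin

lemma chart_pv: "w \<in> chart e G \<Longrightarrow> G \<in> forms e \<Longrightarrow> E G \<noteq> 0 \<Longrightarrow> pv const P w \<in> chart e G"
proof -
  assume w: "w \<in> chart e G" and G: "G \<in> forms e" "E G \<noteq> 0"
  have "(\<Sum>i\<in>I. Polynomial.coeff (map_poly const P) i * w ^ i) \<in> chart e G" for I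
  proof (induction I rule: infinite_finite_induct)
    case (insert i I)
    have "Polynomial.coeff (map_poly const P) i \<in> chart e G"
      using chart_const by (simp add: coeff_map_poly ring_emb_0[OF ring_emb_const])
    thus ?case using insert w G by (auto intro!: chart_add[OF G] chart_mult chart_power)
  qed (auto simp: chart_01)
  thus ?thesis unfolding pv_def poly_altdef .
qed

text \<open>
  As \<open>I\<close> contains a nonzero element, it has finite index and lies in a maximal ideal \<open>J\<close>. The residue
  field is generated by one element \<open>w\<close>. Sending \<open>w\<close> to a root \<open>r\<close> of its minimal polynomial embeds
  the residue field into the algebraic closure, and the images of the coordinate quotients are the
  coordinates of a point where all elements of \<open>J\<close> vanish.
\<close>

theorem nullstellensatz_chart:
  assumes j: "j \<le> n" "gen j \<noteq> 0"
    and I: "mult_ideal (chart 1 (hvar j)) I" "a0 \<in> I" "a0 \<noteq> 0" "1 \<notin> I"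
  shows "\<exists>p\<in>cone. \<forall>l. \<forall>g\<in>forms l. E g / gen j ^ l \<in> I \<longrightarrow> val_at g p = 0"
proof -
  let ?A = "chart 1 (hvar j)"
  have G: "hvar j \<in> forms 1" "E (hvar j) \<noteq> 0" using j homogeneous_var by (auto simp: E_var)
  have a0: "a0 \<in> ?A" using I by (auto simp: mult_ideal_def)
  obtain T where T: "transversal ?A ((*) a0 ` ?A) T" using chart_quotient_finite[OF G a0 I(3)] .
  have T': "finite T" "T \<subseteq> ?A" "\<And>a. a \<in> ?A \<Longrightarrow> \<exists>t\<in>T. a - t \<in> (*) a0 ` ?A"
    using T unfolding transversal_def by blast+
  \<comment> \<open>An ideal containing \<open>a0 A\<close> is determined by its elements in the finite set \<open>T\<close>, so one with the most such elements is maximal.\<close>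
  let ?P = "\<lambda>J. mult_ideal ?A J \<and> I \<subseteq> J \<and> 1 \<notin> J"
  have "?P I" using I by blast
  moreover have "card (J \<inter> T) < Suc (card T)" for J using card_mono[OF T'(1), of "J \<inter> T"] by auto
  ultimately obtain J where J: "?P J" "\<And>J'. ?P J' \<Longrightarrow> card (J' \<inter> T) \<le> card (J \<inter> T)"
    using ex_has_greatest_nat[of ?P I "\<lambda>J. card (J \<inter> T)" "Suc (card T)"] by blast
  have Jid: "\<And>a b. a \<in> J \<Longrightarrow> b \<in> J \<Longrightarrow> a - b \<in> J" "\<And>a b. a \<in> J \<Longrightarrow> b \<in> ?A \<Longrightarrow> b * a \<in> J" "0 \<in> J" "J \<subseteq> ?A"
    using J(1) by (auto simp: mult_ideal_def)
  have Jadd: "a + b \<in> J" if "a \<in> J" "b \<in> J" for a b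
    using Jid(1)[OF that(1) Jid(1)[OF Jid(3) that(2)]] by simp
  have a0A: "(*) a0 ` ?A \<subseteq> J"
  proof
    fix z assume "z \<in> (*) a0 ` ?A"
    then obtain b where b: "b \<in> ?A" "z = b * a0" by (auto simp: mult.commute)
    have "a0 \<in> J" using I(2) J(1) by blast
    thus "z \<in> J" using Jid(2) b by blast
  qed
  have max: "J' = J" if J': "mult_ideal ?A J'" "J \<subseteq> J'" "1 \<notin> J'" for J'
  proof -
    have "?P J'" using J' J(1) by blast
    hence "card (J' \<inter> T) \<le> card (J \<inter> T)" by (rule J(2))
    hence eq: "J \<inter> T = J' \<inter> T" using J'(2) T'(1) by (intro card_seteq) auto
    have "b \<in> J" if b: "b \<in> J'" for b
    proof -
      obtain t where t: "t \<in> T" "b - t \<in> J" using T'(3)[of b] b J'(1) a0A by (auto simp: mult_ideal_def)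
      have "b - (b - t) \<in> J'" using b t(2) J' unfolding mult_ideal_def by blast
      hence "t \<in> J" using eq t(1) by auto
      from Jadd[OF t(2) this] show "b \<in> J" by simp
    qed
    thus ?thesis using J'(2) by blast
  qed
  obtain w where w: "w \<in> ?A" "\<And>a. a \<in> ?A \<Longrightarrow> a \<in> J \<or> (\<exists>i::nat. a - w ^ i \<in> J)"
  proof -
    have "\<exists>w\<in>?A. \<forall>a\<in>?A. a \<in> J \<or> (\<exists>i::nat. a - w ^ i \<in> J)"
    proof (rule primitive_element_mod_maximal)
      show "1 \<in> ?A" by (rule chart_01)
      show "mult_ideal ?A J" "1 \<notin> J" using J(1) by auto
      show "\<exists>t\<in>T. a - t \<in> J" if "a \<in> ?A" for a using T'(3)[OF that] a0A by blast
    qed (use chart_diff[OF G] chart_mult max T' in blast)+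
    thus ?thesis using that by blast
  qed
  have rep: "\<exists>P. a - pv const P w \<in> J" if "a \<in> ?A" for a
    using w(2)[OF that]
  proof
    assume "a \<in> J"
    thus ?thesis by (intro exI[of _ 0]) (simp add: pv_0)
  next
    assume "\<exists>i. a - w ^ i \<in> J"
    then obtain i where "a - w ^ i \<in> J" by blast
    thus ?thesis by (intro exI[of _ "Polynomial.monom 1 i"]) (simp add: pv_monom[OF ring_emb_const])
  qed
  have "\<exists>P. P \<noteq> 0 \<and> pv const P w \<in> J"
  proof -
    have "\<forall>i. \<exists>t\<in>T. w ^ i - t \<in> J" using T'(3)[OF chart_power[OF w(1)]] a0A by blast
    then obtain t where t: "\<And>i. t i \<in> T" "\<And>i. w ^ i - t i \<in> J" by metis
    have "finite (range t)" by (rule finite_subset[OF _ T'(1)]) (use t in blast)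
    hence "\<not> inj t" using finite_imageD[of t UNIV] by auto
    then obtain i k where ik: "i \<noteq> k" "t i = t k" unfolding inj_def by blast
    have "(w ^ i - t i) - (w ^ k - t k) \<in> J" using Jid(1) t(2) by blast
    hence "pv const (Polynomial.monom 1 i - Polynomial.monom 1 k) w \<in> J"
      using ik(2) by (simp add: pv_diff[OF ring_emb_const] pv_monom[OF ring_emb_const])
    moreover have "Polynomial.monom (1::'a) i - Polynomial.monom 1 k \<noteq> 0"
      using ik(1) by (simp add: monom_eq_iff')
    ultimately show ?thesis by blast
  qed
  then obtain P where P: "P \<noteq> 0" "pv const P w \<in> J"
    and Pmin: "\<And>P'. P' \<noteq> 0 \<and> pv const P' w \<in> J \<Longrightarrow> Polynomial.degree P \<le> Polynomial.degree P'"
    using ex_has_least_nat[of "\<lambda>P. P \<noteq> 0 \<and> pv const P w \<in> J" _ Polynomial.degree] by blast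
  have degP: "Polynomial.degree P > 0"
  proof (rule ccontr)
    assume "\<not> ?thesis"
    then obtain c where c: "P = [:c:]" by (auto elim: degree_eq_zeroE)
    hence "c \<noteq> 0" "const c \<in> J" using P by (auto simp: pv_const[OF ring_emb_const])
    hence "const (inverse c) * const c \<in> J" using Jid(2) chart_const by blast
    hence "1 \<in> J" using ring_emb_mult[OF ring_emb_const, of "inverse c" c] ring_emb_1[OF ring_emb_const] \<open>c \<noteq> 0\<close> by simp
    thus False using J(1) by blast
  qed
  have "Polynomial.degree (map_poly to_ac P) = Polynomial.degree P"
    by (rule degree_map_poly) simp
  then obtain r where r: "pv to_ac P r = 0"
    using alg_closed_imp_poly_has_root[of "map_poly to_ac P"] degP by (auto simp: pv_def)
  have kill: "pv to_ac P' r = 0" if P': "pv const P' w \<in> J" for P'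
  proof -
    have dec: "P' = P * (P' div P) + P' mod P" by simp
    have "pv const P' w = pv const (P * (P' div P) + P' mod P) w" by simp
    also have "\<dots> = pv const P w * pv const (P' div P) w + pv const (P' mod P) w"
      by (simp only: pv_add[OF ring_emb_const] pv_mult[OF ring_emb_const])
    finally have "pv const (P' mod P) w = pv const P' w - pv const (P' div P) w * pv const P w"
      by (simp add: mult.commute)
    moreover have "pv const (P' div P) w * pv const P w \<in> J"
      using P(2) chart_pv[OF w(1) G] by (intro Jid(2))
    ultimately have "pv const (P' mod P) w \<in> J" using Jid(1)[OF P'] by simp
    hence "P' mod P = 0" using Pmin[of "P' mod P"] degree_mod_less'[OF P(1), of P'] by fastforce
    hence "P' = P * (P' div P)" using dec by simp
    thus ?thesis using r pv_mult[OF ring_emb_to_ac, of P "P' div P" r] by simp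
  qed
  \<comment> \<open>The graph of the homomorphism from the chart to the algebraic closure with kernel \<open>J\<close>.\<close>
  define rel where "rel = (\<lambda>z c. z \<in> ?A \<and> (\<exists>P. z - pv const P w \<in> J \<and> c = pv to_ac P r))"
  have rel_const: "rel (const c) (to_ac c)" for c
    unfolding rel_def using Jid(3) chart_const
    by (auto intro!: exI[of _ "[:c:]"] simp: pv_const[OF ring_emb_const] pv_const[OF ring_emb_to_ac])
  have rel_0: "rel 0 0" and rel_1: "rel 1 1"
    using rel_const[of 0] rel_const[of 1] by (simp_all add: ring_emb_0[OF ring_emb_const] ring_emb_1[OF ring_emb_const])
  have rel_add: "rel (a + b) (a' + b')" if ab: "rel a a'" "rel b b'" for a b a' b'
  proof -
    obtain P1 P2 where "a \<in> ?A" "b \<in> ?A" "a - pv const P1 w \<in> J" "b - pv const P2 w \<in> J"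
      "a' = pv to_ac P1 r" "b' = pv to_ac P2 r" using ab unfolding rel_def by blast
    moreover from this have "(a - pv const P1 w) + (b - pv const P2 w) \<in> J" by (intro Jadd)
    ultimately show ?thesis unfolding rel_def
      by (intro conjI exI[of _ "P1 + P2"] chart_add[OF G])
         (auto simp: pv_add[OF ring_emb_const] pv_add[OF ring_emb_to_ac] algebra_simps)
  qed
  have rel_mult: "rel (a * b) (a' * b')" if ab: "rel a a'" "rel b b'" for a b a' b'
  proof -
    obtain P1 P2 where *: "a \<in> ?A" "b \<in> ?A" "a - pv const P1 w \<in> J" "b - pv const P2 w \<in> J"
      "a' = pv to_ac P1 r" "b' = pv to_ac P2 r" using ab unfolding rel_def by blast
    have "b * (a - pv const P1 w) + pv const P1 w * (b - pv const P2 w) \<in> J"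
      using * chart_pv[OF w(1) G] by (intro Jadd Jid(2))
    moreover have "b * (a - pv const P1 w) + pv const P1 w * (b - pv const P2 w) = a * b - pv const (P1 * P2) w"
      by (simp add: pv_mult[OF ring_emb_const] algebra_simps)
    ultimately show ?thesis unfolding rel_def using *
      by (intro conjI exI[of _ "P1 * P2"] chart_mult) (auto simp: pv_mult[OF ring_emb_to_ac])
  qed
  let ?u = "\<lambda>i. gen i / gen j"
  have uA: "?u i \<in> ?A" if "i \<le> n" for i
    unfolding chart_def using homogeneous_var[OF that]
    by (intro CollectI exI[of _ "hvar i"] exI[of _ 1]) (simp add: E_var)
  have "\<exists>c. rel (?u i) c" if "i \<le> n" for i
    using rep[OF uA[OF that]] uA[OF that] unfolding rel_def by blast
  then obtain p0 where p0: "\<And>i. i \<le> n \<Longrightarrow> rel (?u i) (p0 i)" by metis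
  define p where "p = (\<lambda>i. if i \<le> n then p0 i else 0)"
  have relp: "rel (?u i) (p i)" if "i \<le> n" for i using p0[OF that] that by (simp add: p_def)
  have main: "val_at g p = 0" if g: "g \<in> forms l" and gJ: "E g / gen j ^ l \<in> J" for g l
  proof -
    have "rel (ev const g ?u) (ev to_ac g p)"
      by (rule ev_related[OF g]) (use rel_const rel_0 rel_1 rel_add rel_mult relp in auto)
    then obtain P' where P': "E g / gen j ^ l - pv const P' w \<in> J" "val_at g p = pv to_ac P' r"
      unfolding rel_def E_over_gen[OF g, symmetric] by blast
    have "E g / gen j ^ l - (E g / gen j ^ l - pv const P' w) \<in> J" using Jid(1)[OF gJ P'(1)] .
    hence "pv const P' w \<in> J" by simp
    thus ?thesis using kill P'(2) by simp
  qed
  have "p \<in> cone"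
  proof (rule cone_memI[of p j])
    obtain P' where P': "1 - pv const P' w \<in> J" "p j = pv to_ac P' r"
      using relp[OF j(1)] j(2) unfolding rel_def by auto
    have "pv const (1 - P') w \<in> J"
      using P'(1) pv_monom[OF ring_emb_const, of 0 w] by (simp add: pv_diff[OF ring_emb_const] monom_0 one_pCons)
    from kill[OF this] show "p j \<noteq> 0"
      using P'(2) pv_monom[OF ring_emb_to_ac, of 0 r] by (simp add: pv_diff[OF ring_emb_to_ac] monom_0 one_pCons)
    show "p i = 0" if "n < i" for i using that by (simp add: p_def)
    fix d g assume g: "g \<in> forms d" "\<forall>y\<in>cone. val_at g y = 0"
    have "E g = 0" using E_eq_0_iff[OF g(1)] g(2) by blast
    hence "E g / gen j ^ d \<in> J" using Jid(3) by simp
    thus "val_at g p = 0" using main[OF g(1)] by blast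
  qed
  moreover have "val_at g p = 0" if "g \<in> forms l" "E g / gen j ^ l \<in> I" for g l
    using main[OF that(1)] that(2) J(1) by blast
  ultimately show ?thesis by blast
qed

section \<open>Homogeneous ideals without zeros\<close>

text \<open>
  On the chart of each coordinate, the ideal that \<open>D\<close> defines there has no zero and hence contains \<open>1\<close>.
  So \<open>D\<close> contains a power of each coordinate, hence every monomial of sufficiently large degree.
\<close>

theorem homogeneous_nullstellensatz:
  fixes D :: "nat \<Rightarrow> 'a mpoly set"
  assumes D: "\<And>d. D d \<subseteq> forms d" "\<And>d g h. g \<in> D d \<Longrightarrow> h \<in> D d \<Longrightarrow> g - h \<in> D d"
    and mult: "\<And>d e g h. g \<in> D d \<Longrightarrow> h \<in> forms e \<Longrightarrow> h * g \<in> D (e + d)"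
    and van: "\<And>d g. g \<in> forms d \<Longrightarrow> E g = 0 \<Longrightarrow> g \<in> D d"
    and nz: "g0 \<in> D d0" "E g0 \<noteq> 0"
    and nozero: "\<And>p. p \<in> cone \<Longrightarrow> \<exists>d. \<exists>g\<in>D d. val_at g p \<noteq> 0"
  shows "\<exists>N. \<forall>d\<ge>N. forms d \<subseteq> D d"
proof -
  have D0: "0 \<in> D d" for d by (rule van[OF homogeneous_0]) (rule E_0)
  have Dadd: "g + h \<in> D d" if "g \<in> D d" "h \<in> D d" for g h d
    using D(2)[OF that(1) D(2)[OF D0 that(2)]] by simp
  have var: "\<exists>N. hvar j ^ N \<in> D N" if j: "j \<le> n" for j
  proof (cases "gen j = 0")
    case True
    have "(hvar j :: 'a mpoly) ^ 1 \<in> D 1"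
      using van[OF homogeneous_var[OF j]] True by (simp add: E_var)
    thus ?thesis by blast
  next
    case False
    let ?A = "chart 1 (hvar j)"
    have G: "hvar j \<in> forms 1" "E (hvar j) \<noteq> 0" using j False homogeneous_var by (auto simp: E_var)
    have A_E: "\<exists>g l. g \<in> forms l \<and> z = E g / gen j ^ l" if "z \<in> ?A" for z
      using that by (auto simp: chart_def E_var)
    define I where "I = {E g / gen j ^ l | g l. g \<in> D l}"
    have raise: "hvar j ^ k * g \<in> D (k + l) \<and> E g / gen j ^ l = E (hvar j ^ k * g) / gen j ^ (k + l)"
      if "g \<in> D l" for g k l
    proof -
      have "hvar j ^ k \<in> forms k" using homogeneous_power[OF homogeneous_var[OF j], of k] by simp
      thus ?thesis using mult[OF that] False by (simp add: E_simps power_add)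
    qed
    have "mult_ideal ?A I"
      unfolding mult_ideal_def
    proof (intro conjI ballI)
      show "I \<subseteq> ?A" unfolding I_def chart_def using D(1) by (auto simp: E_var)
      show "0 \<in> I" unfolding I_def using D0 by (intro CollectI exI[of _ 0]) (auto simp: E_0)
      fix a b assume a: "a \<in> I"
      then obtain g l where g: "g \<in> D l" "a = E g / gen j ^ l" unfolding I_def by blast
      show "a - b \<in> I" if bI: "b \<in> I"
      proof -
        obtain h k where h: "h \<in> D k" "b = E h / gen j ^ k" using bI unfolding I_def by blast
        have 1: "hvar j ^ k * g \<in> D (k + l)" "a = E (hvar j ^ k * g) / gen j ^ (k + l)"
          using raise[OF g(1), of k] g(2) by simp_all
        have 2: "hvar j ^ l * h \<in> D (k + l)" "b = E (hvar j ^ l * h) / gen j ^ (k + l)"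
          using raise[OF h(1), of l] h(2) by (simp_all add: add.commute)
        have "a - b = E (hvar j ^ k * g - hvar j ^ l * h) / gen j ^ (k + l)"
          unfolding 1(2) 2(2) by (simp add: E_diff diff_divide_distrib)
        thus ?thesis using D(2)[OF 1(1) 2(1)] unfolding I_def by blast
      qed
      show "b * a \<in> I" if bA: "b \<in> ?A"
      proof -
        obtain h k where h: "h \<in> forms k" "b = E h / gen j ^ k" using A_E[OF bA] by blast
        have "b * a = E (h * g) / gen j ^ (k + l)" using g h by (simp add: E_mult power_add)
        thus ?thesis using mult[OF g(1) h(1)] unfolding I_def by blast
      qed
    qed
    moreover have "E g0 / gen j ^ d0 \<in> I" using nz unfolding I_def by blast
    moreover have "E g0 / gen j ^ d0 \<noteq> 0" using nz False by simp
    moreover have "\<not> (\<exists>p\<in>cone. \<forall>l. \<forall>g\<in>forms l. E g / gen j ^ l \<in> I \<longrightarrow> val_at g p = 0)"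
    proof
      assume "\<exists>p\<in>cone. \<forall>l. \<forall>g\<in>forms l. E g / gen j ^ l \<in> I \<longrightarrow> val_at g p = 0"
      then obtain p where p: "p \<in> cone" "\<And>l g. g \<in> forms l \<Longrightarrow> E g / gen j ^ l \<in> I \<Longrightarrow> val_at g p = 0" by blast
      obtain d g where "g \<in> D d" "val_at g p \<noteq> 0" using nozero[OF p(1)] by blast
      moreover from this have "E g / gen j ^ d \<in> I" unfolding I_def by blast
      ultimately show False using p(2) D(1) by blast
    qed
    ultimately have "1 \<in> I" using nullstellensatz_chart[OF j False] by blast
    then obtain g l where g: "g \<in> D l" "1 = E g / gen j ^ l" unfolding I_def by blast
    have hv: "hvar j ^ l \<in> forms l" using homogeneous_power[OF homogeneous_var[OF j], of l] by simp
    have "E (hvar j ^ l - g) = 0" using g(2) False by (simp add: E_simps field_simps)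
    hence "hvar j ^ l - g \<in> D l" using van homogeneous_diff[OF hv] g(1) D(1) by blast
    from Dadd[OF this g(1)] have "hvar j ^ l \<in> D l" by simp
    thus ?thesis by blast
  qed
  then obtain N where N: "\<And>j. j \<le> n \<Longrightarrow> hvar j ^ N j \<in> D (N j)" by metis
  define N0 where "N0 = (\<Sum>j\<le>n. N j) + 1"
  have mono: "Poly_Mapping.single \<mu> c \<in> D d"
    if \<mu>: "Poly_Mapping.keys \<mu> \<subseteq> {..n}" "mdeg \<mu> = d" "d \<ge> N0" for \<mu> c d
  proof -
    have "\<exists>j\<le>n. N j \<le> Poly_Mapping.lookup \<mu> j"
    proof (rule ccontr)
      assume "\<not> ?thesis"
      hence "\<And>j. j \<in> {..n} \<Longrightarrow> Poly_Mapping.lookup \<mu> j \<le> N j" by force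
      hence "(\<Sum>j\<le>n. Poly_Mapping.lookup \<mu> j) \<le> (\<Sum>j\<le>n. N j)" by (rule sum_mono)
      thus False using \<mu> mdeg_superset[of "{..n}" \<mu>] by (simp add: N0_def)
    qed
    then obtain j where j: "j \<le> n" "N j \<le> Poly_Mapping.lookup \<mu> j" by blast
    let ?e = "Poly_Mapping.single j (N j)"
    let ?\<nu> = "\<mu> - ?e"
    have \<mu>eq: "\<mu> = ?\<nu> + ?e"
      using j(2) by (intro poly_mapping_eqI) (auto simp: lookup_add lookup_minus lookup_single when_def)
    have pow: "(hvar j :: 'a mpoly) ^ k = Poly_Mapping.single (Poly_Mapping.single j k) 1" for k
      by (induction k) (simp_all add: hvar_def mult_single single_add[symmetric])
    have "Poly_Mapping.keys ?\<nu> \<subseteq> Poly_Mapping.keys \<mu>" by (auto simp: in_keys_iff lookup_minus)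
    hence "Poly_Mapping.single ?\<nu> c \<in> forms (mdeg ?\<nu>)" using \<mu>(1) by (intro homogeneous_single) auto
    from mult[OF N[OF j(1)] this] have "Poly_Mapping.single ?\<nu> c * hvar j ^ N j \<in> D (mdeg ?\<nu> + N j)" .
    also have "Poly_Mapping.single ?\<nu> c * hvar j ^ N j = Poly_Mapping.single \<mu> c"
      unfolding pow mult_single by (subst (2) \<mu>eq) simp
    also have "mdeg ?\<nu> + N j = d"
    proof -
      have "mdeg ?e = N j" by (cases "N j = 0") (simp_all add: mdeg_def)
      thus ?thesis using \<mu>(2) mdeg_add[of ?\<nu> ?e] \<mu>eq by simp
    qed
    finally show ?thesis .
  qed
  have "g \<in> D d" if "d \<ge> N0" "g \<in> forms d" for d g
  proof -
    have "(\<Sum>\<mu>\<in>T. Poly_Mapping.single \<mu> (Poly_Mapping.lookup g \<mu>)) \<in> D d" if "T \<subseteq> Poly_Mapping.keys g" for T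
    proof -
      have "finite T" using that finite_subset finite_keys by blast
      thus ?thesis using that
      proof (induction T rule: finite_induct)
        case (insert \<mu> T)
        have "Poly_Mapping.single \<mu> (Poly_Mapping.lookup g \<mu>) \<in> D d"
          using insert.prems \<open>g \<in> forms d\<close> \<open>d \<ge> N0\<close> by (intro mono) (auto simp: homogeneous_iff)
        thus ?case using insert by (auto intro: Dadd)
      qed (simp add: D0)
    qed
    from this[OF order_refl] show ?thesis using mpoly_sum_single[of g] by simp
  qed
  thus ?thesis by blast
qed

text \<open>
  The forms \<open>h\<close> for which \<open>f h\<close> is again a form on \<open>C\<close> have no common zero, so they include all forms
  of some degree \<open>N\<close>. Multiplication by \<open>f\<close> then maps the finite set of forms of degree \<open>N\<close> to itself,
  and two powers of \<open>f\<close> coincide.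
\<close>

lemma regular_everywhere_root_of_unity:
  assumes f: "f \<in> K" "f \<noteq> 0" and reg: "\<And>p. p \<in> cone \<Longrightarrow> f \<in> Loc p"
  shows "\<exists>k>0. f ^ k = 1"
proof -
  define D where "D = (\<lambda>d. {h \<in> forms d. \<exists>g\<in>forms d. f * E h = E g})"
  have "\<exists>N. \<forall>d\<ge>N. forms d \<subseteq> D d"
  proof -
    obtain g0 h0 d0 where f0: "g0 \<in> forms d0" "h0 \<in> forms d0" "E h0 \<noteq> 0" "f = E g0 / E h0" using f(1) by (rule K_E)
    show ?thesis
    proof (rule homogeneous_nullstellensatz[of D h0 d0])
      show "D d \<subseteq> forms d" for d by (auto simp: D_def)
      show "h0 \<in> D d0" using f0 by (auto simp: D_def)
      show "E h0 \<noteq> 0" by (rule f0)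
      fix d g h assume gh: "g \<in> D d" "h \<in> D d"
      then obtain g' h' where "g' \<in> forms d" "f * E g = E g'" "h' \<in> forms d" "f * E h = E h'" unfolding D_def by blast
      hence "g' - h' \<in> forms d" "f * E (g - h) = E (g' - h')" by (auto simp: E_diff right_diff_distrib intro: homogeneous_diff)
      thus "g - h \<in> D d" using gh unfolding D_def by (blast intro: homogeneous_diff)
    next
      fix d e g h assume gh: "g \<in> D d" "h \<in> forms e"
      then obtain g' where g': "g' \<in> forms d" "f * E g = E g'" unfolding D_def by blast
      have "f * E (h * g) = E h * (f * E g)" by (simp add: E_mult)
      hence "f * E (h * g) = E (h * g')" using g'(2) by (simp add: E_mult)
      moreover have "h * g' \<in> forms (e + d)" "h * g \<in> forms (e + d)"
        using gh g' by (auto simp: D_def intro: homogeneous_mult)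
      ultimately show "h * g \<in> D (e + d)" unfolding D_def by blast
    next
      fix d g assume "g \<in> forms d" "E g = 0"
      thus "g \<in> D d" unfolding D_def using homogeneous_0 by (auto intro!: bexI[of _ 0] simp: E_0)
    next
      fix p assume p: "p \<in> cone"
      obtain g h d where gh: "g \<in> forms d" "h \<in> forms d" "val_at h p \<noteq> 0" "f = E g / E h" using reg[OF p] by (rule Loc_E)
      hence "E h \<noteq> 0" using E_nonzeroI p by blast
      hence "f * E h = E g" using gh(4) by simp
      hence "h \<in> D d" using gh unfolding D_def by blast
      thus "\<exists>d. \<exists>g\<in>D d. val_at g p \<noteq> 0" using gh(3) by blast
    qed
  qed
  then obtain N where N: "forms N \<subseteq> D N" by blast
  obtain j where j: "j \<le> n" "gen j \<noteq> 0" using gen_nonzero by blast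
  let ?v = "gen j ^ N"
  have fv: "f ^ k * ?v \<in> E ` forms N" for k
  proof (induction k)
    case 0
    have "hvar j ^ N \<in> forms N" using homogeneous_power[OF homogeneous_var[OF j(1)], of N] by simp
    moreover have "E (hvar j ^ N) = ?v" by (simp add: E_simps)
    ultimately show ?case by (metis image_eqI mult_1 power_0)
  next
    case (Suc k)
    then obtain g where g: "g \<in> forms N" "f ^ k * ?v = E g" by blast
    hence "f * E g \<in> E ` forms N" using N unfolding D_def by blast
    also have "f * E g = f ^ Suc k * ?v" using g(2) by (simp flip: g(2))
    finally show ?case .
  qed
  have "finite (range (\<lambda>k. f ^ k * ?v))"
    by (rule finite_subset[of _ "E ` forms N"]) (use fv finite_homogeneous in auto)
  hence "\<not> inj (\<lambda>k. f ^ k * ?v)" using finite_imageD[of "\<lambda>k. f ^ k * ?v" UNIV] by auto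
  then obtain s t where st: "s < t" "f ^ s * ?v = f ^ t * ?v" unfolding inj_def by (metis linorder_neqE_nat)
  hence "f ^ s = f ^ t" using j(2) by simp
  also have "f ^ t = f ^ s * f ^ (t - s)" using st(1) by (simp add: power_add[symmetric])
  finally have "f ^ s * 1 = f ^ s * f ^ (t - s)" by simp
  hence "f ^ (t - s) = 1" using f(2) by (simp only: mult_left_cancel power_not_zero not_False_eq_True)
  thus ?thesis using st(1) by (intro exI[of _ "t - s"]) auto
qed

text \<open>
  The function minus its value at \<open>p\<close> is regular everywhere and vanishes at \<open>p\<close>, which a root of unity
  does not.
\<close>

lemma regular_everywhere_const:
  assumes f: "f \<in> K" and reg: "\<And>p. p \<in> cone \<Longrightarrow> f \<in> Loc p"
    and p: "p \<in> cone" "resv p f \<in> range to_ac"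
  shows "f \<in> cF"
proof -
  obtain c where c: "resv p f = to_ac c" using p(2) by blast
  let ?f = "f - const c"
  have "?f = 0"
  proof (rule ccontr)
    assume nz: "?f \<noteq> 0"
    have "?f \<in> K" using f K_const by (intro K_diff)
    moreover have "?f \<in> Loc y" if "y \<in> cone" for y using reg[OF that] Loc_const that by (intro Loc_diff)
    ultimately obtain k where k: "k > 0" "?f ^ k = 1" using regular_everywhere_root_of_unity nz by blast
    have "resv p ?f = 0" using resv_diff[OF p(1) reg[OF p(1)] Loc_const] c resv_const[OF p(1)] by simp
    hence "resv p (?f ^ k) = 0"
      using resv_power[OF p(1) Loc_diff[OF p(1) reg[OF p(1)] Loc_const]] k(1) by simp
    thus False using k(2) resv_01[OF p(1)] by simp
  qed
  thus ?thesis by simp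
qed

end

section \<open>Orders of functions at the points\<close>

lemma pv_pCons: "ring_emb \<iota> \<Longrightarrow> pv \<iota> (pCons c P) w = \<iota> c + w * pv \<iota> P w"
  by (simp add: pv_def map_poly_pCons ring_emb_0)

locale smooth_curve = one_dim_curve n C for n :: nat and C :: "'a::{field, finite} alg_closure ppoint set" +
  assumes nonsingular: "\<And>P. P \<in> C \<Longrightarrow> nonsingular_at n C P"
begin

lemma chart_Loc:
  assumes p: "p \<in> cone" and G: "G \<in> forms e" "val_at G p \<noteq> 0" and z: "z \<in> chart e G"
  shows "z \<in> Loc p"
proof -
  obtain g l where g: "g \<in> forms (l * e)" "z = E g / E G ^ l" using z unfolding chart_def by blast
  have "E g / E (G ^ l) \<in> Loc p"
    using G by (intro Loc_I[OF g(1) homogeneous_power[OF G(1)]]) (simp add: val_simps)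
  thus ?thesis using g by (simp add: E_simps)
qed

lemma resv_form_quotient:
  assumes p: "p \<in> cone" and G: "G \<in> forms e" "val_at G p \<noteq> 0" and g: "g \<in> forms (l * e)"
  shows "resv p (E g / E G ^ l) = val_at g p / val_at G p ^ l"
  using resv_eq[OF p g homogeneous_power[OF G(1)]] G(2) by (simp add: E_simps val_simps)

lemma K_chart_fraction:
  assumes p: "p \<in> cone" "p j \<noteq> 0" and j: "j \<le> n" and f: "f \<in> K"
  shows "\<exists>a\<in>chart 1 (hvar j). \<exists>s\<in>chart 1 (hvar j). s \<noteq> 0 \<and> f = a / s"
proof -
  obtain g h d where f': "g \<in> forms d" "h \<in> forms d" "E h \<noteq> 0" "f = E g / E h" using f by (rule K_E)
  have nz: "gen j \<noteq> 0" using E_nonzeroI[OF homogeneous_var[OF j] p(1)] p(2) by (simp add: val_simps E_var)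
  have "E g / gen j ^ d \<in> chart 1 (hvar j)" "E h / gen j ^ d \<in> chart 1 (hvar j)"
    unfolding chart_def E_var using f' by auto
  moreover have "f = (E g / gen j ^ d) / (E h / gen j ^ d)" using f' nz by simp
  ultimately show ?thesis using f'(3) nz by (intro bexI[of _ "E g / gen j ^ d"] bexI[of _ "E h / gen j ^ d"]) auto
qed

lemma Loc_chart_fraction:
  assumes p: "p \<in> cone" "p j \<noteq> 0" and j: "j \<le> n" and f: "f \<in> Loc p"
  shows "\<exists>a\<in>chart 1 (hvar j). \<exists>s\<in>chart 1 (hvar j). resv p s \<noteq> 0 \<and> s \<noteq> 0 \<and> f = a / s"
proof -
  obtain g h d where f': "g \<in> forms d" "h \<in> forms d" "val_at h p \<noteq> 0" "f = E g / E h" using f by (rule Loc_E)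
  have nz: "gen j \<noteq> 0" using E_nonzeroI[OF homogeneous_var[OF j] p(1)] p(2) by (simp add: val_simps E_var)
  have hz: "E h \<noteq> 0" using E_nonzeroI p f' by blast
  have "E g / gen j ^ d \<in> chart 1 (hvar j)" "E h / gen j ^ d \<in> chart 1 (hvar j)"
    unfolding chart_def E_var using f' by auto
  moreover have "f = (E g / gen j ^ d) / (E h / gen j ^ d)" using f' nz by simp
  moreover have "resv p (E h / gen j ^ d) = val_at h p / p j ^ d"
    using resv_form_quotient[OF p(1) homogeneous_var[OF j], of h d] f'(2) p(2) by (simp add: E_var val_simps)
  hence "resv p (E h / gen j ^ d) \<noteq> 0" using f'(3) p(2) by simp
  ultimately show ?thesis using hz nz by (intro bexI[of _ "E g / gen j ^ d"] bexI[of _ "E h / gen j ^ d"]) auto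
qed

lemma resv_pv:
  assumes p: "p \<in> cone" and x: "x \<in> Loc p"
  shows "pv const P x \<in> Loc p \<and> resv p (pv const P x) = pv to_ac P (resv p x)"
proof (induction P rule: pCons_induct)
  case 0
  show ?case using p by (simp add: pv_0 Loc_01 resv_01)
next
  case (pCons c P)
  have 1: "x * pv const P x \<in> Loc p" "resv p (x * pv const P x) = resv p x * pv to_ac P (resv p x)"
    using pCons(2) x p by (auto simp: Loc_mult resv_mult)
  have 2: "- const c \<in> Loc p" "resv p (- const c) = - to_ac c"
    using Loc_diff[OF p Loc_01(1) Loc_const] resv_diff[OF p Loc_01(1) Loc_const] resv_const[OF p] resv_01[OF p] by auto
  have "const c + x * pv const P x = x * pv const P x - (- const c)" by simp
  thus ?case
    unfolding pv_pCons[OF ring_emb_const] pv_pCons[OF ring_emb_to_ac]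
    using Loc_diff[OF p 1(1) 2(1)] resv_diff[OF p 1(1) 2(1)] 1(2) 2(2) by (simp add: add.commute)
qed

text \<open>
  If nonzero functions that are regular at \<open>p\<close> had nonzero values there, every function would be regular
  at \<open>p\<close>, and a transcendental function would satisfy the algebraic equation of its value.
\<close>

lemma max_ideal_nonzero:
  assumes p: "p \<in> cone"
  shows "\<exists>f\<in>Mloc p. f \<noteq> 0"
proof (rule ccontr)
  assume "\<not> ?thesis"
  hence triv: "\<And>f. f \<in> Mloc p \<Longrightarrow> f = 0" by blast
  obtain x where x: "x \<in> K" "\<And>q. q \<noteq> 0 \<Longrightarrow> (\<And>i. Polynomial.coeff q i \<in> cF) \<Longrightarrow> poly q x \<noteq> 0"
    by (rule transcendental_element) blast
  obtain j where j: "j \<le> n" "p j \<noteq> 0" using cone_nonzero[OF p] by blast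
  obtain a s where as: "a \<in> chart 1 (hvar j)" "s \<in> chart 1 (hvar j)" "s \<noteq> 0" "x = a / s"
    using K_chart_fraction[OF p j(2,1) x(1)] by blast
  have al: "a \<in> Loc p" "s \<in> Loc p"
    using chart_Loc[OF p homogeneous_var[OF j(1)]] as(1,2) j(2) by (auto simp: val_simps)
  have "resv p s \<noteq> 0" using triv[of s] Mloc_iff[OF p] al(2) as(3) by blast
  hence "inverse s \<in> Loc p" by (rule Loc_inverse[OF p al(2)])
  hence xl: "x \<in> Loc p" using Loc_mult[OF p al(1)] as(4) by (simp add: divide_inverse)
  obtain P :: "'a poly" where P: "P \<noteq> 0" "poly (map_poly to_ac P) (resv p x) = 0" by (rule alg_closure_algebraic)
  have "pv const P x \<in> Mloc p" unfolding Mloc_iff[OF p] using resv_pv[OF p xl, of P] P(2) by (simp add: pv_def)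
  hence 0: "poly (map_poly const P) x = 0" using triv by (simp add: pv_def)
  have "map_poly const P \<noteq> 0"
    using P(1) map_poly_eq_0_iff[of const P] ring_emb_0[OF ring_emb_const] ring_emb_eq_0[OF ring_emb_const]
    by (auto simp: poly_eq_iff coeff_map_poly)
  moreover have "Polynomial.coeff (map_poly const P) i \<in> cF" for i
    by (simp add: coeff_map_poly ring_emb_0[OF ring_emb_const])
  ultimately show False using x(2) 0 by blast
qed

lemma cring_local_ring:
  assumes P: "P \<in> C" "p \<in> P"
  shows "cring (local_ring n C P)"
proof -
  have p: "p \<in> cone" using P unfolding cone_def by blast
  have um: "- x \<in> Loc p" if "x \<in> Loc p" for x using Loc_diff[OF p Loc_01(1) that] by simp
  have "\<exists>y\<in>Loc p. y + x = 0 \<and> x + y = 0" if "x \<in> Loc p" for x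
    using that by (intro bexI[of _ "- x"]) (auto intro: um)
  hence cr: "cring (sub_ring (Loc p))"
    unfolding sub_ring_def
    by (intro cringI abelian_groupI comm_monoidI) (auto simp: Loc_add[OF p] Loc_mult[OF p] Loc_01 algebra_simps)
  have sub: "Loc p \<subseteq> K" by (rule Loc_K[OF p])
  have "phi \<in> ring_iso (sub_ring (Loc p)) (local_ring n C P)"
  proof -
    have sK: "x \<in> K" if "x \<in> Loc p" for x using sub that by blast
    have inj: "inj_on phi (Loc p)" using phi_inj sub by (rule inj_on_subset)
    show ?thesis
      unfolding ring_iso_def ring_hom_def bij_betw_def
      by (simp add: sub_ring_def local_ring_def regular_at_eq[OF P] phi_mult phi_add phi_1 sK inj)
  qed
  from cring.ring_iso_imp_img_cring[OF cr this] have "cring (local_ring n C P\<lparr>zero := phi 0\<rparr>)"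
    by (simp add: sub_ring_def)
  also have "local_ring n C P\<lparr>zero := phi 0\<rparr> = local_ring n C P"
    unfolding phi_0[symmetric] by (simp add: local_ring_def function_field_def)
  finally show ?thesis .
qed

lemma genideal_local:
  assumes P: "P \<in> C" "p \<in> P" and t: "t \<in> Loc p"
  shows "Idl\<^bsub>local_ring n C P\<^esub> {phi t} = phi ` ((*) t ` Loc p)"
proof -
  interpret cring "local_ring n C P" by (rule cring_local_ring[OF P])
  have p: "p \<in> cone" using P unfolding cone_def by blast
  have car: "carrier (local_ring n C P) = phi ` Loc p" by (simp add: local_ring_def regular_at_eq[OF P])
  have "Idl\<^bsub>local_ring n C P\<^esub> {phi t} = PIdl\<^bsub>local_ring n C P\<^esub> (phi t)"
    by (rule cgenideal_eq_genideal[symmetric]) (use car t in blast)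
  also have "\<dots> = {phi x \<otimes>\<^bsub>FF\<^esub> phi t | x. x \<in> Loc p}"
    unfolding cgenideal_def car by (auto simp: local_ring_def)
  also have "\<dots> = phi ` ((*) t ` Loc p)"
    using phi_mult Loc_K[OF p] t by (auto simp: image_iff mult.commute subset_iff)
  finally show ?thesis .
qed

lemma phi_image_eq: "A \<subseteq> K \<Longrightarrow> B \<subseteq> K \<Longrightarrow> phi ` A = phi ` B \<longleftrightarrow> A = B"
  using phi_inj by (rule inj_on_image_eq_iff)

definition uniformizer :: "(nat \<Rightarrow> 'a alg_closure) \<Rightarrow> 'a alg_closure ultrapower \<Rightarrow> bool" where
  "uniformizer p t \<longleftrightarrow> t \<in> Loc p \<and> Mloc p = (*) t ` Loc p"

lemma max_ideal_genideal_iff: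
  assumes P: "P \<in> C" "p \<in> P" and t: "t \<in> Loc p"
  shows "max_ideal_at n C P = Idl\<^bsub>local_ring n C P\<^esub> {phi t} \<longleftrightarrow> uniformizer p t"
proof -
  have p: "p \<in> cone" using P unfolding cone_def by blast
  have "Mloc p \<subseteq> K" "(*) t ` Loc p \<subseteq> K" using Loc_K[OF p] Mloc_iff[OF p] Loc_mult[OF p t] by auto
  thus ?thesis unfolding genideal_local[OF assms] max_ideal_at_eq[OF P] uniformizer_def
    using phi_image_eq t by simp
qed

lemma uniformizer_exists:
  assumes p: "p \<in> cone"
  shows "\<exists>t. uniformizer p t"
proof -
  obtain P where P: "P \<in> C" "p \<in> P" using p unfolding cone_def by blast
  obtain i where i: "i \<in> carrier (local_ring n C P)" "max_ideal_at n C P = Idl\<^bsub>local_ring n C P\<^esub> {i}"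
    using principalideal.generate[OF nonsingular[OF P(1), unfolded nonsingular_at_def]] by blast
  obtain t where t: "t \<in> Loc p" "i = phi t" using i(1) by (auto simp: local_ring_def regular_at_eq[OF P])
  thus ?thesis using max_ideal_genideal_iff[OF P t(1)] i(2) by blast
qed

text \<open>
  An arbitrary choice; \<open>order_at_phi\<close> below shows that the orders do not depend on it.
\<close>

definition unif :: "(nat \<Rightarrow> 'a alg_closure) \<Rightarrow> 'a alg_closure ultrapower" where
  "unif p = (SOME t. uniformizer p t)"

lemma uniformizer_nonzero: "p \<in> cone \<Longrightarrow> uniformizer p t \<Longrightarrow> t \<noteq> 0"
  using max_ideal_nonzero unfolding uniformizer_def by fastforce

lemma uniformizer_unif: "p \<in> cone \<Longrightarrow> uniformizer p (unif p)"
  unfolding unif_def using uniformizer_exists by (rule someI_ex)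

lemma uniformizer_resv: "p \<in> cone \<Longrightarrow> uniformizer p t \<Longrightarrow> resv p t = 0"
proof -
  assume p: "p \<in> cone" and t: "uniformizer p t"
  have "t * 1 \<in> Mloc p" using t Loc_01 unfolding uniformizer_def by blast
  thus ?thesis using Mloc_iff[OF p] by simp
qed

definition loc_unit :: "(nat \<Rightarrow> 'a alg_closure) \<Rightarrow> 'a alg_closure ultrapower \<Rightarrow> bool" where
  "loc_unit p u \<longleftrightarrow> u \<in> Loc p \<and> resv p u \<noteq> 0"

lemma loc_unit_nonzero: "p \<in> cone \<Longrightarrow> loc_unit p u \<Longrightarrow> u \<noteq> 0"
  using resv_01 by (auto simp: loc_unit_def)

lemma loc_unit_mult: "p \<in> cone \<Longrightarrow> loc_unit p u \<Longrightarrow> loc_unit p w \<Longrightarrow> loc_unit p (u * w)"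
  by (auto simp: loc_unit_def Loc_mult resv_mult)

lemma loc_unit_inverse:
  assumes p: "p \<in> cone" and u: "loc_unit p u"
  shows "loc_unit p (inverse u)"
proof -
  have iu: "inverse u \<in> Loc p" using u Loc_inverse[OF p] by (simp add: loc_unit_def)
  have "u * inverse u = 1" using loc_unit_nonzero[OF p u] by simp
  hence "resv p u * resv p (inverse u) = 1"
    using resv_mult[OF p _ iu, of u] u resv_01[OF p] by (simp add: loc_unit_def)
  thus ?thesis using iu by (auto simp: loc_unit_def)
qed

lemma loc_unit_powi: "p \<in> cone \<Longrightarrow> loc_unit p u \<Longrightarrow> loc_unit p (u powi k)"
proof -
  assume p: "p \<in> cone" and u: "loc_unit p u"
  have "loc_unit p 1" using Loc_01 resv_01[OF p] by (simp add: loc_unit_def)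
  hence pow: "loc_unit p (w ^ i)" if "loc_unit p w" for w and i :: nat
    using that by (induction i) (auto intro: loc_unit_mult[OF p])
  show ?thesis using pow[OF u] pow[OF loc_unit_inverse[OF p u]] by (simp add: power_int_def)
qed

lemma unit_iff:
  assumes P: "P \<in> C" "p \<in> P" and z: "z \<in> K"
  shows "phi z \<in> Units (local_ring n C P) \<longleftrightarrow> loc_unit p z"
proof -
  have p: "p \<in> cone" using P unfolding cone_def by blast
  have sub: "Loc p \<subseteq> K" by (rule Loc_K[OF p])
  have car: "carrier (local_ring n C P) = phi ` Loc p" by (simp add: local_ring_def regular_at_eq[OF P])
  have mem: "phi w \<in> phi ` Loc p \<longleftrightarrow> w \<in> Loc p" if "w \<in> K" for w
    using that sub phi_eq_iff by (auto simp: image_iff subset_iff)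
  show ?thesis
  proof
    assume "phi z \<in> Units (local_ring n C P)"
    then obtain w where w: "z \<in> Loc p" "w \<in> Loc p" "phi z \<otimes>\<^bsub>FF\<^esub> phi w = phi 1"
      unfolding Units_def car using mem[OF z] by (auto simp: local_ring_def phi_1)
    hence "z * w = 1" using sub z phi_eq_iff[of "z * w" 1] by (auto simp: phi_mult K_mult K_01 subset_iff)
    hence "resv p z * resv p w = 1" using resv_mult[OF p w(1,2)] resv_01[OF p] by simp
    thus "loc_unit p z" using w(1) by (auto simp: loc_unit_def)
  next
    assume u: "loc_unit p z"
    have i: "inverse z \<in> Loc p" using loc_unit_inverse[OF p u] by (simp add: loc_unit_def)
    have "z * inverse z = 1" using loc_unit_nonzero[OF p u] by simp
    hence "phi z \<otimes>\<^bsub>FF\<^esub> phi (inverse z) = phi 1" "phi (inverse z) \<otimes>\<^bsub>FF\<^esub> phi z = phi 1"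
      using z K_inverse by (simp_all add: phi_mult mult.commute)
    thus "phi z \<in> Units (local_ring n C P)"
      unfolding Units_def car using u i by (auto simp: local_ring_def phi_1 loc_unit_def)
  qed
qed

text \<open>
  Otherwise \<open>f\<close>, and with it its numerator \<open>a\<close> on a chart, is divisible by every power of \<open>t\<close>. The ideals
  \<open>J k\<close> of functions on the chart that are divisible by \<open>t ^ k\<close> then contain the multiples of \<open>a\<close>,
  an ideal of finite index, so two of them coincide. But they are distinguished by the powers of the
  numerator \<open>b\<close> of \<open>t\<close>.
\<close>

lemma Loc_unit_power:
  assumes p: "p \<in> cone" and t: "uniformizer p t" and f: "f \<in> Loc p" "f \<noteq> 0"
  shows "\<exists>u k. loc_unit p u \<and> f = u * t ^ k"
proof (rule ccontr)
  assume no: "\<not> ?thesis"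
  have tl: "t \<in> Loc p" using t by (simp add: uniformizer_def)
  have t0: "t \<noteq> 0" using uniformizer_nonzero p t by blast
  have div: "\<exists>c\<in>Loc p. f = t ^ k * c" for k
  proof (induction k)
    case 0
    show ?case using f by (intro bexI[of _ f]) auto
  next
    case (Suc k)
    then obtain c where c: "c \<in> Loc p" "f = t ^ k * c" by blast
    have "\<not> loc_unit p c" using no c(2) by (metis mult.commute)
    hence "c \<in> Mloc p" using c(1) Mloc_iff[OF p] by (simp add: loc_unit_def)
    then obtain c' where "c' \<in> Loc p" "c = t * c'" using t unfolding uniformizer_def by blast
    thus ?case using c(2) by (intro bexI[of _ c']) (auto simp: mult_ac)
  qed
  obtain j where j: "j \<le> n" "p j \<noteq> 0" using cone_nonzero[OF p] by blast
  let ?A = "chart 1 (hvar j)"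
  have G: "hvar j \<in> forms 1" "val_at (hvar j) p \<noteq> 0" using homogeneous_var[OF j(1)] j(2) by (auto simp: val_simps)
  have EG: "E (hvar j) \<noteq> 0" using E_nonzeroI[OF G(1) p G(2)] .
  have AL: "z \<in> Loc p" if "z \<in> ?A" for z using chart_Loc[OF p G that] .
  obtain a s where as: "a \<in> ?A" "s \<in> ?A" "s \<noteq> 0" "f = a / s" using Loc_chart_fraction[OF p j(2,1) f(1)] by blast
  have a: "a = f * s" "a \<noteq> 0" using as f(2) by auto
  obtain b s0 where b: "b \<in> ?A" "s0 \<in> ?A" "resv p s0 \<noteq> 0" "s0 \<noteq> 0" "t = b / s0" using Loc_chart_fraction[OF p j(2,1) tl] by blast
  obtain T where T: "transversal ?A ((*) a ` ?A) T" using chart_quotient_finite[OF G(1) EG as(1) a(2)] .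
  define J where "J = (\<lambda>k. {z \<in> ?A. \<exists>c\<in>Loc p. z = t ^ k * c})"
  have aJ: "a * z \<in> J k" if z: "z \<in> ?A" for z k
  proof -
    obtain c where c: "c \<in> Loc p" "f = t ^ k * c" using div by blast
    have "a * z = t ^ k * (c * s * z)" using a(1) c(2) by (simp add: mult_ac)
    moreover have "c * s * z \<in> Loc p" using c(1) AL as(2) z by (intro Loc_mult[OF p]) auto
    ultimately show ?thesis using chart_mult[OF as(1) z] unfolding J_def by blast
  qed
  have Jdiff: "z - w \<in> J k" if zw: "z \<in> J k" "w \<in> J k" for z w k
  proof -
    obtain c where "c \<in> Loc p" "z = t ^ k * c" "z \<in> ?A" using zw(1) unfolding J_def by blast
    moreover obtain c' where "c' \<in> Loc p" "w = t ^ k * c'" "w \<in> ?A" using zw(2) unfolding J_def by blast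
    ultimately have "z - w = t ^ k * (c - c')" "c - c' \<in> Loc p" "z - w \<in> ?A"
      using Loc_diff[OF p] chart_diff[OF G(1) EG] by (auto simp: right_diff_distrib)
    thus ?thesis unfolding J_def by blast
  qed
  have "finite (range (\<lambda>k. J k \<inter> T))"
    by (rule finite_subset[of _ "Pow T"]) (use T in \<open>auto simp: transversal_def\<close>)
  hence "\<not> inj (\<lambda>k. J k \<inter> T)" using finite_imageD[of "\<lambda>k. J k \<inter> T" UNIV] by auto
  then obtain k l where kl: "k < l" "J k \<inter> T = J l \<inter> T" unfolding inj_def by (metis linorder_neqE_nat)
  have bA: "b ^ k \<in> ?A" by (rule chart_power[OF b(1)])
  have bk: "b ^ k = t ^ k * s0 ^ k" using b(4,5) by (simp add: power_divide)
  have bJ: "b ^ k \<in> J k" unfolding J_def using bA bk Loc_power[OF p AL[OF b(2)]] by blast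
  obtain \<tau> where \<tau>: "\<tau> \<in> T" "b ^ k - \<tau> \<in> (*) a ` ?A" using T bA unfolding transversal_def by blast
  then obtain z where z: "z \<in> ?A" "b ^ k - \<tau> = a * z" by blast
  have "b ^ k - a * z \<in> J k" by (rule Jdiff[OF bJ aJ[OF z(1)]])
  hence "\<tau> \<in> J k" using z(2) by (simp add: algebra_simps)
  hence \<tau>l: "\<tau> \<in> J l" using kl(2) \<tau>(1) by blast
  have "a * z - (a * 0 - \<tau>) \<in> J l" by (intro Jdiff aJ z \<tau>l chart_01)
  hence "b ^ k \<in> J l" using z(2) by (simp add: algebra_simps)
  then obtain c where c: "c \<in> Loc p" "b ^ k = t ^ l * c" unfolding J_def by blast
  have "t ^ k * s0 ^ k = t ^ k * (t ^ (l - k) * c)"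
    using bk c(2) kl(1) by (simp add: mult.assoc[symmetric] power_add[symmetric])
  hence s0k: "s0 ^ k = t ^ (l - k) * c" using t0 by simp
  have "resv p (t ^ (l - k) * c) = 0"
    using resv_mult[OF p Loc_power[OF p tl] c(1)] resv_power[OF p tl] uniformizer_resv[OF p t] kl(1) by simp
  moreover have "resv p (s0 ^ k) \<noteq> 0" using resv_power[OF p AL[OF b(2)]] b(3) by simp
  ultimately show False using s0k by simp
qed

lemma unit_power_unique:
  assumes p: "p \<in> cone" and t: "uniformizer p t"
    and u: "loc_unit p u" "loc_unit p w" and eq: "u * t powi k = w * t powi l"
  shows "k = l"
proof -
  have t0: "t \<noteq> 0" using uniformizer_nonzero p t by blast
  have tl: "t \<in> Loc p" using t by (simp add: uniformizer_def)
  have False if k: "k < l" and u: "loc_unit p u" "loc_unit p w" and eq: "u * t powi k = w * t powi l" for u w k l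
  proof -
    have "t powi l = t powi k * t powi (l - k)" using t0 by (simp add: power_int_add[symmetric])
    also have "t powi (l - k) = t ^ nat (l - k)" using k by (simp add: power_int_def)
    finally have "t powi k * u = t powi k * (w * t ^ nat (l - k))" using eq by (simp add: mult_ac)
    hence "u = w * t ^ nat (l - k)" using t0 by simp
    hence "resv p u = 0"
      using resv_mult[OF p _ Loc_power[OF p tl], of w] u resv_power[OF p tl] uniformizer_resv[OF p t] k
      by (simp add: loc_unit_def)
    thus False using u by (simp add: loc_unit_def)
  qed
  note less = this
  show ?thesis
  proof (rule ccontr)
    assume "k \<noteq> l"
    then consider "k < l" | "l < k" by linarith
    thus False
      using less[OF _ u(1,2) eq] less[OF _ u(2,1) eq[symmetric]] by cases blast+
  qed
qed

definition ord_p :: "(nat \<Rightarrow> 'a alg_closure) \<Rightarrow> 'a alg_closure ultrapower \<Rightarrow> int" where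
  "ord_p p f = (THE k. \<exists>u. loc_unit p u \<and> f = u * unif p powi k)"

lemma ord_unique:
  assumes p: "p \<in> cone" and "loc_unit p u" "f = u * unif p powi k"
  shows "ord_p p f = k"
  unfolding ord_p_def using assms unit_power_unique[OF p uniformizer_unif[OF p]] by (intro the_equality) blast+

lemma ord_exists:
  assumes p: "p \<in> cone" and f: "f \<in> K" "f \<noteq> 0"
  shows "\<exists>u. loc_unit p u \<and> f = u * unif p powi (ord_p p f)"
proof -
  obtain j where j: "j \<le> n" "p j \<noteq> 0" using cone_nonzero[OF p] by blast
  let ?A = "chart 1 (hvar j)"
  have G: "hvar j \<in> forms 1" "val_at (hvar j) p \<noteq> 0" using homogeneous_var[OF j(1)] j(2) by (auto simp: val_simps)
  obtain a s where as: "a \<in> ?A" "s \<in> ?A" "s \<noteq> 0" "f = a / s" using K_chart_fraction[OF p j(2,1) f(1)] by blast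
  note t = uniformizer_unif[OF p]
  have "a \<noteq> 0" using as f(2) by auto
  then obtain u k where u: "loc_unit p u" "a = u * unif p ^ k" using Loc_unit_power[OF p t chart_Loc[OF p G as(1)]] by blast
  obtain w l where w: "loc_unit p w" "s = w * unif p ^ l" using Loc_unit_power[OF p t chart_Loc[OF p G as(2)] as(3)] by blast
  have t0: "unif p \<noteq> 0" using uniformizer_nonzero[OF p t] .
  have feq: "f = (u * inverse w) * unif p powi (int k - int l)"
    unfolding as(4) u(2) w(2) using t0 by (simp add: power_int_diff field_simps)
  have un: "loc_unit p (u * inverse w)" using u(1) w(1) by (intro loc_unit_mult[OF p] loc_unit_inverse[OF p])
  show ?thesis unfolding ord_unique[OF p un feq] using un feq by blast
qed

lemma ord_mult:
  assumes p: "p \<in> cone" and "f \<in> K" "f \<noteq> 0" "g \<in> K" "g \<noteq> 0"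
  shows "ord_p p (f * g) = ord_p p f + ord_p p g"
proof -
  have t0: "unif p \<noteq> 0" using uniformizer_nonzero[OF p uniformizer_unif[OF p]] .
  obtain u where u: "loc_unit p u" "f = u * unif p powi (ord_p p f)" using ord_exists[OF p assms(2,3)] by blast
  obtain w where w: "loc_unit p w" "g = w * unif p powi (ord_p p g)" using ord_exists[OF p assms(4,5)] by blast
  have "f * g = (u * unif p powi (ord_p p f)) * (w * unif p powi (ord_p p g))" using u(2) w(2) by simp
  also have "\<dots> = (u * w) * unif p powi (ord_p p f + ord_p p g)"
    using t0 by (simp add: power_int_add mult_ac)
  finally show ?thesis by (rule ord_unique[OF p loc_unit_mult[OF p u(1) w(1)]])
qed

lemma ord_loc_unit: "p \<in> cone \<Longrightarrow> loc_unit p u \<Longrightarrow> ord_p p u = 0"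
  by (rule ord_unique[of p u]) auto

lemma Loc_iff_ord:
  assumes p: "p \<in> cone" and f: "f \<in> K" "f \<noteq> 0"
  shows "f \<in> Loc p \<longleftrightarrow> 0 \<le> ord_p p f"
proof
  note t = uniformizer_unif[OF p]
  assume "f \<in> Loc p"
  then obtain u k where u: "loc_unit p u" "f = u * unif p ^ k" using Loc_unit_power[OF p t _ f(2)] by blast
  have "f = u * unif p powi int k" using u(2) by simp
  from ord_unique[OF p u(1) this] have "ord_p p f = int k" .
  thus "0 \<le> ord_p p f" by simp
next
  assume 0: "0 \<le> ord_p p f"
  obtain u where u: "loc_unit p u" "f = u * unif p powi (ord_p p f)" using ord_exists[OF p f] by blast
  have "unif p \<in> Loc p" using uniformizer_unif[OF p] by (simp add: uniformizer_def)
  hence "u * unif p ^ nat (ord_p p f) \<in> Loc p" using u(1) by (intro Loc_mult[OF p] Loc_power[OF p]) (auto simp: loc_unit_def)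
  thus "f \<in> Loc p" using u(2) 0 by (simp add: power_int_def)
qed

lemma ord_inverse:
  assumes p: "p \<in> cone" and f: "f \<in> K" "f \<noteq> 0"
  shows "ord_p p (inverse f) = - ord_p p f"
proof -
  have "loc_unit p 1" using Loc_01 resv_01[OF p] by (simp add: loc_unit_def)
  hence "ord_p p 1 = 0" by (rule ord_loc_unit[OF p])
  moreover have "ord_p p (f * inverse f) = ord_p p f + ord_p p (inverse f)"
    using f by (intro ord_mult[OF p] K_inverse) auto
  ultimately show ?thesis using f by simp
qed

lemma ord_divide:
  assumes p: "p \<in> cone" and "f \<in> K" "f \<noteq> 0" "g \<in> K" "g \<noteq> 0"
  shows "ord_p p (f / g) = ord_p p f - ord_p p g"
  using ord_mult[OF p assms(2,3) K_inverse[OF assms(4)]] ord_inverse[OF p assms(4,5)] assms(5)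
  by (simp add: divide_inverse)

lemma ord_le_iff:
  assumes p: "p \<in> cone" and "f \<in> K" "f \<noteq> 0" "g \<in> K" "g \<noteq> 0"
  shows "ord_p p g \<le> ord_p p f \<longleftrightarrow> f / g \<in> Loc p"
  using Loc_iff_ord[OF p K_divide[OF assms(2,4)]] ord_divide[OF assms] assms by simp

lemma Mloc_iff_ord:
  assumes p: "p \<in> cone" and f: "f \<in> K" "f \<noteq> 0"
  shows "f \<in> Mloc p \<longleftrightarrow> 0 < ord_p p f"
proof -
  have "f \<in> Loc p \<Longrightarrow> resv p f \<noteq> 0 \<longleftrightarrow> ord_p p f = 0"
  proof
    assume "f \<in> Loc p" "resv p f \<noteq> 0"
    thus "ord_p p f = 0" using ord_loc_unit[OF p] by (simp add: loc_unit_def)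
  next
    assume "f \<in> Loc p" "ord_p p f = 0"
    thus "resv p f \<noteq> 0" using ord_exists[OF p f] by (auto simp: loc_unit_def)
  qed
  thus ?thesis using Mloc_iff[OF p] Loc_iff_ord[OF p f] by force
qed

lemma ord_diff:
  assumes p: "p \<in> cone" and f: "f \<in> K" "f \<noteq> 0" and g: "g \<in> K" "g \<noteq> 0" and ne: "f \<noteq> g"
  shows "min (ord_p p f) (ord_p p g) \<le> ord_p p (f - g)"
proof -
  have main: "ord_p p g \<le> ord_p p (f - g)" if f: "f \<in> K" "f \<noteq> 0" and g: "g \<in> K" "g \<noteq> 0" and ne: "f \<noteq> g"
    and le: "ord_p p g \<le> ord_p p f" for f g
  proof -
    have "f / g \<in> Loc p" using le ord_le_iff[OF p f g] by simp
    hence "f / g - 1 \<in> Loc p" using Loc_diff[OF p _ Loc_01(2)] by blast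
    hence "(f - g) / g \<in> Loc p" using g by (simp add: diff_divide_distrib)
    thus ?thesis using ord_le_iff[OF p K_diff[OF f(1) g(1)] _ g] ne by simp
  qed
  show ?thesis
  proof (cases "ord_p p g \<le> ord_p p f")
    case True
    from main[OF f g ne this] show ?thesis by simp
  next
    case False
    have "- 1 \<in> K" using K_01 K_uminus by blast
    moreover have "loc_unit p (- 1)"
      using Loc_diff[OF p Loc_01] resv_diff[OF p Loc_01] resv_01[OF p] by (simp add: loc_unit_def)
    ultimately have "ord_p p (- 1 * (g - f)) = ord_p p (g - f)"
      using ord_mult[OF p, of "- 1" "g - f"] ord_loc_unit[OF p] K_diff[OF g(1) f(1)] ne by simp
    moreover have "- 1 * (g - f) = f - g" by simp
    ultimately show ?thesis using main[OF g f ne[symmetric]] False by simp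
  qed
qed

text \<open>
  The constant is the value of \<open>f / g\<close> at \<open>p\<close>.
\<close>

lemma ord_residue:
  assumes p: "p \<in> cone" and rat: "\<And>f. f \<in> Loc p \<Longrightarrow> resv p f \<in> range to_ac"
    and f: "f \<in> K" "f \<noteq> 0" and g: "g \<in> K" "g \<noteq> 0" and eq: "ord_p p f = ord_p p g"
  shows "\<exists>c\<in>cF. f = c * g \<or> ord_p p f < ord_p p (f - c * g)"
proof -
  have fg: "f / g \<in> Loc p" using ord_le_iff[OF p f g] eq by simp
  obtain c where c: "resv p (f / g) = to_ac c" using rat[OF fg] by blast
  have "f = const c * g \<or> ord_p p f < ord_p p (f - const c * g)"
  proof (cases "f = const c * g")
    case False
    have K': "f - const c * g \<in> K" using f g K_const by (intro K_diff K_mult)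
    have "f / g - const c \<in> Mloc p"
      unfolding Mloc_iff[OF p] using Loc_diff[OF p fg Loc_const] resv_diff[OF p fg Loc_const] c resv_const[OF p] by simp
    moreover have "f / g - const c = (f - const c * g) / g" using g by (simp add: field_simps)
    moreover have "(f - const c * g) / g \<in> K" "(f - const c * g) / g \<noteq> 0" using K' g False K_divide by auto
    ultimately have "0 < ord_p p ((f - const c * g) / g)" using Mloc_iff_ord[OF p] by simp
    thus ?thesis using ord_divide[OF p K' _ g] False eq by simp
  qed simp
  thus ?thesis by blast
qed

text \<open>
  Two uniformizers differ by a unit, so the representation in the definition of the order yields the same
  exponent for each of them.
\<close>

lemma order_at_phi:
  assumes P: "P \<in> C" "p \<in> P" and f: "f \<in> K" "f \<noteq> 0"
  shows "order_at n C P (phi f) = ord_p p f"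
proof -
  have p: "p \<in> cone" using P unfolding cone_def by blast
  have sub: "Loc p \<subseteq> K" by (rule Loc_K[OF p])
  note t = uniformizer_unif[OF p]
  have t0: "unif p \<noteq> 0" using uniformizer_nonzero[OF p t] .
  have tl: "unif p \<in> Loc p" using t by (simp add: uniformizer_def)
  have powK: "z powi k \<in> K" if "z \<in> K" for z and k :: int
    using that by (simp add: power_int_def K_power K_inverse)
  show ?thesis
    unfolding order_at_def
  proof (rule the_equality)
    obtain u where u: "loc_unit p u" "f = u * unif p powi (ord_p p f)" using ord_exists[OF p f] by blast
    have uK: "u \<in> K" using u(1) sub by (auto simp: loc_unit_def)
    have tK: "unif p \<in> K" using tl sub by blast
    have "phi f = phi u \<otimes>\<^bsub>FF\<^esub> (phi (unif p) [^]\<^bsub>FF\<^esub> ord_p p f)"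
      using phi_mult[OF uK powK[OF tK]] phi_int_pow[OF tK t0] u(2) by simp
    moreover have "phi (unif p) \<in> regular_at n C P" using tl by (simp add: regular_at_eq[OF P])
    moreover have "phi u \<in> Units (local_ring n C P)" using unit_iff[OF P uK] u(1) by simp
    moreover have "max_ideal_at n C P = Idl\<^bsub>local_ring n C P\<^esub> {phi (unif p)}"
      using max_ideal_genideal_iff[OF P tl] t by simp
    ultimately show "\<exists>t\<in>regular_at n C P. \<exists>u\<in>Units (local_ring n C P).
        max_ideal_at n C P = Idl\<^bsub>local_ring n C P\<^esub> {t} \<and> phi f = u \<otimes>\<^bsub>FF\<^esub> (t [^]\<^bsub>FF\<^esub> ord_p p f)" by blast
  next
    fix k :: int
    assume "\<exists>t\<in>regular_at n C P. \<exists>u\<in>Units (local_ring n C P).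
        max_ideal_at n C P = Idl\<^bsub>local_ring n C P\<^esub> {t} \<and> phi f = u \<otimes>\<^bsub>FF\<^esub> (t [^]\<^bsub>FF\<^esub> k)"
    then obtain t' u' where *: "t' \<in> regular_at n C P" "u' \<in> Units (local_ring n C P)"
      "max_ideal_at n C P = Idl\<^bsub>local_ring n C P\<^esub> {t'}" "phi f = u' \<otimes>\<^bsub>FF\<^esub> (t' [^]\<^bsub>FF\<^esub> k)" by blast
    obtain t1 where t1: "t1 \<in> Loc p" "t' = phi t1" using *(1) by (auto simp: regular_at_eq[OF P])
    have un1: "uniformizer p t1" using *(3) max_ideal_genideal_iff[OF P t1(1)] t1(2) by simp
    have "u' \<in> carrier (local_ring n C P)" using *(2) by (simp add: Units_def)
    then obtain u where u: "u \<in> Loc p" "u' = phi u" by (auto simp: local_ring_def regular_at_eq[OF P])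
    have uK: "u \<in> K" "t1 \<in> K" using u t1 sub by auto
    have uu: "loc_unit p u" using unit_iff[OF P uK(1)] *(2) u(2) by simp
    have t10: "t1 \<noteq> 0" using uniformizer_nonzero[OF p un1] .
    have "phi f = phi (u * t1 powi k)" using *(4) u(2) t1(2) phi_int_pow[OF uK(2) t10] phi_mult[OF uK(1) powK[OF uK(2)]] by simp
    hence feq: "f = u * t1 powi k" using phi_eq_iff[OF f(1)] K_mult[OF uK(1) powK[OF uK(2)]] by blast
    have "t1 * 1 \<in> Mloc p" using un1 Loc_01 unfolding uniformizer_def by blast
    then obtain w where w: "w \<in> Loc p" "t1 = unif p * w" using t unfolding uniformizer_def by auto
    have "unif p * 1 \<in> Mloc p" using t Loc_01 unfolding uniformizer_def by blast
    then obtain w' where w': "w' \<in> Loc p" "unif p = t1 * w'" using un1 unfolding uniformizer_def by auto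
    have "t1 * (w * w') = t1 * 1" using w(2) w'(2) by (metis mult.assoc mult.commute mult_1_right)
    hence "w * w' = 1" using t10 by simp
    hence "resv p w * resv p w' = 1" using resv_mult[OF p w(1) w'(1)] resv_01[OF p] by simp
    hence wu: "loc_unit p w" using w(1) by (auto simp: loc_unit_def)
    have "f = (u * w powi k) * unif p powi k"
      unfolding feq w(2) by (simp add: power_int_mult_distrib mult_ac)
    from ord_unique[OF p loc_unit_mult[OF p uu loc_unit_powi[OF p wu]] this] show "k = ord_p p f" by simp
  qed
qed

end

section \<open>Forms without common zeros\<close>

text \<open>
  On \<open>{0, 1}\<close> the polynomial \<open>a\<^sup>2 + b\<^sup>2 - a b\<close> computes the disjunction. Iterating it on the \<open>N\<close>-th
  powers of the coordinates gives a form of degree \<open>2 ^ k * N\<close> that detects whether one of the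
  coordinates up to the \<open>k\<close>-th is nonzero, provided that their \<open>N\<close>-th powers are \<open>0\<close> or \<open>1\<close>.
\<close>

primrec or_form :: "nat \<Rightarrow> nat \<Rightarrow> 'a::field mpoly" where
  "or_form N 0 = hvar 0 ^ N"
| "or_form N (Suc k) =
     or_form N k ^ 2 + hvar (Suc k) ^ (2 * (2 ^ k * N)) - or_form N k * hvar (Suc k) ^ (2 ^ k * N)"

lemma or_form_homogeneous: "k \<le> n \<Longrightarrow> (or_form N k :: 'a::field mpoly) \<in> homogeneous n (2 ^ k * N)"
proof (induction k)
  case 0
  show ?case using homogeneous_power[OF homogeneous_var[of 0 n], of N] by simp
next
  case (Suc k)
  let ?d = "2 ^ k * N"
  have 1: "(or_form N k :: 'a mpoly) ^ 2 \<in> homogeneous n (2 * ?d)"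
    using Suc by (intro homogeneous_power) auto
  have v: "(hvar (Suc k) :: 'a mpoly) ^ i \<in> homogeneous n i" for i
    using homogeneous_power[OF homogeneous_var[OF Suc.prems], of i] by simp
  have 2: "or_form N k * (hvar (Suc k) :: 'a mpoly) ^ ?d \<in> homogeneous n (2 * ?d)"
    using homogeneous_mult[OF _ v, of "or_form N k" ?d ?d] Suc by (simp add: mult_2)
  show ?case using homogeneous_diff[OF homogeneous_add[OF 1 v] 2] by (simp add: mult.assoc)
qed

lemma or_form_value:
  assumes \<iota>: "ring_emb \<iota>" and N: "N > 0" and z: "\<And>i. i \<le> k \<Longrightarrow> z i ^ N = 0 \<or> z i ^ N = 1"
  shows "ev \<iota> (or_form N k) z = of_bool (\<exists>i\<le>k. z i \<noteq> 0)"
  using z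
proof (induction k)
  case 0
  thus ?case using N by (auto simp: ev_power[OF \<iota>] ev_var[OF \<iota>])
next
  case (Suc k)
  have IH: "ev \<iota> (or_form N k) z = of_bool (\<exists>i\<le>k. z i \<noteq> 0)" using Suc by simp
  have B: "z (Suc k) ^ (2 ^ k * N) = of_bool (z (Suc k) \<noteq> 0)"
  proof -
    have "z (Suc k) ^ (2 ^ k * N) = (z (Suc k) ^ N) ^ (2 ^ k)" by (simp add: power_mult[symmetric] mult.commute)
    moreover have "z (Suc k) ^ N = of_bool (z (Suc k) \<noteq> 0)" using Suc.prems[of "Suc k"] N by auto
    ultimately show ?thesis by simp
  qed
  have B2: "z (Suc k) ^ (2 * (2 ^ k * N)) = of_bool (z (Suc k) \<noteq> 0)"
    using B by (simp add: power_mult mult.commute[of 2])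
  have "ev \<iota> (or_form N (Suc k)) z =
      (of_bool (\<exists>i\<le>k. z i \<noteq> 0))\<^sup>2 + of_bool (z (Suc k) \<noteq> 0) - of_bool (\<exists>i\<le>k. z i \<noteq> 0) * of_bool (z (Suc k) \<noteq> 0)"
    unfolding or_form.simps ev_diff[OF \<iota>] ev_add[OF \<iota>] ev_mult[OF \<iota>] ev_power[OF \<iota>] ev_var[OF \<iota>] IH B B2 ..
  also have "\<dots> = of_bool (\<exists>i\<le>Suc k. z i \<noteq> 0)"
    by (cases "\<exists>i\<le>k. z i \<noteq> 0"; cases "z (Suc k) \<noteq> 0") (auto simp: le_Suc_eq)
  finally show ?case .
qed

section \<open>The Riemann inequality\<close>

locale pointed_curve = smooth_curve n C for n :: nat and C :: "'a::{field, finite} alg_closure ppoint set" +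
  fixes m :: nat and Q :: "nat \<Rightarrow> 'a alg_closure ppoint"
  assumes Q_C: "\<And>i. i \<in> {1..m} \<Longrightarrow> Q i \<in> C"
    and Q_rational: "\<And>i. i \<in> {1..m} \<Longrightarrow> rational_point (Q i)"
    and Q_inj: "inj_on Q {1..m}"
    and two_points: "2 \<le> m" and card_field: "m \<le> card (UNIV :: 'a set)"
begin

definition base_rep :: "nat \<Rightarrow> nat \<Rightarrow> 'a" where
  "base_rep i = (SOME y. (\<lambda>k. to_ac (y k)) \<in> Q i)"

definition qrep :: "nat \<Rightarrow> nat \<Rightarrow> 'a alg_closure" where
  "qrep i = (\<lambda>k. to_ac (base_rep i k))"

lemma qrep_Q: "i \<in> {1..m} \<Longrightarrow> qrep i \<in> Q i"
  unfolding qrep_def base_rep_def using Q_rational[of i] unfolding rational_point_def by (rule someI_ex)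

lemma qrep_cone: "i \<in> {1..m} \<Longrightarrow> qrep i \<in> cone"
  unfolding cone_def using qrep_Q Q_C by blast

lemma val_at_qrep: "val_at g (qrep i) \<in> range to_ac"
proof -
  have "val_at g (qrep i) = to_ac (ev (\<lambda>c. c) g (base_rep i))"
    by (simp add: ev_def monomial_at_def qrep_def to_ac_sum to_ac_prod)
  thus ?thesis by blast
qed

lemma resv_qrep: "i \<in> {1..m} \<Longrightarrow> f \<in> Loc (qrep i) \<Longrightarrow> resv (qrep i) f \<in> range to_ac"
proof -
  assume i: "i \<in> {1..m}" and "f \<in> Loc (qrep i)"
  then obtain g h d where "g \<in> forms d" "h \<in> forms d" "val_at h (qrep i) \<noteq> 0" "f = E g / E h" by (blast elim: Loc_E)
  hence eq: "resv (qrep i) f = val_at g (qrep i) / val_at h (qrep i)" using resv_eq[OF qrep_cone[OF i]] by simp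
  obtain a where a: "val_at g (qrep i) = to_ac a" using val_at_qrep[of g i] by (rule rangeE)
  obtain b where b: "val_at h (qrep i) = to_ac b" using val_at_qrep[of h i] by (rule rangeE)
  have "resv (qrep i) f = to_ac (a / b)" unfolding eq a b by simp
  thus ?thesis by (rule range_eqI)
qed

lemma same_point:
  assumes "P \<in> C" "P' \<in> C" "p \<in> P" "p \<in> P'"
  shows "P = P'"
  using point_rep(3)[of P p] point_rep(3)[of P' p] C_proj assms by blast

lemma Loc_same_point: "P \<in> C \<Longrightarrow> p \<in> P \<Longrightarrow> p' \<in> P \<Longrightarrow> Loc p = Loc p'"
proof -
  assume P: "P \<in> C" "p \<in> P" "p' \<in> P"
  hence "p \<in> cone" "p' \<in> cone" unfolding cone_def by auto
  moreover have "phi ` Loc p = phi ` Loc p'" using regular_at_eq[OF P(1,2)] regular_at_eq[OF P(1,3)] by simp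
  ultimately show ?thesis using phi_image_eq[OF Loc_K Loc_K] by simp
qed

text \<open>
  If all linear forms \<open>y\<^sub>b x\<^sub>a - y\<^sub>a x\<^sub>b\<close> that vanish at the point with coordinates \<open>y\<close> also vanish
  at \<open>p\<close>, then \<open>p\<close> is proportional to \<open>y\<close>. These forms have coefficients in the ground field
  because the point is rational.
\<close>

lemma separating_form:
  assumes i: "i \<in> {1..m}" and p: "p \<in> cone" "p \<notin> Q i"
  shows "\<exists>g\<in>forms 1. val_at g (qrep i) = 0 \<and> val_at g p \<noteq> 0"
proof (rule ccontr)
  assume no: "\<not> ?thesis"
  obtain b where b: "b \<le> n" "qrep i b \<noteq> 0" using cone_nonzero[OF qrep_cone[OF i]] by blast
  have eq: "qrep i b * p a = qrep i a * p b" if a: "a \<le> n" for a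
  proof -
    let ?g = "Poly_Mapping.single 0 (base_rep i b) * hvar a - Poly_Mapping.single 0 (base_rep i a) * hvar b"
    have "?g \<in> forms 1" using a b(1) by (intro homogeneous_diff homogeneous_scale homogeneous_var)
    moreover have "val_at ?g (qrep i) = 0" by (simp add: val_simps qrep_def)
    ultimately have "val_at ?g p = 0" using no by blast
    thus ?thesis by (simp add: val_simps qrep_def)
  qed
  obtain P where P: "P \<in> C" "p \<in> P" using p(1) unfolding cone_def by blast
  have Pp: "P \<in> proj_space n" "Q i \<in> proj_space n" using P Q_C[OF i] C_proj by auto
  have out: "p a = 0 \<and> qrep i a = 0" if "\<not> a \<le> n" for a
    using point_rep(2)[OF Pp(1) P(2)] point_rep(2)[OF Pp(2) qrep_Q[OF i]] that by simp
  have pe: "p = (\<lambda>a. (p b / qrep i b) * qrep i a)"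
  proof
    fix a
    show "p a = (p b / qrep i b) * qrep i a"
      using eq[of a] out[of a] b(2) by (cases "a \<le> n") (auto simp: field_simps)
  qed
  have "p b \<noteq> 0"
  proof
    assume "p b = 0"
    hence "p = (\<lambda>_. 0)" using pe by simp
    thus False using point_rep(1)[OF Pp(1) P(2)] by simp
  qed
  hence "p \<in> Q i"
  proof -
    have "p b / qrep i b \<noteq> 0" using b(2) \<open>p b \<noteq> 0\<close> by simp
    moreover note pe
    ultimately show ?thesis unfolding point_rep(3)[OF Pp(2) qrep_Q[OF i]] by blast
  qed
  thus False using p(2) by blast
qed

text \<open>
  A product of linear forms. Each factor vanishes at one of the points and, as there are at least two
  points, not at all of \<open>C\<close>.
\<close>

lemma vanishing_form: "\<exists>h\<in>forms m. E h \<noteq> 0 \<and> (\<forall>i\<in>{1..m}. val_at h (qrep i) = 0)"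
proof -
  have "\<exists>g\<in>forms 1. val_at g (qrep i) = 0 \<and> nonvanishing g" if i: "i \<in> {1..m}" for i
  proof -
    obtain k where k: "k \<in> {1..m}" "k \<noteq> i" using two_points by (cases "i = 1") (auto intro: that[of 1] that[of 2])
    have "Q i \<noteq> Q k" using inj_onD[OF Q_inj _ i k(1)] k(2) by metis
    hence "qrep k \<notin> Q i"
      using same_point[OF Q_C[OF i] Q_C[OF k(1)] _ qrep_Q[OF k(1)]] by blast
    thus ?thesis using separating_form[OF i qrep_cone[OF k(1)]] qrep_cone[OF k(1)] unfolding nonvanishing_def by blast
  qed
  then obtain g where g: "\<And>i. i \<in> {1..m} \<Longrightarrow> g i \<in> forms 1 \<and> val_at (g i) (qrep i) = 0 \<and> nonvanishing (g i)" by metis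
  let ?h = "\<Prod>i\<in>{1..m}. g i"
  have h: "?h \<in> forms m" using homogeneous_prod[of "{1..m}" g n "\<lambda>_. 1"] g by simp
  have "nonvanishing ?h" using g by (intro nonvanishing_prod[of _ _ "\<lambda>_. 1"]) auto
  hence "E ?h \<noteq> 0" using E_nonzero_iff[OF h] by simp
  moreover have "val_at ?h (qrep i) = 0" if "i \<in> {1..m}" for i using g[OF that] that by (auto simp: val_simps)
  ultimately show ?thesis using h by blast
qed

text \<open>
  The chart of the \<open>j\<close>-th coordinate is finite modulo \<open>h\<close>, so two powers of the coordinate quotient are
  congruent modulo \<open>h\<close>, and their values agree at all zeros of \<open>h\<close>.
\<close>

lemma zeros_roots_of_unity:
  assumes h: "h \<in> forms d" "E h \<noteq> 0" and j: "j \<le> n" and k: "k \<le> n"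
  shows "\<exists>N>0. \<forall>p\<in>cone. val_at h p = 0 \<longrightarrow> p j \<noteq> 0 \<longrightarrow> p k / p j = 0 \<or> (p k / p j) ^ N = 1"
proof (cases "gen j = 0")
  case True
  have "p j = 0" if "p \<in> cone" for p
    using E_nonzeroI[OF homogeneous_var[OF j] that] True by (auto simp: E_var val_simps)
  thus ?thesis by (intro exI[of _ 1]) auto
next
  case False
  let ?A = "chart 1 (hvar j)"
  have G: "hvar j \<in> forms 1" "E (hvar j) \<noteq> 0" using homogeneous_var[OF j] False by (auto simp: E_var)
  let ?a = "E h / E (hvar j) ^ d" and ?u = "E (hvar k) / E (hvar j) ^ 1"
  have a: "?a \<in> ?A" "?a \<noteq> 0" using h G unfolding chart_def by auto
  have u: "?u \<in> ?A" unfolding chart_def using homogeneous_var[OF k] by (intro CollectI exI[of _ "hvar k"] exI[of _ 1]) simp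
  obtain T where T: "transversal ?A ((*) ?a ` ?A) T" using chart_quotient_finite[OF G a] .
  have "\<forall>i. \<exists>t\<in>T. ?u ^ i - t \<in> (*) ?a ` ?A" using T chart_power[OF u] unfolding transversal_def by blast
  then obtain t where t: "\<And>i. t i \<in> T" "\<And>i. ?u ^ i - t i \<in> (*) ?a ` ?A" by metis
  have "finite (range t)" by (rule finite_subset[of _ T]) (use t T in \<open>auto simp: transversal_def\<close>)
  hence "\<not> inj t" using finite_imageD[of t UNIV] by auto
  then obtain r s where rs: "r < s" "t r = t s" unfolding inj_def by (metis linorder_neqE_nat)
  obtain b c where bc: "b \<in> ?A" "c \<in> ?A" "?u ^ r - t r = ?a * b" "?u ^ s - t s = ?a * c" using t(2)[of r] t(2)[of s] by blast
  have "?u ^ r - ?u ^ s = (?u ^ r - t r) - (?u ^ s - t s)" using rs(2) by simp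
  hence diff: "?u ^ r - ?u ^ s = ?a * (b - c)" unfolding bc(3,4) right_diff_distrib .
  have "p k / p j = 0 \<or> (p k / p j) ^ (s - r) = 1" if p: "p \<in> cone" "val_at h p = 0" "p j \<noteq> 0" for p
  proof -
    have vj: "val_at (hvar j) p \<noteq> 0" using p(3) by (simp add: val_simps)
    have AL: "z \<in> Loc p" if "z \<in> ?A" for z using chart_Loc[OF p(1) G(1) vj that] .
    have "resv p ?a = 0" using resv_form_quotient[OF p(1) G(1) vj, of h d] h(1) p(2) by simp
    hence "resv p (?a * (b - c)) = 0" using resv_mult[OF p(1) AL[OF a(1)] Loc_diff[OF p(1) AL[OF bc(1)] AL[OF bc(2)]]] by simp
    moreover have "resv p (?u ^ r - ?u ^ s) = resv p ?u ^ r - resv p ?u ^ s"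
      using resv_diff[OF p(1)] resv_power[OF p(1)] Loc_power[OF p(1)] AL[OF u] by simp
    moreover have "resv p ?u = p k / p j"
      using resv_form_quotient[OF p(1) G(1) vj, of "hvar k" 1] homogeneous_var[OF k] by (simp add: val_simps)
    ultimately have eq: "(p k / p j) ^ r = (p k / p j) ^ s" using diff by simp
    also have "(p k / p j) ^ s = (p k / p j) ^ r * (p k / p j) ^ (s - r)" using rs(1) by (simp add: power_add[symmetric])
    finally have "(p k / p j) ^ r = 0 \<or> (p k / p j) ^ (s - r) = 1" by auto
    thus ?thesis by auto
  qed
  thus ?thesis using rs(1) by (intro exI[of _ "s - r"]) auto
qed

text \<open>
  At the zeros of a form \<open>h\<close> through all the points, the normalized coordinates are \<open>0\<close> or roots of unity
  of bounded order, so an instance of \<open>or_form\<close> has no zero there. Taking powers makes the degrees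
  equal.
\<close>

lemma forms_without_common_zero:
  "\<exists>e G H. e > 0 \<and> G \<in> forms e \<and> H \<in> forms e \<and> E H \<noteq> 0 \<and> (\<forall>i\<in>{1..m}. val_at H (qrep i) = 0) \<and>
     (\<forall>p\<in>cone. val_at H p = 0 \<longrightarrow> val_at G p \<noteq> 0)"
proof -
  obtain h where h: "h \<in> forms m" "E h \<noteq> 0" "\<forall>i\<in>{1..m}. val_at h (qrep i) = 0" using vanishing_form by blast
  have "\<forall>j k. \<exists>N>0. j \<le> n \<longrightarrow> k \<le> n \<longrightarrow>
      (\<forall>p\<in>cone. val_at h p = 0 \<longrightarrow> p j \<noteq> 0 \<longrightarrow> p k / p j = 0 \<or> (p k / p j) ^ N = 1)"
    using zeros_roots_of_unity[OF h(1,2)] by (metis zero_less_one)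
  then obtain N where N: "\<And>j k. N j k > 0" "\<And>j k p. j \<le> n \<Longrightarrow> k \<le> n \<Longrightarrow> p \<in> cone \<Longrightarrow> val_at h p = 0 \<Longrightarrow>
      p j \<noteq> 0 \<Longrightarrow> p k / p j = 0 \<or> (p k / p j) ^ N j k = 1" by metis
  define M where "M = (\<Prod>(j, k)\<in>{..n} \<times> {..n}. N j k)"
  have M0: "M > 0" unfolding M_def using N(1) by (auto intro!: prod_pos)
  have dvd: "N j k dvd M" if "j \<le> n" "k \<le> n" for j k
    unfolding M_def using that dvd_prodI[of "{..n} \<times> {..n}" "(j, k)" "\<lambda>(j, k). N j k"] by simp
  let ?d = "2 ^ n * M"
  let ?G0 = "or_form M n :: 'a mpoly"
  have G0: "?G0 \<in> forms ?d" by (rule or_form_homogeneous) simp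
  have G0_nz: "val_at ?G0 p \<noteq> 0" if p: "p \<in> cone" "val_at h p = 0" for p
  proof -
    obtain j where j: "j \<le> n" "p j \<noteq> 0" using cone_nonzero[OF p(1)] by blast
    let ?z = "\<lambda>k. p k / p j"
    have "?z k ^ M = 0 \<or> ?z k ^ M = 1" if k: "k \<le> n" for k
    proof -
      obtain c where c: "M = N j k * c" using dvd[OF j(1) k] by (elim dvdE)
      show ?thesis using N(2)[OF j(1) k p j(2)]
      proof
        assume "?z k ^ N j k = 1"
        thus ?thesis unfolding c power_mult by simp
      qed (use M0 in simp)
    qed
    hence "val_at ?G0 ?z = of_bool (\<exists>i\<le>n. ?z i \<noteq> 0)" by (rule or_form_value[OF ring_emb_to_ac M0])
    also have "\<dots> = 1" using j by auto
    finally have "val_at ?G0 ?z = 1" .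
    moreover have "val_at ?G0 (\<lambda>k. p j * ?z k) = p j ^ ?d * val_at ?G0 ?z" by (rule ev_scale[OF G0])
    moreover have "(\<lambda>k. p j * ?z k) = p" using j(2) by auto
    ultimately show ?thesis using j(2) by simp
  qed
  have d0: "?d > 0" using M0 by simp
  show ?thesis
  proof (intro exI conjI ballI impI)
    show "m * ?d > 0" using d0 two_points by simp
    show "?G0 ^ m \<in> forms (m * ?d)" by (rule homogeneous_power[OF G0])
    show "h ^ ?d \<in> forms (m * ?d)" using homogeneous_power[OF h(1), of ?d] by (simp add: mult.commute)
    show "E (h ^ ?d) \<noteq> 0" using h(2) by (simp add: E_power)
    show "val_at (h ^ ?d) (qrep i) = 0" if "i \<in> {1..m}" for i using h(3) that d0 by (simp add: val_simps)
    fix p assume p: "p \<in> cone" "val_at (h ^ ?d) p = 0"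
    hence "val_at h p = 0" by (simp add: val_simps)
    thus "val_at (?G0 ^ m) p \<noteq> 0" using G0_nz[OF p(1)] by (simp add: val_simps)
  qed
qed

definition Rg :: "'a alg_closure ultrapower set" where
  "Rg = {f \<in> K. \<forall>p\<in>cone. p \<notin> (\<Union>i\<in>{1..m}. Q i) \<longrightarrow> f \<in> Loc p}"

definition vq :: "nat \<Rightarrow> 'a alg_closure ultrapower \<Rightarrow> int" where
  "vq i f = ord_p (qrep i) f"

lemma Rg_K: "f \<in> Rg \<Longrightarrow> f \<in> K"
  by (simp add: Rg_def)

sublocale pole_filtered_ring cF Rg vq m
proof
  show "2 \<le> m" by (rule two_points)
  show "finite cF" by simp
  have "card cF = card (UNIV :: 'a set)" using ring_emb_inj[OF ring_emb_const] by (rule card_image)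
  thus "m \<le> card cF" using card_field by simp
  show "0 \<in> cF" "1 \<in> cF" by (rule coeffs.zero_F) (rule coeffs.one_F)
  show "a - b \<in> cF" if "a \<in> cF" "b \<in> cF" for a b using that by (rule coeffs.diff_F)
  show "inverse a \<in> cF" if "a \<in> cF" for a
  proof -
    obtain b where "a = const b" using \<open>a \<in> cF\<close> by blast
    hence "inverse a = const (inverse b)" using ring_emb_inverse[OF ring_emb_const] by simp
    thus ?thesis by (rule range_eqI)
  qed
  show "cF \<subseteq> Rg" by (auto simp: Rg_def K_const Loc_const)
  show "a - b \<in> Rg" if "a \<in> Rg" "b \<in> Rg" for a b
    using that by (auto simp: Rg_def K_diff Loc_diff)
  show "a * b \<in> Rg" if "a \<in> Rg" "b \<in> Rg" for a b
    using that by (auto simp: Rg_def K_mult Loc_mult)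
  fix i assume i: "i \<in> {1..m}"
  note p = qrep_cone[OF i]
  show "vq i c = 0" if c: "c \<in> cF" "c \<noteq> 0" for c
  proof -
    obtain b where b: "c = const b" using c(1) by blast
    hence "b \<noteq> 0" using c(2) ring_emb_0[OF ring_emb_const] by auto
    hence "loc_unit (qrep i) c" using b Loc_const resv_const[OF p] by (simp add: loc_unit_def)
    thus ?thesis unfolding vq_def by (rule ord_loc_unit[OF p])
  qed
  fix f g assume fg: "f \<in> Rg" "g \<in> Rg" "f \<noteq> 0" "g \<noteq> 0"
  show "vq i (f * g) = vq i f + vq i g" unfolding vq_def using fg Rg_K by (intro ord_mult[OF p]) auto
  show "min (vq i f) (vq i g) \<le> vq i (f - g)" if "f \<noteq> g"
    unfolding vq_def using fg Rg_K that by (intro ord_diff[OF p]) auto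
  show "\<exists>c\<in>cF. f = c * g \<or> vq i f < vq i (f - c * g)" if "vq i f = vq i g"
    using ord_residue[OF p resv_qrep[OF i]] fg Rg_K that unfolding vq_def by blast
next
  have "{f \<in> Rg. f = 0 \<or> (\<forall>i\<in>{1..m}. 0 \<le> vq i f)} \<subseteq> cF"
  proof safe
    fix f assume f: "f \<in> Rg" "\<forall>i\<in>{1..m}. 0 \<le> vq i f"
    show "f \<in> cF"
    proof (cases "f = 0")
      case False
      have reg: "f \<in> Loc p" if p: "p \<in> cone" for p
      proof (cases "p \<in> (\<Union>i\<in>{1..m}. Q i)")
        case True
        then obtain i where i: "i \<in> {1..m}" "p \<in> Q i" by blast
        have "f \<in> Loc (qrep i)" using Loc_iff_ord[OF qrep_cone[OF i(1)] Rg_K[OF f(1)] False] f(2) i(1) by (simp add: vq_def)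
        thus ?thesis using Loc_same_point[OF Q_C[OF i(1)] i(2) qrep_Q[OF i(1)]] by simp
      qed (use f(1) p in \<open>auto simp: Rg_def\<close>)
      have 1: "1 \<in> {1..m}" using two_points by simp
      show ?thesis
        using regular_everywhere_const[OF Rg_K[OF f(1)] reg qrep_cone[OF 1]] resv_qrep[OF 1 reg[OF qrep_cone[OF 1]]] by blast
    next
      case True
      thus ?thesis using coeffs.zero_F by simp
    qed
  qed (use coeffs.zero_F in simp)
  thus "finite {f \<in> Rg. f = 0 \<or> (\<forall>i\<in>{1..m}. 0 \<le> vq i f)}" by (rule finite_subset) simp
qed

definition vge :: "nat \<Rightarrow> int \<Rightarrow> 'a alg_closure ultrapower \<Rightarrow> bool" where
  "vge i k f \<longleftrightarrow> f = 0 \<or> k \<le> vq i f"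

lemma vge_diff:
  assumes i: "i \<in> {1..m}" and f: "f \<in> K" "vge i k f" and g: "g \<in> K" "vge i k g"
  shows "vge i k (f - g)"
proof -
  note p = qrep_cone[OF i]
  have neg: "ord_p (qrep i) (- g) = ord_p (qrep i) g" if "g \<noteq> 0"
  proof -
    have "loc_unit (qrep i) (- 1)"
      using Loc_diff[OF p Loc_01] resv_diff[OF p Loc_01] resv_01[OF p] by (simp add: loc_unit_def)
    hence "ord_p (qrep i) (- 1) = 0" by (rule ord_loc_unit[OF p])
    thus ?thesis using ord_mult[OF p K_uminus[OF K_01(2)] _ g(1) that] by simp
  qed
  consider "f = g" | "f = 0" "g \<noteq> 0" | "g = 0" | "f \<noteq> g" "f \<noteq> 0" "g \<noteq> 0" by blast
  thus ?thesis
  proof cases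
    case 4
    thus ?thesis using ord_diff[OF p f(1) _ g(1)] f(2) g(2) by (auto simp: vge_def vq_def)
  qed (use f g neg in \<open>auto simp: vge_def vq_def\<close>)
qed

lemma vge_Loc: "i \<in> {1..m} \<Longrightarrow> f \<in> K \<Longrightarrow> f \<in> Loc (qrep i) \<longleftrightarrow> vge i 0 f"
  using Loc_iff_ord[OF qrep_cone] Loc_01 by (cases "f = 0") (auto simp: vge_def vq_def)

lemma vge_mult:
  "i \<in> {1..m} \<Longrightarrow> f \<in> K \<Longrightarrow> g \<in> K \<Longrightarrow> vge i k f \<Longrightarrow> vge i l g \<Longrightarrow> vge i (k + l) (f * g)"
  using ord_mult[OF qrep_cone, of i f g] by (cases "f = 0 \<or> g = 0") (auto simp: vge_def vq_def)

lemma vge_mono: "vge i k f \<Longrightarrow> l \<le> k \<Longrightarrow> vge i l f"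
  by (auto simp: vge_def)

lemma L_iff: "f \<in> L \<alpha> \<longleftrightarrow> f \<in> Rg \<and> (\<forall>i\<in>{1..m}. vge i (- coord \<alpha> i) f)"
  by (auto simp: L_def vge_def)

end

text \<open>
  The setting for Riemann's inequality: the forms \<open>G\<close> and \<open>W\<close> of degree \<open>e\<close> have no common zero on \<open>C\<close>,
  and \<open>W\<close> vanishes at all the points. So \<open>y = W / G\<close> lies in the chart \<open>A\<close> of \<open>G\<close>, and \<open>OZ\<close> is the
  semilocal ring of the zeros of \<open>W\<close>. The number \<open>D\<close> of classes of \<open>A\<close> modulo \<open>y\<close> plays the role of
  the degree of \<open>W\<close>.
\<close>

locale complementary_forms = pointed_curve n C m Q
  for n :: nat and C :: "'a::{field, finite} alg_closure ppoint set" and m :: nat and Q +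
  fixes e :: nat and G W :: "'a mpoly"
  assumes e: "e > 0" and G: "G \<in> forms e" and W: "W \<in> forms e" "E W \<noteq> 0"
    and WQ: "\<And>i. i \<in> {1..m} \<Longrightarrow> val_at W (qrep i) = 0"
    and GW: "\<And>p. p \<in> cone \<Longrightarrow> val_at W p = 0 \<Longrightarrow> val_at G p \<noteq> 0"
begin

abbreviation A :: "'a alg_closure ultrapower set" where
  "A \<equiv> chart e G"

definition y :: "'a alg_closure ultrapower" where
  "y = E W / E G"

definition Z :: "(nat \<Rightarrow> 'a alg_closure) set" where
  "Z = {p \<in> cone. val_at W p = 0}"

definition OZ :: "'a alg_closure ultrapower set" where
  "OZ = {f \<in> K. \<forall>p\<in>Z. f \<in> Loc p}"

definition T :: "'a alg_closure ultrapower set" where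
  "T = (SOME T. transversal A ((*) y ` A) T)"

definition D :: nat where
  "D = card T"

lemma E_G_nonzero: "E G \<noteq> 0"
proof -
  have one: "1 \<in> {1..m}" using two_points by simp
  show ?thesis using E_nonzeroI[OF G qrep_cone[OF one] GW[OF qrep_cone[OF one] WQ[OF one]]] .
qed

lemma y_level: "y \<in> level e G 1"
  unfolding level_def y_def using W by (intro image_eqI[of _ _ W]) auto

lemma y_chart: "y \<in> A"
  using y_level unfolding chart_UN by blast

lemma y_nonzero: "y \<noteq> 0"
  using W E_G_nonzero by (simp add: y_def)

lemma y_K: "y \<in> K"
  unfolding y_def using K_I[OF W(1) G E_G_nonzero] .

lemma qrep_Z: "i \<in> {1..m} \<Longrightarrow> qrep i \<in> Z"
  using qrep_cone WQ by (simp add: Z_def)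

lemma chart_K:
  assumes a: "a \<in> A"
  shows "a \<in> K"
proof -
  obtain g l where "g \<in> forms (l * e)" "a = E g / E G ^ l" using a unfolding chart_def by blast
  thus ?thesis using K_I[OF _ homogeneous_power[OF G]] E_G_nonzero by (metis E_power power_not_zero)
qed

lemma chart_OZ: "a \<in> A \<Longrightarrow> a \<in> OZ"
  using chart_K[of a] chart_Loc[OF _ G GW, of _ a] by (simp add: OZ_def Z_def)

lemma OZ_diff: "f \<in> OZ \<Longrightarrow> g \<in> OZ \<Longrightarrow> f - g \<in> OZ"
  by (auto simp: OZ_def Z_def K_diff Loc_diff)

lemma OZ_mult: "f \<in> OZ \<Longrightarrow> g \<in> OZ \<Longrightarrow> f * g \<in> OZ"
  by (auto simp: OZ_def Z_def K_mult Loc_mult)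

lemma OZ_add: "f \<in> OZ \<Longrightarrow> g \<in> OZ \<Longrightarrow> f + g \<in> OZ"
  by (auto simp: OZ_def Z_def K_add Loc_add)

lemma OZ_0: "0 \<in> OZ"
  by (simp add: OZ_def K_01 Loc_01)

lemma OZ_pow: "f \<in> OZ \<Longrightarrow> f ^ k \<in> OZ"
  by (auto simp: OZ_def Z_def K_power Loc_power)

lemma T: "transversal A ((*) y ` A) T"
proof -
  obtain T0 where "transversal A ((*) y ` A) T0" using chart_quotient_finite[OF G E_G_nonzero y_chart y_nonzero] .
  thus ?thesis unfolding T_def by (rule someI)
qed

lemma T_props: "finite T" "T \<subseteq> A" "\<And>a. a \<in> A \<Longrightarrow> \<exists>t\<in>T. \<exists>b\<in>A. a - t = y * b"
  and T_unique: "\<And>a t t'. a \<in> A \<Longrightarrow> t \<in> T \<Longrightarrow> t' \<in> T \<Longrightarrow> a - t \<in> (*) y ` A \<Longrightarrow> a - t' \<in> (*) y ` A \<Longrightarrow> t = t'"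
  using T unfolding transversal_def by blast+

text \<open>
  The quotient of \<open>OZ\<close> by \<open>y\<close> is already represented by functions on the chart. The forms \<open>g\<close> for which
  \<open>f g\<close> is a form on \<open>C\<close> generate, together with \<open>W\<close>, an ideal without zeros. So a power of \<open>G\<close> lies
  in it, and dividing by this power shows that \<open>f\<close> is congruent modulo \<open>y\<close> to an element of \<open>A\<close>.
\<close>

lemma OZ_mod_y:
  assumes f: "f \<in> OZ"
  shows "\<exists>t\<in>T. \<exists>w\<in>OZ. f - t = y * w"
proof -
  have fK: "f \<in> K" using f by (simp add: OZ_def)
  define Df where "Df = (\<lambda>d. {g \<in> forms d. \<exists>g'\<in>forms d. f * E g = E g'})"
  define Bd where "Bd = (\<lambda>d. {b. b = 0 \<or> (\<exists>k. k + e = d \<and> b \<in> forms k)})"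
  define DD where "DD = (\<lambda>d. {g \<in> forms d. \<exists>g1\<in>Df d. \<exists>b\<in>Bd d. E g = E g1 + E W * E b})"
  have Df0: "0 \<in> Df d" for d unfolding Df_def using homogeneous_0 by (auto intro!: bexI[of _ 0] simp: E_0)
  have Bd0: "0 \<in> Bd d" for d by (simp add: Bd_def)
  have Df_diff: "g - h \<in> Df d" if gh: "g \<in> Df d" "h \<in> Df d" for g h d
  proof -
    obtain g' h' where "g' \<in> forms d" "f * E g = E g'" "h' \<in> forms d" "f * E h = E h'" using gh unfolding Df_def by blast
    hence "g' - h' \<in> forms d" "f * E (g - h) = E (g' - h')" by (auto simp: E_diff right_diff_distrib intro: homogeneous_diff)
    thus ?thesis using gh unfolding Df_def by (blast intro: homogeneous_diff)
  qed
  have Df_mult: "h * g \<in> Df (k + d)" if gh: "g \<in> Df d" "h \<in> forms k" for g h d k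
  proof -
    obtain g' where g': "g' \<in> forms d" "f * E g = E g'" using gh unfolding Df_def by blast
    have "f * E (h * g) = E h * (f * E g)" by (simp add: E_mult)
    hence "f * E (h * g) = E (h * g')" using g'(2) by (simp add: E_mult)
    moreover have "h * g' \<in> forms (k + d)" "h * g \<in> forms (k + d)"
      using gh g' by (auto simp: Df_def intro: homogeneous_mult)
    ultimately show ?thesis unfolding Df_def by blast
  qed
  have Bd_diff: "b - c \<in> Bd d" if bc: "b \<in> Bd d" "c \<in> Bd d" for b c d
  proof -
    consider "b = 0" "c = 0" | k where "k + e = d" "b \<in> forms k" "c \<in> forms k"
      using bc homogeneous_0 unfolding Bd_def by fastforce
    thus ?thesis by cases (auto simp: Bd_def intro: homogeneous_diff)
  qed
  have Bd_mult: "h * b \<in> Bd (k + d)" if bh: "b \<in> Bd d" "h \<in> forms k" for b h d k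
  proof -
    consider "b = 0" | l where "l + e = d" "b \<in> forms l" using bh(1) unfolding Bd_def by blast
    thus ?thesis
    proof cases
      case 2
      have "h * b \<in> forms (k + l)" by (rule homogeneous_mult[OF bh(2) 2(2)])
      moreover have "(k + l) + e = k + d" using 2(1) by simp
      ultimately show ?thesis unfolding Bd_def by blast
    qed (simp add: Bd_def)
  qed
  obtain g0 h0 d0 where f0: "g0 \<in> forms d0" "h0 \<in> forms d0" "E h0 \<noteq> 0" "f = E g0 / E h0" using fK by (rule K_E)
  have Df_DD: "g \<in> DD d" if "g \<in> Df d" for g d
  proof -
    have "E g = E g + E W * E 0" by (simp add: E_0)
    moreover have "g \<in> forms d" using that by (simp add: Df_def)
    ultimately show ?thesis unfolding DD_def using that Bd0[of d] by blast
  qed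
  have "\<exists>N. \<forall>d\<ge>N. forms d \<subseteq> DD d"
  proof (rule homogeneous_nullstellensatz[of DD h0 d0])
    show "DD d \<subseteq> forms d" for d by (auto simp: DD_def)
    have "h0 \<in> Df d0" using f0 by (auto simp: Df_def)
    thus "h0 \<in> DD d0" by (rule Df_DD)
    show "E h0 \<noteq> 0" by (rule f0)
  next
    fix d g h assume gh: "g \<in> DD d" "h \<in> DD d"
    then obtain g1 b where g: "g1 \<in> Df d" "b \<in> Bd d" "E g = E g1 + E W * E b" "g \<in> forms d" unfolding DD_def by blast
    obtain h1 c where h: "h1 \<in> Df d" "c \<in> Bd d" "E h = E h1 + E W * E c" "h \<in> forms d" using gh unfolding DD_def by blast
    have "E (g - h) = E (g1 - h1) + E W * E (b - c)" using g(3) h(3) by (simp add: E_diff algebra_simps)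
    thus "g - h \<in> DD d" unfolding DD_def using Df_diff[OF g(1) h(1)] Bd_diff[OF g(2) h(2)] homogeneous_diff[OF g(4) h(4)] by blast
  next
    fix d k g h assume gh: "g \<in> DD d" "h \<in> forms k"
    then obtain g1 b where g: "g1 \<in> Df d" "b \<in> Bd d" "E g = E g1 + E W * E b" "g \<in> forms d" unfolding DD_def by blast
    have "E (h * g) = E (h * g1) + E W * E (h * b)" using g(3) by (simp add: E_mult algebra_simps)
    thus "h * g \<in> DD (k + d)" unfolding DD_def using Df_mult[OF g(1) gh(2)] Bd_mult[OF g(2) gh(2)] homogeneous_mult[OF gh(2) g(4)] by blast
  next
    fix d g assume "g \<in> forms d" "E g = 0"
    hence "g \<in> Df d" unfolding Df_def using homogeneous_0 by (auto intro!: bexI[of _ 0] simp: E_0)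
    thus "g \<in> DD d" by (rule Df_DD)
  next
    fix p assume p: "p \<in> cone"
    show "\<exists>d. \<exists>g\<in>DD d. val_at g p \<noteq> 0"
    proof (cases "val_at W p = 0")
      case True
      hence "f \<in> Loc p" using f p by (simp add: OZ_def Z_def)
      then obtain g h d where gh: "g \<in> forms d" "h \<in> forms d" "val_at h p \<noteq> 0" "f = E g / E h" by (rule Loc_E)
      hence "E h \<noteq> 0" using E_nonzeroI p by blast
      hence "f * E h = E g" using gh(4) by simp
      hence "h \<in> Df d" using gh unfolding Df_def by blast
      thus ?thesis using gh(3) Df_DD by blast
    next
      case False
      have "1 \<in> Bd e" unfolding Bd_def using homogeneous_1[of n] by auto
      moreover have "E W = E 0 + E W * E 1" by (simp add: E_0 E_1)
      ultimately have "W \<in> DD e" unfolding DD_def using W(1) Df0 by blast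
      thus ?thesis using False by blast
    qed
  qed
  then obtain N where N: "\<And>d. d \<ge> N \<Longrightarrow> forms d \<subseteq> DD d" by blast
  define N' where "N' = Suc N"
  have "N' * e \<ge> N" using e unfolding N'_def by (cases e) auto
  hence "G ^ N' \<in> DD (N' * e)" using N homogeneous_power[OF G] by blast
  then obtain g1 b where g1: "g1 \<in> Df (N' * e)" and b: "b \<in> Bd (N' * e)" and eq: "E (G ^ N') = E g1 + E W * E b"
    unfolding DD_def by blast
  obtain g2 where g2: "g2 \<in> forms (N' * e)" "f * E g1 = E g2" using g1 unfolding Df_def by blast
  have bf: "b \<in> forms (N * e)" using b homogeneous_0 unfolding Bd_def N'_def by auto
  define a where "a = E g2 / E G ^ N'"
  define c where "c = E b / E G ^ N"
  have aA: "a \<in> A" unfolding chart_def a_def using g2 by blast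
  have cA: "c \<in> A" unfolding chart_def c_def using bf by blast
  have "f = f * E (G ^ N') / E G ^ N'" using E_G_nonzero by (simp add: E_power)
  also have "\<dots> = (E g2 + E W * E b * f) / E G ^ N'" unfolding eq by (simp add: algebra_simps g2(2))
  also have "\<dots> = a + y * (c * f)" using E_G_nonzero by (simp add: a_def c_def y_def N'_def add_divide_distrib)
  finally have fe: "f = a + y * (c * f)" .
  obtain t a' where t: "t \<in> T" "a' \<in> A" "a - t = y * a'" using T_props(3)[OF aA] by blast
  have "f - t = (a - t) + y * (c * f)" using fe by (simp add: algebra_simps)
  also have "\<dots> = y * (a' + c * f)" unfolding t(3) by (simp add: algebra_simps)
  finally have "f - t = y * (a' + c * f)" .
  moreover have "a' + c * f \<in> OZ" using chart_OZ[OF t(2)] chart_OZ[OF cA] f by (intro OZ_add OZ_mult)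
  ultimately show ?thesis using t(1) by blast
qed

lemma OZ_mod_y_power: "\<exists>S. finite S \<and> card S \<le> D ^ l \<and> (\<forall>f\<in>OZ. \<exists>s\<in>S. \<exists>w\<in>OZ. f - s = y ^ l * w)"
proof (induction l)
  case 0
  show ?case by (intro exI[of _ "{0}"]) auto
next
  case (Suc l)
  then obtain S where S: "finite S" "card S \<le> D ^ l" "\<forall>f\<in>OZ. \<exists>s\<in>S. \<exists>w\<in>OZ. f - s = y ^ l * w" by blast
  let ?S = "(\<lambda>(s, t). s + y ^ l * t) ` (S \<times> T)"
  have "\<exists>s\<in>?S. \<exists>w\<in>OZ. f - s = y ^ Suc l * w" if fOZ: "f \<in> OZ" for f
  proof -
    obtain s w where s: "s \<in> S" "w \<in> OZ" "f - s = y ^ l * w" using bspec[OF S(3) fOZ] by blast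
    obtain t w' where t: "t \<in> T" "w' \<in> OZ" "w - t = y * w'" using OZ_mod_y[OF s(2)] by blast
    have "f - (s + y ^ l * t) = y ^ l * (w - t)" using s(3) by (simp add: algebra_simps)
    also have "\<dots> = y ^ Suc l * w'" unfolding t(3) by simp
    finally have "f - (s + y ^ l * t) = y ^ Suc l * w'" .
    moreover have "s + y ^ l * t \<in> ?S" using s(1) t(1) by (intro image_eqI[of _ _ "(s, t)"]) auto
    ultimately show ?thesis using t(2) by blast
  qed
  moreover have "card ?S \<le> D ^ Suc l"
  proof -
    have "card ?S \<le> card (S \<times> T)" using S(1) T_props(1) by (intro card_image_le finite_cartesian_product)
    also have "\<dots> \<le> D ^ l * D" using S(2) by (simp add: card_cartesian_product D_def)
    finally show ?thesis by (simp add: mult.commute)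
  qed
  ultimately show ?case using S(1) T_props(1) by (intro exI[of _ ?S]) auto
qed

text \<open>
  Elements \<open>t + y a\<close> with \<open>t \<in> T\<close> are determined by \<open>t\<close> and \<open>a\<close>, so the cardinality grows by the
  factor \<open>D\<close> with each level.
\<close>

lemma level_growth:
  assumes l0: "T \<subseteq> level e G l0"
  shows "D ^ l \<le> card (level e G (l0 + l))"
proof (induction l)
  case 0
  have "level e G l0 \<noteq> {}" using level_0 by blast
  thus ?case using finite_level[of e G l0] by (simp add: Suc_leI card_gt_0_iff)
next
  case (Suc l)
  have "card (T \<times> level e G (l0 + l)) \<le> card (level e G (l0 + Suc l))"
  proof (rule card_inj_on_le[of "\<lambda>(t, a). t + y * a"])
    show "inj_on (\<lambda>(t, a). t + y * a) (T \<times> level e G (l0 + l))"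
    proof (rule inj_onI; clarify)
      fix t a t' a' assume *: "t \<in> T" "t' \<in> T" "a \<in> level e G (l0 + l)" "a' \<in> level e G (l0 + l)" "t + y * a = t' + y * a'"
      have aA: "a \<in> A" "a' \<in> A" using * unfolding chart_UN by blast+
      have "t - t = y * 0" "t - t' = y * (a' - a)" using *(5) by (simp_all add: algebra_simps)
      hence "t - t \<in> (*) y ` A" "t - t' \<in> (*) y ` A" using chart_diff[OF G E_G_nonzero aA(2,1)] chart_01 by blast+
      hence "t = t'" using T_unique[of t t t'] *(1,2) T_props(2) by blast
      thus "t = t' \<and> a = a'" using *(5) y_nonzero by simp
    qed
    show "(\<lambda>(t, a). t + y * a) ` (T \<times> level e G (l0 + l)) \<subseteq> level e G (l0 + Suc l)"
    proof clarify
      fix t a assume ta: "t \<in> T" "a \<in> level e G (l0 + l)"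
      have "t \<in> level e G (l0 + Suc l)" using level_raise[OF G E_G_nonzero, of t l0] ta(1) l0 by auto
      moreover have "y * a \<in> level e G (l0 + Suc l)" using level_mult[OF y_level ta(2)] by simp
      ultimately show "t + y * a \<in> level e G (l0 + Suc l)" by (rule level_add)
    qed
  qed (rule finite_level)
  hence "D * card (level e G (l0 + l)) \<le> card (level e G (l0 + Suc l))"
    by (simp only: card_cartesian_product D_def)
  with mult_le_mono2[OF Suc] show ?case unfolding power_Suc by (rule order_trans)
qed

lemma order_y_pos:
  assumes i: "i \<in> {1..m}"
  shows "1 \<le> vq i y"
proof -
  have "resv (qrep i) y = 0"
    using resv_eq[OF qrep_cone[OF i] W(1) G GW[OF qrep_cone[OF i] WQ[OF i]]] WQ[OF i] by (simp add: y_def)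
  hence "y \<in> Mloc (qrep i)" using Mloc_iff[OF qrep_cone[OF i]] chart_OZ[OF y_chart] qrep_Z[OF i] by (auto simp: OZ_def)
  thus ?thesis using Mloc_iff_ord[OF qrep_cone[OF i] y_K y_nonzero] by (simp add: vq_def)
qed

text \<open>
  The ring \<open>A\<close> is finite modulo \<open>y\<close>, so if \<open>a\<close> vanishes at the \<open>i\<close>-th point, two powers of \<open>a\<close> are
  congruent modulo \<open>y\<close>, say the \<open>r\<close>-th and the \<open>s\<close>-th with \<open>r < s\<close>. Then \<open>1 - a ^ (s - r)\<close> has the
  value \<open>1\<close> at the point and annihilates \<open>a ^ r\<close> modulo \<open>y\<close>. The product of these elements for all
  representatives \<open>a \<in> T\<close> that vanish at the point serves for all \<open>a\<close> at once.
\<close>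

lemma annihilator:
  assumes i: "i \<in> {1..m}"
  shows "\<exists>B\<in>A. resv (qrep i) B = 1 \<and> (\<forall>a\<in>A. resv (qrep i) a = 0 \<longrightarrow> (\<exists>r. B * a ^ r \<in> (*) y ` A))"
proof -
  let ?q = "qrep i"
  note q = qrep_cone[OF i]
  have Gq: "val_at G ?q \<noteq> 0" using GW[OF q WQ[OF i]] .
  have AL: "a \<in> Loc ?q" if "a \<in> A" for a using chart_Loc[OF q G Gq that] .
  have nil: "\<exists>r b. b \<in> A \<and> resv ?q b = 1 \<and> b * a ^ r \<in> (*) y ` A" if a: "a \<in> A" "resv ?q a = 0" for a
  proof -
    have "\<forall>k. \<exists>t\<in>T. \<exists>b\<in>A. a ^ k - t = y * b" using T_props(3)[OF chart_power[OF a(1)]] by blast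
    then obtain t b where t: "\<And>k. t k \<in> T" "\<And>k. b k \<in> A" "\<And>k. a ^ k - t k = y * b k" by metis
    have "finite (range t)" by (rule finite_subset[OF _ T_props(1)]) (use t in blast)
    hence "\<not> inj t" using finite_imageD[of t UNIV] by auto
    then obtain r s where rs: "r < s" "t r = t s" unfolding inj_def by (metis linorder_neqE_nat)
    have "a ^ r - a ^ s = y * (b r - b s)" using t(3)[of r] t(3)[of s] rs(2) by (simp add: algebra_simps)
    moreover have "a ^ s = a ^ (s - r) * a ^ r" using rs(1) by (simp add: power_add[symmetric])
    ultimately have "(1 - a ^ (s - r)) * a ^ r = y * (b r - b s)" by (simp add: algebra_simps)
    moreover have "1 - a ^ (s - r) \<in> A" by (intro chart_diff[OF G E_G_nonzero] chart_01 chart_power a(1))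
    moreover have "resv ?q (1 - a ^ (s - r)) = 1"
      using resv_diff[OF q Loc_01(2) Loc_power[OF q AL[OF a(1)]]] resv_power[OF q AL[OF a(1)]] a(2) rs(1) resv_01[OF q] by simp
    ultimately show ?thesis using chart_diff[OF G E_G_nonzero t(2) t(2)] by (intro exI[of _ r] exI[of _ "1 - a ^ (s - r)"]) auto
  qed
  define T0 where "T0 = {t \<in> T. resv ?q t = 0}"
  have "\<forall>t. \<exists>r b. t \<in> T0 \<longrightarrow> b \<in> A \<and> resv ?q b = 1 \<and> b * t ^ r \<in> (*) y ` A"
    using nil T_props(2) unfolding T0_def by blast
  then obtain r b where rb: "\<And>t. t \<in> T0 \<Longrightarrow> b t \<in> A \<and> resv ?q (b t) = 1 \<and> b t * t ^ r t \<in> (*) y ` A" by metis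
  define B where "B = (\<Prod>t\<in>T0. b t)"
  have finT0: "finite T0" using T_props(1) by (simp add: T0_def)
  have prodA: "(\<Prod>t\<in>S. b t) \<in> A \<and> resv ?q (\<Prod>t\<in>S. b t) = 1" if "S \<subseteq> T0" for S
  proof -
    have "finite S" using that finT0 finite_subset by blast
    thus ?thesis using that
    proof (induction S rule: finite_induct)
      case (insert t S)
      thus ?case using rb[of t] by (auto simp: chart_mult resv_mult[OF q AL AL])
    qed (use chart_01 resv_01[OF q] in auto)
  qed
  have BA: "B \<in> A" and Bq: "resv ?q B = 1" using prodA[OF order_refl] by (auto simp: B_def)
  have yq: "resv ?q y = 0" using order_y_pos[OF i] Mloc_iff[OF q] Mloc_iff_ord[OF q y_K y_nonzero] by (simp add: vq_def)
  have Bnil: "\<exists>r. B * a ^ r \<in> (*) y ` A" if a: "a \<in> A" "resv ?q a = 0" for a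
  proof -
    obtain t c where t: "t \<in> T" "c \<in> A" "a - t = y * c" using T_props(3)[OF a(1)] by blast
    have tA: "t \<in> A" using t(1) T_props(2) by blast
    have "t = a - y * c" using t(3) by (simp add: algebra_simps)
    hence "resv ?q t = 0"
      using resv_diff[OF q AL[OF a(1)] Loc_mult[OF q AL[OF y_chart] AL[OF t(2)]]] resv_mult[OF q AL[OF y_chart] AL[OF t(2)]] a(2) yq by simp
    hence tT0: "t \<in> T0" using t(1) by (simp add: T0_def)
    obtain z where z: "z \<in> A" "b t * t ^ r t = y * z" using rb[OF tT0] by blast
    have "\<exists>z'\<in>A. a ^ k - t ^ k = y * z'" for k
    proof (induction k)
      case 0
      show ?case using chart_01 by (intro bexI[of _ 0]) auto
    next
      case (Suc k)
      then obtain z' where z': "z' \<in> A" "a ^ k - t ^ k = y * z'" by blast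
      have "a ^ Suc k - t ^ Suc k = a * (a ^ k - t ^ k) + (a - t) * t ^ k" by (simp add: algebra_simps)
      also have "\<dots> = y * (a * z' + c * t ^ k)" unfolding z'(2) t(3) by (simp add: algebra_simps)
      finally show ?case using a(1) z'(1) t(2) tA
        by (intro bexI[of _ "a * z' + c * t ^ k"] chart_add[OF G E_G_nonzero] chart_mult chart_power)
    qed
    then obtain z' where z': "z' \<in> A" "a ^ r t - t ^ r t = y * z'" by blast
    have "B = b t * (\<Prod>t\<in>T0 - {t}. b t)" unfolding B_def using finT0 tT0 by (rule prod.remove)
    hence "B * t ^ r t = y * (z * (\<Prod>t\<in>T0 - {t}. b t))" using z(2) by (simp add: mult_ac)
    hence "B * a ^ r t = y * (z * (\<Prod>t\<in>T0 - {t}. b t) + B * z')"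
      using z'(2) by (simp add: algebra_simps)
    moreover have "z * (\<Prod>t\<in>T0 - {t}. b t) + B * z' \<in> A"
      using prodA[of "T0 - {t}"] z(1) z'(1) BA by (intro chart_add[OF G E_G_nonzero] chart_mult) auto
    ultimately show ?thesis by blast
  qed
  show ?thesis using BA Bq Bnil by blast
qed

text \<open>
  A uniformizer, multiplied by the unit \<open>h ^ e / G ^ d\<close>, where \<open>h\<close> is its denominator.
\<close>

lemma simple_zero:
  assumes i: "i \<in> {1..m}"
  shows "\<exists>s\<in>A. s \<noteq> 0 \<and> vq i s = 1"
proof -
  let ?q = "qrep i"
  note q = qrep_cone[OF i]
  have Gq: "val_at G ?q \<noteq> 0" using GW[OF q WQ[OF i]] .
  have AL: "a \<in> Loc ?q" if "a \<in> A" for a using chart_Loc[OF q G Gq that] .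
  let ?t = "unif ?q"
  have un: "uniformizer ?q ?t" by (rule uniformizer_unif[OF q])
  have t: "?t \<in> Loc ?q" "?t \<noteq> 0" using un uniformizer_nonzero[OF q un] by (auto simp: uniformizer_def)
  obtain g h d where gh: "g \<in> forms d" "h \<in> forms d" "val_at h ?q \<noteq> 0" "?t = E g / E h" using t(1) by (rule Loc_E)
  have hz: "E h \<noteq> 0" using E_nonzeroI[OF gh(2) q gh(3)] .
  let ?w = "E h ^ e / E G ^ d"
  have hf: "h ^ e \<in> forms (d * e)" using homogeneous_power[OF gh(2), of e] by (simp add: mult.commute)
  have "?w \<in> A" unfolding chart_def using hf by (intro CollectI exI[of _ "h ^ e"] exI[of _ d]) (simp add: E_power)
  hence w: "?w \<in> Loc ?q" "resv ?q ?w \<noteq> 0" "?w \<noteq> 0"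
    using AL[of ?w] resv_form_quotient[OF q G Gq hf] gh(3) Gq hz E_G_nonzero by (auto simp: E_power val_simps)
  have "?t * ?w = E (g * h ^ (e - 1)) / E G ^ d"
    unfolding gh(4) using hz e by (cases e) (auto simp: E_simps)
  moreover have "g * h ^ (e - 1) \<in> forms (d * e)"
  proof -
    have "g * h ^ (e - 1) \<in> forms (d + (e - 1) * d)" by (rule homogeneous_mult[OF gh(1) homogeneous_power[OF gh(2)]])
    also have "d + (e - 1) * d = d * e" using e by (cases e) auto
    finally show ?thesis .
  qed
  ultimately have "?t * ?w \<in> A" unfolding chart_def by blast
  moreover have "vq i (?t * ?w) = 1"
  proof -
    have "loc_unit ?q ?w" using w by (simp add: loc_unit_def)
    moreover have "?t * ?w = ?w * ?t powi 1" by simp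
    ultimately show ?thesis unfolding vq_def by (rule ord_unique[OF q])
  qed
  ultimately show ?thesis using t(2) w(3) by (intro bexI[of _ "?t * ?w"]) auto
qed

text \<open>
  Let \<open>B\<close> be the annihilator. At a zero \<open>p\<close> of \<open>W\<close> other than the \<open>i\<close>-th point, some \<open>a \<in> A\<close> vanishes at
  the \<open>i\<close>-th point but not at \<open>p\<close>, and \<open>B a ^ r \<in> y A\<close> shows that \<open>B / y\<close> is regular at \<open>p\<close>. At the
  \<open>i\<close>-th point \<open>B / y\<close> has a pole, whose order is reduced to one by a power of a function with a
  simple zero.
\<close>

lemma simple_pole:
  assumes i: "i \<in> {1..m}"
  shows "\<exists>\<tau>\<in>K. \<tau> \<noteq> 0 \<and> vq i \<tau> = - 1 \<and> (\<forall>p\<in>Z. p \<notin> Q i \<longrightarrow> \<tau> \<in> Loc p)"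
proof -
  let ?q = "qrep i"
  note q = qrep_cone[OF i]
  have Gq: "val_at G ?q \<noteq> 0" using GW[OF q WQ[OF i]] .
  have AL: "a \<in> Loc ?q" if "a \<in> A" for a using chart_Loc[OF q G Gq that] .
  obtain B where BA: "B \<in> A" and Bq: "resv ?q B = 1"
    and Bnil: "\<And>a. a \<in> A \<Longrightarrow> resv ?q a = 0 \<Longrightarrow> \<exists>r. B * a ^ r \<in> (*) y ` A"
    using annihilator[OF i] by blast
  obtain s where s: "s \<in> A" "s \<noteq> 0" "vq i s = 1" using simple_zero[OF i] by blast
  define k where "k = nat (vq i y - 1)"
  define \<tau> where "\<tau> = B * s ^ k / y"
  have B0: "B \<noteq> 0" using Bq resv_01[OF q] by auto
  have BK: "B \<in> K" "s \<in> K" "s ^ k \<in> K" using chart_K BA s(1) chart_power by blast+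
  have vpow: "vq i (s ^ l) = int l" for l
  proof (induction l)
    case 0
    show ?case using v_const[OF i, of 1] coeffs.one_F by simp
  next
    case (Suc l)
    thus ?case using ord_mult[OF q BK(2) s(2) K_power[OF BK(2)], of l] s(2,3) by (simp add: vq_def)
  qed
  have "vq i B = 0" unfolding vq_def using AL[OF BA] Bq by (intro ord_loc_unit[OF q]) (simp add: loc_unit_def)
  hence "vq i (B * s ^ k) = int k" using ord_mult[OF q BK(1) B0 BK(3)] vpow[of k] s(2) by (simp add: vq_def)
  hence "vq i \<tau> = int k - vq i y"
    unfolding \<tau>_def using ord_divide[OF q K_mult[OF BK(1,3)] _ y_K y_nonzero] B0 s(2) by (simp add: vq_def)
  hence v1: "vq i \<tau> = - 1" using order_y_pos[OF i] by (simp add: k_def)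
  have \<tau>K: "\<tau> \<in> K" unfolding \<tau>_def by (intro K_divide K_mult BK y_K)
  have "\<tau> \<in> Loc p" if p: "p \<in> Z" "p \<notin> Q i" for p
  proof -
    have pc: "p \<in> cone" "val_at W p = 0" using p(1) by (auto simp: Z_def)
    have Gp: "val_at G p \<noteq> 0" using GW pc by blast
    obtain \<mu> where lam: "\<mu> \<in> forms 1" "val_at \<mu> ?q = 0" "val_at \<mu> p \<noteq> 0" using separating_form[OF i pc(1) p(2)] by blast
    let ?a = "E (\<mu> ^ e) / E G ^ 1"
    have lf: "\<mu> ^ e \<in> forms (1 * e)" using homogeneous_power[OF lam(1), of e] by simp
    have aA: "?a \<in> A" unfolding chart_def using lf by blast
    have "resv ?q ?a = 0" using resv_form_quotient[OF q G Gq lf] lam(2) e by (simp add: val_simps)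
    then obtain r z where z: "z \<in> A" "B * ?a ^ r = y * z" using Bnil[OF aA] by blast
    have ap: "resv p ?a \<noteq> 0" using resv_form_quotient[OF pc(1) G Gp lf] lam(3) Gp by (simp add: val_simps)
    have AL': "x \<in> Loc p" if "x \<in> A" for x using chart_Loc[OF pc(1) G Gp that] .
    have arp: "resv p (?a ^ r) \<noteq> 0" using resv_power[OF pc(1) AL'[OF aA]] ap by simp
    have inv: "inverse (?a ^ r) \<in> Loc p" using Loc_inverse[OF pc(1) Loc_power[OF pc(1) AL'[OF aA]] arp] .
    have ar0: "?a ^ r \<noteq> 0" using arp resv_01(1)[OF pc(1)] by metis
    have "B = y * z * inverse (?a ^ r)" using z(2) ar0 by (simp add: field_simps)
    hence "\<tau> = z * inverse (?a ^ r) * s ^ k" using y_nonzero by (simp add: \<tau>_def)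
    moreover have "z * inverse (?a ^ r) * s ^ k \<in> Loc p"
      using AL'[OF z(1)] inv AL'[OF chart_power[OF s(1)]] by (intro Loc_mult[OF pc(1)])
    ultimately show ?thesis by simp
  qed
  thus ?thesis using \<tau>K v1 B0 s(2) y_nonzero by (intro bexI[of _ \<tau>]) (auto simp: \<tau>_def)
qed

definition MM :: "ivec \<Rightarrow> 'a alg_closure ultrapower set" where
  "MM \<alpha> = {f \<in> K. (\<forall>p\<in>Z. p \<notin> (\<Union>i\<in>{1..m}. Q i) \<longrightarrow> f \<in> Loc p) \<and> (\<forall>i\<in>{1..m}. vge i (- coord \<alpha> i) f)}"

lemma OZ_vge:
  assumes f: "f \<in> OZ" and i: "i \<in> {1..m}"
  shows "vge i 0 f"
proof -
  have "f \<in> K" "f \<in> Loc (qrep i)" using f qrep_Z[OF i] by (simp_all add: OZ_def)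
  thus ?thesis using vge_Loc[OF i] by simp
qed

lemma MM_diff: "f \<in> MM \<alpha> \<Longrightarrow> g \<in> MM \<alpha> \<Longrightarrow> f - g \<in> MM \<alpha>"
  by (simp add: MM_def Z_def K_diff Loc_diff vge_diff)

text \<open>
  Modulo \<open>OZ\<close> one can prescribe the principal parts. From \<open>\<gamma>\<close> to \<open>\<gamma> + e\<^sub>i\<close>, add the constant multiples
  of a power of a function with a simple pole at the \<open>i\<close>-th point.
\<close>

lemma principal_parts:
  assumes \<alpha>: "\<alpha> \<in> int_vecs m" "vec_le m 0 \<alpha>"
  shows "\<exists>Y. finite Y \<and> Y \<subseteq> MM \<alpha> \<and> card Y = card cF ^ nat (vdeg m \<alpha>) \<and>
    (\<forall>a\<in>Y. \<forall>b\<in>Y. a - b \<in> OZ \<longrightarrow> a = b) \<and> 0 \<le> vdeg m \<alpha>"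
  using int_vecs_0 \<alpha>
proof (induction rule: vec_le_induct)
  case base
  have "0 \<in> MM 0" unfolding MM_def using K_01 Loc_01 by (auto simp: vge_def)
  thus ?case by (intro exI[of _ "{0}"]) (auto simp: vdeg_def)
next
  case (step \<gamma> i)
  then obtain Y where Y: "finite Y" "Y \<subseteq> MM \<gamma>" "card Y = card cF ^ nat (vdeg m \<gamma>)"
    "\<forall>a\<in>Y. \<forall>b\<in>Y. a - b \<in> OZ \<longrightarrow> a = b" "0 \<le> vdeg m \<gamma>" by blast
  note i = step(3)
  obtain \<tau> where \<tau>: "\<And>i. i \<in> {1..m} \<Longrightarrow>
      \<tau> i \<in> K \<and> \<tau> i \<noteq> 0 \<and> vq i (\<tau> i) = - 1 \<and> (\<forall>p\<in>Z. p \<notin> Q i \<longrightarrow> \<tau> i \<in> Loc p)"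
    using simple_pole by metis
  note q = qrep_cone[OF i]
  have \<gamma>i: "0 \<le> coord \<gamma> j" if "j \<in> {1..m}" for j using step(2) that by (auto simp: vec_le_def)
  define k where "k = nat (coord \<gamma> i + 1)"
  have kk: "int k = coord \<gamma> i + 1" using \<gamma>i[OF i] by (simp add: k_def)
  define \<sigma> where "\<sigma> = \<tau> i ^ k"
  have \<sigma>K: "\<sigma> \<in> K" "\<sigma> \<noteq> 0" unfolding \<sigma>_def using \<tau>[OF i] K_power by auto
  have "vq i (\<tau> i ^ l) = - int l" for l
  proof (induction l)
    case 0
    show ?case using v_const[OF i, of 1] coeffs.one_F by simp
  next
    case (Suc l)
    thus ?case using ord_mult[OF q _ _ K_power, of "\<tau> i" "\<tau> i" l] \<tau>[OF i] by (simp add: vq_def)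
  qed
  hence v\<sigma>: "vq i \<sigma> = - (coord \<gamma> i + 1)" using kk by (simp add: \<sigma>_def)
  have \<sigma>L: "\<sigma> \<in> Loc p" if "p \<in> Z" "p \<notin> Q i" for p
    unfolding \<sigma>_def using \<tau>[OF i] that Loc_power by (auto simp: Z_def)
  have c\<sigma>: "vq i (c * \<sigma>) = - (coord \<gamma> i + 1)" "c * \<sigma> \<noteq> 0" "c * \<sigma> \<in> K" if c: "c \<in> cF" "c \<noteq> 0" for c
  proof -
    have cK: "c \<in> K" using c cF_K by blast
    have "ord_p (qrep i) c = 0" using v_const[OF i c] by (simp add: vq_def)
    thus "vq i (c * \<sigma>) = - (coord \<gamma> i + 1)" using ord_mult[OF q cK c(2) \<sigma>K] v\<sigma> by (simp add: vq_def)
    show "c * \<sigma> \<noteq> 0" "c * \<sigma> \<in> K" using c(2) \<sigma>K cK K_mult by auto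
  qed
  let ?\<beta> = "\<gamma> + axis i 1"
  have \<sigma>MM: "c * \<sigma> \<in> MM ?\<beta>" if c: "c \<in> cF" for c
  proof -
    have cL: "c \<in> Loc p" for p using c Loc_const by blast
    have "c * \<sigma> \<in> K" using c cF_K \<sigma>K K_mult by blast
    moreover have "c * \<sigma> \<in> Loc p" if "p \<in> Z" "p \<notin> Q i" for p
      using \<sigma>L[OF that] cL Loc_mult that by (auto simp: Z_def)
    moreover have "vge j (- coord ?\<beta> j) (c * \<sigma>)" if j: "j \<in> {1..m}" for j
    proof (cases "j = i")
      case True
      thus ?thesis using c\<sigma>(1)[OF c] by (cases "c = 0") (auto simp: vge_def coord_simps)
    next
      case False
      have "qrep j \<notin> Q i"
        using same_point[OF Q_C[OF i] Q_C[OF j] _ qrep_Q[OF j]] inj_onD[OF Q_inj _ i j] False by metis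
      hence "c * \<sigma> \<in> Loc (qrep j)" using calculation(2) qrep_Z[OF j] by blast
      hence "vge j 0 (c * \<sigma>)" using vge_Loc[OF j] calculation(1) by blast
      thus ?thesis using \<gamma>i[OF j] False by (elim vge_mono) (simp add: coord_simps)
    qed
    ultimately show ?thesis unfolding MM_def using i by blast
  qed
  have MMmono: "MM \<gamma> \<subseteq> MM ?\<beta>" unfolding MM_def by (auto simp: coord_simps elim!: vge_mono)
  have MMadd: "f + g \<in> MM ?\<beta>" if fg: "f \<in> MM ?\<beta>" "g \<in> MM ?\<beta>" for f g
  proof -
    have "0 \<in> MM ?\<beta>" using \<sigma>MM[OF coeffs.zero_F] by simp
    hence "f - (0 - g) \<in> MM ?\<beta>" using fg MM_diff by blast
    thus ?thesis by simp
  qed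
  let ?f = "\<lambda>(z, c). z + c * \<sigma>"
  have key: "c = c' \<and> z = z'" if *: "z \<in> Y" "z' \<in> Y" "c \<in> cF" "c' \<in> cF" "(z + c * \<sigma>) - (z' + c' * \<sigma>) \<in> OZ" for z z' c c'
  proof -
    have "c = c'"
    proof (rule ccontr)
      assume ne: "c \<noteq> c'"
      have cc: "c - c' \<in> cF" "c - c' \<noteq> 0" using * ne coeffs.diff_F by auto
      let ?d = "(z + c * \<sigma>) - (z' + c' * \<sigma>)"
      have zz: "z - z' \<in> MM \<gamma>" using *(1,2) Y(2) MM_diff by blast
      have "vge i (- coord \<gamma> i) ?d" using OZ_vge[OF *(5) i] \<gamma>i[OF i] by (elim vge_mono) simp
      moreover have "vge i (- coord \<gamma> i) (z - z')" "z - z' \<in> K" using zz i by (auto simp: MM_def)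
      moreover have "?d \<in> K" using *(5) by (simp add: OZ_def)
      ultimately have "vge i (- coord \<gamma> i) (?d - (z - z'))" using vge_diff[OF i] by blast
      moreover have "?d - (z - z') = (c - c') * \<sigma>" by (simp add: algebra_simps)
      ultimately show False using c\<sigma>(1,2)[OF cc] by (auto simp: vge_def)
    qed
    moreover from this have "z - z' \<in> OZ" using *(5) by simp
    ultimately show ?thesis using Y(4) *(1,2) by blast
  qed
  have inj: "inj_on ?f (Y \<times> cF)"
  proof (rule inj_onI; clarify)
    fix z c z' c' assume "z \<in> Y" "z' \<in> Y" "z + const c * \<sigma> = z' + const c' * \<sigma>"
    thus "z = z' \<and> const c = const c'" using key[of z z' "const c" "const c'"] OZ_0 by simp
  qed
  have deg: "vdeg m ?\<beta> = vdeg m \<gamma> + 1" using i by (simp add: vdeg_add vdeg_axis)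
  show ?case
  proof (intro exI[of _ "?f ` (Y \<times> cF)"] conjI ballI impI)
    show "finite (?f ` (Y \<times> cF))" using Y(1) by simp
    show "?f ` (Y \<times> cF) \<subseteq> MM ?\<beta>" using Y(2) MMmono \<sigma>MM MMadd by auto
    show "card (?f ` (Y \<times> cF)) = card cF ^ nat (vdeg m ?\<beta>)"
      using card_image[OF inj] Y(3,5) unfolding deg by (simp add: card_cartesian_product nat_add_distrib mult.commute)
    show "0 \<le> vdeg m ?\<beta>" using Y(5) deg by simp
    fix a b assume ab: "a \<in> ?f ` (Y \<times> cF)" "b \<in> ?f ` (Y \<times> cF)" "a - b \<in> OZ"
    obtain zc where zc: "zc \<in> Y \<times> cF" "a = ?f zc" using ab(1) by (rule imageE)
    obtain zc' where zc': "zc' \<in> Y \<times> cF" "b = ?f zc'" using ab(2) by (rule imageE)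
    have a: "a = fst zc + snd zc * \<sigma>" and b: "b = fst zc' + snd zc' * \<sigma>"
      unfolding zc(2) zc'(2) by (simp_all only: case_prod_beta)
    have "snd zc = snd zc' \<and> fst zc = fst zc'"
      by (rule key) (use zc(1) zc'(1) ab(3) a b in \<open>simp_all add: mem_Times_iff\<close>)
    thus "a = b" unfolding a b by simp
  qed
qed

text \<open>
  Let \<open>V\<close> consist of the functions \<open>a / y ^ l\<close> with \<open>a\<close> of level \<open>l = l0 + r\<close>; they are regular outside
  the zeros of \<open>W\<close>, and there are at least \<open>D ^ r\<close> of them. For large \<open>r\<close> the sums \<open>f + z\<close> of \<open>f \<in> V\<close>
  and a prescribed principal part \<open>z \<in> Y\<close> lie in \<open>y ^ (- l) OZ\<close>, which has at most \<open>D ^ l\<close> classes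
  modulo \<open>OZ\<close>. For two pairs in the same class, the difference of the functions \<open>f\<close> is in \<open>L \<alpha>\<close>, and
  it determines the difference of the principal parts. So each class contains at most as many pairs
  as \<open>L \<alpha>\<close> has elements.
\<close>

lemma riemann_bound:
  assumes l0: "T \<subseteq> level e G l0" and \<alpha>: "\<alpha> \<in> int_vecs m" "vec_le m 0 \<alpha>"
  shows "card cF ^ nat (vdeg m \<alpha>) \<le> D ^ l0 * card (L \<alpha>)"
proof -
  obtain Y where Y: "finite Y" "Y \<subseteq> MM \<alpha>" "card Y = card cF ^ nat (vdeg m \<alpha>)"
    "\<forall>a\<in>Y. \<forall>b\<in>Y. a - b \<in> OZ \<longrightarrow> a = b" using principal_parts[OF \<alpha>] by blast
  define r where "r = nat (Max (insert 0 (coord \<alpha> ` {1..m})))"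
  have r: "coord \<alpha> i \<le> int r" if "i \<in> {1..m}" for i
  proof -
    have "coord \<alpha> i \<le> Max (insert 0 (coord \<alpha> ` {1..m}))" using that by (intro Max_ge) auto
    thus ?thesis by (simp add: r_def)
  qed
  define l where "l = l0 + r"
  define V where "V = (\<lambda>a. a / y ^ l) ` level e G l"
  have cardV: "card V = card (level e G l)" unfolding V_def by (rule card_image) (use y_nonzero in \<open>auto simp: inj_on_def\<close>)
  have VK: "f \<in> K" if "f \<in> V" for f
    using that chart_K y_K K_power K_divide unfolding V_def chart_UN by blast
  have VL: "f \<in> Loc p" if f: "f \<in> V" and p: "p \<in> cone" "p \<notin> Z" for f p
  proof -
    obtain g where g: "g \<in> forms (l * e)" "f = E g / E G ^ l / y ^ l" using f unfolding V_def level_def by blast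
    have "f = E g / E (W ^ l)" using g(2) E_G_nonzero by (simp add: y_def E_power power_divide)
    moreover have "val_at (W ^ l) p \<noteq> 0" using p by (simp add: Z_def val_simps)
    ultimately show ?thesis using Loc_I[OF g(1) homogeneous_power[OF W(1)]] by simp
  qed
  have yOZ: "y ^ l * f \<in> OZ" if fV: "f \<in> V" for f
  proof -
    obtain a where a: "a \<in> level e G l" "f = a / y ^ l" using fV unfolding V_def by blast
    have "a \<in> A" using a(1) unfolding chart_UN by blast
    thus ?thesis using chart_OZ a(2) y_nonzero by simp
  qed
  have yMM: "y ^ l * z \<in> OZ" if z: "z \<in> MM \<alpha>" for z
  proof -
    have zK: "z \<in> K" using z by (simp add: MM_def)
    have ylK: "y ^ l \<in> K" by (rule K_power[OF y_K])
    have "y ^ l * z \<in> Loc p" if p: "p \<in> Z" for p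
    proof (cases "p \<in> (\<Union>i\<in>{1..m}. Q i)")
      case True
      then obtain i where i: "i \<in> {1..m}" "p \<in> Q i" by blast
      have vl: "vge i (int k) (y ^ k)" for k
      proof (induction k)
        case 0
        show ?case using v_const[OF i(1), of 1] coeffs.one_F by (simp add: vge_def)
      next
        case (Suc k)
        have "vge i 1 y" using order_y_pos[OF i(1)] by (simp add: vge_def)
        from vge_mult[OF i(1) y_K K_power[OF y_K] this Suc] show ?case by simp
      qed
      have "vge i (int l + - coord \<alpha> i) (y ^ l * z)"
        by (rule vge_mult[OF i(1) ylK zK vl]) (use z i(1) in \<open>auto simp: MM_def\<close>)
      hence "vge i 0 (y ^ l * z)" using r[OF i(1)] by (elim vge_mono) (simp add: l_def)
      hence "y ^ l * z \<in> Loc (qrep i)" using vge_Loc[OF i(1) K_mult[OF ylK zK]] by blast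
      thus ?thesis using Loc_same_point[OF Q_C[OF i(1)] i(2) qrep_Q[OF i(1)]] by simp
    next
      case False
      hence "z \<in> Loc p" using z p by (simp add: MM_def)
      moreover have "y ^ l \<in> Loc p" using OZ_pow[OF chart_OZ[OF y_chart]] p by (auto simp: OZ_def)
      ultimately show ?thesis using p by (auto simp: Z_def intro: Loc_mult)
    qed
    thus ?thesis using K_mult[OF ylK zK] by (simp add: OZ_def)
  qed
  obtain S where S: "finite S" "card S \<le> D ^ l" "\<forall>f\<in>OZ. \<exists>s\<in>S. \<exists>w\<in>OZ. f - s = y ^ l * w" using OZ_mod_y_power by blast
  define Fib where "Fib = (\<lambda>s. {(f, z) \<in> V \<times> Y. \<exists>w\<in>OZ. y ^ l * (f + z) - s = y ^ l * w})"
  have finV: "finite V" unfolding V_def using finite_level by simp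
  have finFib: "finite (Fib s)" for s
    by (rule finite_subset[of _ "V \<times> Y"]) (use finV Y(1) in \<open>auto simp: Fib_def\<close>)
  have cover: "V \<times> Y \<subseteq> (\<Union>s\<in>S. Fib s)"
  proof clarify
    fix f z assume fz: "f \<in> V" "z \<in> Y"
    have "y ^ l * f + y ^ l * z \<in> OZ" using yOZ[OF fz(1)] yMM fz(2) Y(2) by (intro OZ_add) auto
    then obtain s where "s \<in> S" "\<exists>w\<in>OZ. y ^ l * (f + z) - s = y ^ l * w" using S(3) by (metis distrib_left)
    thus "(f, z) \<in> (\<Union>s\<in>S. Fib s)" using fz by (auto simp: Fib_def)
  qed
  have fib: "card (Fib s) \<le> card (L \<alpha>)" for s
  proof (cases "Fib s = {}")
    case False
    then obtain f0 z0 where f0: "(f0, z0) \<in> Fib s" by auto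
    have diff: "(f - f0) + (z - z0) \<in> OZ" if Fib: "(f, z) \<in> Fib s" "(f0, z0) \<in> Fib s" for f z f0 z0
    proof -
      obtain w w0 where w: "w \<in> OZ" "w0 \<in> OZ" "y ^ l * (f + z) - s = y ^ l * w" "y ^ l * (f0 + z0) - s = y ^ l * w0"
        using Fib by (auto simp: Fib_def)
      have "y ^ l * ((f - f0) + (z - z0)) = (y ^ l * (f + z) - s) - (y ^ l * (f0 + z0) - s)" by (simp add: algebra_simps)
      also have "\<dots> = y ^ l * (w - w0)" unfolding w(3,4) by (simp add: algebra_simps)
      finally have "(f - f0) + (z - z0) = w - w0" using y_nonzero by simp
      thus ?thesis using OZ_diff[OF w(1,2)] by simp
    qed
    show ?thesis
    proof (rule card_inj_on_le[of "\<lambda>(f, z). f - f0"])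
      show "inj_on (\<lambda>(f, z). f - f0) (Fib s)"
      proof (rule inj_onI; clarify)
        fix f z f' z' assume *: "(f, z) \<in> Fib s" "(f', z') \<in> Fib s" "f - f0 = f' - f0"
        hence "f = f'" by simp
        hence "z - z' \<in> OZ" using diff[OF *(1,2)] by simp
        hence "z = z'" using Y(4) * by (auto simp: Fib_def)
        thus "f = f' \<and> z = z'" using \<open>f = f'\<close> by simp
      qed
      show "(\<lambda>(f, z). f - f0) ` Fib s \<subseteq> L \<alpha>"
      proof clarify
        fix f z assume fz: "(f, z) \<in> Fib s"
        have mem: "f \<in> V" "f0 \<in> V" "z \<in> MM \<alpha>" "z0 \<in> MM \<alpha>" using fz f0 Y(2) by (auto simp: Fib_def)
        define w where "w = (f - f0) + (z - z0)"
        have w: "w \<in> OZ" unfolding w_def by (rule diff[OF fz f0])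
        have wMM: "w \<in> MM \<alpha>"
        proof -
          have "vge i (- coord \<alpha> i) w" if i: "i \<in> {1..m}" for i
            using OZ_vge[OF w i] \<alpha>(2) i by (elim vge_mono) (auto simp: vec_le_def)
          thus ?thesis using w by (auto simp: MM_def OZ_def)
        qed
        have "f - f0 = w - (z - z0)" by (simp add: w_def)
        hence ffMM: "f - f0 \<in> MM \<alpha>" using MM_diff[OF wMM MM_diff[OF mem(3,4)]] by simp
        have "f - f0 \<in> Loc p" if p: "p \<in> cone" "p \<notin> (\<Union>i\<in>{1..m}. Q i)" for p
        proof (cases "p \<in> Z")
          case True
          thus ?thesis using ffMM p(2) by (simp add: MM_def)
        next
          case False
          thus ?thesis using VL[OF mem(1) p(1)] VL[OF mem(2) p(1)] Loc_diff[OF p(1)] by blast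
        qed
        thus "f - f0 \<in> L \<alpha>" unfolding L_iff using ffMM by (auto simp: MM_def Rg_def)
      qed
    qed (rule finite_L)
  qed simp
  have "card V * card Y = card (V \<times> Y)" by (simp add: card_cartesian_product)
  also have "\<dots> \<le> card (\<Union>s\<in>S. Fib s)" using cover S(1) finFib by (intro card_mono) auto
  also have "\<dots> \<le> (\<Sum>s\<in>S. card (Fib s))" using S(1) by (rule card_UN_le)
  also have "\<dots> \<le> (\<Sum>s\<in>S. card (L \<alpha>))" using fib by (intro sum_mono)
  also have "\<dots> = card S * card (L \<alpha>)" by simp
  also have "\<dots> \<le> D ^ l * card (L \<alpha>)" using S(2) by simp
  finally have VY: "card V * card Y \<le> D ^ l * card (L \<alpha>)" .
  have "D ^ r * card Y \<le> card V * card Y" unfolding cardV l_def using level_growth[OF l0, of r] by simp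
  also note VY
  also have "D ^ l * card (L \<alpha>) = D ^ r * (D ^ l0 * card (L \<alpha>))" by (simp add: l_def power_add)
  finally have "D ^ r * card Y \<le> D ^ r * (D ^ l0 * card (L \<alpha>))" .
  moreover have "D > 0"
  proof -
    obtain t where "t \<in> T" using T_props(3)[OF chart_01(1)] by blast
    thus ?thesis unfolding D_def using T_props(1) by (auto simp: card_gt_0_iff)
  qed
  ultimately show ?thesis using Y(3) by simp
qed

end

context pointed_curve
begin

text \<open>
  The constant of \<open>riemann_bound\<close> depends only on the forms \<open>G\<close> and \<open>W\<close>.
\<close>

theorem riemann_inequality:
  "\<exists>c. \<forall>\<alpha>\<in>int_vecs m. vec_le m 0 \<alpha> \<longrightarrow> card cF ^ nat (vdeg m \<alpha>) \<le> c * card (L \<alpha>)"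
proof -
  obtain e G W where *: "e > 0" "G \<in> forms e" "W \<in> forms e" "E W \<noteq> 0"
    "\<forall>i\<in>{1..m}. val_at W (qrep i) = 0" "\<forall>p\<in>cone. val_at W p = 0 \<longrightarrow> val_at G p \<noteq> 0"
    using forms_without_common_zero by blast
  interpret complementary_forms n C m Q e G W
    by unfold_locales (use * in auto)
  obtain l0 where "T \<subseteq> level e G l0" using chart_common_level[OF G E_G_nonzero T_props(1,2)] by blast
  thus ?thesis using riemann_bound by blast
qed

sublocale riemann_ring cF Rg vq m
  by unfold_locales (rule riemann_inequality)

end

section \<open>Dimension over a finite field\<close>

context field
begin

lemma card_of_dimension:
  assumes S: "subfield S R" "finite S" and d: "dimension d S E"
  shows "finite E \<and> card E = card S ^ d"
  using d S
proof (induction d S E rule: dimension.induct)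
  case (Suc_dim v E d S)
  have IH: "finite E" "card E = card S ^ d" using Suc_dim by auto
  note E = space_subgroup_props[OF Suc_dim.prems(1) Suc_dim.hyps(3)]
  have SR: "S \<subseteq> carrier R" using subringE(1)[OF subfieldE(1)[OF Suc_dim.prems(1)]] .
  let ?f = "\<lambda>(k, u). k \<otimes> v \<oplus> u"
  have img: "line_extension S v E = ?f ` (S \<times> E)"
    by (auto simp: line_extension_mem_iff image_iff) blast
  have "inj_on ?f (S \<times> E)"
  proof (rule inj_onI; clarify)
    fix k u k' u' assume *: "k \<in> S" "k' \<in> S" "u \<in> E" "u' \<in> E" "k \<otimes> v \<oplus> u = k' \<otimes> v \<oplus> u'"
    have c: "k \<in> carrier R" "k' \<in> carrier R" "u \<in> carrier R" "u' \<in> carrier R" "v \<in> carrier R"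
      using * SR E(1) Suc_dim.hyps(1) by auto
    have "(k \<ominus> k') \<otimes> v = (k \<otimes> v \<oplus> u) \<ominus> (k' \<otimes> v \<oplus> u)" using c by algebra
    also have "\<dots> = (k' \<otimes> v \<oplus> u') \<ominus> (k' \<otimes> v \<oplus> u)" using *(5) by simp
    also have "\<dots> = u' \<oplus> \<ominus> u" using c by algebra
    finally have "(k \<ominus> k') \<otimes> v \<in> E" using E(3)[OF *(4) E(4)[OF *(3)]] by simp
    moreover have "k \<ominus> k' \<in> S"
      using subringE(5,7)[OF subfieldE(1)[OF Suc_dim.prems(1)]] *(1,2) by (simp add: a_minus_def)
    ultimately have "k \<ominus> k' = \<zero>" using E(6)[of "k \<ominus> k'" v] c(5) Suc_dim.hyps(2) by blast
    hence "k = k'" using c by (simp add: r_right_minus_eq)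
    moreover from this have "u = u'" using *(5) c by simp
    ultimately show "k = k' \<and> u = u'" by simp
  qed
  hence "card (line_extension S v E) = card S * card E" by (simp add: img card_image card_cartesian_product)
  thus ?case using IH Suc_dim.prems(2) by (simp add: img)
qed simp

text \<open>
  A finite subspace is spanned by the list of its elements, so it has a dimension, which the number of
  elements determines.
\<close>

lemma dim_eq_of_card:
  assumes S: "subfield S R" "finite S" and E: "finite E" "subgroup E (add_monoid R)"
    and smult: "\<And>k v. k \<in> S \<Longrightarrow> v \<in> E \<Longrightarrow> k \<otimes> v \<in> E" and card: "card E = card S ^ d"
  shows "dim S E = d"
proof -
  obtain us where us: "set us = E" using finite_list[OF E(1)] by blast
  have EC: "E \<subseteq> carrier R" using subgroup.subset[OF E(2)] by simp
  have "Span S us \<subseteq> E" by (rule Span_min[OF S(1)]) (use us EC E(2) smult in \<open>auto simp: set_mult_def\<close>)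
  hence "Span S us = E" using Span_base_incl[OF S(1), of us] us EC by auto
  hence "finite_dimension S E" using Span_finite_dimension[OF S(1), of us] us EC by simp
  then obtain k where k: "dimension k S E" unfolding finite_dimension_def by blast
  have "card S ^ k = card S ^ d" using card_of_dimension[OF S k] card by simp
  moreover have "2 \<le> card S"
    using card_mono[OF S(2), of "{\<zero>, \<one>}"] subringE(2,3)[OF subfieldE(1)[OF S(1)]] zero_not_one by simp
  ultimately have "k = d" by (simp add: power_inject_exp)
  thus ?thesis using dimI[OF S(1) k] by (simp add: over_def)
qed

end

section \<open>The invariants of a datum\<close>

context pointed_curve
begin

lemma point_cone: "P \<in> C \<Longrightarrow> p \<in> P \<Longrightarrow> p \<in> cone"
  unfolding cone_def by blast

lemma point_nonempty:
  assumes "P \<in> C"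
  obtains p where "p \<in> P"
  using proj_nonempty C_proj assms by blast

lemma regular_at_phi:
  assumes "P \<in> C" "p \<in> P" "f \<in> K"
  shows "phi f \<in> regular_at n C P \<longleftrightarrow> f \<in> Loc p"
  unfolding regular_at_eq[OF assms(1,2)]
  using inj_on_image_mem_iff[OF phi_inj assms(3) Loc_K[OF point_cone[OF assms(1,2)]]] .

lemma regular_outside_eq: "regular_outside m n C Q = phi ` Rg"
proof -
  have "(\<forall>P\<in>C - Q ` {1..m}. phi f \<in> regular_at n C P) \<longleftrightarrow> f \<in> Rg" if f: "f \<in> K" for f
  proof
    assume *: "\<forall>P\<in>C - Q ` {1..m}. phi f \<in> regular_at n C P"
    have "f \<in> Loc p" if p: "p \<in> cone" "p \<notin> (\<Union>i\<in>{1..m}. Q i)" for p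
    proof -
      obtain P where P: "P \<in> C" "p \<in> P" using p(1) unfolding cone_def by blast
      hence "P \<notin> Q ` {1..m}" using p(2) by blast
      hence "phi f \<in> regular_at n C P" using * P(1) by blast
      thus ?thesis using regular_at_phi[OF P f] by simp
    qed
    thus "f \<in> Rg" using f by (simp add: Rg_def)
  next
    assume fR: "f \<in> Rg"
    show "\<forall>P\<in>C - Q ` {1..m}. phi f \<in> regular_at n C P"
    proof
      fix P assume P: "P \<in> C - Q ` {1..m}"
      hence PC: "P \<in> C" by simp
      obtain p where p: "p \<in> P" using point_nonempty[OF PC] .
      have "p \<notin> Q i" if i: "i \<in> {1..m}" for i
      proof
        assume "p \<in> Q i"
        hence "P = Q i" using same_point[OF PC Q_C[OF i] p] by simp
        thus False using P i by blast
      qed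
      hence "f \<in> Loc p" using fR point_cone[OF PC p] by (simp add: Rg_def)
      thus "phi f \<in> regular_at n C P" using regular_at_phi[OF PC p f] by simp
    qed
  qed
  hence "regular_outside m n C Q = phi ` {f \<in> K. f \<in> Rg}"
    unfolding regular_outside_def carrier_FF by auto
  moreover have "{f \<in> K. f \<in> Rg} = Rg" using Rg_K by blast
  ultimately show ?thesis by simp
qed

lemma order_at_Q: "i \<in> {1..m} \<Longrightarrow> f \<in> K \<Longrightarrow> f \<noteq> 0 \<Longrightarrow> order_at n C (Q i) (phi f) = vq i f"
  unfolding vq_def by (rule order_at_phi[OF Q_C qrep_Q])

lemma pole_vector_eq: "f \<in> Rg \<Longrightarrow> f \<noteq> 0 \<Longrightarrow> pole_vector m n C Q (phi f) = rho f"
  unfolding pole_vector_def rho_def by (intro sum.cong refl) (simp add: order_at_Q Rg_K)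

lemma weierstrass_semigroup_eq: "weierstrass_semigroup m n C Q = H"
proof -
  have "phi ` Rg - {phi 0} = phi ` (Rg - {0})"
    using inj_on_image_set_diff[OF phi_inj, of Rg "{0}"] Rg_K K_01 by auto
  hence "weierstrass_semigroup m n C Q = (\<lambda>f. pole_vector m n C Q (phi f)) ` (Rg - {0})"
    unfolding weierstrass_semigroup_def regular_outside_eq phi_0 by (simp add: image_image)
  also have "\<dots> = H" unfolding H_def by (rule image_cong) (auto simp: pole_vector_eq)
  finally show ?thesis .
qed

lemma maximal_elements_eq: "maximal_elements m n C Q = Max_H"
  unfolding maximal_elements_def Max_H_def nabla_def nab_def weierstrass_semigroup_eq ..

lemma point_divisor_Q: "i \<in> {1..m} \<Longrightarrow> point_divisor m Q \<alpha> (Q i) = coord \<alpha> i"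
proof -
  assume i: "i \<in> {1..m}"
  have "point_divisor m Q \<alpha> (Q i) = (\<Sum>j\<in>{1..m}. if j = i then coord \<alpha> j else 0)"
    unfolding point_divisor_def using inj_on_eq_iff[OF Q_inj _ i] by (intro sum.cong) auto
  thus ?thesis using i by simp
qed

lemma point_divisor_outside: "P \<notin> Q ` {1..m} \<Longrightarrow> point_divisor m Q \<alpha> P = 0"
  unfolding point_divisor_def by (intro sum.neutral) auto

lemma divisor_condition_iff:
  assumes f: "f \<in> K" "f \<noteq> 0"
  shows "(\<forall>P\<in>C. 0 \<le> order_at n C P (phi f) + point_divisor m Q \<alpha> P) \<longleftrightarrow>
         f \<in> Rg \<and> (\<forall>i\<in>{1..m}. - coord \<alpha> i \<le> vq i f)"
proof -
  have out: "0 \<le> order_at n C P (phi f) + point_divisor m Q \<alpha> P \<longleftrightarrow> phi f \<in> regular_at n C P"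
    if P: "P \<in> C - Q ` {1..m}" for P
  proof -
    have PC: "P \<in> C" using P by simp
    obtain p where p: "p \<in> P" using point_nonempty[OF PC] .
    show ?thesis
      using P order_at_phi[OF PC p f] Loc_iff_ord[OF point_cone[OF PC p] f] regular_at_phi[OF PC p f(1)]
      by (simp add: point_divisor_outside)
  qed
  have "phi f \<in> regular_outside m n C Q \<longleftrightarrow> f \<in> Rg"
    unfolding regular_outside_eq using inj_on_image_mem_iff[OF phi_inj f(1)] Rg_K by blast
  hence "f \<in> Rg \<longleftrightarrow> (\<forall>P\<in>C - Q ` {1..m}. phi f \<in> regular_at n C P)"
    using phi_carrier[OF f(1)] by (simp add: regular_outside_def)
  also have "\<dots> \<longleftrightarrow> (\<forall>P\<in>C - Q ` {1..m}. 0 \<le> order_at n C P (phi f) + point_divisor m Q \<alpha> P)"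
    using out by simp
  finally have R: "f \<in> Rg \<longleftrightarrow> (\<forall>P\<in>C - Q ` {1..m}. 0 \<le> order_at n C P (phi f) + point_divisor m Q \<alpha> P)" .
  have "(\<forall>i\<in>{1..m}. - coord \<alpha> i \<le> vq i f) \<longleftrightarrow>
        (\<forall>P\<in>Q ` {1..m}. 0 \<le> order_at n C P (phi f) + point_divisor m Q \<alpha> P)"
    unfolding ball_simps using f by (intro ball_cong refl) (auto simp: order_at_Q point_divisor_Q)
  moreover have "C = (C - Q ` {1..m}) \<union> Q ` {1..m}" using Q_C by blast
  ultimately show ?thesis using R by (metis (no_types, lifting) Un_iff)
qed

lemma riemann_roch_space_eq: "riemann_roch_space n C (point_divisor m Q \<alpha>) = phi ` L \<alpha>"
proof -
  have "phi f = phi 0 \<or> (\<forall>P\<in>C. order_at n C P (phi f) + point_divisor m Q \<alpha> P \<ge> 0) \<longleftrightarrow> f \<in> L \<alpha>"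
    if f: "f \<in> K" for f
  proof (cases "f = 0")
    case False
    thus ?thesis using divisor_condition_iff[OF f False, of \<alpha>] phi_eq_iff[OF f K_01(1)] unfolding L_def by simp
  qed simp
  hence "riemann_roch_space n C (point_divisor m Q \<alpha>) = phi ` {f \<in> K. f \<in> L \<alpha>}"
    unfolding riemann_roch_space_def carrier_FF phi_0 by auto
  moreover have "{f \<in> K. f \<in> L \<alpha>} = L \<alpha>" using Rg_K L_R by blast
  ultimately show ?thesis by simp
qed

lemma subfield_constants: "subfield (phi ` cF) FF"
proof -
  interpret FFf: field FF by (rule field_FF)
  have cK: "c \<in> K" if "c \<in> cF" for c using that cF_K by blast
  show ?thesis
  proof (rule FFf.subfieldI'[OF FFf.subringI])
    show "phi ` cF \<subseteq> carrier FF" unfolding carrier_FF by (rule image_mono[OF cF_K])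
    show "\<one>\<^bsub>FF\<^esub> \<in> phi ` cF" unfolding phi_1 by (rule imageI) (rule coeffs.one_F)
    show "\<ominus>\<^bsub>FF\<^esub> h \<in> phi ` cF" if h: "h \<in> phi ` cF" for h
    proof -
      obtain c where c: "c \<in> cF" "h = phi c" using h by blast
      show ?thesis unfolding c(2) phi_uminus[OF cK[OF c(1)]] by (intro imageI coeffs.uminus_F c(1))
    qed
    fix h1 h2 assume "h1 \<in> phi ` cF" "h2 \<in> phi ` cF"
    then obtain c d where c: "c \<in> cF" "h1 = phi c" and d: "d \<in> cF" "h2 = phi d" by blast
    show "h1 \<otimes>\<^bsub>FF\<^esub> h2 \<in> phi ` cF"
      unfolding c(2) d(2) phi_mult[OF cK[OF c(1)] cK[OF d(1)]] by (intro imageI coeffs.mult_F c(1) d(1))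
    show "h1 \<oplus>\<^bsub>FF\<^esub> h2 \<in> phi ` cF"
      unfolding c(2) d(2) phi_add[OF cK[OF c(1)] cK[OF d(1)]] by (intro imageI coeffs.add_F c(1) d(1))
  next
    fix h assume "h \<in> phi ` cF - {\<zero>\<^bsub>FF\<^esub>}"
    hence h: "h \<in> phi ` cF" "h \<noteq> \<zero>\<^bsub>FF\<^esub>" by simp_all
    then obtain c where c: "c \<in> cF" "h = phi c" by blast
    have "c \<noteq> 0" using h(2) c(2) phi_0 by auto
    show "inv\<^bsub>FF\<^esub> h \<in> phi ` cF"
      unfolding c(2) phi_inverse[OF cK[OF c(1)] \<open>c \<noteq> 0\<close>] by (intro imageI F_inverse c(1))
  qed
qed

lemma ell_eq:
  assumes \<alpha>: "\<alpha> \<in> int_vecs m"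
  shows "ell m n C Q \<alpha> = ldim \<alpha>"
proof -
  interpret FFf: field FF by (rule field_FF)
  have LK: "L \<alpha> \<subseteq> K" using Rg_K L_R by blast
  have inj: "inj_on phi (L \<alpha>)" "inj_on phi cF"
    using inj_on_subset[OF phi_inj] LK cF_K by blast+
  have "FFf.dim (phi ` cF) (phi ` L \<alpha>) = ldim \<alpha>"
  proof (rule FFf.dim_eq_of_card[OF subfield_constants])
    show "finite (phi ` cF)" "finite (phi ` L \<alpha>)" using finite_L by simp_all
    show "card (phi ` L \<alpha>) = card (phi ` cF) ^ ldim \<alpha>" using card_L[OF \<alpha>] by (simp only: card_image[OF inj(1)] card_image[OF inj(2)])
    show "k \<otimes>\<^bsub>FF\<^esub> v \<in> phi ` L \<alpha>" if kv: "k \<in> phi ` cF" "v \<in> phi ` L \<alpha>" for k v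
    proof -
      obtain c where c: "c \<in> cF" "k = phi c" using kv(1) by blast
      obtain f where f: "f \<in> L \<alpha>" "v = phi f" using kv(2) by (elim imageE)
      have "c \<in> K" "f \<in> K" using c(1) f(1) cF_K LK by blast+
      thus ?thesis unfolding c(2) f(2) by (simp only: phi_mult imageI L_scale[OF c(1) f(1)])
    qed
    show "subgroup (phi ` L \<alpha>) (add_monoid FF)"
    proof (rule FFf.add.subgroupI)
      show "phi ` L \<alpha> \<subseteq> carrier FF" unfolding carrier_FF by (rule image_mono[OF LK])
      show "phi ` L \<alpha> \<noteq> {}" using zero_L by blast
      show "\<ominus>\<^bsub>FF\<^esub> a \<in> phi ` L \<alpha>" if a: "a \<in> phi ` L \<alpha>" for a
      proof -
        obtain f where f: "f \<in> L \<alpha>" "a = phi f" using a by (elim imageE)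
        have "f \<in> K" using f(1) LK by blast
        thus ?thesis unfolding f(2) by (simp only: phi_uminus imageI L_uminus[OF f(1)])
      qed
      show "a \<oplus>\<^bsub>FF\<^esub> b \<in> phi ` L \<alpha>" if ab: "a \<in> phi ` L \<alpha>" "b \<in> phi ` L \<alpha>" for a b
      proof -
        obtain f where f: "f \<in> L \<alpha>" "a = phi f" using ab(1) by (elim imageE)
        obtain g where g: "g \<in> L \<alpha>" "b = phi g" using ab(2) by (elim imageE)
        have "f \<in> K" "g \<in> K" using f(1) g(1) LK by blast+
        thus ?thesis unfolding f(2) g(2) by (simp only: phi_add imageI L_add[OF f(1) g(1)])
      qed
    qed
  qed
  thus ?thesis unfolding ell_def constants_eq riemann_roch_space_eq .
qed

lemma poincare_coeff_eq:
  assumes \<alpha>: "\<alpha> \<in> int_vecs m" and i: "i \<in> {1..m}"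
  shows "poincare_coeff m n C Q i \<alpha> = alt_coeff m ldim i \<alpha>"
proof -
  have "ell_diff m n C Q i (\<alpha> - ones {1..m} + ones J + ones {i}) =
        int (ldim (\<alpha> - ones {1..m} + ones J + ones {i})) -
        int (ldim (\<alpha> - ones {1..m} + ones J + ones {i} - ones {i}))" if "J \<subseteq> {1..m} - {i}" for J
  proof -
    have 1: "\<alpha> - ones {1..m} + ones J + ones {i} \<in> int_vecs m"
      using \<alpha> i that by (intro int_vecs_add int_vecs_diff int_vecs_ones) auto
    hence "\<alpha> - ones {1..m} + ones J + ones {i} - ones {i} \<in> int_vecs m"
      using i by (intro int_vecs_diff int_vecs_ones) auto
    thus ?thesis unfolding ell_diff_def by (simp only: ell_eq[OF 1] ell_eq)
  qed
  thus ?thesis unfolding poincare_coeff_def alt_coeff_def by (intro arg_cong2[of _ _ _ _ "(*)"] refl sum.cong) auto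
qed

text \<open>
  A function whose zeros and poles are among the points is a unit of the ring of functions that are
  regular outside the points.
\<close>

lemma principal_iff:
  assumes \<alpha>: "\<alpha> \<in> int_vecs m"
  shows "principal_divisor n C (point_divisor m Q \<alpha>) \<longleftrightarrow> (\<exists>u. R_unit u \<and> (\<forall>k\<in>{1..m}. vq k u = coord \<alpha> k))"
proof
  assume "principal_divisor n C (point_divisor m Q \<alpha>)"
  then obtain z where z: "z \<in> carrier FF" "z \<noteq> \<zero>\<^bsub>FF\<^esub>" "\<forall>P\<in>C. order_at n C P z = point_divisor m Q \<alpha> P"
    unfolding principal_divisor_def by blast
  obtain f where f: "f \<in> K" "z = phi f" using z(1) unfolding carrier_FF by blast
  have f0: "f \<noteq> 0" using z(2) f(2) phi_0 by auto
  have v: "vq k f = coord \<alpha> k" if "k \<in> {1..m}" for k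
    using z(3) Q_C[OF that] order_at_Q[OF that f(1) f0] point_divisor_Q[OF that] f(2) by simp
  have ord: "ord_p p f = 0" if p: "p \<in> cone" "p \<notin> (\<Union>i\<in>{1..m}. Q i)" for p
  proof -
    obtain P where P: "P \<in> C" "p \<in> P" using p(1) unfolding cone_def by blast
    hence "P \<notin> Q ` {1..m}" using p(2) by blast
    thus ?thesis using z(3) P order_at_phi[OF P f(1) f0] point_divisor_outside[of P \<alpha>] f(2) by simp
  qed
  have "f \<in> Rg" unfolding Rg_def using f(1) ord Loc_iff_ord[OF _ f(1) f0] by simp
  moreover have "inverse f \<in> Rg"
    unfolding Rg_def using K_inverse[OF f(1)] ord Loc_iff_ord[OF _ K_inverse[OF f(1)]] ord_inverse[OF _ f(1) f0] f0 by simp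
  ultimately have "R_unit f" unfolding R_unit_def using f0 by (intro conjI bexI[of _ "inverse f"]) auto
  thus "\<exists>u. R_unit u \<and> (\<forall>k\<in>{1..m}. vq k u = coord \<alpha> k)" using v by blast
next
  assume "\<exists>u. R_unit u \<and> (\<forall>k\<in>{1..m}. vq k u = coord \<alpha> k)"
  then obtain u w where u: "u \<in> Rg" "w \<in> Rg" "u * w = 1" and v: "\<forall>k\<in>{1..m}. vq k u = coord \<alpha> k"
    unfolding R_unit_def by blast
  have uK: "u \<in> K" "w \<in> K" using u Rg_K by auto
  have u0: "u \<noteq> 0" "w \<noteq> 0" using u(3) by auto
  have w: "w = inverse u" using u(3) u0 by (simp add: field_simps)
  have "order_at n C P (phi u) = point_divisor m Q \<alpha> P" if P: "P \<in> C" for P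
  proof (cases "P \<in> Q ` {1..m}")
    case True
    then obtain i where i: "i \<in> {1..m}" "P = Q i" by blast
    show ?thesis unfolding i(2) using order_at_Q[OF i(1) uK(1) u0(1)] point_divisor_Q[OF i(1)] v i(1) by simp
  next
    case False
    obtain p where p: "p \<in> P" using point_nonempty[OF P] .
    note pc = point_cone[OF P p]
    have out: "p \<notin> (\<Union>i\<in>{1..m}. Q i)"
    proof
      assume "p \<in> (\<Union>i\<in>{1..m}. Q i)"
      then obtain i where i: "i \<in> {1..m}" "p \<in> Q i" by blast
      thus False using same_point[OF P Q_C[OF i(1)] p i(2)] False by blast
    qed
    have "u \<in> Loc p" "w \<in> Loc p" using u(1,2) pc out unfolding Rg_def by auto
    hence "0 \<le> ord_p p u" "0 \<le> ord_p p w" using Loc_iff_ord[OF pc uK(1) u0(1)] Loc_iff_ord[OF pc uK(2) u0(2)] by auto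
    hence "ord_p p u = 0" using ord_inverse[OF pc uK(1) u0(1)] w by simp
    thus ?thesis using order_at_phi[OF P p uK(1) u0(1)] point_divisor_outside[OF False] by simp
  qed
  moreover have "phi u \<in> carrier FF - {\<zero>\<^bsub>FF\<^esub>}"
    using phi_carrier[OF uK(1)] phi_eq_iff[OF uK(1) K_01(1)] u0(1) by (simp add: phi_0)
  ultimately show "principal_divisor n C (point_divisor m Q \<alpha>)" unfolding principal_divisor_def by blast
qed

lemma unit_periods_period: "unit_periods (period m n C Q)"
  unfolding unit_periods_def
proof
  fix i assume i: "i \<in> {1..<m}"
  let ?\<alpha> = "\<lambda>t::nat. axis i (int t) - axis (Suc i) (int t)"
  have \<alpha>: "?\<alpha> t \<in> int_vecs m" for t using i by (intro int_vecs_diff int_vecs_axis) auto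
  have ii: "i \<in> {1..m}" "Suc i \<in> {1..m}" "i \<noteq> Suc i" using i by auto
  have "\<exists>t. 0 < t \<and> principal_divisor n C (point_divisor m Q (?\<alpha> t))"
    using unit_period[OF ii] unfolding principal_iff[OF \<alpha>] by blast
  hence "0 < period m n C Q i \<and> principal_divisor n C (point_divisor m Q (?\<alpha> (period m n C Q i)))"
    unfolding period_def by (rule LeastI_ex)
  thus "0 < period m n C Q i \<and>
      (\<exists>u. R_unit u \<and> (\<forall>k\<in>{1..m}. vq k u = coord (eta_vec (period m n C Q) i) k))"
    unfolding principal_iff[OF \<alpha>] eta_vec_def .
qed

lemma theta_group_eq: "theta_group m n C Q = theta_lattice m (period m n C Q)"
  unfolding theta_group_def theta_lattice_def eta_def eta_vec_def ..

lemma fundamental_region_eq: "fundamental_region m n C Q = fund_region m (period m n C Q)"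
  unfolding fundamental_region_def fund_region_def ..

lemma semigroup_poly_eq:
  assumes "i \<in> {1..m}"
  shows "semigroup_poly m n C Q i =
    (\<Sum>\<gamma>\<in>Max_H \<inter> fund_region m (period m n C Q). Poly_Mapping.single \<gamma> (alt_coeff m ldim i \<gamma>))"
  unfolding semigroup_poly_def maximal_elements_eq fundamental_region_eq
  by (intro sum.cong refl) (simp add: poincare_coeff_eq[OF _ assms] fund_region_def)

lemma poincare_series_functional_equation:
  assumes i: "i \<in> {1..m}"
  shows "poincare_series m n C Q i =
    series_mult (support_series (theta_group m n C Q)) (semigroup_poly m n C Q i)"
proof
  fix \<alpha>
  have "poincare_series m n C Q i \<alpha> = (if \<alpha> \<in> int_vecs m then alt_coeff m ldim i \<alpha> else 0)"
    unfolding poincare_series_def using poincare_coeff_eq[OF _ i] by simp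
  thus "poincare_series m n C Q i \<alpha> =
      series_mult (support_series (theta_group m n C Q)) (semigroup_poly m n C Q i) \<alpha>"
    unfolding theta_group_eq semigroup_poly_eq[OF i] functional_equation[OF unit_periods_period i] .
qed

end

lemma pointed_curve_of_datum: "weierstrass_datum m n C Q \<Longrightarrow> pointed_curve n C m Q"
  unfolding weierstrass_datum_def nonsingular_projective_curve_def
  by unfold_locales auto

theorem theorem4p3:
  fixes m n i :: nat
    and C :: "'a::{field, finite} alg_closure ppoint set"
    and Q :: "nat \<Rightarrow> 'a alg_closure ppoint"
  assumes "weierstrass_datum m n C Q"
    and "i \<in> {1..m}"
  shows "(\<forall>n' (C' :: 'b::{field, finite} alg_closure ppoint set) Q'. \<forall>i'\<in>{1..m}.
            weierstrass_datum m n' C' Q' \<longrightarrow>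
            poincare_series m n C Q i = poincare_series m n' C' Q' i' \<longrightarrow>
            weierstrass_semigroup m n C Q = weierstrass_semigroup m n' C' Q') \<and>
         poincare_series m n C Q i =
           series_mult (support_series (theta_group m n C Q)) (semigroup_poly m n C Q i)"
proof -
  interpret A: pointed_curve n C m Q by (rule pointed_curve_of_datum[OF assms(1)])
  have "weierstrass_semigroup m n C Q = weierstrass_semigroup m n' C' Q'"
    if i': "i' \<in> {1..m}" and datum: "weierstrass_datum m n' C' Q'"
      and eq: "poincare_series m n C Q i = poincare_series m n' C' Q' i'"
    for n' i' and C' :: "'b alg_closure ppoint set" and Q'
  proof -
    interpret B: pointed_curve n' C' m Q' by (rule pointed_curve_of_datum[OF datum])
    have "alt_coeff m A.ldim i \<alpha> = alt_coeff m B.ldim i' \<alpha>" if \<alpha>: "\<alpha> \<in> int_vecs m" for \<alpha>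
      using fun_cong[OF eq, of \<alpha>] \<alpha> A.poincare_coeff_eq[OF \<alpha> assms(2)] B.poincare_coeff_eq[OF \<alpha> i']
      by (simp add: poincare_series_def)
    hence "A.H = B.H"
      by (rule alt_coeff_determines_semigroup[OF A.pole_filtered_ring_axioms B.pole_filtered_ring_axioms assms(2) i'])
    thus ?thesis unfolding A.weierstrass_semigroup_eq B.weierstrass_semigroup_eq .
  qed
  thus ?thesis using A.poincare_series_functional_equation[OF assms(2)] by blast
qed

end
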